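(* Let $A$ be a unital AF-algebra (simple or non-simple). Suppose that $\alpha\in\mathrm{Aut}(A)$ has the tracial cyclic Rokhlin property and that $A$ is $\alpha$-simple. Suppose also that there is an integer $J\geq 1$ such that $(\alpha^{J})_{*0}=\mathrm{id}_{K_0(A)}$, where $(\alpha^J)_{*0}$ denotes the automorphism of $K_0(A)$ induced by $\alpha^J$. Then $\mathrm{TR}(A\rtimes_{\alpha}\mathbb{Z})=0$, i.e. the crossed product $A\rtimes_\alpha\mathbb{Z}$ has tracial (topological) rank zero.
   Context: Let $A$ be a $C^*$-algebra and $\alpha\in\mathrm{Aut}(A)$. $A$ is called $\alpha$-simple if it has no closed two-sided ideals $I$ with $\alpha(I)=I$ other than $\{0\}$ and $A$. Comparison. For a positive element $a\in A$ and a projection $p\in A$, write $[p]\leq[a]$ if there are a projection $q\in\overline{aAa}$ and a partial isometry $v\in A$ with $v^*v=p$ and $vv^*=q$. Write $[p]\leq_\alpha[a]$ if there are $n\in\mathbb{N}$, mutually orthogonal projections $p_1,\dots,p_n\in A$, mutually orthogonal positive elements $a_1,\dots,a_n$ in the hereditary $C^*$-subalgebra generated by $a$, and integers $s_1,\dots,s_n\in\mathbb{Z}$ such that $p=\sum_{i=1}^n p_i$ and $[\alpha^{s_i}(p_i)]\leq[a_i]$ for $i=1,\dots,n$. Tracial cyclic Rokhlin property. For $A$ unital, $\alpha$ has the tracial cyclic Rokhlin property if for every $\varepsilon>0$, every $n\in\mathbb{N}$ (positive integer), every nonzero positive $a\in A$, and every finite set $\mathcal{F}=\{p_1,\dots,p_m,a_1,\dots,a_s\}\subset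 A$ where $p_1,\dots,p_m$ are mutually orthogonal nonzero projections, there are mutually orthogonal projections $e_1,\dots,e_n\in A$ such that: (1) $\|\alpha(e_j)-e_{j+1}\|<\varepsilon$ for $1\leq j\leq n$, where $e_{n+1}=e_1$; (2) $\|e_jb-be_j\|<\varepsilon$ for $1\leq j\leq n$ and all $b\in\mathcal{F}$; (3) $\|e_1p_je_1\|\geq 1-\varepsilon$ for $1\leq j\leq m$; (4) with $e=\sum_{j=1}^n e_j$, $[1-e]\leq_\alpha[a]$. Tracial rank zero. A unital simple $C^*$-algebra $B$ has tracial (topological) rank zero, written $\mathrm{TR}(B)=0$, if for any $\varepsilon>0$, any finite set $\mathcal{F}\subset B$, and any nonzero positive element $a\in B$, there exist a nonzero projection $p\in B$ and a finite-dimensional $C^*$-subalgebra $C\subset B$ with $1_C=p$ such that: (1) $\|px-xp\|<\varepsilon$ for all $x\in\mathcal{F}$; (2) $\mathrm{dist}(pxp,C)<\varepsilon$ for all $x\in\mathcal{F}$; (3) $[1-p]\leq[a]$ (comparison in $B$). *)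

theory Defs
  imports "HOL-Analysis.Analysis" "HOL-Algebra.Group" "Jordan_Normal_Form.Matrix"
begin

section \<open>Unital C*-algebras\<close>

text \<open>The class \<open>real_normed_algebra_1\<close> includes \<open>1 \<noteq> 0\<close>, so unital C*-algebras are nonzero.\<close>

class cstar_algebra = real_normed_algebra_1 + banach +
  fixes scaleC :: "complex \<Rightarrow> 'a \<Rightarrow> 'a" (infixr \<open>*\<^sub>C\<close> 75)
    and star :: "'a \<Rightarrow> 'a"
  assumes scaleC_add_right: "c *\<^sub>C (x + y) = c *\<^sub>C x + c *\<^sub>C y"
    and scaleC_add_left: "(c + d) *\<^sub>C x = c *\<^sub>C x + d *\<^sub>C x"
    and scaleC_scaleC: "c *\<^sub>C d *\<^sub>C x = (c * d) *\<^sub>C x"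
    and scaleC_one: "1 *\<^sub>C x = x"
    and scaleR_scaleC: "r *\<^sub>R x = complex_of_real r *\<^sub>C x"
    and mult_scaleC_left: "(c *\<^sub>C x) * y = c *\<^sub>C (x * y)"
    and mult_scaleC_right: "x * (c *\<^sub>C y) = c *\<^sub>C (x * y)"
    and norm_scaleC: "norm (c *\<^sub>C x) = cmod c * norm x"
    and star_add: "star (x + y) = star x + star y"
    and star_scaleC: "star (c *\<^sub>C x) = cnj c *\<^sub>C star x"
    and star_mult: "star (x * y) = star y * star x"
    and star_star: "star (star x) = x"
    and cstar_identity: "norm (star x * x) = (norm x)\<^sup>2"

global_interpretation complex_vector: vector_space "scaleC :: complex \<Rightarrow> 'a::cstar_algebra \<Rightarrow> 'a"
  defines csubspace = complex_vector.subspace and cspan = complex_vector.span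
  by unfold_locales
    (simp_all add: scaleC_add_right scaleC_add_left scaleC_scaleC scaleC_one)

definition cstar_hom :: "('a::cstar_algebra \<Rightarrow> 'b::cstar_algebra) \<Rightarrow> bool" where
  "cstar_hom \<phi> \<longleftrightarrow>
     (\<forall>x y. \<phi> (x + y) = \<phi> x + \<phi> y) \<and> (\<forall>c x. \<phi> (c *\<^sub>C x) = c *\<^sub>C \<phi> x) \<and>
     (\<forall>x y. \<phi> (x * y) = \<phi> x * \<phi> y) \<and> (\<forall>x. \<phi> (star x) = star (\<phi> x))"

definition cstar_automorphism :: "('a::cstar_algebra \<Rightarrow> 'a) \<Rightarrow> bool" where
  "cstar_automorphism \<alpha> \<longleftrightarrow> cstar_hom \<alpha> \<and> bij \<alpha>"

definition aut_powi :: "('a \<Rightarrow> 'a) \<Rightarrow> int \<Rightarrow> 'a \<Rightarrow> 'a" where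
  "aut_powi \<alpha> k = (if 0 \<le> k then \<alpha> ^^ nat k else inv_into UNIV \<alpha> ^^ nat (- k))"

definition projection :: "'a::cstar_algebra \<Rightarrow> bool" where
  "projection p \<longleftrightarrow> p * p = p \<and> star p = p"

definition partial_isometry :: "'a::cstar_algebra \<Rightarrow> bool" where
  "partial_isometry v \<longleftrightarrow> v * star v * v = v"

definition unitary :: "'a::cstar_algebra \<Rightarrow> bool" where
  "unitary u \<longleftrightarrow> star u * u = 1 \<and> u * star u = 1"

definition positive :: "'a::cstar_algebra \<Rightarrow> bool" where
  "positive a \<longleftrightarrow> (\<exists>x. a = star x * x)"

text \<open>The unit of a C*-subalgebra, if there is one, need not be the unit of the ambient algebra.\<close>

definition cstar_subalgebra :: "'a::cstar_algebra set \<Rightarrow> bool" where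
  "cstar_subalgebra B \<longleftrightarrow> csubspace B \<and> closed B \<and>
     (\<forall>x\<in>B. \<forall>y\<in>B. x * y \<in> B) \<and> (\<forall>x\<in>B. star x \<in> B)"

definition finite_dimensional :: "'a::cstar_algebra set \<Rightarrow> bool" where
  "finite_dimensional B \<longleftrightarrow> (\<exists>S. finite S \<and> B = cspan S)"

definition hereditary :: "'a::cstar_algebra set \<Rightarrow> bool" where
  "hereditary B \<longleftrightarrow> (\<forall>a b. b \<in> B \<and> positive a \<and> positive (b - a) \<longrightarrow> a \<in> B)"

definition hereditary_generated :: "'a::cstar_algebra \<Rightarrow> 'a set" where
  "hereditary_generated a = \<Inter>{B. cstar_subalgebra B \<and> hereditary B \<and> a \<in> B}"

definition closed_ideal :: "'a::cstar_algebra set \<Rightarrow> bool" where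
  "closed_ideal I \<longleftrightarrow> csubspace I \<and> closed I \<and> (\<forall>x. \<forall>y\<in>I. x * y \<in> I \<and> y * x \<in> I)"

definition simple_algebra :: "'a::cstar_algebra itself \<Rightarrow> bool" where
  "simple_algebra _ \<longleftrightarrow> (\<forall>I::'a set. closed_ideal I \<longrightarrow> I = {0} \<or> I = UNIV)"

definition aut_simple :: "('a::cstar_algebra \<Rightarrow> 'a) \<Rightarrow> bool" where
  "aut_simple \<alpha> \<longleftrightarrow> (\<forall>I. closed_ideal I \<and> \<alpha> ` I = I \<longrightarrow> I = {0} \<or> I = UNIV)"

definition AF_algebra :: "'a::cstar_algebra itself \<Rightarrow> bool" where
  "AF_algebra _ \<longleftrightarrow> (\<exists>F :: nat \<Rightarrow> 'a set. incseq F \<and>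
     (\<forall>n. cstar_subalgebra (F n) \<and> finite_dimensional (F n)) \<and> closure (\<Union>n. F n) = UNIV)"


section \<open>Comparison, tracial cyclic Rokhlin property, tracial rank zero\<close>

definition proj_le :: "'a::cstar_algebra \<Rightarrow> 'a \<Rightarrow> bool" where
  "proj_le p a \<longleftrightarrow> (\<exists>q v. projection q \<and> q \<in> closure {a * x * a | x. True} \<and>
     partial_isometry v \<and> star v * v = p \<and> v * star v = q)"

definition proj_le_aut :: "('a::cstar_algebra \<Rightarrow> 'a) \<Rightarrow> 'a \<Rightarrow> 'a \<Rightarrow> bool" where
  "proj_le_aut \<alpha> p a \<longleftrightarrow> (\<exists>(n::nat) (P :: nat \<Rightarrow> 'a) (B :: nat \<Rightarrow> 'a) (s :: nat \<Rightarrow> int). 1 \<le> n \<and>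
     (\<forall>i\<in>{1..n}. projection (P i)) \<and>
     (\<forall>i\<in>{1..n}. \<forall>j\<in>{1..n}. i \<noteq> j \<longrightarrow> P i * P j = 0) \<and>
     (\<forall>i\<in>{1..n}. positive (B i) \<and> B i \<in> hereditary_generated a) \<and>
     (\<forall>i\<in>{1..n}. \<forall>j\<in>{1..n}. i \<noteq> j \<longrightarrow> B i * B j = 0) \<and>
     p = (\<Sum>i=1..n. P i) \<and>
     (\<forall>i\<in>{1..n}. proj_le (aut_powi \<alpha> (s i) (P i)) (B i)))"

text \<open>The finite set \<open>\<F>\<close> of the definition is \<open>P \<union> G\<close>, where \<open>P\<close> consists of the mutually
  orthogonal nonzero projections \<open>p\<^sub>1, \<dots>, p\<^sub>m\<close> (these are pairwise distinct) and \<open>G\<close> of the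
  remaining elements.\<close>

definition tracial_cyclic_rokhlin :: "('a::cstar_algebra \<Rightarrow> 'a) \<Rightarrow> bool" where
  "tracial_cyclic_rokhlin \<alpha> \<longleftrightarrow>
     (\<forall>(\<epsilon>::real) (n::nat) a P G. 0 < \<epsilon> \<and> 1 \<le> n \<and> positive a \<and> a \<noteq> 0 \<and> finite P \<and> finite G \<and>
        (\<forall>p\<in>P. projection p \<and> p \<noteq> 0) \<and> (\<forall>p\<in>P. \<forall>q\<in>P. p \<noteq> q \<longrightarrow> p * q = 0) \<longrightarrow>
      (\<exists>e :: nat \<Rightarrow> 'a.
        (\<forall>j\<in>{1..n}. projection (e j)) \<and>
        (\<forall>i\<in>{1..n}. \<forall>j\<in>{1..n}. i \<noteq> j \<longrightarrow> e i * e j = 0) \<and>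
        (\<forall>j\<in>{1..n}. norm (\<alpha> (e j) - (if j = n then e 1 else e (j + 1))) < \<epsilon>) \<and>
        (\<forall>j\<in>{1..n}. \<forall>b\<in>P \<union> G. norm (e j * b - b * e j) < \<epsilon>) \<and>
        (\<forall>p\<in>P. norm (e 1 * p * e 1) \<ge> 1 - \<epsilon>) \<and>
        proj_le_aut \<alpha> (1 - (\<Sum>j=1..n. e j)) a))"

definition tracial_rank_zero :: "'a::cstar_algebra itself \<Rightarrow> bool" where
  "tracial_rank_zero _ \<longleftrightarrow> simple_algebra TYPE('a) \<and>
     (\<forall>(\<epsilon>::real) F (a::'a). 0 < \<epsilon> \<and> finite F \<and> positive a \<and> a \<noteq> 0 \<longrightarrow>
      (\<exists>p C. projection p \<and> p \<noteq> 0 \<and> cstar_subalgebra C \<and> finite_dimensional C \<and>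
        p \<in> C \<and> (\<forall>c\<in>C. p * c = c \<and> c * p = c) \<and>
        (\<forall>x\<in>F. norm (p * x - x * p) < \<epsilon>) \<and>
        (\<forall>x\<in>F. infdist (p * x * p) C < \<epsilon>) \<and>
        proj_le (1 - p) a))"


section \<open>The group \<open>K\<^sub>0\<close> of a unital C*-algebra\<close>

text \<open>\<open>K\<^sub>0\<close> is the Grothendieck group of the semigroup of Murray-von Neumann classes of projections
  in matrix algebras: its elements are the classes of pairs \<open>(p, q)\<close>, standing for \<open>[p] - [q]\<close>.
  Matrices of different sizes are compared by rectangular partial isometries.\<close>

definition mat_star :: "'a::cstar_algebra mat \<Rightarrow> 'a mat" where
  "mat_star M = map_mat star (transpose_mat M)"

definition mat_projections :: "'a::cstar_algebra mat set" where
  "mat_projections = {p. square_mat p \<and> p * p = p \<and> mat_star p = p}"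

definition mvn_equiv :: "'a::cstar_algebra mat \<Rightarrow> 'a mat \<Rightarrow> bool" where
  "mvn_equiv p q \<longleftrightarrow>
     (\<exists>v\<in>carrier_mat (dim_row q) (dim_row p). mat_star v * v = p \<and> v * mat_star v = q)"

definition mat_dsum :: "'a::cstar_algebra mat \<Rightarrow> 'a mat \<Rightarrow> 'a mat" where
  "mat_dsum p q = diag_block_mat [p, q]"

definition K0_rel :: "(('a::cstar_algebra mat \<times> 'a mat) \<times> ('a mat \<times> 'a mat)) set" where
  "K0_rel = {((p, q), (p', q')).
     p \<in> mat_projections \<and> q \<in> mat_projections \<and> p' \<in> mat_projections \<and> q' \<in> mat_projections \<and>
     (\<exists>r\<in>mat_projections. mvn_equiv (mat_dsum (mat_dsum p q') r) (mat_dsum (mat_dsum p' q) r))}"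

definition K0 :: "'a::cstar_algebra itself \<Rightarrow> ('a mat \<times> 'a mat) set monoid" where
  "K0 _ = \<lparr>carrier = (mat_projections \<times> mat_projections) // K0_rel,
           monoid.mult = (\<lambda>X Y. K0_rel `` {(mat_dsum p p', mat_dsum q q') | p q p' q'.
                               (p, q) \<in> X \<and> (p', q') \<in> Y}),
           one = K0_rel `` {(0\<^sub>m 1 1, 0\<^sub>m 1 1)}\<rparr>"

text \<open>The induced map \<open>\<phi>\<^bsub>*0\<^esub>([p] - [q]) = [\<phi>(p)] - [\<phi>(q)]\<close>.\<close>

definition K0_map ::
  "('a::cstar_algebra \<Rightarrow> 'b::cstar_algebra) \<Rightarrow> ('a mat \<times> 'a mat) set \<Rightarrow> ('b mat \<times> 'b mat) set" where
  "K0_map \<phi> X = K0_rel `` {(map_mat \<phi> p, map_mat \<phi> q) | p q. (p, q) \<in> X}"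


section \<open>The crossed product by an automorphism\<close>

text \<open>The *-algebra \<open>C\<^sub>c(\<int>, A)\<close>, with \<open>f\<close> standing for the formal sum of \<open>f(k) u\<^sup>k\<close>, and with
  multiplication and involution forced by \<open>u a u\<^sup>* = \<alpha>(a)\<close>.\<close>

definition Cc :: "(int \<Rightarrow> 'a::cstar_algebra) set" where
  "Cc = {f. finite {k. f k \<noteq> 0}}"

definition Cc_mult ::
  "('a::cstar_algebra \<Rightarrow> 'a) \<Rightarrow> (int \<Rightarrow> 'a) \<Rightarrow> (int \<Rightarrow> 'a) \<Rightarrow> int \<Rightarrow> 'a" where
  "Cc_mult \<alpha> f g = (\<lambda>n. \<Sum>k | f k \<noteq> 0. f k * aut_powi \<alpha> k (g (n - k)))"

definition Cc_star :: "('a::cstar_algebra \<Rightarrow> 'a) \<Rightarrow> (int \<Rightarrow> 'a) \<Rightarrow> int \<Rightarrow> 'a" where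
  "Cc_star \<alpha> f = (\<lambda>n. aut_powi \<alpha> n (star (f (- n))))"

definition Cc_cstar_seminorm ::
  "('a::cstar_algebra \<Rightarrow> 'a) \<Rightarrow> ((int \<Rightarrow> 'a) \<Rightarrow> real) \<Rightarrow> bool" where
  "Cc_cstar_seminorm \<alpha> \<gamma> \<longleftrightarrow>
     (\<forall>f\<in>Cc. 0 \<le> \<gamma> f) \<and>
     (\<forall>f\<in>Cc. \<forall>g\<in>Cc. \<gamma> (\<lambda>k. f k + g k) \<le> \<gamma> f + \<gamma> g) \<and>
     (\<forall>c. \<forall>f\<in>Cc. \<gamma> (\<lambda>k. c *\<^sub>C f k) = cmod c * \<gamma> f) \<and>
     (\<forall>f\<in>Cc. \<forall>g\<in>Cc. \<gamma> (Cc_mult \<alpha> f g) \<le> \<gamma> f * \<gamma> g) \<and>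
     (\<forall>f\<in>Cc. \<gamma> (Cc_mult \<alpha> (Cc_star \<alpha> f) f) = (\<gamma> f)\<^sup>2)"

definition unitary_powi :: "'a::cstar_algebra \<Rightarrow> int \<Rightarrow> 'a" where
  "unitary_powi u k = (if 0 \<le> k then u ^ nat k else star u ^ nat (- k))"

definition covariant_pair ::
  "('a::cstar_algebra \<Rightarrow> 'a) \<Rightarrow> ('a \<Rightarrow> 'b::cstar_algebra) \<Rightarrow> 'b \<Rightarrow> bool" where
  "covariant_pair \<alpha> \<pi> u \<longleftrightarrow> cstar_hom \<pi> \<and> \<pi> 1 = 1 \<and> unitary u \<and>
     (\<forall>a. u * \<pi> a * star u = \<pi> (\<alpha> a))"

definition integrated_form :: "('a::cstar_algebra \<Rightarrow> 'b::cstar_algebra) \<Rightarrow> 'b \<Rightarrow> (int \<Rightarrow> 'a) \<Rightarrow> 'b" where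
  "integrated_form \<pi> u f = (\<Sum>k | f k \<noteq> 0. \<pi> (f k) * unitary_powi u k)"

text \<open>The crossed product is the enveloping C*-algebra of \<open>C\<^sub>c(\<int>, A)\<close>, that is, its completion in
  the greatest C*-seminorm. The predicate says that the C*-algebra \<open>'b\<close>, with canonical
  *-homomorphism \<open>\<pi>\<close> and canonical unitary \<open>u\<close>, is this completion (the norm of
  \<open>integrated_form \<pi> u f\<close> is itself a C*-seminorm). C*-seminorms are real valued functions on
  \<open>C\<^sub>c(\<int>, A)\<close>, so the universality is not restricted to covariant pairs in C*-algebras of
  a particular type.\<close>

definition crossed_product ::
  "('a::cstar_algebra \<Rightarrow> 'a) \<Rightarrow> ('a \<Rightarrow> 'b::cstar_algebra) \<Rightarrow> 'b \<Rightarrow> bool" where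
  "crossed_product \<alpha> \<pi> u \<longleftrightarrow> covariant_pair \<alpha> \<pi> u \<and>
     closure (integrated_form \<pi> u ` Cc) = UNIV \<and>
     (\<forall>\<gamma>. Cc_cstar_seminorm \<alpha> \<gamma> \<longrightarrow> (\<forall>f\<in>Cc. \<gamma> f \<le> norm (integrated_form \<pi> u f)))"

end

theory Submission
  imports Defs "HOL-Computational_Algebra.Fundamental_Theorem_Algebra" "HOL-Library.Function_Algebras"
begin

text \<open>Projections of an AF-algebra are compared through the ranks of their approximants at the minimal
  projections of the finite-dimensional algebras \<open>F n\<close>. Hence triviality of \<open>\<alpha>\<^sup>J\<close> on \<open>K\<^sub>0\<close> makes every
  projection equivalent to its image under \<open>\<alpha>\<^sup>J\<close>, and for \<open>S\<close> divisible by \<open>J\<close> some unitary of the algebra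
  implements \<open>\<alpha>\<^sup>S\<close> on a given \<open>F n\<close>.

  A Rokhlin tower \<open>e 1, \<dots>, e M\<close> of height \<open>M = S + L\<close> gives, by polar decomposition of
  \<open>\<pi> (e j) u\<^sup>j\<^sup>-\<^sup>1 \<pi> (e 1)\<close>, partial isometries \<open>s j\<close> which \<open>u\<close> shifts up to a small error. With the help of
  such a unitary, Berg's technique rotates the last \<open>L\<close> of them into the first \<open>L\<close> in steps of size
  \<open>O(1/L)\<close>. The resulting projection \<open>p\<close> almost commutes with \<open>u\<close> and with finitely many prescribed
  elements of \<open>\<pi> A\<close>, and compresses them into a matrix algebra over a finite-dimensional
  subalgebra of \<open>\<pi> (e 1) \<pi> A \<pi> (e 1)\<close>.

  The part of the tower lost to \<open>p\<close> is equivalent to \<open>e 1 + \<dots> + e L\<close>. As \<open>J\<close> divides \<open>L\<close>, the tower contains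
  \<open>M / L\<close> orthogonal equivalent copies of this projection, which is therefore small by \<open>\<alpha>\<close>-simplicity.
  Finally, Fejer means and compression by a tower show that the hereditary subalgebra of a nonzero
  positive element of the crossed product contains a copy of a nonzero projection of \<open>A\<close>; this yields
  simplicity and the comparison of \<open>1 - p\<close> with a given positive element.\<close>

text \<open>Compressing \<open>u\<close> to a whole tower gives a shift, but the step from the top
  back to the bottom involves a high power of \<alpha>, which a finite-dimensional algebra over
  \<open>e 1\<close> need not contain. K-theory supplies what is missing: on prescribed elements the
  power \<open>S\<close> of \<alpha> is conjugation by a unitary, and the corner of that unitary at
  \<open>e 1\<close> glues level \<open>S + i\<close> to level \<open>i\<close>. Spreading the
  gluing over \<open>L\<close> levels makes each jump small; the price is a defect of
  \<open>L\<close> levels, so the ratio \<open>M / L\<close> is taken from the fullness constant of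
  the target projection. The algebra may be non-simple, so a nonzero projection \<open>h\<close>
  need not be full; only its orbit is. Smallness inside the algebra therefore means comparison with
  the first \<open>J\<close> translates of \<open>h\<close>, which become equivalent in the crossed
  product. Hence \<open>J\<close> orthogonal copies of one projection absorb the defect and one more
  absorbs the complement of the tower: the origin of \<open>Suc J\<close>. Square roots, polar
  decompositions and projections near almost idempotent elements all come from one power series,
  that of (1 - y)^(-1/2) for norm y < 1.\<close>

section \<open>Elementary consequences of the C*-identity\<close>

lemma star_zero [simp]: "star (0::'a::cstar_algebra) = 0"
  using star_add[of "0::'a" 0] by simp

lemma star_minus [simp]: "star (- x) = - star (x::'a::cstar_algebra)"
  using star_add[of x "- x"] by (simp add: eq_neg_iff_add_eq_0 add.commute)

lemma star_diff: "star (x - y) = star x - star (y::'a::cstar_algebra)"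
  using star_add[of x "- y"] by simp

lemma star_one [simp]: "star (1::'a::cstar_algebra) = 1"
  using star_mult[of "1::'a" "star 1"] by (simp add: star_star)

lemma star_scaleR: "star (r *\<^sub>R x) = r *\<^sub>R star (x::'a::cstar_algebra)"
  by (simp add: scaleR_scaleC star_scaleC)

lemma star_sum: "star (sum f A) = (\<Sum>i\<in>A. star (f i :: 'a::cstar_algebra))"
  by (induction A rule: infinite_finite_induct) (auto simp: star_add)

lemma star_power: "star (x ^ n) = star (x::'a::cstar_algebra) ^ n"
  by (induction n) (auto simp: star_mult power_commutes)

lemma star_eq_zero [simp]: "star x = 0 \<longleftrightarrow> (x::'a::cstar_algebra) = 0"
  by (metis star_star star_zero)

text \<open>The C*-identity and submultiplicativity give one inequality; applying it to
  \<open>star x\<close> gives the other.\<close>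

lemma norm_star [simp]: "norm (star x) = norm (x::'a::cstar_algebra)"
proof -
  have le: "norm (y::'a) \<le> norm (star y)" for y
  proof (cases "y = 0")
    case False
    have "norm y * norm y \<le> norm (star y) * norm y"
      using cstar_identity[of y] norm_mult_ineq[of "star y" y] by (simp add: power2_eq_square)
    thus ?thesis using False by simp
  qed simp
  show ?thesis using le[of x] le[of "star x"] by (simp add: star_star)
qed

lemma bounded_linear_star: "bounded_linear (star :: 'a::cstar_algebra \<Rightarrow> 'a)"
  by (rule bounded_linear_intro[where K=1]) (auto simp: star_add star_scaleR)

lemma bounded_linear_scaleC: "bounded_linear (\<lambda>x::'a::cstar_algebra. c *\<^sub>C x)"
  by (rule bounded_linear_intro[where K="cmod c"])
    (auto simp: scaleC_add_right scaleR_scaleC scaleC_scaleC norm_scaleC mult.commute)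

lemmas star_tendsto [tendsto_intros] = bounded_linear.tendsto[OF bounded_linear_star]
lemmas scaleC_tendsto [tendsto_intros] = bounded_linear.tendsto[OF bounded_linear_scaleC]

lemma norm_eq_one_if_star_mult:
  fixes v :: "'a::cstar_algebra"
  assumes "star v * v = p" "norm p \<le> 1" shows "norm v \<le> 1"
proof -
  have "(norm v)\<^sup>2 \<le> 1\<^sup>2" using assms cstar_identity[of v] by simp
  thus ?thesis by (rule power2_le_imp_le) simp
qed

lemma projectionD: "projection p \<Longrightarrow> p * p = p" "projection p \<Longrightarrow> star p = p"
  by (auto simp: projection_def)

lemma projection_norm: 
  assumes "projection (p::'a::cstar_algebra)" "p \<noteq> 0" shows "norm p = 1"
  using cstar_identity[of p] assms by (auto simp: projection_def power2_eq_square)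

lemma projection_norm_le: "projection (p::'a::cstar_algebra) \<Longrightarrow> norm p \<le> 1"
  using projection_norm by fastforce

lemma projection_zero [simp]: "projection 0" by (simp add: projection_def)
lemma projection_one [simp]: "projection 1" by (simp add: projection_def)

lemma projection_le_sym: 
  assumes "projection p" "projection q" "p * q = q" shows "q * p = (q::'a::cstar_algebra)"
  using assms star_mult[of p q] by (simp add: projection_def)

lemma projection_orth_sym:
  assumes "projection p" "projection q" "p * q = 0" shows "q * p = (0::'a::cstar_algebra)"
  using assms star_mult[of p q] by (simp add: projection_def)

lemma projection_add: 
  assumes "projection p" "projection q" "p * q = (0::'a::cstar_algebra)" shows "projection (p + q)"
  using assms projection_orth_sym[OF assms] by (simp add: projection_def star_add algebra_simps)

lemma projection_diff:
  assumes "projection p" "projection q" "p * q = (q::'a::cstar_algebra)" shows "projection (p - q)"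
  using assms projection_le_sym[OF assms] by (simp add: projection_def star_diff algebra_simps)

lemma projection_sum:
  assumes "finite A" "\<And>i. i \<in> A \<Longrightarrow> projection (f i)" "\<And>i j. i \<in> A \<Longrightarrow> j \<in> A \<Longrightarrow> i \<noteq> j \<Longrightarrow> f i * f j = (0::'a::cstar_algebra)"
  shows "projection (sum f A)"
  using assms
proof (induction A rule: finite_induct)
  case (insert x A)
  have "f x * sum f A = 0" unfolding sum_distrib_left using insert by (intro sum.neutral) auto
  thus ?case using insert by (simp add: projection_add)
qed simp

text \<open>For \<open>d = v * p - v\<close> the product \<open>star d * d\<close> expands to zero,
  so the C*-identity gives \<open>d = 0\<close>. This replaces an argument with vectors of a Hilbert
  space.\<close>

lemma partial_isometry_right:
  assumes "star v * v = p" "projection (p::'a::cstar_algebra)" shows "v * p = v"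
proof -
  have sv: "star v * (v * x) = p * x" for x using assms(1) by (simp add: mult.assoc[symmetric])
  have "star (v * p - v) * (v * p - v) = p * (star v * v) * p - p * (star v * v) - (star v * v) * p + star v * v"
    using assms sv by (simp add: star_diff star_mult projectionD algebra_simps)
  also have "\<dots> = 0" using assms by (simp add: projection_def)
  finally have "norm (v * p - v) = 0" using cstar_identity[of "v * p - v"] by simp
  thus ?thesis by simp
qed

lemma partial_isometry_left:
  assumes "star v * v = p" "projection (p::'a::cstar_algebra)" shows "projection (v * star v)" "v * star v * v = v"
proof -
  show "v * star v * v = v" using partial_isometry_right[OF assms] assms(1) by (simp add: mult.assoc)
  thus "projection (v * star v)" by (simp add: projection_def star_mult star_star mult.assoc[symmetric])
qed

subsection \<open>The power series of \<open>(1 - y)\<close> to the power \<open>-1/2\<close>\<close>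

text \<open>These numbers equal (2n choose n) / 4^n. They lie in [0, 1], so the series is dominated
  by the geometric one.\<close>

definition rsqrt_coeff :: "nat \<Rightarrow> real" where
  "rsqrt_coeff n = (- 1) ^ n * ((- 1/2) gchoose n)"

lemma rsqrt_coeff_0 [simp]: "rsqrt_coeff 0 = 1" by (simp add: rsqrt_coeff_def)

lemma rsqrt_coeff_Suc: "rsqrt_coeff (Suc n) = rsqrt_coeff n * ((2 * real n + 1) / (2 * real n + 2))"
proof -
  have *: "real (Suc n) * ((-1/2::real) gchoose Suc n) = (-1/2 - real n) * ((-1/2) gchoose n)"
    using gbinomial_absorption'[of "Suc n" "-1/2::real"] gbinomial_mult_1[of "-1/2::real" n] 
    by (simp add: algebra_simps)
  hence "((-1/2::real) gchoose Suc n) = (-1/2 - real n) / real (Suc n) * ((-1/2) gchoose n)"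
    by (simp add: field_simps)
  moreover have "(-1/2 - real n) / real (Suc n) = - ((2 * real n + 1) / (2 * real n + 2))"
    by (simp add: divide_simps) (simp add: algebra_simps)
  ultimately have "((-1/2::real) gchoose Suc n) = - ((2 * real n + 1) / (2 * real n + 2)) * ((-1/2) gchoose n)"
    by (simp only:)
  thus ?thesis unfolding rsqrt_coeff_def by (simp only: power_Suc mult_minus_left mult_minus_right mult_1_left minus_minus mult_ac)
qed

lemma rsqrt_coeff_bounds: "0 \<le> rsqrt_coeff n \<and> rsqrt_coeff n \<le> 1"
proof (induction n)
  case (Suc n)
  have "0 \<le> (2 * real n + 1) / (2 * real n + 2)" "(2 * real n + 1) / (2 * real n + 2) \<le> 1" by auto
  thus ?case using Suc mult_mono[of "rsqrt_coeff n" 1 "(2 * real n + 1) / (2 * real n + 2)" 1]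
    by (auto simp: rsqrt_coeff_Suc)
qed simp

text \<open>Vandermonde's identity: twice the exponent -1/2 is -1, so the convolution has the
  coefficients of the geometric series.\<close>

lemma rsqrt_coeff_conv: "(\<Sum>i\<le>n. rsqrt_coeff i * rsqrt_coeff (n - i)) = 1"
proof -
  have "(\<Sum>i\<le>n. rsqrt_coeff i * rsqrt_coeff (n - i)) = 
      (\<Sum>i\<le>n. (-1) ^ n * (((-1/2) gchoose i) * ((-1/2) gchoose (n - i))))"
  proof (intro sum.cong refl)
    fix i assume "i \<in> {..n}"
    hence "(-1::real) ^ n = (-1) ^ i * (-1) ^ (n - i)" by (simp add: power_add[symmetric])
    thus "rsqrt_coeff i * rsqrt_coeff (n - i) = (-1) ^ n * (((-1/2) gchoose i) * ((-1/2) gchoose (n - i)))"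
      unfolding rsqrt_coeff_def by (simp only: mult_ac)
  qed
  also have "\<dots> = (-1) ^ n * ((-1) gchoose n)"
    using gbinomial_Vandermonde[of "-1/2::real" "-1/2" n] by (simp add: sum_distrib_left[symmetric] atMost_atLeast0)
  also have "((-1::real) gchoose n) = (-1) ^ n"
    using gbinomial_minus[of "1::real" n] binomial_gbinomial[of n n, where 'a=real] by simp
  finally show ?thesis by (simp add: power_mult_distrib[symmetric])
qed

definition rsqrt :: "'a::{real_normed_algebra_1,banach} \<Rightarrow> 'a" where
  "rsqrt y = (\<Sum>n. rsqrt_coeff n *\<^sub>R y ^ n)"

context
  fixes y :: "'a::{real_normed_algebra_1,banach}" assumes y: "norm y < 1"
begin

lemma rsqrt_norm_term: "norm (rsqrt_coeff n *\<^sub>R y ^ n) \<le> norm y ^ n"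
proof -
  have "norm (rsqrt_coeff n *\<^sub>R y ^ n) = rsqrt_coeff n * norm (y ^ n)" using rsqrt_coeff_bounds by simp
  also have "\<dots> \<le> 1 * norm y ^ n" using rsqrt_coeff_bounds by (intro mult_mono norm_power_ineq) auto
  finally show ?thesis by simp
qed

lemma rsqrt_summable_norm: "summable (\<lambda>n. norm (rsqrt_coeff n *\<^sub>R y ^ n))"
  by (rule summable_comparison_test'[OF summable_geometric, where N = 0 and c1 = "norm y"]) (use y rsqrt_norm_term in auto)

lemma rsqrt_summable: "summable (\<lambda>n. rsqrt_coeff n *\<^sub>R y ^ n)"
  using rsqrt_summable_norm by (rule summable_norm_cancel)

lemma rsqrt_sums: "(\<lambda>n. rsqrt_coeff n *\<^sub>R y ^ n) sums rsqrt y"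
  using rsqrt_summable unfolding rsqrt_def by (rule summable_sums)

text \<open>The Cauchy square of the series is the geometric series; hence the square of
  \<open>rsqrt y\<close> inverts \<open>1 - y\<close>.\<close>

lemma rsqrt_square_sums: "(\<lambda>n. y ^ n) sums (rsqrt y * rsqrt y)"
proof -
  have "(\<lambda>k. \<Sum>i\<le>k. (rsqrt_coeff i *\<^sub>R y ^ i) * (rsqrt_coeff (k - i) *\<^sub>R y ^ (k - i))) sums (rsqrt y * rsqrt y)"
    unfolding rsqrt_def using rsqrt_summable_norm rsqrt_summable_norm by (rule Cauchy_product_sums)
  also have "(\<lambda>k. \<Sum>i\<le>k. (rsqrt_coeff i *\<^sub>R y ^ i) * (rsqrt_coeff (k - i) *\<^sub>R y ^ (k - i))) = (\<lambda>k. y ^ k)"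
  proof
    fix k
    have "(\<Sum>i\<le>k. (rsqrt_coeff i *\<^sub>R y ^ i) * (rsqrt_coeff (k - i) *\<^sub>R y ^ (k - i))) =
        (\<Sum>i\<le>k. (rsqrt_coeff i * rsqrt_coeff (k - i)) *\<^sub>R y ^ k)"
      by (intro sum.cong refl) (auto simp: power_add[symmetric])
    also have "\<dots> = y ^ k" by (simp add: scaleR_sum_left[symmetric] rsqrt_coeff_conv)
    finally show "(\<Sum>i\<le>k. (rsqrt_coeff i *\<^sub>R y ^ i) * (rsqrt_coeff (k - i) *\<^sub>R y ^ (k - i))) = y ^ k" .
  qed
  finally show ?thesis .
qed

lemma rsqrt_commutes: 
  assumes "y * z = z * y" shows "rsqrt y * z = z * rsqrt y"
proof -
  have *: "y ^ n * z = z * y ^ n" for n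
    by (induction n) (auto simp: mult.assoc assms, simp add: mult.assoc[symmetric] assms)
  have "(\<lambda>n. (rsqrt_coeff n *\<^sub>R y ^ n) * z) sums (rsqrt y * z)" using rsqrt_sums by (rule sums_mult2)
  moreover have "(\<lambda>n. z * (rsqrt_coeff n *\<^sub>R y ^ n)) sums (z * rsqrt y)" using rsqrt_sums by (rule sums_mult)
  ultimately show ?thesis using * by (simp add: sums_iff)
qed

lemma rsqrt_inverse: "(1 - y) * (rsqrt y * rsqrt y) = 1" "rsqrt y * rsqrt y * (1 - y) = 1"
proof -
  have "(\<lambda>n. y ^ n * (1 - y)) sums (rsqrt y * rsqrt y * (1 - y))"
    using rsqrt_square_sums by (rule sums_mult2)
  moreover have "(\<lambda>n. y ^ n * (1 - y)) sums (y ^ 0 - 0)"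
  proof -
    have "(\<lambda>n. y ^ n) \<longlonglongrightarrow> 0" using y by (rule LIMSEQ_power_zero)
    hence "(\<lambda>n. y ^ n - y ^ Suc n) sums (y ^ 0 - 0)" by (rule telescope_sums')
    moreover have "y ^ n * (1 - y) = y ^ n - y ^ Suc n" for n by (simp add: right_diff_distrib power_commutes)
    ultimately show ?thesis by simp
  qed
  ultimately show 1: "rsqrt y * rsqrt y * (1 - y) = 1" by (auto dest: sums_unique2)
  have c: "rsqrt y * (1 - y) = (1 - y) * rsqrt y" using rsqrt_commutes[of "1 - y"] by (simp add: left_diff_distrib right_diff_distrib)
  have "(1 - y) * (rsqrt y * rsqrt y) = rsqrt y * (1 - y) * rsqrt y" by (simp only: c mult.assoc[symmetric])
  also have "\<dots> = rsqrt y * rsqrt y * (1 - y)" by (simp only: c[symmetric] mult.assoc)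
  finally show "(1 - y) * (rsqrt y * rsqrt y) = 1" using 1 by simp
qed

lemma rsqrt_minus_one: "norm (rsqrt y - 1) \<le> norm y / (1 - norm y)"
proof -
  have s: "(\<lambda>n. rsqrt_coeff (Suc n) *\<^sub>R y ^ Suc n) sums (rsqrt y - 1)"
    using rsqrt_sums sums_Suc_iff[of "\<lambda>n. rsqrt_coeff n *\<^sub>R y ^ n" "rsqrt y - 1"] by simp
  have g: "(\<lambda>n. norm y * norm y ^ n) sums (norm y * (1 / (1 - norm y)))"
    by (rule sums_mult[OF geometric_sums]) (use y in simp)
  have "norm (rsqrt y - 1) \<le> norm y * (1 / (1 - norm y))"
  proof (rule norm_sums_le[OF s g])
    show "norm (rsqrt_coeff (Suc n) *\<^sub>R y ^ Suc n) \<le> norm y * norm y ^ n" for n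
      using rsqrt_norm_term[of "Suc n"] by simp
  qed
  thus ?thesis by simp
qed

text \<open>The partial sums stay in \<open>S\<close>. With \<open>z = w = 1\<close> this keeps the
  root inside any closed unital algebra that contains \<open>y\<close>.\<close>

lemma rsqrt_closed_subspace:
  assumes "closed S" "subspace S" 
    "\<And>n. z * y ^ n * w \<in> S"
  shows "z * rsqrt y * w \<in> S"
proof -
  have "(\<lambda>n. z * (rsqrt_coeff n *\<^sub>R y ^ n) * w) sums (z * rsqrt y * w)"
    by (rule sums_mult2[OF sums_mult[OF rsqrt_sums]])
  hence "(\<lambda>n. \<Sum>i<n. rsqrt_coeff i *\<^sub>R (z * y ^ i * w)) \<longlonglongrightarrow> z * rsqrt y * w" by (simp add: sums_def)
  moreover have "(\<Sum>i<n. rsqrt_coeff i *\<^sub>R (z * y ^ i * w)) \<in> S" for n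
    by (intro subspace_sum[OF assms(2)] subspace_scale[OF assms(2)] assms(3))
  ultimately show ?thesis using closed_sequentially[OF assms(1)] by metis
qed

end

lemma rsqrt_star:
  fixes y :: "'a::cstar_algebra"
  assumes "norm y < 1" "star y = y" shows "star (rsqrt y) = rsqrt y"
proof -
  have "(\<lambda>n. star (rsqrt_coeff n *\<^sub>R y ^ n)) sums star (rsqrt y)"
    using rsqrt_sums[OF assms(1)] bounded_linear.sums[OF bounded_linear_star] by blast
  thus ?thesis using rsqrt_sums[OF assms(1)] assms(2) by (simp add: star_scaleR star_power sums_iff)
qed

lemma csubspace_subspace: "csubspace S \<Longrightarrow> subspace S"
  by (auto simp: subspace_def scaleR_scaleC complex_vector.subspace_0 complex_vector.subspace_add complex_vector.subspace_scale)

subsection \<open>Contractivity of homomorphisms\<close>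

text \<open>The element \<open>w = h + i k\<close> is normal with \<open>star w * w = r\<close>, and
  \<open>h\<close> is its real part. Norm bounds for self-adjoint elements below are obtained by
  producing \<open>k\<close> as the square root of \<open>r - h * h\<close>.\<close>

lemma sa_norm_le:
  fixes h k :: "'a::cstar_algebra"
  assumes "star h = h" "star k = k" "h * k = k * h" "h * h + k * k = r *\<^sub>R 1"
  shows "(norm h)\<^sup>2 \<le> \<bar>r\<bar>"
proof -
  define w where "w = h + \<i> *\<^sub>C k"
  have sw: "star w = h + (- \<i>) *\<^sub>C k" by (simp add: w_def star_add star_scaleC assms)
  have "star w * w = (h + (- \<i>) *\<^sub>C k) * (h + \<i> *\<^sub>C k)" unfolding sw by (simp only: w_def)
  also have "\<dots> = h * h + k * k"
    by (simp add: algebra_simps mult_scaleC_left mult_scaleC_right scaleC_scaleC assms(3) scaleC_one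
      complex_vector.scale_left_diff_distrib)
  finally have ww: "star w * w = h * h + k * k" .
  hence "(norm w)\<^sup>2 = \<bar>r\<bar>" using cstar_identity[of w] assms(4) by simp
  moreover have "norm h \<le> norm w"
  proof -
    have "w + star w = w + (h + (- \<i>) *\<^sub>C k)" by (simp only: sw)
    also have "\<dots> = 2 *\<^sub>R h" by (simp add: w_def scaleR_2)
    finally have "2 *\<^sub>R h = w + star w" ..
    hence "2 * norm h \<le> norm w + norm (star w)" by (metis norm_scaleR abs_numeral norm_triangle_ineq)
    thus ?thesis by simp
  qed
  ultimately show ?thesis by (metis norm_ge_zero power_mono)
qed

text \<open>The root is (1 - x) times (1 - x)^(-1/2). Being a limit of polynomials in
  \<open>x\<close>, it commutes with whatever commutes with \<open>x\<close>.\<close>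

lemma sqrt_one_minus:
  fixes x :: "'a::cstar_algebra"
  assumes "star x = x" "norm x < 1"
  shows "\<exists>y. star y = y \<and> y * y = 1 - x \<and> (\<forall>z. x * z = z * x \<longrightarrow> y * z = z * y)"
proof -
  define y where "y = (1 - x) * rsqrt x"
  have c: "rsqrt x * z = z * rsqrt x" if "x * z = z * x" for z
    using rsqrt_commutes[OF assms(2) that] .
  have c1: "rsqrt x * (1 - x) = (1 - x) * rsqrt x" by (rule c) (simp add: algebra_simps)
  have 1: "star y = y" using c1 by (simp add: y_def star_mult rsqrt_star[OF assms(2,1)] star_diff assms(1))
  have "y * y = (1 - x) * (rsqrt x * (1 - x)) * rsqrt x" by (simp add: y_def mult.assoc)
  also have "\<dots> = (1 - x) * ((1 - x) * (rsqrt x * rsqrt x))" by (simp only: c1 mult.assoc)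
  also have "\<dots> = 1 - x" using rsqrt_inverse[OF assms(2)] by simp
  finally have 2: "y * y = 1 - x" .
  have 3: "y * z = z * y" if "x * z = z * x" for z
  proof -
    have "(1 - x) * z = z * (1 - x)" using that by (simp add: algebra_simps)
    thus ?thesis using c[OF that] by (metis y_def mult.assoc)
  qed
  show ?thesis using 1 2 3 by (intro exI[of _ y] conjI allI impI)
qed

lemma cstar_homD:
  assumes "cstar_hom \<phi>"
  shows "\<phi> (x + y) = \<phi> x + \<phi> y" "\<phi> (c *\<^sub>C x) = c *\<^sub>C \<phi> x" "\<phi> (x * y) = \<phi> x * \<phi> y" "\<phi> (star x) = star (\<phi> x)"
    "\<phi> (r *\<^sub>R x) = r *\<^sub>R \<phi> x" "\<phi> 0 = 0" "\<phi> (- x) = - \<phi> x" "\<phi> (x - y) = \<phi> x - \<phi> y"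
proof -
  show *: "\<phi> (x + y) = \<phi> x + \<phi> y" "\<phi> (c *\<^sub>C x) = c *\<^sub>C \<phi> x" "\<phi> (x * y) = \<phi> x * \<phi> y" "\<phi> (star x) = star (\<phi> x)" for x y c
    using assms by (auto simp: cstar_hom_def)
  show "\<phi> (r *\<^sub>R x) = r *\<^sub>R \<phi> x" by (simp add: scaleR_scaleC *)
  show 0: "\<phi> 0 = 0" using *(1)[of 0 0] by simp
  show n: "\<phi> (- x) = - \<phi> x" for x using *(1)[of x "- x"] 0 by (simp add: eq_neg_iff_add_eq_0 add.commute)
  show "\<phi> (x - y) = \<phi> x - \<phi> y" using *(1)[of x "- y"] n[of y] by simp
qed

lemma cstar_hom_sum: "cstar_hom \<phi> \<Longrightarrow> \<phi> (sum f A) = (\<Sum>i\<in>A. \<phi> (f i))"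
  by (induction A rule: infinite_finite_induct) (auto simp: cstar_homD)

text \<open>For \<open>norm x < 1\<close> put \<open>k = star x * x\<close>. A square root
  \<open>y\<close> of \<open>1 - k * k\<close> exists in the domain, and its image completes the
  image of \<open>k\<close> to a pair as in \<open>sa_norm_le\<close> with \<open>r = 1\<close>.
  Scaling gives the general bound.\<close>

lemma cstar_hom_norm_le:
  assumes "cstar_hom \<phi>" "\<phi> 1 = 1"
  shows "norm (\<phi> x) \<le> norm x"
proof -
  note h = cstar_homD[OF assms(1)]
  have 1: "norm (\<phi> x) \<le> 1" if "norm x < 1" for x
  proof -
    define k where "k = star x * x"
    have ks: "star k = k" by (simp add: k_def star_mult star_star)
    have nk: "norm k < 1" using that cstar_identity[of x] by (simp add: k_def power_less_one_iff)
    have "norm (k * k) < 1" using nk norm_mult_ineq[of k k] mult_strict_mono[of "norm k" 1 "norm k" 1] by simp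
    note nkk = this
    have kks: "star (k * k) = k * k" by (simp add: star_mult ks)
    obtain y where y: "star y = y" "y * y = 1 - k * k" "\<forall>z. (k * k) * z = z * (k * k) \<longrightarrow> y * z = z * y"
      using sqrt_one_minus[OF kks nkk] by blast
    have "y * k = k * y" by (rule y(3)[rule_format]) (simp add: mult.assoc)
    have "(norm (\<phi> k))\<^sup>2 \<le> \<bar>1\<bar>"
    proof (rule sa_norm_le)
      show "star (\<phi> k) = \<phi> k" "star (\<phi> y) = \<phi> y" using h(4)[of k] h(4)[of y] ks y(1) by auto
      show "\<phi> k * \<phi> y = \<phi> y * \<phi> k" using h(3) \<open>y * k = k * y\<close> by metis
      have "k * k + y * y = 1" using y(2) by simp
      thus "\<phi> k * \<phi> k + \<phi> y * \<phi> y = 1 *\<^sub>R 1" by (metis h(1,3) assms(2) scaleR_one)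
    qed
    hence "norm (\<phi> k) \<le> 1" by (simp add: power_le_one_iff)
    moreover have "norm (\<phi> k) = (norm (\<phi> x))\<^sup>2" unfolding k_def h(3) h(4) by (rule cstar_identity)
    ultimately show ?thesis by (simp add: power_le_one_iff)
  qed
  show ?thesis
  proof (rule field_le_epsilon)
    fix e :: real assume e: "e > 0"
    define r where "r = norm x + e"
    have r: "r > 0" using e by (simp add: r_def add_nonneg_pos)
    have "norm ((1 / r) *\<^sub>R x) = norm x / r" using r by simp
    also have "\<dots> < 1" using r e by (simp add: r_def)
    finally have "norm ((1 / r) *\<^sub>R x) < 1" .
    hence "norm (\<phi> ((1 / r) *\<^sub>R x)) \<le> 1" by (rule 1)
    hence "norm (\<phi> x) / r \<le> 1" using r by (simp add: h(5))
    thus "norm (\<phi> x) \<le> norm x + e" using r by (simp add: r_def[symmetric])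
  qed
qed

lemma cstar_hom_bounded_linear: "cstar_hom \<phi> \<Longrightarrow> \<phi> 1 = 1 \<Longrightarrow> bounded_linear \<phi>"
  by (rule bounded_linear_intro[where K=1]) (auto simp: cstar_homD cstar_hom_norm_le)

lemma cstar_hom_projection: "cstar_hom \<phi> \<Longrightarrow> projection p \<Longrightarrow> projection (\<phi> p)"
  unfolding projection_def by (metis cstar_homD(3,4))

subsection \<open>The cone generated by squares\<close>

text \<open>A substitute for positivity (a self-adjoint \<open>b\<close> lies in the cone iff its spectrum is nonnegative)
  that needs no functional calculus.\<close>

definition cone :: "'a::cstar_algebra \<Rightarrow> bool" where
  "cone b \<longleftrightarrow> star b = b \<and> (\<exists>t. norm (t *\<^sub>R 1 - b) \<le> t)"

lemma cone_add: "cone a \<Longrightarrow> cone b \<Longrightarrow> cone (a + b)"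
proof -
  assume "cone a" "cone b"
  then obtain t s where ts: "norm (t *\<^sub>R 1 - a) \<le> t" "norm (s *\<^sub>R 1 - b) \<le> s" "star a = a" "star b = b"
    by (auto simp: cone_def)
  have "norm ((t + s) *\<^sub>R 1 - (a + b)) \<le> norm (t *\<^sub>R 1 - a) + norm (s *\<^sub>R 1 - b)"
    using norm_triangle_ineq[of "t *\<^sub>R 1 - a" "s *\<^sub>R 1 - b"] by (simp add: algebra_simps)
  thus ?thesis using ts by (auto simp: cone_def star_add intro!: exI[of _ "t + s"])
qed

text \<open>For \<open>k\<close> of norm below 1 the element \<open>1 - k * k\<close> is the square
  of some \<open>y\<close>, and \<open>sa_norm_le\<close> bounds \<open>y\<close> by 1. So
  \<open>t\<close> is the square of the scaling factor.\<close>

lemma cone_square: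
  assumes "star h = (h::'a::cstar_algebra)" shows "cone (h * h)"
proof -
  define s where "s = norm h + 1"
  have s: "s > 0" "norm h < s" by (auto simp: s_def add_nonneg_pos)
  define k where "k = (1 / s) *\<^sub>R h"
  have k: "star k = k" "norm k < 1" using s assms by (auto simp: k_def star_scaleR)
  have "norm (k * k) < 1" using k(2) norm_mult_ineq[of k k] mult_strict_mono[of "norm k" 1 "norm k" 1] by simp
  note nkk = this
    have kks: "star (k * k) = k * k" by (simp add: star_mult k)
  obtain y where y: "star y = y" "y * y = 1 - k * k" "\<forall>z. (k * k) * z = z * (k * k) \<longrightarrow> y * z = z * y"
    using sqrt_one_minus[OF kks nkk] by blast
  have "y * k = k * y" by (rule y(3)[rule_format]) (simp add: mult.assoc)
  hence "(norm y)\<^sup>2 \<le> \<bar>1\<bar>" by (rule sa_norm_le[OF y(1) k(1)]) (simp add: y(2))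
  moreover have "norm (y * y) = (norm y)\<^sup>2" using cstar_identity[of y] y(1) by simp
  ultimately have "norm (1 - k * k) \<le> 1" using y(2) by simp
  moreover have "s\<^sup>2 *\<^sub>R 1 - h * h = s\<^sup>2 *\<^sub>R (1 - k * k)"
    using s by (simp add: k_def algebra_simps power2_eq_square)
  ultimately have "norm (s\<^sup>2 *\<^sub>R 1 - h * h) \<le> s\<^sup>2" using s by (simp add: mult_left_le)
  thus ?thesis using assms by (auto simp: cone_def star_mult)
qed

lemma cone_scaleR: assumes "cone b" "r \<ge> 0" shows "cone (r *\<^sub>R b)"
proof -
  obtain t where t: "norm (t *\<^sub>R 1 - b) \<le> t" "star b = b" using assms by (auto simp: cone_def)
  have "norm ((r * t) *\<^sub>R 1 - r *\<^sub>R b) = r * norm (t *\<^sub>R 1 - b)"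
    using assms(2) by (metis abs_of_nonneg norm_scaleR scaleR_diff_right scaleR_scaleR)
  also have "\<dots> \<le> r * t" using t assms by (intro mult_left_mono)
  finally show ?thesis using t by (auto simp: cone_def star_scaleR)
qed

text \<open>After scaling, \<open>1 - c\<close> and \<open>1 + c\<close> are contractions. For small
  \<theta> both \<theta> + (1-\<theta>)c and \<theta> - (1-\<theta>)c are then squares of commuting
  self-adjoint elements. The squares add up to 2\<theta>, so by \<open>sa_norm_le\<close> each is of
  size 2\<theta>, and \<open>c\<close> is of order \<theta>.\<close>

lemma cone_antisym:
  assumes "cone b" "cone (- b)" shows "(b::'a::cstar_algebra) = 0"
proof -
  obtain t' s' where ts: "norm (t' *\<^sub>R 1 - b) \<le> t'" "norm (s' *\<^sub>R 1 + b) \<le> s'" and b: "star b = b"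
    using assms by (auto simp: cone_def)
  \<comment> \<open>Enlarging a witness of cone membership keeps it a witness; this common one is
    strictly positive.\<close>
  define t where "t = t' + s' + 1"
  have t0: "t' \<ge> 0" "s' \<ge> 0" using ts norm_ge_zero order_trans by blast+
  hence t: "t > 0" by (simp add: t_def)
  have n1: "norm (t *\<^sub>R 1 - b) \<le> t"
  proof -
    have "norm (t *\<^sub>R 1 - b) \<le> norm (t' *\<^sub>R 1 - b) + norm ((s' + 1) *\<^sub>R (1::'a))"
      using norm_triangle_ineq[of "t' *\<^sub>R 1 - b" "(s' + 1) *\<^sub>R 1"] by (simp add: t_def algebra_simps)
    thus ?thesis using ts t0 by (simp add: t_def)
  qed
  have n2: "norm (t *\<^sub>R 1 + b) \<le> t"
  proof -
    have "norm (t *\<^sub>R 1 + b) \<le> norm (s' *\<^sub>R 1 + b) + norm ((t' + 1) *\<^sub>R (1::'a))"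
      using norm_triangle_ineq[of "s' *\<^sub>R 1 + b" "(t' + 1) *\<^sub>R 1"] by (simp add: t_def algebra_simps)
    thus ?thesis using ts t0 by (simp add: t_def)
  qed
  define c where "c = (1 / t) *\<^sub>R b"
  have cb: "1 - c = (1 / t) *\<^sub>R (t *\<^sub>R 1 - b)" "1 + c = (1 / t) *\<^sub>R (t *\<^sub>R 1 + b)"
    using t by (auto simp: c_def algebra_simps)
  have c: "star c = c" "norm (1 - c) \<le> 1" "norm (1 + c) \<le> 1"
    unfolding cb using n1 n2 t by (auto simp: c_def star_scaleR b)
  have key: "norm c * (1 - \<theta>) \<le> 3 * \<theta>" if \<theta>: "0 < \<theta>" "\<theta> < 1" for \<theta>
  proof -
    have nx: "norm ((1 - \<theta>) *\<^sub>R (1 - c)) < 1" "norm ((1 - \<theta>) *\<^sub>R (1 + c)) < 1"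
    proof -
      have "norm ((1 - \<theta>) *\<^sub>R z) < 1" if "norm z \<le> 1" for z :: 'a
      proof -
        have "norm ((1 - \<theta>) *\<^sub>R z) = (1 - \<theta>) * norm z" using \<theta> by simp
        also have "\<dots> \<le> (1 - \<theta>) * 1" using \<theta> that by (intro mult_left_mono) auto
        also have "\<dots> < 1" using \<theta> by simp
        finally show ?thesis .
      qed
      thus "norm ((1 - \<theta>) *\<^sub>R (1 - c)) < 1" "norm ((1 - \<theta>) *\<^sub>R (1 + c)) < 1" using c(2,3) by blast+
    qed
    have ss: "star ((1 - \<theta>) *\<^sub>R (1 - c)) = (1 - \<theta>) *\<^sub>R (1 - c)" "star ((1 - \<theta>) *\<^sub>R (1 + c)) = (1 - \<theta>) *\<^sub>R (1 + c)"
      by (simp_all add: star_scaleR star_diff star_add c(1))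
    obtain s where s: "star s = s" "s * s = 1 - (1 - \<theta>) *\<^sub>R (1 - c)"
      "\<forall>z. (1 - \<theta>) *\<^sub>R (1 - c) * z = z * ((1 - \<theta>) *\<^sub>R (1 - c)) \<longrightarrow> s * z = z * s"
      using sqrt_one_minus[OF _ nx(1)] ss(1) by blast
    obtain r where r: "star r = r" "r * r = 1 - (1 - \<theta>) *\<^sub>R (1 + c)"
      "\<forall>z. (1 - \<theta>) *\<^sub>R (1 + c) * z = z * ((1 - \<theta>) *\<^sub>R (1 + c)) \<longrightarrow> r * z = z * r"
      using sqrt_one_minus[OF _ nx(2)] ss(2) by blast
    have "s * ((1 - \<theta>) *\<^sub>R (1 + c)) = ((1 - \<theta>) *\<^sub>R (1 + c)) * s"
      by (rule s(3)[rule_format]) (simp add: algebra_simps)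
    hence "r * s = s * r" by (intro r(3)[rule_format]) (rule sym)
    moreover have "s * s + r * r = (2 * \<theta>) *\<^sub>R 1" unfolding s(2) r(2) by (simp add: algebra_simps) (simp add: scaleR_left.add[symmetric])
    ultimately have "(norm s)\<^sup>2 \<le> \<bar>2 * \<theta>\<bar>" using sa_norm_le[OF s(1) r(1)] by simp
    hence "norm (s * s) \<le> 2 * \<theta>" using cstar_identity[of s] s(1) \<theta> by simp
    moreover have "(1 - \<theta>) *\<^sub>R c = s * s - \<theta> *\<^sub>R 1" unfolding s(2) by (simp add: algebra_simps)
    hence "norm ((1 - \<theta>) *\<^sub>R c) \<le> norm (s * s) + norm (\<theta> *\<^sub>R (1::'a))" by (metis norm_triangle_ineq4)
    ultimately show ?thesis using \<theta> by (simp add: mult.commute)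
  qed
  have "norm c = 0"
  proof (rule ccontr)
    assume "norm c \<noteq> 0"
    hence pos: "norm c > 0" by simp
    define \<theta> where "\<theta> = min (1/2) (norm c / 8)"
    have \<theta>: "0 < \<theta>" "\<theta> \<le> 1/2" "\<theta> \<le> norm c / 8" using pos by (auto simp: \<theta>_def)
    have "norm c * (1/2) \<le> norm c * (1 - \<theta>)" using \<theta> by (intro mult_left_mono) auto
    also have "\<dots> \<le> 3 * \<theta>" using \<theta> by (intro key) auto
    also have "\<dots> \<le> 3 * (norm c / 8)" using \<theta> by simp
    finally show False using pos by simp
  qed
  thus ?thesis using t by (simp add: c_def)
qed

text \<open>The part of the positivity of \<open>star x * x\<close> that is required. If it equals
  \<open>- p\<close>, then \<open>q = - (x * star x)\<close> is a projection too, and the sum of the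
  two products is half a sum of two self-adjoint squares. So a sum of cone elements containing
  \<open>2 p\<close> is zero, and \<open>cone_antisym\<close> applies.\<close>

lemma star_mult_eq_neg_projection:
  assumes "star x * x = - p" "projection (p::'a::cstar_algebra)" shows "p = 0"
proof -
  have xp: "x * p = x"
  proof -
    have sv: "star x * (x * z) = - (p * z)" for z using assms(1) by (simp add: mult.assoc[symmetric])
    have "star (x * p - x) * (x * p - x) = 0"
      using assms(1) projectionD[OF assms(2)] by (simp add: star_diff star_mult algebra_simps sv)
    hence "norm (x * p - x) = 0" using cstar_identity[of "x * p - x"] by simp
    thus ?thesis by simp
  qed
  define q where "q = - (x * star x)"
  have "q * q = x * (star x * x) * star x" by (simp add: q_def mult.assoc)
  also have "\<dots> = - (x * p * star x)" using assms(1) by (simp add: mult.assoc)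
  finally have q: "q * q = q" "star q = q" using xp by (auto simp: q_def star_mult star_star)
  define a b where "a = x + star x" and "b = \<i> *\<^sub>C (x - star x)"
  have ab: "star a = a" "star b = b"
    by (auto simp: a_def b_def star_add star_diff star_star star_scaleC complex_vector.scale_right_diff_distrib)
  have bb: "b * b = - ((x - star x) * (x - star x))" 
    by (simp add: b_def mult_scaleC_left mult_scaleC_right scaleC_scaleC scaleC_one complex_vector.scale_minus_left)
  have "a * a + b * b = 2 *\<^sub>R (star x * x) + 2 *\<^sub>R (x * star x)"
    unfolding bb by (simp add: a_def algebra_simps scaleR_2)
  also have "\<dots> = - (2 *\<^sub>R p + 2 *\<^sub>R q)" using assms(1) by (simp add: q_def)
  finally have *: "2 *\<^sub>R p + (2 *\<^sub>R q + (a * a + b * b)) = 0" by (simp add: algebra_simps)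
  have pc: "cone p" "cone q" using cone_square[of p] cone_square[of q] projectionD[OF assms(2)] q by simp_all
  have "cone (2 *\<^sub>R p)" "cone (2 *\<^sub>R q + (a * a + b * b))"
    by (intro cone_add cone_scaleR cone_square pc ab; simp)+
  moreover have "2 *\<^sub>R q + (a * a + b * b) = - (2 *\<^sub>R p)" using * by (simp add: eq_neg_iff_add_eq_0 add.commute)
  ultimately have "2 *\<^sub>R p = 0" using cone_antisym[of "2 *\<^sub>R p"] by simp
  thus ?thesis by simp
qed

text \<open>Self-adjointness makes the scalar real; a negative one could be normalised to -1, which
  the previous lemma excludes.\<close>

lemma star_mult_eq_scale_projection:
  assumes "star x * x = c *\<^sub>C p" "projection (p::'a::cstar_algebra)" "p \<noteq> 0"
  shows "c = of_real (cmod c)"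
proof -
  have "star (star x * x) = star x * x" by (simp add: star_mult star_star)
  hence "cnj c *\<^sub>C p = c *\<^sub>C p" using assms(1) projectionD[OF assms(2)] by (simp add: star_scaleC)
  hence "cnj c = c" using assms(3) by (simp add: complex_vector.scale_cancel_right)
  then obtain r where r: "c = of_real r" by (metis complex_cnj_cancel_iff complex_is_Real_iff Reals_cnj_iff Reals_cases)
  have "r \<ge> 0"
  proof (rule ccontr)
    assume "\<not> r \<ge> 0"
    define y where "y = (1 / sqrt (- r)) *\<^sub>R x"
    have "star y * y = (1 / sqrt (- r) * (1 / sqrt (- r))) *\<^sub>R (star x * x)" 
      by (simp add: y_def star_scaleR)
    also have "\<dots> = (1 / sqrt (- r) * (1 / sqrt (- r))) *\<^sub>R (r *\<^sub>R p)" using assms(1) r by (simp add: scaleR_scaleC)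
    also have "\<dots> = - p" using \<open>\<not> r \<ge> 0\<close> by simp
    finally show False using star_mult_eq_neg_projection[OF _ assms(2)] assms(3) by blast
  qed
  thus ?thesis by (simp add: r)
qed

subsection \<open>Perturbation of projections and partial isometries\<close>

text \<open>Polar decomposition in a corner: \<open>s\<close> is \<open>x\<close> times the inverse
  square root of \<open>star x * x\<close>, computed from \<open>y = q - star x * x\<close>, which
  is small.\<close>

lemma polar_perturbation:
  fixes x :: "'a::cstar_algebra"
  assumes p: "projection p" and q: "projection q" and px: "p * x = x" and xq: "x * q = x"
    and xx: "norm (star x * x - q) \<le> \<delta>" and xx': "norm (x * star x - p) \<le> \<delta>" and \<delta>: "\<delta> \<le> 1/10"
  shows "\<exists>s. star s * s = q \<and> s * star s = p \<and> norm (s - x) \<le> 4 * \<delta>"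
proof -
  define y where "y = q - star x * x"
  define r where "r = rsqrt y"
  define s where "s = x * r"
  note pq = projectionD[OF p] projectionD[OF q]
  have qx: "q * star x = star x" using arg_cong[OF xq, of star] by (simp add: star_mult pq)
  have ny: "norm y \<le> \<delta>" using xx by (simp add: y_def norm_minus_commute)
  hence ny1: "norm y < 1" using \<delta> by simp
  have \<delta>0: "\<delta> \<ge> 0" using ny norm_ge_zero order_trans by blast
  have ys: "star y = y" by (simp add: y_def star_diff star_mult star_star pq)
  have rs: "star r = r" unfolding r_def by (rule rsqrt_star[OF ny1 ys])
  have yq: "y * q = y" "q * y = y" by (simp_all add: y_def left_diff_distrib right_diff_distrib pq mult.assoc xq)
    (simp add: mult.assoc[symmetric] qx)
  have rq: "r * q = q * r" unfolding r_def by (rule rsqrt_commutes[OF ny1]) (simp add: yq)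
  have ry: "r * y = y * r" unfolding r_def by (rule rsqrt_commutes[OF ny1]) simp
  have "star x * x = (1 - y) * q" by (simp add: y_def left_diff_distrib pq mult.assoc xq)
  moreover have "star s * s = r * (star x * x) * r" by (simp add: s_def star_mult rs mult.assoc)
  ultimately have "star s * s = r * (1 - y) * (q * r)" by (simp add: mult.assoc)
  also have "r * (1 - y) = (1 - y) * r" by (simp add: left_diff_distrib right_diff_distrib ry)
  also have "(1 - y) * r * (q * r) = (1 - y) * (r * r) * q" by (simp add: mult.assoc rq[symmetric])
  also have "\<dots> = q" using rsqrt_inverse(1)[OF ny1] by (simp add: r_def)
  finally have ss: "star s * s = q" .
  have r1: "norm (r - 1) \<le> 2 * \<delta>"
  proof -
    have "norm (r - 1) \<le> norm y / (1 - norm y)" unfolding r_def by (rule rsqrt_minus_one[OF ny1])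
    also have "\<dots> \<le> \<delta> / (1/2)" using ny \<delta> \<delta>0 by (intro frac_le) auto
    finally show ?thesis by simp
  qed
  have nx2: "(norm x)\<^sup>2 \<le> 1 + \<delta>"
  proof -
    have "(norm x)\<^sup>2 = norm ((star x * x - q) + q)" using cstar_identity[of x] by simp
    also have "\<dots> \<le> \<delta> + 1" using norm_triangle_ineq[of "star x * x - q" q] xx projection_norm_le[OF q] by simp
    finally show ?thesis by simp
  qed
  have nx: "norm x \<le> 2" by (rule power2_le_imp_le) (use nx2 \<delta> in auto)
  have "norm (s - x) = norm (x * (r - 1))" by (simp add: s_def right_diff_distrib)
  also have "\<dots> \<le> 2 * (2 * \<delta>)" by (rule order_trans[OF norm_mult_ineq mult_mono[OF nx r1]]) auto
  finally have sx: "norm (s - x) \<le> 4 * \<delta>" by simp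
  define p' where "p' = s * star s"
  have p': "projection p'" "s * star s * s = s" unfolding p'_def using partial_isometry_left[OF ss q] by auto
  have pp': "p * p' = p'" by (simp add: p'_def s_def mult.assoc[symmetric] px)
  have "norm (p - p') < 1"
  proof -
    have "p' - x * star x = x * ((r - 1) * (r + 1)) * star x"
      by (simp add: p'_def s_def star_mult rs algebra_simps)
    hence "norm (p' - x * star x) \<le> norm x * norm ((r - 1) * (r + 1)) * norm x"
      using norm_mult_ineq[of "x * ((r - 1) * (r + 1))" "star x"] norm_mult_ineq[of x "(r - 1) * (r + 1)"]
        mult_right_mono[of "norm (x * ((r - 1) * (r + 1)))" "norm x * norm ((r - 1) * (r + 1))" "norm x"] by simp
    also have "\<dots> = (norm x)\<^sup>2 * norm ((r - 1) * (r + 1))" by (simp add: power2_eq_square)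
    also have "norm ((r - 1) * (r + 1)) \<le> norm (r - 1) * norm (r + 1)" by (rule norm_mult_ineq)
    also have "norm (r + 1) \<le> norm (r - 1) + norm (1 + 1::'a)" using norm_triangle_ineq[of "r - 1" "1 + 1"] by (simp add: add.assoc[symmetric] flip: one_add_one)
    also have "norm (r - 1) * (norm (r - 1) + norm (1 + 1::'a)) \<le> (1/5) * (1/5 + 2)"
      using r1 \<delta> by (intro mult_mono add_mono) auto
    also have "(norm x)\<^sup>2 * (1/5 * (1/5 + 2)) \<le> (1 + 1/10) * (1/5 * (1/5 + 2))" using nx2 \<delta> by (intro mult_right_mono) auto
    finally have "norm (p' - x * star x) \<le> (1 + 1/10) * (1/5 * (1/5 + 2))" by (simp add: mult_left_mono mult_right_mono)
    moreover have "norm (p - p') \<le> norm (x * star x - p) + norm (p' - x * star x)"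
      using norm_triangle_ineq4[of "p - x * star x" "p' - x * star x"] by (simp add: norm_minus_commute)
    ultimately show ?thesis using xx' \<delta> by simp
  qed
  \<comment> \<open>A projection of norm below 1 vanishes, so the range of \<open>s\<close> is all
    of \<open>p\<close>.\<close>
  hence "p - p' = 0" using projection_norm[OF projection_diff[OF p p'(1) pp']] by auto
  thus ?thesis using ss sx p'_def by auto
qed

text \<open>The partial isometry is the polar part of \<open>p * q\<close>; it lies within 4\<delta>
  of \<open>p * q\<close>, which is within \<delta> of \<open>q\<close>.\<close>

lemma close_projections:
  assumes p: "projection p" and q: "projection (q::'a::cstar_algebra)" and \<delta>: "norm (p - q) \<le> \<delta>" "\<delta> \<le> 1/10"
  shows "\<exists>s. star s * s = q \<and> s * star s = p \<and> norm (s - q) \<le> 5 * \<delta>"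
proof -
  note pq = projectionD[OF p] projectionD[OF q]
  have *: "norm (a * b * a - a) \<le> norm (b - a)" if "projection a" for a b :: 'a
  proof -
    have "a * b * a - a = a * (b - a) * a" using projectionD[OF that] by (simp add: algebra_simps)
    also have "norm \<dots> \<le> norm (a * (b - a)) * norm a" by (rule norm_mult_ineq)
    also have "\<dots> \<le> norm (a * (b - a)) * 1" using projection_norm_le[OF that] by (intro mult_left_mono) auto
    also have "norm (a * (b - a)) \<le> norm a * norm (b - a)" by (rule norm_mult_ineq)
    also have "\<dots> \<le> 1 * norm (b - a)" using projection_norm_le[OF that] by (intro mult_right_mono) auto
    finally show ?thesis by simp
  qed
  have ppx: "p * (p * z) = p * z" "q * (q * z) = q * z" for z by (simp_all add: mult.assoc[symmetric] pq)
  have "star (p * q) * (p * q) = q * p * q" "p * q * star (p * q) = p * q * p"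
    by (simp_all add: star_mult pq mult.assoc ppx)
  hence "norm (star (p * q) * (p * q) - q) \<le> \<delta>" "norm (p * q * star (p * q) - p) \<le> \<delta>"
    using *[OF p, of q] *[OF q, of p] \<delta> by (simp_all add: norm_minus_commute)
  hence "\<exists>s. star s * s = q \<and> s * star s = p \<and> norm (s - p * q) \<le> 4 * \<delta>"
    using \<delta>(2) by (intro polar_perturbation[OF p q]) (simp_all add: mult.assoc pq ppx)
  then obtain s where s: "star s * s = q" "s * star s = p" "norm (s - p * q) \<le> 4 * \<delta>" by blast
  have "p * q - q = (p - q) * q" by (simp add: left_diff_distrib pq)
  hence "norm (p * q - q) \<le> norm (p - q) * norm q" by (simp add: norm_mult_ineq)
  also have "\<dots> \<le> norm (p - q) * 1" using projection_norm_le[OF q] by (intro mult_left_mono) auto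
  finally have "norm (s - q) \<le> 5 * \<delta>" using s(3) norm_triangle_ineq[of "s - p * q" "p * q - q"] \<delta>(1) by simp
  thus ?thesis using s by blast
qed

text \<open>With \<open>h = x - 1/2\<close> one has \<open>1 - y = 4 h * h\<close>, so
  \<open>h * r\<close> is half the sign of \<open>h\<close> and \<open>e\<close> is the spectral
  projection of \<open>x\<close> for the half-line above 1/2. The two closure properties keep
  \<open>e\<close> in a given finite-dimensional algebra and in commutants.\<close>

lemma nearly_idempotent:
  fixes x :: "'a::cstar_algebra"
  assumes x: "star x = x" and d: "norm (x * x - x) \<le> \<delta>" "\<delta> \<le> 1/8"
  shows "\<exists>e. projection e \<and> norm (e - x) \<le> 8 * \<delta> \<and> (\<forall>z. x * z = z * x \<longrightarrow> e * z = z * e) \<and>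
    (\<forall>S. subspace S \<and> closed S \<and> 1 \<in> S \<and> x \<in> S \<and> (\<forall>a\<in>S. \<forall>b\<in>S. a * b \<in> S) \<longrightarrow> e \<in> S)"
proof -
  define y where "y = 4 *\<^sub>R (x - x * x)"
  define r where "r = rsqrt y"
  define h where "h = x - (1/2) *\<^sub>R 1"
  define e where "e = (1/2) *\<^sub>R 1 + h * r"
  have ny: "norm y \<le> 4 * \<delta>" using d(1) by (simp add: y_def norm_minus_commute)
  hence ny1: "norm y < 1" using d by simp
  have ys: "star y = y" by (simp add: y_def star_scaleR star_diff star_mult x)
  have rc: "r * z = z * r" if "x * z = z * x" for z
  proof -
    have "x * x * z = z * (x * x)" using that by (metis mult.assoc)
    hence "y * z = z * y" using that by (simp add: y_def algebra_simps)
    thus ?thesis unfolding r_def by (rule rsqrt_commutes[OF ny1])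
  qed
  have rh: "r * h = h * r" by (rule rc) (simp add: h_def algebra_simps)
  have hs: "star h = h" by (simp add: h_def star_diff star_scaleR x)
  have rs: "star r = r" unfolding r_def by (rule rsqrt_star[OF ny1 ys])
  have hh: "h * h = (1/4) *\<^sub>R (1 - y)" by (simp add: h_def y_def algebra_simps scaleR_left.add[symmetric])
  have "(h * r) * (h * r) = (h * h) * (r * r)" using rh by (metis mult.assoc)
  also have "\<dots> = (1/4) *\<^sub>R 1" using rsqrt_inverse(1)[OF ny1] by (simp add: hh r_def)
  finally have k: "(h * r) * (h * r) = (1/4) *\<^sub>R 1" .
  have "e * e = (1/4) *\<^sub>R 1 + h * r + (h * r) * (h * r)" by (simp add: e_def algebra_simps scaleR_left.add[symmetric])
  hence "e * e = e" unfolding k by (simp add: e_def algebra_simps scaleR_left.add[symmetric])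
  moreover have "star e = e" by (simp add: e_def star_add star_scaleR star_mult hs rs rh)
  ultimately have pe: "projection e" by (simp add: projection_def)
  have "norm (h * h) \<le> 1/4 + 1/8"
  proof -
    have "h * h = (1/4) *\<^sub>R 1 + (x * x - x)" by (simp add: h_def algebra_simps scaleR_left.add[symmetric])
    thus ?thesis using norm_triangle_ineq[of "(1/4) *\<^sub>R 1" "x * x - x"] d by simp
  qed
  hence "(norm h)\<^sup>2 \<le> 1\<^sup>2" using cstar_identity[of h] hs by simp
  hence nh: "norm h \<le> 1" by (rule power2_le_imp_le) simp
  have r1: "norm (r - 1) \<le> 8 * \<delta>"
  proof -
    have "norm (r - 1) \<le> norm y / (1 - norm y)" unfolding r_def by (rule rsqrt_minus_one[OF ny1])
    also have "\<dots> \<le> (4 * \<delta>) / (1/2)" using ny d order_trans[OF norm_ge_zero d(1)] by (intro frac_le) auto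
    finally show ?thesis by simp
  qed
  have "e - x = h * (r - 1)" by (simp add: e_def h_def algebra_simps)
  hence "norm (e - x) \<le> norm h * norm (r - 1)" by (simp add: norm_mult_ineq)
  also have "\<dots> \<le> 1 * (8 * \<delta>)" using nh r1 by (intro mult_mono) auto
  finally have ne: "norm (e - x) \<le> 8 * \<delta>" by simp
  have ec: "e * z = z * e" if "x * z = z * x" for z
  proof -
    have "h * z = z * h" using that by (simp add: h_def algebra_simps)
    hence "h * r * z = z * (h * r)" using rc[OF that] by (metis mult.assoc)
    thus ?thesis by (simp add: e_def algebra_simps)
  qed
  have eS: "e \<in> S" if S: "subspace S" "closed S" "1 \<in> S" "x \<in> S" "\<forall>a\<in>S. \<forall>b\<in>S. a * b \<in> S" for S
  proof -
    have yS: "y \<in> S" unfolding y_def using S by (intro subspace_scale subspace_diff) auto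
    have "y ^ n \<in> S" for n by (induction n) (use yS S in auto)
    hence "1 * rsqrt y * 1 \<in> S" by (intro rsqrt_closed_subspace[OF ny1 S(2,1)]) simp
    moreover have "h \<in> S" unfolding h_def using S by (intro subspace_scale subspace_diff) auto
    ultimately show ?thesis unfolding e_def r_def using S by (intro subspace_add subspace_scale) auto
  qed
  show ?thesis using pe ne ec eS by blast
qed

subsection \<open>Murray-von Neumann equivalence\<close>

lemma mult_eq_left: "a * b = c \<Longrightarrow> a * (b * z) = c * (z::'a::semigroup_mult)"
  by (simp add: mult.assoc[symmetric])

definition proj_equiv :: "'a::cstar_algebra \<Rightarrow> 'a \<Rightarrow> bool" where
  "proj_equiv p q \<longleftrightarrow> projection p \<and> projection q \<and> (\<exists>v. star v * v = p \<and> v * star v = q)"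

text \<open>The condition \<open>q * v = v\<close> says that the range projection
  \<open>v * star v\<close> lies below \<open>q\<close>.\<close>

definition proj_sub :: "'a::cstar_algebra \<Rightarrow> 'a \<Rightarrow> bool" where
  "proj_sub p q \<longleftrightarrow> projection p \<and> projection q \<and> (\<exists>v. star v * v = p \<and> q * v = v)"

lemma proj_equiv_refl: "projection p \<Longrightarrow> proj_equiv p p"
  unfolding proj_equiv_def by (auto simp: projection_def intro!: exI[of _ p])

lemma proj_equiv_sym: "proj_equiv p q \<Longrightarrow> proj_equiv q p"
  unfolding proj_equiv_def by (metis star_star)

lemma proj_sub_trans: assumes "proj_sub p q" "proj_sub q r" shows "proj_sub p r"
proof -
  obtain v w where v: "star v * v = p" "q * v = v" and w: "star w * w = q" "r * w = w"
    using assms by (auto simp: proj_sub_def)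
  have "star (w * v) * (w * v) = p" using v mult_eq_left[OF w(1), of v] by (simp add: star_mult mult.assoc)
  moreover have "r * (w * v) = w * v" using w(2) by (simp add: mult.assoc[symmetric])
  ultimately show ?thesis using assms unfolding proj_sub_def by blast
qed

lemma proj_equiv_left: assumes "star v * v = p" "v * star v = q" "projection p" shows "q * v = v"
  using partial_isometry_right[OF assms(1,3)] assms by (metis mult.assoc)

lemma proj_equiv_sub: "proj_equiv p q \<Longrightarrow> proj_sub p q"
  unfolding proj_equiv_def proj_sub_def using proj_equiv_left by blast

lemma proj_equiv_trans: assumes "proj_equiv p q" "proj_equiv q r" shows "proj_equiv p r"
proof -
  obtain v w where v: "star v * v = p" "v * star v = q" and w: "star w * w = q" "w * star w = r" 
    and p: "projection p" "projection q" "projection r"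
    using assms by (auto simp: proj_equiv_def)
  have qv: "q * v = v" and wq: "w * q = w"
    using proj_equiv_left[OF v p(1)] partial_isometry_right[OF w(1) p(2)] .
  have "star (w * v) * (w * v) = p" using v qv mult_eq_left[OF w(1), of v] by (simp add: star_mult mult.assoc)
  moreover have "w * v * star (w * v) = r"
    using mult_eq_left[OF v(2), of "star w"] mult_eq_left[OF wq, of "star w"] w(2) by (simp add: star_mult mult.assoc)
  ultimately show ?thesis unfolding proj_equiv_def using p by blast
qed

lemma proj_equiv_hom: assumes "cstar_hom \<phi>" "proj_equiv p q" shows "proj_equiv (\<phi> p) (\<phi> q)"
  using assms cstar_hom_projection[OF assms(1)] cstar_homD(3,4)[OF assms(1)] unfolding proj_equiv_def by metis

lemma proj_equiv_zero: "proj_equiv p 0 \<Longrightarrow> p = 0"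
proof -
  assume "proj_equiv p 0"
  then obtain v where v: "star v * v = p" "v * star v = 0" by (auto simp: proj_equiv_def)
  have "v = 0" using cstar_identity[of "star v"] v(2) by (simp add: star_star)
  thus "p = 0" using v(1) by simp
qed

lemma proj_sub_sum:
  assumes "finite I" "\<And>i. i \<in> I \<Longrightarrow> proj_sub (P i) (Q i)"
    "\<And>i j. i \<in> I \<Longrightarrow> j \<in> I \<Longrightarrow> i \<noteq> j \<Longrightarrow> P i * P j = 0"
    "\<And>i j. i \<in> I \<Longrightarrow> j \<in> I \<Longrightarrow> i \<noteq> j \<Longrightarrow> Q i * Q j = 0"
  shows "proj_sub (sum P I) (sum Q I)"
proof -
  have "\<forall>i\<in>I. \<exists>v. star v * v = P i \<and> Q i * v = v" using assms(2) by (auto simp: proj_sub_def)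
  then obtain v where v: "\<And>i. i \<in> I \<Longrightarrow> star (v i) * v i = P i" "\<And>i. i \<in> I \<Longrightarrow> Q i * v i = v i" by metis
  have pr: "projection (P i)" "projection (Q i)" if "i \<in> I" for i using assms(2)[OF that] by (auto simp: proj_sub_def)
  have vv: "star (v i) * v j = (if i = j then P i else 0)" if "i \<in> I" "j \<in> I" for i j
  proof (cases "i = j")
    case False
    have "star (v i) * v j = star (v i) * Q i * (Q j * v j)"
      using v(2)[OF that(1)] v(2)[OF that(2)] pr(2)[OF that(1)] by (metis projectionD(2) star_mult)
    also have "\<dots> = star (v i) * (Q i * Q j) * v j" by (simp add: mult.assoc)
    finally show ?thesis using assms(4)[OF that False] False by simp
  qed (use v that in auto)
  have "star (sum v I) * sum v I = (\<Sum>i\<in>I. \<Sum>j\<in>I. star (v i) * v j)"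
    by (simp add: star_sum sum_product)
  also have "\<dots> = (\<Sum>i\<in>I. \<Sum>j\<in>I. if i = j then P i else 0)" by (intro sum.cong refl vv)
  also have "\<dots> = sum P I" using assms(1) by simp
  finally have 1: "star (sum v I) * sum v I = sum P I" .
  have "Q j * v i = (if i = j then v i else 0)" if "i \<in> I" "j \<in> I" for i j
  proof (cases "i = j")
    case False
    have "Q j * v i = Q j * (Q i * v i)" using v(2) that by simp
    thus ?thesis using assms(4)[of j i] that False by (simp add: mult.assoc[symmetric])
  qed (use v that in auto)
  hence "sum Q I * v i = v i" if "i \<in> I" for i
    using that assms(1) unfolding sum_distrib_right by (subst sum.cong[OF refl]) auto
  hence 2: "sum Q I * sum v I = sum v I" by (simp add: sum_distrib_left)
  have "projection (sum P I)" "projection (sum Q I)"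
    by (rule projection_sum[OF assms(1)]; use pr assms(3,4) in blast)+
  thus ?thesis unfolding proj_sub_def using 1 2 by blast
qed

lemma proj_sub_add:
  assumes "proj_sub p q" "proj_sub p' q'" "p * p' = 0" "q * q' = 0"
  shows "proj_sub (p + p') (q + q')"
proof -
  have "projection p" "projection q" "projection p'" "projection q'" using assms by (auto simp: proj_sub_def)
  hence "p' * p = 0" "q' * q = 0" using assms projection_orth_sym by auto
  \<comment> \<open>The two summands are treated as a family indexed by \<open>bool\<close>.\<close>
  hence "proj_sub (\<Sum>i\<in>UNIV. if i then p else p') (\<Sum>i\<in>UNIV. if i then q else q')"
    using assms by (intro proj_sub_sum) auto
  thus ?thesis by (simp add: UNIV_bool add.commute)
qed

lemma proj_sub_le: "projection p \<Longrightarrow> projection q \<Longrightarrow> q * p = p \<Longrightarrow> proj_sub p q"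
  unfolding proj_sub_def by (auto simp: projection_def intro!: exI[of _ p])

subsection \<open>Evaluation of polynomials\<close>

definition ev :: "'a::cstar_algebra \<Rightarrow> complex poly \<Rightarrow> 'a" where
  "ev h q = fold_coeffs (\<lambda>c x. c *\<^sub>C 1 + h * x) q 0"

lemma ev_0 [simp]: "ev h 0 = 0" by (simp add: ev_def)

lemma ev_pCons [simp]: "ev h (pCons c q) = c *\<^sub>C 1 + h * ev h q"
  by (cases "c = 0 \<and> q = 0") (auto simp: ev_def)

lemma ev_add: "ev h (p + q) = ev h p + ev h q"
  by (induction p q rule: poly_induct2) (auto simp: algebra_simps scaleC_add_left)

lemma ev_sum: "ev h (sum f A) = (\<Sum>i\<in>A. ev h (f i))"
  by (induction A rule: infinite_finite_induct) (auto simp: ev_add)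

lemma ev_smult: "ev h (Polynomial.smult c q) = c *\<^sub>C ev h q"
  by (induction q) (auto simp: complex_vector.scale_right_distrib scaleC_scaleC mult_scaleC_right)

lemma ev_mult: "ev h (p * q) = ev h p * ev h q"
  by (induction p) (auto simp: ev_add ev_smult algebra_simps mult_scaleC_left)

lemma ev_monom: "ev h (monom c n) = c *\<^sub>C h ^ n"
  by (induction n) (auto simp: monom_0 monom_Suc mult_scaleC_right)

lemma ev_star: "star h = h \<Longrightarrow> star (ev h q) = ev h (map_poly cnj q)"
proof (induction q)
  case (pCons c q)
  have "h * ev h r = ev h r * h" for r
    using ev_mult[of h "[:0,1:]" r] ev_mult[of h r "[:0,1:]"] by (simp add: mult.commute)
  thus ?case using pCons by (simp add: map_poly_pCons star_add star_scaleC star_mult)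
qed simp

lemma ev_commute: "z * h = h * z \<Longrightarrow> z * ev h q = ev h q * z"
proof (induction q)
  case (pCons c q)
  have "z * (h * ev h q) = h * ev h q * z" using pCons by (metis mult.assoc)
  thus ?case by (simp add: algebra_simps mult_scaleC_left mult_scaleC_right)
qed simp

lemma ev_eigen: "h * k = l *\<^sub>C k \<Longrightarrow> ev h q * k = poly q l *\<^sub>C k"
  by (induction q) (auto simp: algebra_simps mult_scaleC_left mult_scaleC_right mult.assoc scaleC_add_left scaleC_scaleC mult.commute)


subsection \<open>Finite-dimensional algebras\<close>

locale fd_algebra =
  fixes F :: "'a::cstar_algebra set"
  assumes subalgebra: "cstar_subalgebra F" and fin_dim: "finite_dimensional F" and one_in: "1 \<in> F"
begin

lemma csubspace_F: "csubspace F" using subalgebra by (simp add: cstar_subalgebra_def)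
lemma mult_in: "x \<in> F \<Longrightarrow> y \<in> F \<Longrightarrow> x * y \<in> F" using subalgebra by (simp add: cstar_subalgebra_def)
lemma star_in: "x \<in> F \<Longrightarrow> star x \<in> F" using subalgebra by (simp add: cstar_subalgebra_def)
lemma closed_F: "closed F" using subalgebra by (simp add: cstar_subalgebra_def)
lemma subspace_F: "subspace F" using csubspace_F by (rule csubspace_subspace)
lemmas scaleC_in = complex_vector.subspace_scale[OF csubspace_F]
lemmas add_in = complex_vector.subspace_add[OF csubspace_F]
lemmas diff_in = complex_vector.subspace_diff[OF csubspace_F]
lemmas sum_in = complex_vector.subspace_sum[OF csubspace_F]
lemmas zero_in = complex_vector.subspace_0[OF csubspace_F]
lemmas scaleR_in = subspace_scale[OF subspace_F]

definition orthset :: "'a set \<Rightarrow> bool" where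
  "orthset E \<longleftrightarrow> finite E \<and> E \<subseteq> F \<and> (\<forall>e\<in>E. projection e \<and> e \<noteq> 0) \<and> (\<forall>e\<in>E. \<forall>f\<in>E. e \<noteq> f \<longrightarrow> e * f = 0)"

definition minimal :: "'a \<Rightarrow> bool" where
  "minimal m \<longleftrightarrow> m \<in> F \<and> projection m \<and> m \<noteq> 0 \<and> (\<forall>e\<in>F. projection e \<and> m * e = e \<longrightarrow> e = 0 \<or> e = m)"

text \<open>Orthogonal nonzero projections are linearly independent, so a finite spanning set bounds
  their number.\<close>

lemma orthset_card_bound: "\<exists>k. \<forall>E. orthset E \<longrightarrow> card E \<le> k"
proof -
  obtain S where S: "finite S" "F = cspan S" using fin_dim by (auto simp: finite_dimensional_def)
  have "card E \<le> card S" if E: "orthset E" for E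
  proof -
    have "\<not> complex_vector.dependent E"
    proof
      assume "complex_vector.dependent E"
      then obtain T c v where T: "finite T" "T \<subseteq> E" "(\<Sum>v\<in>T. c v *\<^sub>C v) = 0" "v \<in> T" "c v \<noteq> 0"
        unfolding complex_vector.dependent_explicit by blast
      have "v * (\<Sum>w\<in>T. c w *\<^sub>C w) = (\<Sum>w\<in>T. if w = v then c v *\<^sub>C v else 0)"
        unfolding sum_distrib_left using E T by (intro sum.cong) (auto simp: orthset_def mult_scaleC_right projection_def subset_iff)
      also have "\<dots> = c v *\<^sub>C v" using T by simp
      finally have "c v *\<^sub>C v = 0" using T(3) by simp
      thus False using T E by (auto simp: orthset_def)
    qed
    moreover have "E \<subseteq> cspan S" using E unfolding S(2)[symmetric] orthset_def by blast
    ultimately show ?thesis using complex_vector.independent_span_bound[OF S(1)] by blast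
  qed
  thus ?thesis by blast
qed

text \<open>Take an orthogonal decomposition with the largest number of terms; a term that is not
  minimal could be split into \<open>f\<close> and \<open>e - f\<close>, giving a longer
  one.\<close>

lemma orthset_decomposition:
  assumes "p \<in> F" "projection p"
  shows "\<exists>E. orthset E \<and> (\<forall>e\<in>E. minimal e) \<and> \<Sum>E = p"
proof -
  define \<E> where "\<E> = {E. orthset E \<and> \<Sum>E = p}"
  obtain k where k: "\<And>E. orthset E \<Longrightarrow> card E \<le> k" using orthset_card_bound by blast
  have ne: "\<exists>E. E \<in> \<E>"
  proof (cases "p = 0")
    case True thus ?thesis by (intro exI[of _ "{}"]) (auto simp: \<E>_def orthset_def)
  next
    case False thus ?thesis using assms by (intro exI[of _ "{p}"]) (auto simp: \<E>_def orthset_def)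
  qed
  hence "\<exists>E. E \<in> \<E> \<and> (\<forall>E'. E' \<in> \<E> \<longrightarrow> card E' \<le> card E)"
    using ex_has_greatest_nat[of "\<lambda>E. E \<in> \<E>" _ card "Suc k"] k by (auto simp: \<E>_def less_Suc_eq_le)
  then obtain E where E: "orthset E" "\<Sum>E = p" and max: "\<And>E'. orthset E' \<Longrightarrow> \<Sum>E' = p \<Longrightarrow> card E' \<le> card E"
    by (auto simp: \<E>_def)
  have "minimal e" if e: "e \<in> E" for e
  proof (rule ccontr)
    have eF: "e \<in> F" "projection e" "e \<noteq> 0" using E e by (auto simp: orthset_def)
    assume "\<not> minimal e"
    then obtain f where f: "f \<in> F" "projection f" "e * f = f" "f \<noteq> 0" "f \<noteq> e" using eF by (auto simp: minimal_def)
    define g where "g = e - f"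
    have fe: "f * e = f" using projection_le_sym[OF eF(2) f(2,3)] .
    have g: "projection g" "g \<in> F" "g \<noteq> 0" "f * g = 0" "g * f = 0" "e * g = g" "g * e = g"
      using projection_diff[OF eF(2) f(2,3)] f eF fe projectionD(1)[OF f(2)] projectionD(1)[OF eF(2)]
      by (auto simp: g_def diff_in algebra_simps)
    define E' where "E' = insert f (insert g (E - {e}))"
    have o: "h * f = 0" "h * g = 0" "f * h = 0" "g * h = 0" if "h \<in> E - {e}" for h
    proof -
      have "h * e = 0" "e * h = 0" using that E(1) e by (auto simp: orthset_def)
      thus "h * f = 0" "h * g = 0" "f * h = 0" "g * h = 0"
        using f(3) fe g(6,7) by (metis mult.assoc mult_zero_left mult_zero_right)+
    qed
    have ff: "f * f = f" "g * g = g" using f(2) g(1) by (auto simp: projection_def)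
    have fg: "f \<noteq> g" using g ff f by auto
    have nin: "f \<notin> E - {e}" "g \<notin> E - {e}" using o ff f(4) g(3) by metis+
    have "orthset E'" using E(1) f g o by (auto simp: orthset_def E'_def)
    moreover have fin: "finite E" using E by (simp add: orthset_def)
    have "\<Sum>E' = f + (g + \<Sum>(E - {e}))" unfolding E'_def using fin nin fg by (subst sum.insert; simp)+
    hence "\<Sum>E' = p" using E(2) sum.remove[OF fin e, of "\<lambda>x. x"] by (simp add: g_def)
    ultimately have "card E' \<le> card E" using max by blast
    moreover have "card E' = Suc (Suc (card (E - {e})))" unfolding E'_def using fin nin fg by simp
    moreover have "card E = Suc (card (E - {e}))" using fin e by (metis card.remove)
    ultimately show False by simp
  qed
  thus ?thesis using E by blast
qed

lemma ev_in: "h \<in> F \<Longrightarrow> ev h q \<in> F"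
  by (induction q) (auto simp: zero_in add_in scaleC_in one_in mult_in)

text \<open>The vectors \<open>h ^ n * p\<close> live in a finite-dimensional space. The factor
  \<open>p\<close> makes the polynomial act in the corner of \<open>p\<close>, whose unit is
  \<open>p\<close> and not 1.\<close>

lemma annihilating_poly:
  assumes h: "h \<in> F" and p: "p \<in> F"
  shows "\<exists>q. q \<noteq> 0 \<and> ev h q * p = 0"
proof -
  obtain S where S: "finite S" "F = cspan S" using fin_dim by (auto simp: finite_dimensional_def)
  define w where "w n = h ^ n * p" for n
  have wF: "w n \<in> F" for n by (induction n) (use p h mult_in in \<open>auto simp: w_def mult.assoc\<close>)
  show ?thesis
  \<comment> \<open>Dependence is a property of sets and does not see repeated vectors; a repetition
    gives a difference of two monomials instead.\<close>
  proof (cases "inj_on w {..card S}")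
    case False
    then obtain i j where ij: "i \<noteq> j" "w i = w j" by (auto simp: inj_on_def)
    have "coeff (monom 1 i + monom (-1) j) i = (1::complex)" using ij by simp
    hence "monom (1::complex) i + monom (-1) j \<noteq> 0" by (metis coeff_0 zero_neq_one)
    moreover have "ev h (monom 1 i + monom (-1) j) * p = 0"
      using ij by (simp add: ev_add ev_monom w_def algebra_simps scaleC_one)
    ultimately show ?thesis by blast
  next
    case True
    let ?W = "w ` {..card S}"
    have "complex_vector.dependent ?W"
    proof (rule ccontr)
      assume "\<not> complex_vector.dependent ?W"
      hence "card ?W \<le> card S" using complex_vector.independent_span_bound[OF S(1), of ?W] wF S(2) by auto
      thus False using card_image[OF True] by simp
    qed
    then obtain T c v where T: "finite T" "T \<subseteq> ?W" "(\<Sum>v\<in>T. c v *\<^sub>C v) = 0" "v \<in> T" "c v \<noteq> 0"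
      unfolding complex_vector.dependent_explicit by blast
    define N where "N = {n \<in> {..card S}. w n \<in> T}"
    have N: "finite N" "inj_on w N" "w ` N = T" using T(2) True by (auto simp: N_def inj_on_def)
    define q where "q = (\<Sum>n\<in>N. monom (c (w n)) n)"
    obtain n where n: "n \<in> N" "v = w n" using N(3) T(4) by auto
    have "coeff q n = (\<Sum>i\<in>N. if i = n then c (w n) else 0)" unfolding q_def coeff_sum by (intro sum.cong) auto
    also have "\<dots> = c v" using n N(1) by simp
    finally have "q \<noteq> 0" using T(5) by auto
    moreover have "ev h q * p = (\<Sum>n\<in>N. c (w n) *\<^sub>C w n)"
      by (simp add: q_def ev_sum ev_monom sum_distrib_right mult_scaleC_left w_def)
    hence "ev h q * p = 0" using T(3) sum.reindex[OF N(2), of "\<lambda>v. c v *\<^sub>C v"] N(3) by simp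
    ultimately show ?thesis by blast
  qed
qed

text \<open>A minimal polynomial of \<open>h\<close> in the corner of \<open>p\<close> has a complex
  root \<open>l\<close>. The cofactor evaluated at \<open>h\<close> is a nonzero eigenelement
  \<open>k\<close>, and \<open>star k * k\<close> is a self-adjoint multiple of \<open>k\<close>
  whose square is a nonzero multiple of itself: it normalises to the projection.\<close>

lemma eigenprojection:
  assumes h: "h \<in> F" "star h = h" and p: "p \<in> F" "projection p" "p \<noteq> 0" and hp: "h * p = h" "p * h = h"
  shows "\<exists>e r. e \<in> F \<and> projection e \<and> e \<noteq> 0 \<and> p * e = e \<and> h * e = r *\<^sub>R e"
proof -
  \<comment> \<open>Least degree among the annihilating polynomials guarantees that the cofactor of
    a root does not annihilate \<open>p\<close>.\<close>
  define A where "A q \<longleftrightarrow> q \<noteq> 0 \<and> ev h q * p = 0" for q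
  obtain q0 where "A q0" using annihilating_poly[OF h(1) p(1)] by (auto simp: A_def)
  then obtain q where q: "A q" "\<And>r. A r \<Longrightarrow> degree q \<le> degree r" using ex_has_least_nat[of A q0 degree] by blast
  have "degree q \<noteq> 0"
  proof
    assume "degree q = 0"
    then obtain c where "q = [:c:]" by (metis degree_eq_zeroE)
    thus False using q(1) p(3) by (auto simp: A_def mult_scaleC_left)
  qed
  then obtain l where l: "poly q l = 0" using fundamental_theorem_of_algebra[of q] by (auto simp: constant_degree)
  then obtain q' where q': "q = [:- l, 1:] * q'" by (metis poly_eq_0_iff_dvd dvdE)
  have q'0: "q' \<noteq> 0" using q' q(1) by (auto simp: A_def)
  have "degree q = degree [:- l, 1:] + degree q'" unfolding q' by (rule degree_mult_eq) (use q'0 in auto)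
  hence "degree q' < degree q" by simp
  define k where "k = ev h q' * p"
  have k0: "k \<noteq> 0" using q(2)[of q'] \<open>degree q' < degree q\<close> q'0 by (auto simp: A_def k_def)
  have "ev h q = (h - l *\<^sub>C 1) * ev h q'" unfolding q' ev_mult
    by (simp add: complex_vector.scale_minus_left)
  hence "(h - l *\<^sub>C 1) * k = 0" using q(1) by (simp add: A_def k_def mult.assoc)
  hence hk: "h * k = l *\<^sub>C k" by (simp add: left_diff_distrib mult_scaleC_left)
  have pe: "p * ev h r = ev h r * p" for r by (rule ev_commute) (simp add: hp)
  have kh: "k * h = h * k" using ev_commute[of h h q'] hp by (simp add: k_def mult.assoc) (metis mult.assoc)
  define s where "s = star k * k"
  have s0: "s \<noteq> 0" using k0 cstar_identity[of k] by (auto simp: s_def)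
  \<comment> \<open>The adjoint of \<open>k\<close> is again \<open>p\<close> times a polynomial in
    \<open>h\<close>, so it acts on the eigenelement \<open>k\<close> by the scalar
    \<open>b\<close>.\<close>
  define b where "b = poly (map_poly cnj q') l"
  have pk: "p * k = k" using pe projectionD[OF p(2)] by (simp add: k_def mult.assoc[symmetric]) (simp add: mult.assoc)
  have "star k = p * ev h (map_poly cnj q')" by (simp add: k_def star_mult projectionD[OF p(2)] ev_star[OF h(2)])
  hence "s = p * (b *\<^sub>C k)" by (simp add: s_def mult.assoc ev_eigen[OF hk] b_def)
  hence sb: "s = b *\<^sub>C k" using pk by (simp add: mult_scaleC_right)
  have ss: "star s = s" by (simp add: s_def star_mult star_star)
  have hs: "h * s = l *\<^sub>C s" using hk by (simp add: sb mult_scaleC_right scaleC_scaleC mult.commute)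
  have sh: "s * h = h * s" using kh by (simp add: sb mult_scaleC_left mult_scaleC_right)
  have "star (h * s) = cnj l *\<^sub>C s" unfolding hs by (simp add: star_scaleC ss)
  moreover have "star (h * s) = l *\<^sub>C s" using trans[OF sh hs] by (simp only: star_mult ss h(2))
  ultimately have "cnj l *\<^sub>C s = l *\<^sub>C s" by metis
  hence "cnj l = l" using s0 by simp
  then obtain r where r: "l = of_real r" by (metis Reals_cnj_iff Reals_cases)
  have ps: "p * s = s" using pk by (simp add: sb mult_scaleC_right)
  define n where "n = b * poly q' l"
  have "s * s = b *\<^sub>C (ev h q' * (p * s))" by (simp add: sb k_def mult_scaleC_left mult.assoc)
  also have "\<dots> = n *\<^sub>C s" unfolding ps ev_eigen[OF hs] by (simp add: n_def scaleC_scaleC)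
  finally have sq: "s * s = n *\<^sub>C s" .
  have n0: "n \<noteq> 0"
  proof
    assume "n = 0"
    hence "star s * s = 0" using sq ss by simp
    thus False using s0 cstar_identity[of s] by simp
  qed
  have "star (s * s) = s * s" by (simp only: star_mult ss)
  hence "cnj n *\<^sub>C s = n *\<^sub>C s" unfolding sq by (simp add: star_scaleC ss)
  hence cn: "cnj n = n" using s0 by simp
  define e where "e = (1 / n) *\<^sub>C s"
  have "e \<in> F" unfolding e_def s_def k_def by (intro scaleC_in mult_in star_in ev_in h p)
  moreover have "projection e" unfolding projection_def e_def
    using n0 cn by (simp add: mult_scaleC_left mult_scaleC_right sq scaleC_scaleC star_scaleC ss)
  moreover have "e \<noteq> 0" using n0 s0 by (simp add: e_def)
  moreover have "p * e = e" by (simp add: e_def mult_scaleC_right ps)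
  moreover have "h * e = r *\<^sub>R e" by (simp add: e_def mult_scaleC_right hs r scaleR_scaleC scaleC_scaleC mult.commute)
  ultimately show ?thesis by blast
qed

section \<open>Minimal projections and ranks in a finite-dimensional algebra\<close>

lemma minimal_sa:
  assumes "minimal m" "h \<in> F" "star h = h" "h * m = h" "m * h = h"
  shows "\<exists>r. h = r *\<^sub>R m"
proof -
  obtain e r where e: "e \<in> F" "projection e" "e \<noteq> 0" "m * e = e" "h * e = r *\<^sub>R e"
    using eigenprojection[of h m] assms by (auto simp: minimal_def)
  hence "e = m" using assms(1) by (auto simp: minimal_def)
  thus ?thesis using e(5) assms(4) by auto
qed

text \<open>The corner of a minimal projection is one-dimensional: \<open>minimal_sa\<close> applies
  to the real and the imaginary part.\<close>

lemma minimal_scalar: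
  assumes m: "minimal m" and x: "x \<in> F" shows "\<exists>c. m * x * m = c *\<^sub>C m"
proof -
  have mF: "m \<in> F" "m * m = m" "star m = m" using m by (auto simp: minimal_def projection_def)
  note mm = mult_eq_left[OF mF(2)]
  define y where "y = m * x * m"
  have y: "y \<in> F" "m * y = y" "y * m = y" "m * star y = star y" "star y * m = star y"
    unfolding y_def using x mF by (auto intro!: mult_in simp: mult.assoc mm star_mult)
  have "\<exists>r. y + star y = r *\<^sub>R m"
    by (rule minimal_sa[OF m]) (use y in \<open>auto simp: add_in star_in star_add star_star algebra_simps\<close>)
  then obtain r where r: "y + star y = r *\<^sub>R m" by blast
  have "\<exists>r. \<i> *\<^sub>C (y - star y) = r *\<^sub>R m"
    by (rule minimal_sa[OF m]) (use y in \<open>auto simp: scaleC_in diff_in star_in star_diff star_scaleC star_star algebra_simps mult_scaleC_left mult_scaleC_right complex_vector.scale_right_diff_distrib\<close>)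
  then obtain t where t: "\<i> *\<^sub>C (y - star y) = t *\<^sub>R m" by blast
  have "y = (1/2::complex) *\<^sub>C ((y + star y) + (- \<i>) *\<^sub>C (\<i> *\<^sub>C (y - star y)))"
    by (simp add: scaleC_scaleC scaleC_one complex_vector.scale_right_distrib complex_vector.scale_right_diff_distrib complex_vector.scale_left_distrib[symmetric])
  also have "\<dots> = ((1/2) * (of_real r + (- \<i>) * of_real t)) *\<^sub>C m"
    unfolding r t by (simp only: scaleR_scaleC scaleC_scaleC scaleC_add_left[symmetric])
  finally show ?thesis unfolding y_def by blast
qed

lemma minimal_star:
  assumes m: "minimal m" and x: "x \<in> F" shows "\<exists>s\<ge>0. m * (star x * x) * m = s *\<^sub>R m"
proof -
  have m': "m \<in> F" "projection m" "m \<noteq> 0" using m by (auto simp: minimal_def)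
  obtain c where c: "m * (star x * x) * m = c *\<^sub>C m" using minimal_scalar[OF m] x by (blast intro: mult_in star_in)
  have "star (x * m) * (x * m) = c *\<^sub>C m" using c projectionD[OF m'(2)] by (simp add: star_mult mult.assoc)
  hence "c = of_real (cmod c)" by (rule star_mult_eq_scale_projection[OF _ m'(2,3)])
  thus ?thesis using c by (intro exI[of _ "cmod c"]) (simp add: scaleR_scaleC)
qed

text \<open>Unlike in \<open>proj_equiv\<close>, the partial isometry must lie in \<open>F\<close>:
  for minimal projections the relation records membership in the same matrix summand.\<close>

definition feq :: "'a \<Rightarrow> 'a \<Rightarrow> bool" where
  "feq m n \<longleftrightarrow> (\<exists>v\<in>F. star v * v = m \<and> v * star v = n)"

text \<open>Schur's lemma: for nonzero \<open>y = n * x * m\<close> the product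
  \<open>star y * y\<close> is a positive multiple of \<open>m\<close>, so \<open>y\<close>
  normalises to a partial isometry, whose range is all of \<open>n\<close> by minimality.\<close>

lemma minimal_equiv:
  assumes m: "minimal m" and n: "minimal n" and x: "x \<in> F" "n * x * m \<noteq> 0"
  shows "feq m n"
proof -
  have m': "m \<in> F" "projection m" "m \<noteq> 0" and n': "n \<in> F" "projection n" "n \<noteq> 0" using m n by (auto simp: minimal_def)
  note pr = projectionD[OF m'(2)] projectionD[OF n'(2)]
  define y where "y = n * x * m"
  have yF: "y \<in> F" unfolding y_def by (intro mult_in m' n' x)
  have ym: "y * m = y" "n * y = y" "m * star y = star y" "star y * n = star y"
    by (simp_all add: y_def mult.assoc star_mult pr mult_eq_left[OF pr(1)] mult_eq_left[OF pr(3)])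
  obtain s where s: "s \<ge> 0" "m * (star y * y) * m = s *\<^sub>R m" using minimal_star[OF m yF] by blast
  hence yy: "star y * y = s *\<^sub>R m" using ym by (simp add: mult.assoc) (simp add: mult.assoc[symmetric] ym)
  have "s \<noteq> 0" using yy cstar_identity[of y] x(2) by (auto simp: y_def[symmetric])
  hence s0: "s > 0" using s by simp
  define v where "v = (1 / sqrt s) *\<^sub>R y"
  have vF: "v \<in> F" unfolding v_def by (intro scaleR_in yF)
  have vv: "star v * v = m" using s0 by (simp add: v_def star_scaleR yy)
  have nv: "n * v = v" "star v * n = star v" using ym by (simp_all add: v_def star_scaleR)
  have "projection (v * star v)" using partial_isometry_left[OF vv m'(2)] by simp
  moreover have "n * (v * star v) = v * star v" using nv by (simp add: mult.assoc[symmetric])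
  ultimately have "v * star v = 0 \<or> v * star v = n" using n vF by (auto simp: minimal_def intro!: mult_in star_in)
  moreover have "v * star v \<noteq> 0"
  proof
    assume "v * star v = 0"
    hence "star v = 0" using cstar_identity[of "star v"] by (simp add: star_star)
    thus False using vv m'(3) by simp
  qed
  ultimately show ?thesis using vv vF by (auto simp: feq_def)
qed

lemma feq_sym: "feq m n \<Longrightarrow> feq n m" unfolding feq_def by (metis star_star star_in)

lemma feq_trans: assumes "feq m n" "feq n k" "projection m" "projection n" shows "feq m k"
proof -
  obtain v w where v: "v \<in> F" "star v * v = m" "v * star v = n" and w: "w \<in> F" "star w * w = n" "w * star w = k" 
    using assms by (auto simp: feq_def)
  have qv: "n * v = v" and wq: "w * n = w"
    using proj_equiv_left[OF v(2,3) assms(3)] partial_isometry_right[OF w(2) assms(4)] .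
  have "star (w * v) * (w * v) = m" using v qv mult_eq_left[OF w(2), of v] by (simp add: star_mult mult.assoc)
  moreover have "w * v * star (w * v) = k"
    using mult_eq_left[OF v(3), of "star w"] mult_eq_left[OF wq, of "star w"] w(3) by (simp add: star_mult mult.assoc)
  ultimately show ?thesis unfolding feq_def using v w mult_in by blast
qed

text \<open>For minimal \<open>m\<close> this is the rank of \<open>q\<close> in the matrix summand
  of \<open>m\<close>. Written as a dimension, it can be compared through injective linear
  maps.\<close>

definition rk :: "'a \<Rightarrow> 'a \<Rightarrow> nat" where
  "rk m q = complex_vector.dim {q * x * m | x. x \<in> F}"

text \<open>The partial isometries from \<open>m\<close> to those \<open>e\<close> that are
  equivalent to it form a basis of the space whose dimension is the rank; the other summands
  contribute nothing by \<open>minimal_equiv\<close>.\<close>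

lemma rk_decomposition:
  assumes m: "minimal m" and E: "orthset E" "\<And>e. e \<in> E \<Longrightarrow> minimal e"
  shows "rk m (\<Sum>E) = card {e\<in>E. feq m e}"
proof -
  have m': "m \<in> F" "projection m" "m \<noteq> 0" using m by (auto simp: minimal_def)
  note mm = projectionD[OF m'(2)]
  define E' where "E' = {e\<in>E. feq m e}"
  have fin: "finite E" "finite E'" using E(1) by (auto simp: E'_def orthset_def)
  have "\<forall>e\<in>E'. \<exists>v\<in>F. star v * v = m \<and> v * star v = e" by (auto simp: E'_def feq_def)
  then obtain v where v: "\<And>e. e \<in> E' \<Longrightarrow> v e \<in> F" "\<And>e. e \<in> E' \<Longrightarrow> star (v e) * v e = m" "\<And>e. e \<in> E' \<Longrightarrow> v e * star (v e) = e"
    by metis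
  have inj: "inj_on v E'" using v(3) by (metis inj_onI)
  have ev: "e * v e = v e" "v e * m = v e" if "e \<in> E'" for e
    using proj_equiv_left[OF v(2,3)[OF that] m'(2)] partial_isometry_right[OF v(2)[OF that] m'(2)] by auto
  have orth: "e * v f = 0" if "e \<in> E" "f \<in> E'" "e \<noteq> f" for e f
  proof -
    have "e * f = 0" using E(1) that by (auto simp: orthset_def E'_def)
    thus ?thesis using ev(1)[OF that(2)] by (metis mult.assoc mult_zero_left)
  qed
  have ind: "\<not> complex_vector.dependent (v ` E')"
  proof
    assume "complex_vector.dependent (v ` E')"
    then obtain T c w where T: "finite T" "T \<subseteq> v ` E'" "(\<Sum>w\<in>T. c w *\<^sub>C w) = 0" "w \<in> T" "c w \<noteq> 0"
      unfolding complex_vector.dependent_explicit by blast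
    obtain e where e: "e \<in> E'" "w = v e" using T by auto
    have "e * (\<Sum>x\<in>T. c x *\<^sub>C x) = (\<Sum>x\<in>T. if x = w then c w *\<^sub>C w else 0)"
      unfolding sum_distrib_left
    proof (intro sum.cong refl)
      fix x assume "x \<in> T"
      then obtain f where f: "f \<in> E'" "x = v f" using T by auto
      show "e * c x *\<^sub>C x = (if x = w then c w *\<^sub>C w else 0)"
        using ev(1)[OF e(1)] orth[of e f] e f by (auto simp: mult_scaleC_right E'_def)
    qed
    also have "\<dots> = c w *\<^sub>C w" using T by simp
    finally have "w = 0" using T(3,5) by simp
    thus False using v(2)[OF e(1)] e m'(3) by simp
  qed
  have span: "cspan (v ` E') = {\<Sum>E * x * m | x. x \<in> F}"
  proof (intro equalityI subsetI)
    fix y assume "y \<in> cspan (v ` E')"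
    then obtain c where c: "y = (\<Sum>e\<in>E'. c e *\<^sub>C v e)"
      using fin(2) inj by (auto simp: complex_vector.span_finite sum.reindex o_def)
    have yF: "y \<in> F" unfolding c by (intro sum_in scaleC_in v)
    have "\<Sum>E * v e = v e" if "e \<in> E'" for e
    proof -
      have "\<Sum>E * v e = (\<Sum>f\<in>E. if f = e then v e else 0)"
        unfolding sum_distrib_right using ev orth that by (intro sum.cong) auto
      thus ?thesis using that fin by (auto simp: E'_def)
    qed
    hence "\<Sum>E * y * m = y" unfolding c using ev(2) by (simp add: sum_distrib_left sum_distrib_right mult_scaleC_left mult_scaleC_right)
    thus "y \<in> {\<Sum>E * x * m | x. x \<in> F}" using yF by (metis (mono_tags, lifting) mem_Collect_eq)
  next
    fix y assume "y \<in> {\<Sum>E * x * m | x. x \<in> F}"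
    then obtain x where x: "x \<in> F" "y = \<Sum>E * x * m" by blast
    have "e * x * m \<in> cspan (v ` E')" if e: "e \<in> E" for e
    proof (cases "e * x * m = 0")
      case False
      hence "feq m e" using minimal_equiv[OF m E(2)[OF e] x(1)] by simp
      hence e': "e \<in> E'" using e by (simp add: E'_def)
      obtain c where c: "m * (star (v e) * x) * m = c *\<^sub>C m" using minimal_scalar[OF m] v(1)[OF e'] x(1) by (blast intro: mult_in star_in)
      have "e * x * m = v e * (star (v e) * x * m)" using v(3)[OF e'] by (simp add: mult.assoc[symmetric])
      also have "\<dots> = v e * (m * (star (v e) * x) * m)" using ev(2)[OF e'] by (simp add: mult.assoc[symmetric])
      also have "\<dots> = c *\<^sub>C v e" unfolding c using ev(2)[OF e'] by (simp add: mult_scaleC_right)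
      finally have "e * x * m = c *\<^sub>C v e" .
      thus ?thesis using e' complex_vector.span_scale[OF complex_vector.span_base[of "v e" "v ` E'"]] by simp
    qed (simp add: complex_vector.span_zero)
    thus "y \<in> cspan (v ` E')" unfolding x(2) sum_distrib_right by (intro complex_vector.span_sum)
  qed
  have "rk m (\<Sum>E) = complex_vector.dim (cspan (v ` E'))" unfolding rk_def span ..
  also have "\<dots> = card (v ` E')" using complex_vector.dim_span_eq_card_independent[OF ind] .
  also have "\<dots> = card E'" by (rule card_image[OF inj])
  finally show ?thesis by (simp add: E'_def)
qed

lemma rk_pos:
  assumes "p \<in> F" "projection p" "p \<noteq> 0" shows "\<exists>m. minimal m \<and> rk m p > 0"
proof -
  obtain E where E: "orthset E" "\<forall>e\<in>E. minimal e" "\<Sum>E = p" using orthset_decomposition assms by blast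
  then obtain e where e: "e \<in> E" using assms(3) by fastforce
  have "feq e e" using E(2) e by (auto simp: feq_def minimal_def projection_def intro!: bexI[of _ e])
  hence "{f\<in>E. feq e f} \<noteq> {}" using e by blast
  moreover have "finite E" using E(1) by (simp add: orthset_def)
  ultimately have "rk e p > 0" using rk_decomposition[OF _ E(1), of e] E(2,3) e by (simp add: card_gt_0_iff)
  thus ?thesis using E e by blast
qed

lemma subspace_fin_dim:
  assumes "csubspace V" "V \<subseteq> F" shows "finite_dimensional V"
proof -
  obtain S where S: "finite S" "F = cspan S" using fin_dim by (auto simp: finite_dimensional_def)
  obtain B where B: "B \<subseteq> V" "\<not> complex_vector.dependent B" "V \<subseteq> cspan B"
    using complex_vector.maximal_independent_subset[of V] by blast
  have "finite B" using complex_vector.independent_span_bound[OF S(1) B(2)] B(1) assms(2) S(2) by blast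
  moreover have "V = cspan B" using B assms(1) complex_vector.span_minimal by blast
  ultimately show ?thesis by (auto simp: finite_dimensional_def)
qed

text \<open>Decomposing 1 inside the commutant of \<open>h\<close> yields projections that commute
  with \<open>h\<close>, which is the way to diagonalise \<open>h\<close>.\<close>

lemma commutant_fd_algebra:
  assumes "h \<in> F" "star h = h" shows "fd_algebra {x\<in>F. x * h = h * x}"
proof
  let ?C = "{x\<in>F. x * h = h * x}"
  have sub: "csubspace ?C"
    unfolding complex_vector.subspace_def
    by (auto simp: zero_in add_in scaleC_in algebra_simps mult_scaleC_left mult_scaleC_right)
  have "closed ({x. x * h = h * x})" by (intro closed_Collect_eq continuous_intros)
  hence "closed ?C" using closed_F by (auto intro: closed_Int simp: Collect_conj_eq)
  moreover have "x * y * h = h * (x * y)" if "x * h = h * x" "y * h = h * y" for x y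
    using that by (metis mult.assoc)
  moreover have "star x * h = h * star x" if "x * h = h * x" for x
    using arg_cong[OF that, of star] by (simp add: star_mult assms)
  ultimately show "cstar_subalgebra ?C" unfolding cstar_subalgebra_def using sub by (auto intro: mult_in star_in)
  show "finite_dimensional ?C" by (rule subspace_fin_dim[OF sub]) auto
  show "1 \<in> ?C" by (simp add: one_in)
qed

text \<open>The spectral theorem in finite dimension: on each minimal projection of the commutant,
  \<open>h\<close> is a real scalar. The norm is at most the largest modulus \<open>R\<close>, by
  \<open>sa_norm_le\<close>.\<close>

lemma norm_eigenvalue:
  assumes h: "h \<in> F" "star h = h" "h \<noteq> 0"
  shows "\<exists>e r. e \<in> F \<and> projection e \<and> e \<noteq> 0 \<and> h * e = r *\<^sub>R e \<and> norm h \<le> \<bar>r\<bar>"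
proof -
  interpret C: fd_algebra "{x\<in>F. x * h = h * x}" by (rule commutant_fd_algebra[OF h(1,2)])
  obtain E where E: "C.orthset E" "\<forall>e\<in>E. C.minimal e" "\<Sum>E = 1" using C.orthset_decomposition[of 1] one_in by auto
  have fin: "finite E" using E(1) by (simp add: C.orthset_def)
  have "\<exists>r. h * e = r *\<^sub>R e" if e: "e \<in> E" for e
  proof -
    have m: "C.minimal e" using E(2) e by blast
    hence e': "e \<in> F" "e * h = h * e" "e * e = e" "star e = e" by (auto simp: C.minimal_def projection_def)
    have "h * e * e = h * e" "e * (h * e) = h * e" using e' by (metis mult.assoc)+
    moreover have "star (h * e) = h * e" using e' h by (simp add: star_mult)
    moreover have "h * e * h = h * (h * e)" using e' by (simp add: mult.assoc)
    ultimately show ?thesis using C.minimal_sa[OF m, of "h * e"] e' h mult_in by auto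
  qed
  then obtain r where r: "\<And>e. e \<in> E \<Longrightarrow> h * e = r e *\<^sub>R e" by metis
  have Ene: "E \<noteq> {}" using E(3) by auto
  define R where "R = Max ((\<lambda>e. \<bar>r e\<bar>) ` E)"
  have R: "\<bar>r e\<bar> \<le> R" if "e \<in> E" for e unfolding R_def using fin that by simp
  have "R \<in> (\<lambda>e. \<bar>r e\<bar>) ` E" unfolding R_def using fin Ene by (intro Max_in) auto
  then obtain e where e: "e \<in> E" "R = \<bar>r e\<bar>" by blast
  have hs: "h = (\<Sum>e\<in>E. r e *\<^sub>R e)"
  proof -
    have "h = h * \<Sum>E" by (simp add: E(3))
    also have "\<dots> = (\<Sum>e\<in>E. r e *\<^sub>R e)" unfolding sum_distrib_left by (intro sum.cong refl r)
    finally show ?thesis .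
  qed
  \<comment> \<open>The complement with \<open>h * h + y * y\<close> equal to the square of
    \<open>R\<close>.\<close>
  define y where "y = (\<Sum>e\<in>E. sqrt (R\<^sup>2 - (r e)\<^sup>2) *\<^sub>R e)"
  have es: "star e = e" "e * e = e" if "e \<in> E" for e using E(1) that by (auto simp: C.orthset_def projection_def)
  have prod: "(\<Sum>e\<in>E. a e *\<^sub>R e) * (\<Sum>e\<in>E. b e *\<^sub>R e) = (\<Sum>e\<in>E. (a e * b e) *\<^sub>R e)" for a b :: "'a \<Rightarrow> real"
  proof -
    have "(a e *\<^sub>R e) * (\<Sum>f\<in>E. b f *\<^sub>R f) = (a e * b e) *\<^sub>R e" if "e \<in> E" for e
    proof -
      have "(a e *\<^sub>R e) * (\<Sum>f\<in>E. b f *\<^sub>R f) = (\<Sum>f\<in>E. if f = e then (a e * b e) *\<^sub>R e else 0)"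
        unfolding sum_distrib_left
      proof (intro sum.cong refl)
        fix f assume f: "f \<in> E"
        show "a e *\<^sub>R e * b f *\<^sub>R f = (if f = e then (a e * b e) *\<^sub>R e else 0)"
        proof (cases "f = e")
          case True thus ?thesis using es[OF that] by simp
        next
          case False
          hence "e * f = 0" using E(1) f that by (simp add: C.orthset_def)
          thus ?thesis using False by simp
        qed
      qed
      thus ?thesis using fin that by simp
    qed
    thus ?thesis by (simp add: sum_distrib_right)
  qed
  have "(norm h)\<^sup>2 \<le> \<bar>R\<^sup>2\<bar>"
  proof (rule sa_norm_le[OF h(2), where k = y])
    show "star y = y" unfolding y_def star_sum star_scaleR by (intro sum.cong refl) (simp add: es)
    show "h * y = y * h" unfolding hs y_def prod by (simp add: mult.commute)
    have "h * h + y * y = (\<Sum>e\<in>E. ((r e * r e) + sqrt (R\<^sup>2 - (r e)\<^sup>2) * sqrt (R\<^sup>2 - (r e)\<^sup>2)) *\<^sub>R e)"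
      unfolding hs y_def prod by (simp add: sum.distrib scaleR_left.add)
    also have "\<dots> = (\<Sum>e\<in>E. R\<^sup>2 *\<^sub>R e)"
    proof (intro sum.cong refl)
      fix e assume "e \<in> E"
      hence "(r e)\<^sup>2 \<le> R\<^sup>2" using R abs_le_square_iff[of "r e" R] by fastforce
      thus "((r e * r e) + sqrt (R\<^sup>2 - (r e)\<^sup>2) * sqrt (R\<^sup>2 - (r e)\<^sup>2)) *\<^sub>R e = R\<^sup>2 *\<^sub>R e"
        by (simp add: power2_eq_square)
    qed
    also have "\<dots> = R\<^sup>2 *\<^sub>R 1" using E(3) by (simp add: scaleR_sum_right[symmetric])
    finally show "h * h + y * y = R\<^sup>2 *\<^sub>R 1" .
  qed
  hence "norm h \<le> R" using e by (auto intro: power2_le_imp_le)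
  thus ?thesis using e r[OF e(1)] E(1) by (auto simp: C.orthset_def)
qed

text \<open>The norm of \<open>star x * x\<close> is attained on an eigenprojection, hence on a
  minimal projection below it; \<open>minimal_star\<close> removes the absolute value.\<close>

lemma minimal_norm:
  assumes x: "x \<in> F" "x \<noteq> 0"
  shows "\<exists>m r. minimal m \<and> m * (star x * x) * m = r *\<^sub>R m \<and> (norm x)\<^sup>2 \<le> r"
proof -
  define h where "h = star x * x"
  have h: "h \<in> F" "star h = h" "norm h = (norm x)\<^sup>2"
    using x by (auto simp: h_def mult_in star_in star_mult star_star cstar_identity)
  have "h \<noteq> 0" using h(3) x(2) by auto
  then obtain e r where e: "e \<in> F" "projection e" "e \<noteq> 0" "h * e = r *\<^sub>R e" "norm h \<le> \<bar>r\<bar>"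
    using norm_eigenvalue[OF h(1,2)] by blast
  obtain E where E: "orthset E" "\<forall>e\<in>E. minimal e" "\<Sum>E = e" using orthset_decomposition e by blast
  then obtain m where m: "m \<in> E" using e(3) by fastforce
  have mm: "m * m = m" "m \<noteq> 0" using E(1) m by (auto simp: orthset_def projection_def)
  have "e * m = (\<Sum>f\<in>E. if f = m then m else 0)" unfolding E(3)[symmetric] sum_distrib_right
    using E(1) m mm by (intro sum.cong) (auto simp: orthset_def)
  hence em: "e * m = m" using E(1) m by (simp add: orthset_def)
  have "h * m = h * e * m" using em by (simp add: mult.assoc)
  also have "\<dots> = r *\<^sub>R m" using e(4) em by simp
  finally have hm: "m * h * m = r *\<^sub>R m" using mm by (simp add: mult.assoc)
  obtain s where s: "s \<ge> 0" "m * (star x * x) * m = s *\<^sub>R m" using minimal_star E(2) m x(1) by blast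
  hence "s = r" using hm mm(2) by (simp add: h_def)
  hence "(norm x)\<^sup>2 \<le> r" using e(5) h(3) s(1) by simp
  thus ?thesis using hm E(2) m unfolding h_def by blast
qed

text \<open>Compress to the minimal projection that detects the norm of \<open>x\<close>; there the
  second term is a nonnegative scalar.\<close>

lemma norm_star_mult_add:
  assumes x: "x \<in> F" and y: "y \<in> F"
  shows "(norm x)\<^sup>2 \<le> norm (star x * x + star y * y)"
proof (cases "x = 0")
  case False
  then obtain m r where m: "minimal m" "m * (star x * x) * m = r *\<^sub>R m" "(norm x)\<^sup>2 \<le> r" using minimal_norm x by blast
  obtain s where s: "s \<ge> 0" "m * (star y * y) * m = s *\<^sub>R m" using minimal_star[OF m(1) y] by blast
  have nm: "norm m = 1" using m(1) projection_norm by (auto simp: minimal_def)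
  have "m * (star x * x + star y * y) * m = (r + s) *\<^sub>R m" using m(2) s(2) by (simp add: algebra_simps scaleR_left.add)
  hence "\<bar>r + s\<bar> = norm (m * (star x * x + star y * y) * m)" using nm by simp
  also have "\<dots> \<le> norm (m * (star x * x + star y * y)) * norm m" by (rule norm_mult_ineq)
  also have "\<dots> \<le> norm (star x * x + star y * y)" using norm_mult_ineq[of m "star x * x + star y * y"] nm by simp
  finally show ?thesis using m(3) s(1) by simp
qed simp

end

subsection \<open>Comparing ranks\<close>

text \<open>Tuples of elements are functions on \<open>nat\<close>; in this vector space the direct
  sum of several corners is a subspace.\<close>

definition scaleF :: "complex \<Rightarrow> (nat \<Rightarrow> 'a::cstar_algebra) \<Rightarrow> nat \<Rightarrow> 'a" where
  "scaleF c f = (\<lambda>i. c *\<^sub>C f i)"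

global_interpretation fun_space: vector_space "scaleF :: complex \<Rightarrow> (nat \<Rightarrow> 'a::cstar_algebra) \<Rightarrow> _"
  by unfold_locales (auto simp: scaleF_def fun_eq_iff scaleC_add_right scaleC_add_left scaleC_scaleC scaleC_one)

definition single :: "nat \<Rightarrow> 'a::cstar_algebra \<Rightarrow> nat \<Rightarrow> 'a" where
  "single i x = (\<lambda>j. if j = i then x else 0)"

lemma sum_apply: "(sum f A) (i::nat) = (\<Sum>a\<in>A. f a i :: 'a::cstar_algebra)"
  by (induction A rule: infinite_finite_induct) auto

lemma single_hom: "module_hom scaleC scaleF (single i)"
proof -
  show ?thesis
    unfolding module_hom_iff using complex_vector.module_axioms fun_space.module_axioms
    by (auto simp: single_def scaleF_def fun_eq_iff)
qed

context fd_algebra begin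

lemma corner_subspace: "csubspace {q * x * m | x. x \<in> F}"
  unfolding complex_vector.subspace_def
proof (intro conjI ballI allI)
  show "0 \<in> {q * x * m | x. x \<in> F}" using zero_in by (auto intro!: exI[of _ 0])
  fix c x assume "x \<in> {q * x * m | x. x \<in> F}"
  then obtain a where a: "a \<in> F" "x = q * a * m" by blast
  show "c *\<^sub>C x \<in> {q * x * m | x. x \<in> F}"
    using a scaleC_in by (auto simp: mult_scaleC_left mult_scaleC_right intro!: exI[of _ "c *\<^sub>C a"])
  fix y assume "y \<in> {q * x * m | x. x \<in> F}"
  then obtain b where b: "b \<in> F" "y = q * b * m" by blast
  show "x + y \<in> {q * x * m | x. x \<in> F}"
    using a b add_in by (auto simp: algebra_simps intro!: exI[of _ "a + b"])
qed

lemma rk_basis: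
  assumes "q \<in> F" "m \<in> F"
  shows "\<exists>B. finite B \<and> \<not> complex_vector.dependent B \<and> cspan B = {q * x * m | x. x \<in> F} \<and> card B = rk m q"
proof -
  let ?V = "{q * x * m | x. x \<in> F}"
  obtain S where S: "finite S" "F = cspan S" using fin_dim by (auto simp: finite_dimensional_def)
  obtain B where B: "B \<subseteq> ?V" "\<not> complex_vector.dependent B" "?V \<subseteq> cspan B" "card B = complex_vector.dim ?V"
    using complex_vector.basis_exists[of ?V] by blast
  have "?V \<subseteq> F" using assms by (auto intro!: mult_in)
  hence "finite B" using complex_vector.independent_span_bound[OF S(1) B(2)] B(1) S(2) by blast
  moreover have "cspan B = ?V" using B complex_vector.span_minimal[OF B(1) corner_subspace] by blast
  ultimately show ?thesis using B by (auto simp: rk_def)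
qed

text \<open>The matrix with entries \<open>D' l * T l j\<close> maps the direct sum of the corners
  of the \<open>D i\<close> into that of the \<open>D' l\<close>. Applying \<open>T'\<close>
  afterwards is within \<epsilon>, entry by entry, of the identity, so the map is injective and
  dimensions compare.\<close>

lemma rk_sum_le:
  fixes n k :: nat
  assumes m: "m \<in> F"
    and D: "\<And>i. i < n \<Longrightarrow> D i \<in> F" "\<And>i. i < n \<Longrightarrow> D i * D i = D i"
    and D': "\<And>l. l < k \<Longrightarrow> D' l \<in> F"
    and T: "\<And>l i. T l i \<in> F"
    and err: "\<And>i j. i < n \<Longrightarrow> j < n \<Longrightarrow> norm ((\<Sum>l<k. T' i l * D' l * T l j) - (if i = j then D i else 0)) \<le> \<epsilon>"
    and \<epsilon>: "real n * \<epsilon> < 1"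
  shows "(\<Sum>i<n. rk m (D i)) \<le> (\<Sum>l<k. rk m (D' l))"
proof -
  have "\<forall>i\<in>{..<n}. \<exists>B. finite B \<and> \<not> complex_vector.dependent B \<and> cspan B = {D i * x * m | x. x \<in> F} \<and> card B = rk m (D i)"
    by (intro ballI rk_basis m D(1)) simp
  from bchoice[OF this] obtain B where B0: "\<forall>i\<in>{..<n}. finite (B i) \<and> \<not> complex_vector.dependent (B i) \<and> 
    cspan (B i) = {D i * x * m | x. x \<in> F} \<and> card (B i) = rk m (D i)" by (elim exE)
  have B: "finite (B i)" "\<not> complex_vector.dependent (B i)" "cspan (B i) = {D i * x * m | x. x \<in> F}" 
    "card (B i) = rk m (D i)" if "i < n" for i
    using bspec[OF B0, of i] that by simp_all
  have "\<forall>i\<in>{..<k}. \<exists>B. finite B \<and> \<not> complex_vector.dependent B \<and> cspan B = {D' i * x * m | x. x \<in> F} \<and> card B = rk m (D' i)"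
    by (intro ballI rk_basis m D') simp
  from bchoice[OF this] obtain B' where B0': "\<forall>i\<in>{..<k}. finite (B' i) \<and> \<not> complex_vector.dependent (B' i) \<and> 
    cspan (B' i) = {D' i * x * m | x. x \<in> F} \<and> card (B' i) = rk m (D' i)" by (elim exE)
  have B': "finite (B' i)" "cspan (B' i) = {D' i * x * m | x. x \<in> F}" "card (B' i) = rk m (D' i)" if "i < k" for i
    using bspec[OF B0', of i] that by simp_all
  \<comment> \<open>Bases of the two direct sums, made of tuples with a single nonzero
    entry.\<close>
  define BB where "BB = (\<Union>i<n. single i ` B i)"
  define BB' where "BB' = (\<Union>l<k. single l ` B' l)"
  have nz: "0 \<notin> B i" if "i < n" for i using B(2)[OF that] complex_vector.dependent_zero by blast
  have s_inj: "inj (single i :: 'a \<Rightarrow> nat \<Rightarrow> 'a)" for i by (rule injI) (metis single_def)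
  have finBB: "finite BB" unfolding BB_def using B(1) by auto
  have cardBB: "card BB = (\<Sum>i<n. rk m (D i))"
  proof -
    have "card BB = (\<Sum>i<n. card (single i ` B i))" unfolding BB_def
    proof (rule card_UN_disjoint)
      show "\<forall>i\<in>{..<n}. \<forall>j\<in>{..<n}. i \<noteq> j \<longrightarrow> single i ` B i \<inter> single j ` B j = {}"
      proof (intro ballI impI equals0I)
        fix i j f assume ij: "i \<in> {..<n}" "j \<in> {..<n}" "i \<noteq> j" "f \<in> single i ` B i \<inter> single j ` B j"
        then obtain x y where xy: "x \<in> B i" "y \<in> B j" "f = single i x" "f = single j y" by blast
        have "f i = x" by (subst xy(3)) (simp add: single_def)
        moreover have "f i = 0" by (subst xy(4)) (use ij(3) in \<open>simp add: single_def\<close>)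
        ultimately have "x = 0" by simp
        thus False using nz ij(1) xy(1) by auto
      qed
    qed (use B(1) in auto)
    also have "\<dots> = (\<Sum>i<n. rk m (D i))" using B(4) by (intro sum.cong) (simp_all add: card_image inj_on_subset[OF s_inj])
    finally show ?thesis .
  qed
  have spanBB: "D i * f i = f i" if f: "f \<in> fun_space.span BB" and i: "i < n" for f i
  proof -
    define V where "V = {D i * x * m | x. x \<in> F}"
    have V: "csubspace V" unfolding V_def by (rule corner_subspace)
    have "fun_space.subspace {f. f i \<in> V}"
      using complex_vector.subspace_0[OF V] complex_vector.subspace_add[OF V] complex_vector.subspace_scale[OF V]
      by (auto simp: fun_space.subspace_def scaleF_def)
    moreover have "BB \<subseteq> {f. f i \<in> V}"
    proof
      fix f assume "f \<in> BB"
      then obtain j b where b: "j < n" "b \<in> B j" "f = single j b" by (auto simp: BB_def)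
      show "f \<in> {f. f i \<in> V}"
        using b complex_vector.span_base[of b "B i"] B(3)[OF i, folded V_def] complex_vector.subspace_0[OF V]
        by (auto simp: single_def)
    qed
    ultimately have "fun_space.span BB \<subseteq> {f. f i \<in> V}" using fun_space.span_minimal by blast
    hence "f i \<in> V" using f by blast
    then obtain x where "f i = D i * x * m" unfolding V_def by blast
    thus ?thesis using mult_eq_left[OF D(2)[OF i]] by (simp add: mult.assoc)
  qed
  have indBB: "\<not> fun_space.dependent BB"
  proof
    assume "fun_space.dependent BB"
    then obtain S c w where S: "finite S" "S \<subseteq> BB" "(\<Sum>w\<in>S. scaleF (c w) w) = 0" "w \<in> S" "c w \<noteq> 0"
      unfolding fun_space.dependent_explicit by blast
    obtain i b where b: "i < n" "b \<in> B i" "w = single i b" using S by (auto simp: BB_def)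
    define U where "U = {b \<in> B i. single i b \<in> S}"
    have "(\<Sum>b\<in>U. c (single i b) *\<^sub>C b) = (\<Sum>w\<in>single i ` U. c w *\<^sub>C w i)"
      by (subst sum.reindex) (auto simp: single_def intro!: inj_on_subset[OF s_inj])
    also have "\<dots> = (\<Sum>w\<in>S. c w *\<^sub>C w i)"
    proof (rule sum.mono_neutral_left[OF S(1)])
      show "single i ` U \<subseteq> S" by (auto simp: U_def)
      show "\<forall>w\<in>S - single i ` U. c w *\<^sub>C w i = 0"
      proof
        fix w assume w: "w \<in> S - single i ` U"
        then obtain j x where x: "j < n" "x \<in> B j" "w = single j x" using S(2) by (auto simp: BB_def)
        have "j \<noteq> i" using w x by (auto simp: U_def)
        thus "c w *\<^sub>C w i = 0" using x by (simp add: single_def)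
      qed
    qed
    also have "\<dots> = (\<Sum>w\<in>S. scaleF (c w) w) i" by (simp add: scaleF_def sum_apply)
    also have "\<dots> = 0" using S(3) by simp
    finally have "(\<Sum>b\<in>U. c (single i b) *\<^sub>C b) = 0" .
    moreover have "U \<subseteq> B i" "finite U" using B(1)[OF b(1)] by (auto simp: U_def)
    moreover have "b \<in> U" using b S by (auto simp: U_def)
    ultimately have "complex_vector.dependent (B i)" unfolding complex_vector.dependent_explicit using b(3) S(5)
      by (intro exI[of _ U] exI[of _ "\<lambda>b. c (single i b)"]) auto
    thus False using B(2)[OF b(1)] by simp
  qed
  \<comment> \<open>Entries beyond \<open>k\<close> are set to zero so that the values are tuples of
    length \<open>k\<close>.\<close>
  define \<Phi> where "\<Phi> f = (\<lambda>l. if l < k then \<Sum>j<n. D' l * T l j * f j else 0)" for f :: "nat \<Rightarrow> 'a"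
  interpret \<Phi>: module_hom scaleF scaleF \<Phi>
    by unfold_locales (auto simp: \<Phi>_def fun_eq_iff scaleF_def algebra_simps sum.distrib mult_scaleC_right complex_vector.scale_sum_right)
  have "inj_on \<Phi> (fun_space.span BB)"
    unfolding \<Phi>.inj_on_iff_eq_0[OF fun_space.subspace_span]
  proof (intro ballI impI)
    fix f assume f: "f \<in> fun_space.span BB" "\<Phi> f = 0"
    have bound: "norm (f i) \<le> \<epsilon> * (\<Sum>j<n. norm (f j))" if i: "i < n" for i
    proof -
      have "0 = (\<Sum>l<k. T' i l * \<Phi> f l)" using f(2) by simp
      also have "\<dots> = (\<Sum>l<k. \<Sum>j<n. T' i l * D' l * T l j * f j)" by (simp add: \<Phi>_def sum_distrib_left mult.assoc)
      also have "\<dots> = (\<Sum>j<n. (\<Sum>l<k. T' i l * D' l * T l j) * f j)" by (subst sum.swap) (simp add: sum_distrib_right)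
      finally have 1: "(\<Sum>j<n. (\<Sum>l<k. T' i l * D' l * T l j) * f j) = 0" ..
      have 2: "(\<Sum>j<n. (if i = j then D i else 0) * f j) = f i"
      proof -
        have "(\<Sum>j<n. (if i = j then D i else 0) * f j) = (\<Sum>j<n. if j = i then f i else 0)"
          using spanBB[OF f(1)] by (intro sum.cong) auto
        thus ?thesis using i by simp
      qed
      define w where "w = (\<Sum>j<n. ((\<Sum>l<k. T' i l * D' l * T l j) - (if i = j then D i else 0)) * f j)"
      have "w = 0 - f i" unfolding w_def left_diff_distrib sum_subtractf 1 2 ..
      hence "norm (f i) = norm w" by simp
      also have "norm w \<le> (\<Sum>j<n. \<epsilon> * norm (f j))" unfolding w_def
      proof (rule sum_norm_le)
        fix j assume j: "j \<in> {..<n}"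
        have "norm (((\<Sum>l<k. T' i l * D' l * T l j) - (if i = j then D i else 0)) * f j) \<le> 
          norm ((\<Sum>l<k. T' i l * D' l * T l j) - (if i = j then D i else 0)) * norm (f j)" by (rule norm_mult_ineq)
        also have "\<dots> \<le> \<epsilon> * norm (f j)" using err[OF i] j by (intro mult_right_mono) auto
        finally show "norm (((\<Sum>l<k. T' i l * D' l * T l j) - (if i = j then D i else 0)) * f j) \<le> \<epsilon> * norm (f j)" .
      qed
      finally show ?thesis by (simp add: sum_distrib_left)
    qed
    \<comment> \<open>Adding the \<open>n\<close> bounds gives \<open>s\<close> at most
      \<open>n * \<epsilon> * s\<close> with a factor below 1, hence \<open>s = 0\<close>.\<close>
    define s where "s = (\<Sum>j<n. norm (f j))"
    have "s \<le> (\<Sum>i<n. \<epsilon> * s)" unfolding s_def using bound by (intro sum_mono) auto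
    hence "s \<le> (real n * \<epsilon>) * s" by simp
    moreover have "s \<ge> 0" by (simp add: s_def sum_nonneg)
    ultimately have "s = 0" using \<epsilon> by (metis mult_right_cancel mult_le_cancel_right1 order_antisym_conv not_less order_less_le)
    hence z: "f i = 0" if "i < n" for i using that unfolding s_def by (subst (asm) sum_nonneg_eq_0_iff) auto
    have "f i = 0" if "\<not> i < n" for i
    proof -
      have "fun_space.subspace {f. f i = (0::'a)}" by (auto simp: fun_space.subspace_def scaleF_def)
      moreover have "BB \<subseteq> {f. f i = 0}" using that by (auto simp: BB_def single_def)
      ultimately show ?thesis using f(1) fun_space.span_minimal by blast
    qed
    thus "f = 0" using z by (auto simp: fun_eq_iff)
  qed
  hence ind': "\<not> fun_space.dependent (\<Phi> ` BB)" using indBB \<Phi>.independent_injective_image by blast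
  have c1: "card (\<Phi> ` BB) \<le> card BB'"
  proof -
    have fin': "finite BB'" unfolding BB'_def using B'(1) by auto
    have "\<Phi> ` BB \<subseteq> fun_space.span BB'"
    proof
      fix g assume "g \<in> \<Phi> ` BB"
      then obtain i b where b: "i < n" "b \<in> B i" "g = \<Phi> (single i b)" by (auto simp: BB_def)
      obtain x where x: "x \<in> F" "b = D i * x * m" using complex_vector.span_base[OF b(2)] B(3)[OF b(1)] by blast
      have gl: "g l = D' l * (T l i * D i * x) * m" if "l < k" for l
      proof -
        have "g l = (\<Sum>j<n. D' l * T l j * (if j = i then b else 0))" unfolding b(3) \<Phi>_def single_def using that by simp
        also have "\<dots> = (\<Sum>j<n. if j = i then D' l * T l i * b else 0)" by (intro sum.cong) auto
        finally have "g l = (\<Sum>j<n. if j = i then D' l * T l i * b else 0)" .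
        thus ?thesis using b(1) x(2) by (simp add: mult.assoc)
      qed
      have "g = (\<Sum>l<k. single l (g l))"
      proof
        fix l show "g l = (\<Sum>l<k. single l (g l)) l"
          using b(3) by (auto simp: single_def sum_apply \<Phi>_def)
      qed
      also have "\<dots> \<in> fun_space.span BB'"
      proof (rule fun_space.span_sum)
        fix l assume l: "l \<in> {..<k}"
        interpret s: module_hom scaleC scaleF "single l :: 'a \<Rightarrow> _" by (rule single_hom)
        have lk: "l < k" using l by simp
        have "T l i * D i * x \<in> F" by (intro mult_in T D(1) x(1) b(1))
        hence "g l \<in> cspan (B' l)" unfolding B'(2)[OF lk] gl[OF lk] by blast
        hence "single l (g l) \<in> fun_space.span (single l ` B' l)" unfolding s.span_image cspan_def by (rule imageI)
        moreover have "single l ` B' l \<subseteq> BB'" unfolding BB'_def using l by (rule UN_upper)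
        ultimately show "single l (g l) \<in> fun_space.span BB'" using fun_space.span_mono[of "single l ` B' l" BB'] by (meson subsetD)
      qed
      finally show "g \<in> fun_space.span BB'" .
    qed
    thus ?thesis using fun_space.independent_span_bound[OF fin' ind'] by blast
  qed
  have c2: "card BB' \<le> (\<Sum>l<k. card (single l ` B' l))" unfolding BB'_def by (rule card_UN_le) simp
  have c3: "(\<Sum>l<k. card (single l ` B' l)) \<le> (\<Sum>l<k. rk m (D' l))"
  proof (rule sum_mono)
    fix l assume "l \<in> {..<k}"
    hence l: "l < k" by simp
    show "card (single l ` B' l) \<le> rk m (D' l)" using card_image_le[OF B'(1)[OF l]] B'(3)[OF l] by simp
  qed
  have c4: "card (\<Phi> ` BB) = card BB"
    by (rule card_image[OF inj_on_subset[OF \<open>inj_on \<Phi> (fun_space.span BB)\<close> fun_space.span_superset]])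
  show ?thesis using c1 c2 c3 unfolding c4 cardBB by (rule order_trans[OF order_trans])
qed

end

section \<open>Classification of projections by their ranks\<close>

lemma proj_equiv_sum:
  assumes "finite I" "\<And>i. i \<in> I \<Longrightarrow> proj_equiv (P i) (Q i)"
    "\<And>i j. i \<in> I \<Longrightarrow> j \<in> I \<Longrightarrow> i \<noteq> j \<Longrightarrow> P i * P j = 0"
    "\<And>i j. i \<in> I \<Longrightarrow> j \<in> I \<Longrightarrow> i \<noteq> j \<Longrightarrow> Q i * Q j = 0"
  shows "proj_equiv (sum P I) (sum Q I)"
proof -
  have "\<forall>i\<in>I. \<exists>v. star v * v = P i \<and> v * star v = Q i" using assms(2) by (auto simp: proj_equiv_def)
  then obtain v where v: "\<And>i. i \<in> I \<Longrightarrow> star (v i) * v i = P i" "\<And>i. i \<in> I \<Longrightarrow> v i * star (v i) = Q i" by metis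
  have pr: "projection (P i)" "projection (Q i)" if "i \<in> I" for i using assms(2)[OF that] by (auto simp: proj_equiv_def)
  have Qv: "Q i * v i = v i" if "i \<in> I" for i using proj_equiv_left[OF v(1,2)[OF that] pr(1)[OF that]] .
  have Pv: "P i * star (v i) = star (v i)" if "i \<in> I" for i
    using partial_isometry_right[OF v(1)[OF that] pr(1)[OF that]] projectionD(2)[OF pr(1)[OF that]] by (metis star_mult)
  have vv: "star (v i) * v j = (if i = j then P i else 0)" if "i \<in> I" "j \<in> I" for i j
  proof (cases "i = j")
    case False
    have "star (v i) = star (v i) * Q i" using Qv[OF that(1)] projectionD(2)[OF pr(2)[OF that(1)]] by (metis star_mult)
    hence "star (v i) * v j = star (v i) * Q i * (Q j * v j)" using Qv[OF that(2)] by simp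
    also have "\<dots> = star (v i) * (Q i * Q j) * v j" by (simp add: mult.assoc)
    finally show ?thesis using assms(4)[OF that False] False by simp
  qed (use v that in auto)
  have vv': "v i * star (v j) = (if i = j then Q i else 0)" if "i \<in> I" "j \<in> I" for i j
  proof (cases "i = j")
    case False
    have "v i * P i = v i" using partial_isometry_right[OF v(1)[OF that(1)] pr(1)[OF that(1)]] .
    hence "v i * star (v j) = v i * P i * (P j * star (v j))" using Pv[OF that(2)] by simp
    also have "\<dots> = v i * (P i * P j) * star (v j)" by (simp add: mult.assoc)
    finally show ?thesis using assms(3)[OF that False] False by simp
  qed (use v that in auto)
  have "star (sum v I) * sum v I = (\<Sum>i\<in>I. \<Sum>j\<in>I. star (v i) * v j)" by (simp add: star_sum sum_product)
  also have "\<dots> = (\<Sum>i\<in>I. \<Sum>j\<in>I. if i = j then P i else 0)" by (intro sum.cong refl vv)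
  also have "\<dots> = sum P I" using assms(1) by simp
  finally have 1: "star (sum v I) * sum v I = sum P I" .
  have "sum v I * star (sum v I) = (\<Sum>i\<in>I. \<Sum>j\<in>I. v i * star (v j))" by (simp add: star_sum sum_product)
  also have "\<dots> = (\<Sum>i\<in>I. \<Sum>j\<in>I. if i = j then Q i else 0)" by (intro sum.cong refl vv')
  also have "\<dots> = sum Q I" using assms(1) by simp
  finally have 2: "sum v I * star (sum v I) = sum Q I" .
  have "projection (sum P I)" "projection (sum Q I)"
    by (rule projection_sum[OF assms(1)]; use pr assms(3,4) in blast)+
  thus ?thesis unfolding proj_equiv_def using 1 2 by blast
qed

text \<open>Each fibre of \<open>f\<close> injects into the corresponding fibre of \<open>g\<close>,
  and the injections are glued. Fibres will be equivalence classes of minimal projections.\<close>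

lemma fiberwise_injection:
  assumes A: "finite A" and B: "finite B"
    and le: "\<And>a. a \<in> A \<Longrightarrow> card {a'\<in>A. f a' = f a} \<le> card {b\<in>B. g b = f a}"
  shows "\<exists>\<iota>. inj_on \<iota> A \<and> \<iota> ` A \<subseteq> B \<and> (\<forall>a\<in>A. g (\<iota> a) = f a)"
proof -
  have "\<exists>h. h ` {a'\<in>A. f a' = x} \<subseteq> {b\<in>B. g b = x} \<and> inj_on h {a'\<in>A. f a' = x}" if "x \<in> f ` A" for x
    using that le A B by (intro card_le_inj) auto
  hence "\<forall>x\<in>f ` A. \<exists>h. h ` {a'\<in>A. f a' = x} \<subseteq> {b\<in>B. g b = x} \<and> inj_on h {a'\<in>A. f a' = x}" by (intro ballI)
  from bchoice[OF this] obtain h where h0: "\<forall>x\<in>f ` A. h x ` {a'\<in>A. f a' = x} \<subseteq> {b\<in>B. g b = x} \<and> inj_on (h x) {a'\<in>A. f a' = x}" 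
    by (elim exE)
  have h: "h x ` {a'\<in>A. f a' = x} \<subseteq> {b\<in>B. g b = x}" "inj_on (h x) {a'\<in>A. f a' = x}" if "x \<in> f ` A" for x
    by (rule conjunct1[OF bspec[OF h0 that]], rule conjunct2[OF bspec[OF h0 that]])
  define \<iota> where "\<iota> a = h (f a) a" for a
  have g: "\<iota> a \<in> B \<and> g (\<iota> a) = f a" if "a \<in> A" for a
    using h(1)[of "f a"] that unfolding \<iota>_def by auto
  have "inj_on \<iota> A"
  proof (rule inj_onI)
    fix a b assume ab: "a \<in> A" "b \<in> A" "\<iota> a = \<iota> b"
    hence "f a = f b" using g by metis
    thus "a = b" using h(2)[of "f a"] ab by (auto simp: \<iota>_def inj_on_def)
  qed
  thus ?thesis using g by auto
qed

context fd_algebra begin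

lemma feq_refl: "minimal m \<Longrightarrow> feq m m"
  by (auto simp: feq_def minimal_def projection_def intro!: bexI[of _ m])

text \<open>Turns the relation \<open>feq\<close> into equality of values of a function, the form
  that \<open>fiberwise_injection\<close> takes.\<close>

lemma feq_class:
  assumes "minimal a" "minimal b"
  shows "{m. minimal m \<and> feq m a} = {m. minimal m \<and> feq m b} \<longleftrightarrow> feq a b"
proof
  assume "{m. minimal m \<and> feq m a} = {m. minimal m \<and> feq m b}"
  thus "feq a b" using feq_refl[OF assms(1)] assms(1) by blast
next
  assume ab: "feq a b"
  have "feq m a \<longleftrightarrow> feq m b" if "minimal m" for m
    using feq_trans[of m a b] feq_trans[of m b a] ab feq_sym[OF ab] that assms by (auto simp: minimal_def)
  thus "{m. minimal m \<and> feq m a} = {m. minimal m \<and> feq m b}" by blast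
qed

lemma feq_equiv: "minimal a \<Longrightarrow> minimal b \<Longrightarrow> feq a b \<Longrightarrow> proj_equiv a b"
  by (auto simp: feq_def proj_equiv_def minimal_def)

lemma orthset_sum_left: "orthset E \<Longrightarrow> e \<in> E \<Longrightarrow> \<Sum>E * e = e"
proof -
  assume E: "orthset E" "e \<in> E"
  have "\<Sum>E * e = (\<Sum>f\<in>E. if f = e then e else 0)" unfolding sum_distrib_right
    using E by (intro sum.cong) (auto simp: orthset_def projection_def)
  thus ?thesis using E by (auto simp: orthset_def)
qed

text \<open>By \<open>rk_decomposition\<close> a rank counts the members of one equivalence class,
  so inequalities of ranks are inequalities between fibres. The disjoint sum of the
  \<open>G l\<close> keeps the targets apart.\<close>

lemma rank_matching:
  assumes E: "orthset E" "\<And>e. e \<in> E \<Longrightarrow> minimal e"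
    and G: "\<And>l. l < (k::nat) \<Longrightarrow> orthset (G l)" "\<And>l e. l < k \<Longrightarrow> e \<in> G l \<Longrightarrow> minimal e"
    and le: "\<And>m. minimal m \<Longrightarrow> rk m (\<Sum>E) \<le> (\<Sum>l<k. rk m (\<Sum>(G l)))"
  shows "\<exists>\<iota>. inj_on \<iota> E \<and> \<iota> ` E \<subseteq> Sigma {..<k} G \<and> (\<forall>a\<in>E. feq a (snd (\<iota> a)))"
proof -
  define cl where "cl a = {m. minimal m \<and> feq m a}" for a
  have finG: "finite (G l)" if "l < k" for l using G(1)[OF that] by (simp add: orthset_def)
  have cl: "cl a = cl b \<longleftrightarrow> feq a b" if "minimal a" "minimal b" for a b unfolding cl_def using that by (rule feq_class)
  have "\<exists>\<iota>. inj_on \<iota> E \<and> \<iota> ` E \<subseteq> Sigma {..<k} G \<and> (\<forall>a\<in>E. cl (snd (\<iota> a)) = cl a)"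
  proof (rule fiberwise_injection)
    show "finite E" using E by (simp add: orthset_def)
    show "finite (Sigma {..<k} G)" using finG by auto
    fix a assume a: "a \<in> E"
    have "{a'\<in>E. cl a' = cl a} = {e\<in>E. feq a e}" using cl E(2) a feq_sym by blast
    hence "card {a'\<in>E. cl a' = cl a} = rk a (\<Sum>E)" using rk_decomposition[OF E(2)[OF a] E] by simp
    also have "\<dots> \<le> (\<Sum>l<k. rk a (\<Sum>(G l)))" by (rule le[OF E(2)[OF a]])
    also have "\<dots> = (\<Sum>l<k. card {e\<in>G l. feq a e})" by (intro sum.cong refl rk_decomposition E(2)[OF a] G) auto
    also have "\<dots> = card (Sigma {..<k} (\<lambda>l. {e\<in>G l. feq a e}))" using finG by (subst card_SigmaI) auto
    also have "Sigma {..<k} (\<lambda>l. {e\<in>G l. feq a e}) = {b \<in> Sigma {..<k} G. cl (snd b) = cl a}"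
      using cl G(2) E(2) a feq_sym by (auto simp: set_eq_iff) blast+
    finally show "card {a'\<in>E. cl a' = cl a} \<le> card {b \<in> Sigma {..<k} G. cl (snd b) = cl a}" .
  qed
  then obtain \<iota> where \<iota>: "inj_on \<iota> E" "\<iota> ` E \<subseteq> Sigma {..<k} G" "\<forall>a\<in>E. cl (snd (\<iota> a)) = cl a" by blast
  have "feq a (snd (\<iota> a))" if a: "a \<in> E" for a
  proof -
    have "minimal (snd (\<iota> a))" using \<iota>(2) a G(2)[of "fst (\<iota> a)" "snd (\<iota> a)"] by auto
    thus ?thesis using cl[of "snd (\<iota> a)" a] \<iota>(3) a E(2) feq_sym by auto
  qed
  thus ?thesis using \<iota> by blast
qed

text \<open>The minimal summands of \<open>f\<close> are matched with minimal summands of the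
  \<open>g l\<close>; those that land in \<open>g l\<close> are collected into
  \<open>P l\<close>.\<close>

lemma rank_comparison:
  assumes f: "f \<in> F" "projection f" and g: "\<And>l. l < (k::nat) \<Longrightarrow> g l \<in> F" "\<And>l. l < k \<Longrightarrow> projection (g l)"
    and le: "\<And>m. minimal m \<Longrightarrow> rk m f \<le> (\<Sum>l<k. rk m (g l))"
  shows "\<exists>P. (\<forall>l<k. proj_sub (P l) (g l)) \<and> (\<forall>l<k. \<forall>j<k. l \<noteq> j \<longrightarrow> P l * P j = 0) \<and> f = (\<Sum>l<k. P l)"
proof -
  obtain E where E: "orthset E" "\<And>e. e \<in> E \<Longrightarrow> minimal e" "\<Sum>E = f" using orthset_decomposition[OF f] by blast
  have "\<forall>l\<in>{..<k}. \<exists>G. orthset G \<and> (\<forall>e\<in>G. minimal e) \<and> \<Sum>G = g l"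
    using orthset_decomposition g by auto
  from bchoice[OF this] obtain G where "\<forall>l\<in>{..<k}. orthset (G l) \<and> (\<forall>e\<in>G l. minimal e) \<and> \<Sum>(G l) = g l" by (elim exE)
  hence G: "orthset (G l)" "\<Sum>(G l) = g l" "\<And>e. e \<in> G l \<Longrightarrow> minimal e" if "l < k" for l using that by auto
  have "\<exists>\<iota>. inj_on \<iota> E \<and> \<iota> ` E \<subseteq> Sigma {..<k} G \<and> (\<forall>a\<in>E. feq a (snd (\<iota> a)))"
    by (rule rank_matching[OF E(1,2)]) (use G E(3) le in auto)
  then obtain \<iota> where \<iota>: "inj_on \<iota> E" "\<And>a. a \<in> E \<Longrightarrow> \<iota> a \<in> Sigma {..<k} G" "\<And>a. a \<in> E \<Longrightarrow> feq a (snd (\<iota> a))" by blast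
  have finE: "finite E" using E by (simp add: orthset_def)
  \<comment> \<open>The minimal summands of \<open>f\<close> whose match lies in
    \<open>g l\<close>.\<close>
  define A where "A l = {a\<in>E. fst (\<iota> a) = l}" for l
  define P where "P l = \<Sum>(A l)" for l
  have pr: "projection a" "a * b = 0" if "a \<in> E" "b \<in> E" "a \<noteq> b" for a b using E(1) that by (auto simp: orthset_def)
  have "proj_sub (P l) (g l)" if l: "l < k" for l
  proof (rule proj_sub_trans)
    have fst: "fst (\<iota> a) = l" "snd (\<iota> a) \<in> G l" "a \<in> E" if "a \<in> A l" for a 
      using \<iota>(2)[of a] that by (auto simp: A_def)
    have og: "snd (\<iota> a) * snd (\<iota> b) = 0" if "a \<in> A l" "b \<in> A l" "a \<noteq> b" for a b
    proof -
      have "snd (\<iota> a) \<noteq> snd (\<iota> b)" using \<iota>(1) that fst by (metis inj_onD prod_eqI)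
      thus ?thesis using G(1)[OF l] fst(2) that by (auto simp: orthset_def)
    qed
    have "proj_equiv (sum (\<lambda>a. a) (A l)) (sum (\<lambda>a. snd (\<iota> a)) (A l))"
    proof (rule proj_equiv_sum)
      show "finite (A l)" using finE by (simp add: A_def)
      show "proj_equiv a (snd (\<iota> a))" if "a \<in> A l" for a 
        using feq_equiv[OF E(2) G(3)[OF l fst(2)] \<iota>(3)] fst(3)[OF that] that by blast
      show "a * b = 0" if "a \<in> A l" "b \<in> A l" "a \<noteq> b" for a b using pr(2) fst(3) that by blast
      show "snd (\<iota> a) * snd (\<iota> b) = 0" if "a \<in> A l" "b \<in> A l" "a \<noteq> b" for a b using og that by blast
    qed
    thus 1: "proj_sub (P l) (sum (\<lambda>a. snd (\<iota> a)) (A l))" unfolding P_def by (rule proj_equiv_sub)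
    show "proj_sub (sum (\<lambda>a. snd (\<iota> a)) (A l)) (g l)"
    proof (rule proj_sub_le)
      show "projection (sum (\<lambda>a. snd (\<iota> a)) (A l))" using 1 by (simp add: proj_sub_def)
      show "projection (g l)" by (rule g(2)[OF l])
      show "g l * sum (\<lambda>a. snd (\<iota> a)) (A l) = sum (\<lambda>a. snd (\<iota> a)) (A l)"
        unfolding sum_distrib_left using orthset_sum_left[OF G(1)[OF l]] G(2)[OF l] fst(2) by (intro sum.cong) auto
    qed
  qed
  moreover have "P l * P j = 0" if "l \<noteq> j" for l j
    unfolding P_def sum_product using that pr(2) by (intro sum.neutral ballI) (auto simp: A_def)
  moreover have "f = (\<Sum>l<k. P l)"
  proof -
    have "f = sum (\<lambda>a. a) (\<Union>l<k. A l)" using E(3) \<iota>(2) by (auto simp: A_def intro!: sum.cong) fastforce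
    also have "\<dots> = (\<Sum>l<k. P l)" unfolding P_def using finE by (intro sum.UNION_disjoint) (auto simp: A_def)
    finally show ?thesis .
  qed
  ultimately show ?thesis by blast
qed

text \<open>Equal ranks give injective matchings in both directions; the cardinalities then agree
  and the first matching is onto.\<close>

lemma rank_equiv:
  assumes f: "f \<in> F" "projection f" and g: "g \<in> F" "projection g"
    and eq: "\<And>m. minimal m \<Longrightarrow> rk m f = rk m g"
  shows "proj_equiv f g"
proof -
  obtain E where E: "orthset E" "\<And>e. e \<in> E \<Longrightarrow> minimal e" "\<Sum>E = f" using orthset_decomposition[OF f] by blast
  obtain G where G: "orthset G" "\<And>e. e \<in> G \<Longrightarrow> minimal e" "\<Sum>G = g" using orthset_decomposition[OF g] by blast
  have fin: "finite E" "finite G" using E G by (auto simp: orthset_def)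
  \<comment> \<open>A single target is a family over \<open>{..<1}\<close>.\<close>
  have "\<exists>\<iota>. inj_on \<iota> E \<and> \<iota> ` E \<subseteq> Sigma {..<1::nat} (\<lambda>_. G) \<and> (\<forall>a\<in>E. feq a (snd (\<iota> a)))"
    by (rule rank_matching[OF E(1,2)]) (use G E(3) eq in auto)
  then obtain \<iota> where \<iota>: "inj_on \<iota> E" "\<iota> ` E \<subseteq> Sigma {..<1::nat} (\<lambda>_. G)" "\<forall>a\<in>E. feq a (snd (\<iota> a))" by blast
  have "\<exists>\<iota>. inj_on \<iota> G \<and> \<iota> ` G \<subseteq> Sigma {..<1::nat} (\<lambda>_. E) \<and> (\<forall>a\<in>G. feq a (snd (\<iota> a)))"
    by (rule rank_matching[OF G(1,2)]) (use E G(3) eq in auto)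
  then obtain \<kappa> where \<kappa>: "inj_on \<kappa> G" "\<kappa> ` G \<subseteq> Sigma {..<1::nat} (\<lambda>_. E)" by blast
  have "card G \<le> card (Sigma {..<1::nat} (\<lambda>_. E))" using card_inj_on_le[OF \<kappa>] fin by simp
  hence cGE: "card G \<le> card E" by (simp add: card_cartesian_product)
  have inj: "inj_on (\<lambda>a. snd (\<iota> a)) E"
  proof (rule inj_onI)
    fix a b assume ab: "a \<in> E" "b \<in> E" "snd (\<iota> a) = snd (\<iota> b)"
    moreover have "\<iota> a \<in> Sigma {..<1} (\<lambda>_. G)" "\<iota> b \<in> Sigma {..<1} (\<lambda>_. G)" using \<iota>(2) ab(1,2) by blast+
    hence "fst (\<iota> a) = fst (\<iota> b)" by auto
    ultimately show "a = b" using \<iota>(1) by (metis inj_onD prod_eqI)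
  qed
  have sub: "(\<lambda>a. snd (\<iota> a)) ` E \<subseteq> G" using \<iota>(2) by auto
  have "(\<lambda>a. snd (\<iota> a)) ` E = G"
    using sub cGE card_image[OF inj] by (intro card_subset_eq fin) (auto intro!: antisym card_mono[OF fin(2) sub, unfolded card_image[OF inj]])
  hence "g = sum (\<lambda>a. snd (\<iota> a)) E" using G(3) sum.reindex[OF inj, of "\<lambda>x. x"] by (simp add: o_def)
  moreover have "proj_equiv (sum (\<lambda>a. a) E) (sum (\<lambda>a. snd (\<iota> a)) E)"
  proof (rule proj_equiv_sum[OF fin(1)])
    show "proj_equiv a (snd (\<iota> a))" if "a \<in> E" for a using feq_equiv E(2) G(2) \<iota>(3) sub that by blast
    show "a * b = 0" if "a \<in> E" "b \<in> E" "a \<noteq> b" for a b using E(1) that by (auto simp: orthset_def)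
    show "snd (\<iota> a) * snd (\<iota> b) = 0" if "a \<in> E" "b \<in> E" "a \<noteq> b" for a b
    proof -
      have "snd (\<iota> a) \<noteq> snd (\<iota> b)" using inj that by (auto simp: inj_on_def)
      thus ?thesis using sub that G(1) unfolding orthset_def by blast
    qed
  qed
  ultimately show ?thesis using E(3) by simp
qed

end


subsection \<open>AF-algebras\<close>

text \<open>The elements \<open>1 - (1 - x) ^ k\<close> are polynomials in \<open>x\<close> without
  constant term, so they lie in \<open>F\<close>, and they converge to 1.\<close>

lemma one_in_of_close:
  assumes F: "cstar_subalgebra F" and x: "x \<in> F" "norm (1 - x) < (1::real)" shows "(1::'a::cstar_algebra) \<in> F"
proof -
  have sub: "csubspace F" "closed F" and m: "\<And>x y. x \<in> F \<Longrightarrow> y \<in> F \<Longrightarrow> x * y \<in> F" using F by (auto simp: cstar_subalgebra_def)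
  have "1 - (1 - x) ^ k \<in> F" for k
  proof (induction k)
    case 0 thus ?case using complex_vector.subspace_0[OF sub(1)] by simp
  next
    case (Suc k)
    have "1 - (1 - x) ^ Suc k = (1 - (1 - x) ^ k) + (x - (1 - (1 - x) ^ k) * x)"
      unfolding power_Suc2 by (simp add: algebra_simps)
    also have "\<dots> \<in> F" by (rule complex_vector.subspace_add[OF sub(1) Suc complex_vector.subspace_diff[OF sub(1) x(1) m[OF Suc x(1)]]])
    finally show ?case .
  qed
  moreover have "(\<lambda>k. 1 - (1 - x) ^ k) \<longlonglongrightarrow> 1 - 0" by (intro tendsto_intros LIMSEQ_power_zero x)
  ultimately show ?thesis using closed_sequentially[OF sub(2), of "\<lambda>k. 1 - (1 - x) ^ k"] by auto
qed

locale af =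
  fixes F :: "nat \<Rightarrow> 'a::cstar_algebra set"
  assumes inc: "incseq F" and fd: "\<And>n. fd_algebra (F n)" and dense: "closure (\<Union>n. F n) = UNIV"

sublocale af \<subseteq> Fn: fd_algebra "F n" for n by (rule fd)

text \<open>The given algebras may have units different from 1; by density one of them comes close
  to 1, so from some index on all contain it.\<close>

lemma AF_algebra_af:
  assumes "AF_algebra TYPE('a::cstar_algebra)" shows "\<exists>F :: nat \<Rightarrow> 'a set. af F"
proof -
  obtain F :: "nat \<Rightarrow> 'a set" where F: "incseq F" "\<And>n. cstar_subalgebra (F n)" "\<And>n. finite_dimensional (F n)" "closure (\<Union>n. F n) = UNIV"
    using assms by (auto simp: AF_algebra_def)
  have "1 \<in> closure (\<Union>n. F n)" using F(4) by simp
  hence "\<exists>x\<in>\<Union>n. F n. dist x 1 < 1" unfolding closure_approachable by (elim allE[of _ 1]) simp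
  then obtain x where "x \<in> (\<Union>n. F n)" "dist x 1 < 1" by blast
  then obtain n0 x where x: "x \<in> F n0" "norm (1 - x) < 1" by (auto simp: dist_norm norm_minus_commute)
  have "1 \<in> F n0" using one_in_of_close[OF F(2) x] .
  hence one: "1 \<in> F (n + n0)" for n using incseqD[OF F(1), of n0 "n + n0"] by auto
  have "af (\<lambda>n. F (n + n0))"
  proof
    show "incseq (\<lambda>n. F (n + n0))" using F(1) by (auto simp: incseq_def)
    fix n
    show "cstar_subalgebra (F (n + n0))" "finite_dimensional (F (n + n0))" "1 \<in> F (n + n0)" using F one by auto
  next
    have "(\<Union>n. F n) \<subseteq> (\<Union>n. F (n + n0))"
      using incseqD[OF F(1), of _ "_ + n0"] by (auto intro: le_add1)
    hence "closure (\<Union>n. F n) \<subseteq> closure (\<Union>n. F (n + n0))" by (rule closure_mono)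
    thus "closure (\<Union>n. F (n + n0)) = UNIV" using F(4) by auto
  qed
  thus ?thesis by blast
qed

context af begin

text \<open>Choose almost nearest points. The distances from \<open>x\<close> to the
  \<open>F n\<close> tend to zero because the algebras increase to a dense union.\<close>

lemma approx_seq: "\<exists>a. (\<forall>n. a n \<in> F n) \<and> a \<longlonglongrightarrow> x"
proof -
  have ne: "F n \<noteq> {}" for n using Fn.one_in by blast
  have "\<exists>y\<in>F n. dist x y < infdist x (F n) + 1 / real (Suc n)" for n
    using cInf_lessD[of "dist x ` F n" "infdist x (F n) + 1 / real (Suc n)"] ne by (auto simp: infdist_notempty)
  then obtain a where a: "\<And>n. a n \<in> F n" "\<And>n. dist x (a n) < infdist x (F n) + 1 / real (Suc n)" by metis
  have "(\<lambda>n. infdist x (F n)) \<longlonglongrightarrow> 0"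
  proof (rule LIMSEQ_I)
    fix e :: real assume e: "e > 0"
    have "x \<in> closure (\<Union>n. F n)" by (simp add: dense)
    then obtain y N where y: "y \<in> F N" "dist y x < e" using e unfolding closure_approachable by blast
    have "norm (infdist x (F n) - 0) < e" if "n \<ge> N" for n
    proof -
      have "y \<in> F n" using y(1) incseqD[OF inc that] by blast
      thus ?thesis using infdist_le[of y "F n" x] y(2) by (simp add: dist_commute infdist_nonneg)
    qed
    thus "\<exists>no. \<forall>n\<ge>no. norm (infdist x (F n) - 0) < e" by blast
  qed
  hence "(\<lambda>n. infdist x (F n) + 1 / real (Suc n)) \<longlonglongrightarrow> 0" 
    using tendsto_add[OF _ LIMSEQ_Suc[OF lim_1_over_n], of "\<lambda>n. infdist x (F n)" 0] by simp
  hence "(\<lambda>n. dist x (a n)) \<longlonglongrightarrow> 0"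
    by (rule Lim_null_comparison[rotated]) (use a(2) in \<open>auto intro!: always_eventually less_imp_le\<close>)
  hence "a \<longlonglongrightarrow> x" using tendsto_dist_iff[of a x sequentially] by (simp add: dist_commute)
  thus ?thesis using a(1) by blast
qed

text \<open>Symmetrised approximants are self-adjoint and eventually almost idempotent, and
  \<open>nearly_idempotent\<close> corrects them inside \<open>F n\<close>.\<close>

lemma approx_projection:
  assumes q: "projection q"
  shows "\<exists>Q. (\<forall>n. Q n \<in> F n \<and> projection (Q n)) \<and> Q \<longlonglongrightarrow> q"
proof -
  obtain a where a: "\<And>n. a n \<in> F n" "a \<longlonglongrightarrow> q" using approx_seq by blast
  define b where "b n = (1/2) *\<^sub>R (a n + star (a n))" for n
  have bF: "b n \<in> F n" "star (b n) = b n" for n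
    using a(1) by (auto simp: b_def star_scaleR star_add star_star add.commute intro!: Fn.scaleR_in Fn.add_in Fn.star_in)
  have "b \<longlonglongrightarrow> (1/2) *\<^sub>R (q + star q)" unfolding b_def by (intro tendsto_intros a)
  also have "(1/2) *\<^sub>R (q + star q) = q" using projectionD(2)[OF q] by (simp add: scaleR_2[symmetric])
  finally have bq: "b \<longlonglongrightarrow> q" .
  define d where "d n = norm (b n * b n - b n)" for n
  have "d \<longlonglongrightarrow> norm (q * q - q)" unfolding d_def by (intro tendsto_intros bq)
  hence d0: "d \<longlonglongrightarrow> 0" using projectionD(1)[OF q] by simp
  have "\<exists>e. e \<in> F n \<and> projection e \<and> (d n \<le> 1/8 \<longrightarrow> norm (e - b n) \<le> 8 * d n)" for n
  proof (cases "d n \<le> 1/8")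
    case True
    obtain e where e: "projection e" "norm (e - b n) \<le> 8 * d n" 
      "\<forall>S. subspace S \<and> closed S \<and> 1 \<in> S \<and> b n \<in> S \<and> (\<forall>a\<in>S. \<forall>b\<in>S. a * b \<in> S) \<longrightarrow> e \<in> S"
      using nearly_idempotent[OF bF(2)[of n] _ True] by (auto simp: d_def)
    have "e \<in> F n" using e(3) Fn.subspace_F Fn.closed_F Fn.one_in bF(1) Fn.mult_in by blast
    thus ?thesis using e by blast
  next
    \<comment> \<open>A default for the finitely many levels whose approximant is not yet close to
      an idempotent.\<close>
    case False thus ?thesis using Fn.zero_in by (intro exI[of _ 0]) auto
  qed
  then obtain Q where Q: "\<And>n. Q n \<in> F n" "\<And>n. projection (Q n)" "\<And>n. d n \<le> 1/8 \<Longrightarrow> norm (Q n - b n) \<le> 8 * d n" by metis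
  have "(\<lambda>n. Q n - b n) \<longlonglongrightarrow> 0"
  proof (rule Lim_null_comparison)
    have "eventually (\<lambda>n. d n < 1/8) sequentially" using order_tendstoD(2)[OF d0, of "1/8"] by simp
    thus "eventually (\<lambda>n. norm (Q n - b n) \<le> 8 * d n) sequentially" by eventually_elim (use Q(3) in auto)
    show "(\<lambda>n. 8 * d n) \<longlonglongrightarrow> 0" using tendsto_mult_left[OF d0, of 8] by simp
  qed
  from tendsto_add[OF this bq] have "Q \<longlonglongrightarrow> q" by simp
  thus ?thesis using Q by blast
qed

text \<open>A fixed sequence of approximants for each element, so that ranks of projections of the
  whole algebra can be read off level by level.\<close>

definition ap :: "'a \<Rightarrow> nat \<Rightarrow> 'a" where
  "ap x = (SOME Q. (\<forall>n. Q n \<in> F n \<and> (projection x \<longrightarrow> projection (Q n))) \<and> Q \<longlonglongrightarrow> x)"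

lemma ap: "ap x n \<in> F n" "projection x \<Longrightarrow> projection (ap x n)" "ap x \<longlonglongrightarrow> x"
proof -
  have "\<exists>Q. (\<forall>n. Q n \<in> F n \<and> (projection x \<longrightarrow> projection (Q n))) \<and> Q \<longlonglongrightarrow> x"
    using approx_seq[of x] approx_projection[of x] by (cases "projection x") auto
  hence "(\<forall>n. ap x n \<in> F n \<and> (projection x \<longrightarrow> projection (ap x n))) \<and> ap x \<longlonglongrightarrow> x"
    unfolding ap_def by (rule someI_ex)
  thus "ap x n \<in> F n" "projection x \<Longrightarrow> projection (ap x n)" "ap x \<longlonglongrightarrow> x" by auto
qed

lemma ap_close: "0 < e \<Longrightarrow> eventually (\<lambda>n. norm (x - ap x n) < e) sequentially"
  using tendstoD[OF ap(3)[of x]] by (simp add: dist_norm norm_minus_commute)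

lemma ap_equiv: "projection p \<Longrightarrow> eventually (\<lambda>n. proj_equiv p (ap p n)) sequentially"
proof -
  assume p: "projection p"
  have "eventually (\<lambda>n. norm (p - ap p n) < 1/10) sequentially" by (rule ap_close) simp
  thus ?thesis
  proof eventually_elim
    case (elim n)
    hence "\<exists>s. star s * s = ap p n \<and> s * star s = p \<and> norm (s - ap p n) \<le> 5 * (1/10)"
      by (intro close_projections p ap(2)) auto
    thus ?case using p ap(2) proj_equiv_sym unfolding proj_equiv_def by blast
  qed
qed

text \<open>Only the values at large levels carry information, whence the \<open>eventually\<close>
  in what follows.\<close>

definition R :: "nat \<Rightarrow> 'a \<Rightarrow> 'a \<Rightarrow> nat" where "R n m q = Fn.rk n m (ap q n)"

text \<open>Left multiplication by the matrix \<open>d' l * T l j\<close> is injective on the tuples \<open>x\<close> with \<open>d i * x i = x i\<close>.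
  This persists after approximation within \<open>F N\<close>, where it is an inequality of dimensions.\<close>

lemma rank_inequality:
  fixes k n :: nat
  assumes d: "\<And>i. i < n \<Longrightarrow> projection (d i)" and d': "\<And>l. l < k \<Longrightarrow> projection (d' l)"
    and eq: "\<And>i j. i < n \<Longrightarrow> j < n \<Longrightarrow> (\<Sum>l<k. T' i l * d' l * T l j) = (if i = j then d i else 0)"
  shows "eventually (\<lambda>N. \<forall>m. Fn.minimal N m \<longrightarrow> (\<Sum>i<n. R N m (d i)) \<le> (\<Sum>l<k. R N m (d' l))) sequentially"
proof -
  define \<epsilon> where "\<epsilon> = 1 / (real n + 1)"
  have \<epsilon>: "\<epsilon> > 0" "real n * \<epsilon> < 1" by (auto simp: \<epsilon>_def field_simps)
  define E where "E N i j = (\<Sum>l<k. ap (T' i l) N * ap (d' l) N * ap (T l j) N) - (if i = j then ap (d i) N else 0)" for N i j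
  have "(\<lambda>N. E N i j) \<longlonglongrightarrow> 0" if ij: "i < n" "j < n" for i j
  proof -
    have "(\<lambda>N. E N i j) \<longlonglongrightarrow> (\<Sum>l<k. T' i l * d' l * T l j) - (if i = j then d i else 0)"
      unfolding E_def by (cases "i = j") (auto intro!: tendsto_intros ap(3))
    thus ?thesis using eq[OF ij] by simp
  qed
  hence "eventually (\<lambda>N. norm (E N i j) < \<epsilon>) sequentially" if "i < n" "j < n" for i j
    using tendstoD[OF _ \<epsilon>(1)] that by fastforce
  hence "eventually (\<lambda>N. \<forall>i\<in>{..<n}. \<forall>j\<in>{..<n}. norm (E N i j) < \<epsilon>) sequentially"
    by (intro eventually_ball_finite ballI) auto
  thus ?thesis
  proof eventually_elim
    case (elim N)
    show ?case
    proof (intro allI impI)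
      fix m assume m: "Fn.minimal N m"
      show "(\<Sum>i<n. R N m (d i)) \<le> (\<Sum>l<k. R N m (d' l))"
        unfolding R_def
      proof (rule Fn.rk_sum_le[where T = "\<lambda>l j. ap (T l j) N" and T' = "\<lambda>i l. ap (T' i l) N" and \<epsilon> = \<epsilon>])
        show "m \<in> F N" using m by (simp add: Fn.minimal_def)
        show "norm ((\<Sum>l<k. ap (T' i l) N * ap (d' l) N * ap (T l j) N) - (if i = j then ap (d i) N else 0)) \<le> \<epsilon>"
          if "i < n" "j < n" for i j using elim that by (auto simp: E_def less_imp_le)
        show "ap (d i) N * ap (d i) N = ap (d i) N" if "i < n" for i using projectionD(1)[OF ap(2)[OF d[OF that]]] .
      qed (use ap \<epsilon> in auto)
    qed
  qed
qed

lemma R_mono_sub: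
  assumes "proj_sub p q"
  shows "eventually (\<lambda>N. \<forall>m. Fn.minimal N m \<longrightarrow> R N m p \<le> R N m q) sequentially"
proof -
  obtain v where v: "star v * v = p" "q * v = v" "projection p" "projection q" using assms by (auto simp: proj_sub_def)
  have "eventually (\<lambda>N. \<forall>m. Fn.minimal N m \<longrightarrow> (\<Sum>i<(1::nat). R N m ((\<lambda>_. p) i)) \<le> (\<Sum>l<(1::nat). R N m ((\<lambda>_. q) l))) sequentially"
    by (rule rank_inequality[where n = 1 and k = 1 and d = "\<lambda>_. p" and d' = "\<lambda>_. q" and T = "\<lambda>_ _. v" and T' = "\<lambda>_ _. star v"]) (use v in \<open>auto simp: mult.assoc\<close>)
  thus ?thesis by simp
qed

lemma R_orth_sum:
  assumes "\<And>i. i < (n::nat) \<Longrightarrow> projection (q i)" "\<And>i j. i < n \<Longrightarrow> j < n \<Longrightarrow> i \<noteq> j \<Longrightarrow> q i * q j = 0"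
  shows "eventually (\<lambda>N. \<forall>m. Fn.minimal N m \<longrightarrow> (\<Sum>i<n. R N m (q i)) \<le> R N m 1) sequentially"
proof -
  have "eventually (\<lambda>N. \<forall>m. Fn.minimal N m \<longrightarrow> (\<Sum>i<n. R N m (q i)) \<le> (\<Sum>l<(1::nat). R N m ((\<lambda>_. 1) l))) sequentially"
    by (rule rank_inequality[where k = 1 and d' = "\<lambda>_. 1" and T = "\<lambda>_ j. q j" and T' = "\<lambda>i _. q i"]) (use assms in \<open>auto simp: projectionD\<close>)
  thus ?thesis by simp
qed

lemma R_one_le:
  assumes "\<And>l. l < (k::nat) \<Longrightarrow> projection (q l)" "(\<Sum>l<k. x l * q l * y l) = 1"
  shows "eventually (\<lambda>N. \<forall>m. Fn.minimal N m \<longrightarrow> R N m 1 \<le> (\<Sum>l<k. R N m (q l))) sequentially"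
proof -
  have "eventually (\<lambda>N. \<forall>m. Fn.minimal N m \<longrightarrow> (\<Sum>i<(1::nat). R N m ((\<lambda>_. 1) i)) \<le> (\<Sum>l<k. R N m (q l))) sequentially"
    by (rule rank_inequality[where n = 1 and d = "\<lambda>_. 1" and T = "\<lambda>l _. y l" and T' = "\<lambda>_ l. x l"]) (use assms in auto)
  thus ?thesis by simp
qed

lemma proj_equiv_of_rank:
  assumes p: "projection p" and q: "projection q"
    and eq: "eventually (\<lambda>N. \<forall>m. Fn.minimal N m \<longrightarrow> R N m p = R N m q) sequentially"
  shows "proj_equiv p q"
proof -
  have "eventually (\<lambda>N. proj_equiv p q) sequentially"
    using eq ap_equiv[OF p] ap_equiv[OF q]
  proof eventually_elim
    case (elim N)
    have "proj_equiv (ap p N) (ap q N)" by (rule Fn.rank_equiv[OF ap(1) ap(2)[OF p] ap(1) ap(2)[OF q]]) (use elim(1) in \<open>auto simp: R_def\<close>)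
    thus ?case using elim(2,3) proj_equiv_trans proj_equiv_sym by blast
  qed
  thus ?thesis by simp
qed

lemma proj_equiv_conj:
  assumes "star z * z = e" "z * star z = f" "projection e" "projection p" "e * p = p"
  shows "proj_equiv p (z * p * star z)"
proof -
  note pp = projectionD[OF assms(4)]
  have pe: "p * e = p" using projection_le_sym[OF assms(3,4,5)] .
  have 1: "star (z * p) * (z * p) = p" using mult_eq_left[OF assms(1), of p] assms(5) pp by (simp add: star_mult mult.assoc)
  have "z * p * star (z * p) = z * p * star z" using mult_eq_left[OF pp(1), of "star z"] by (simp add: star_mult pp mult.assoc)
  thus ?thesis unfolding proj_equiv_def using 1 assms(4) partial_isometry_left(1)[OF 1 assms(4)] by auto
qed

text \<open>At one sufficiently high level the approximant of \<open>p\<close> is decomposed by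
  \<open>rank_comparison\<close>; a partial isometry \<open>z\<close> from the approximant to
  \<open>p\<close> carries the pieces back.\<close>

lemma sub_decomposition:
  assumes p: "projection p" and h: "\<And>l. l < (k::nat) \<Longrightarrow> projection (h l)"
    and le: "eventually (\<lambda>N. \<forall>m. Fn.minimal N m \<longrightarrow> R N m p \<le> (\<Sum>l<k. R N m (h l))) sequentially"
  shows "\<exists>P. (\<forall>l<k. proj_sub (P l) (h l)) \<and> (\<forall>l<k. \<forall>j<k. l \<noteq> j \<longrightarrow> P l * P j = 0) \<and> p = (\<Sum>l<k. P l)"
proof -
  have "eventually (\<lambda>N. \<forall>l\<in>{..<k}. proj_equiv (h l) (ap (h l) N)) sequentially"
    by (intro eventually_ball_finite ballI ap_equiv h) auto
  with le ap_equiv[OF p] have "eventually (\<lambda>N. (\<forall>m. Fn.minimal N m \<longrightarrow> R N m p \<le> (\<Sum>l<k. R N m (h l))) \<and> 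
      proj_equiv p (ap p N) \<and> (\<forall>l\<in>{..<k}. proj_equiv (h l) (ap (h l) N))) sequentially"
    by eventually_elim auto
  then obtain N where N: "\<And>m. Fn.minimal N m \<Longrightarrow> R N m p \<le> (\<Sum>l<k. R N m (h l))" "proj_equiv p (ap p N)" 
    "\<And>l. l < k \<Longrightarrow> proj_equiv (h l) (ap (h l) N)"
    by (auto dest!: eventually_happens)
  have "\<exists>P. (\<forall>l<k. proj_sub (P l) (ap (h l) N)) \<and> (\<forall>l<k. \<forall>j<k. l \<noteq> j \<longrightarrow> P l * P j = 0) \<and> ap p N = (\<Sum>l<k. P l)"
    by (rule Fn.rank_comparison) (use ap p h N(1) in \<open>auto simp: R_def\<close>)
  then obtain P where P: "\<And>l. l < k \<Longrightarrow> proj_sub (P l) (ap (h l) N)" "\<And>l j. l < k \<Longrightarrow> j < k \<Longrightarrow> l \<noteq> j \<Longrightarrow> P l * P j = 0" 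
    "ap p N = (\<Sum>l<k. P l)" by blast
  obtain z where z: "star z * z = ap p N" "z * star z = p" using proj_equiv_sym[OF N(2)] by (auto simp: proj_equiv_def)
  have prP: "projection (P l)" if "l < k" for l using P(1)[OF that] by (simp add: proj_sub_def)
  have le: "ap p N * P l = P l" if l: "l < k" for l
  proof -
    have "ap p N * P l = (\<Sum>j<k. if j = l then P l else 0)" unfolding P(3) sum_distrib_right
      using P(2) l projectionD(1)[OF prP[OF l]] by (intro sum.cong) auto
    thus ?thesis using l by simp
  qed
  define Q where "Q l = z * P l * star z" for l
  have eq: "proj_equiv (P l) (Q l)" if "l < k" for l
    unfolding Q_def by (rule proj_equiv_conj[OF z ap(2)[OF p] prP[OF that] le[OF that]])
  have "proj_sub (Q l) (h l)" if "l < k" for l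
    using proj_sub_trans[OF proj_equiv_sub[OF proj_equiv_sym[OF eq[OF that]]] proj_sub_trans[OF P(1)[OF that] proj_equiv_sub[OF proj_equiv_sym[OF N(3)[OF that]]]]] .
  moreover have "Q l * Q j = 0" if "l < k" "j < k" "l \<noteq> j" for l j
  proof -
    have "Q l * Q j = z * (P l * (ap p N * P j)) * star z" using z(1) by (simp add: Q_def mult.assoc[symmetric])
      (simp add: mult.assoc)
    thus ?thesis using le[OF that(2)] P(2)[OF that] by simp
  qed
  moreover have "p = (\<Sum>l<k. Q l)"
  proof -
    have "(\<Sum>l<k. Q l) = z * ap p N * star z" unfolding Q_def P(3) by (simp add: sum_distrib_left sum_distrib_right)
    also have "\<dots> = p * p" unfolding z(1)[symmetric] by (simp add: z(2)[symmetric] mult.assoc)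
    finally show ?thesis using projectionD(1)[OF p] by simp
  qed
  ultimately show ?thesis by blast
qed

lemma norm_star_mult_add: "(norm (x::'a))\<^sup>2 \<le> norm (star x * x + star y * y)"
proof (rule LIMSEQ_le)
  show "(\<lambda>n. (norm (ap x n))\<^sup>2) \<longlonglongrightarrow> (norm x)\<^sup>2" by (intro tendsto_intros ap)
  show "(\<lambda>n. norm (star (ap x n) * ap x n + star (ap y n) * ap y n)) \<longlonglongrightarrow> norm (star x * x + star y * y)"
    by (intro tendsto_intros ap)
  show "\<exists>N. \<forall>n\<ge>N. (norm (ap x n))\<^sup>2 \<le> norm (star (ap x n) * ap x n + star (ap y n) * ap y n)"
    using Fn.norm_star_mult_add ap(1) by blast
qed

lemma star_mult_add_eq_0: "star x * x + star y * y = 0 \<Longrightarrow> x = (0::'a)"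
  using norm_star_mult_add[of x y] by simp

end

subsection \<open>Cancellation\<close>

text \<open>Matrices are functions on all pairs of indices; only the summation index is
  bounded.\<close>

definition mm :: "nat \<Rightarrow> (nat \<Rightarrow> nat \<Rightarrow> 'a::cstar_algebra) \<Rightarrow> (nat \<Rightarrow> nat \<Rightarrow> 'a) \<Rightarrow> nat \<Rightarrow> nat \<Rightarrow> 'a" where
  "mm K a b = (\<lambda>i j. \<Sum>l<K. a i l * b l j)"

lemma mm_assoc: "mm K (mm K a b) c = mm K a (mm K b c)"
proof (intro ext)
  fix i j
  have "mm K (mm K a b) c i j = (\<Sum>x<K. \<Sum>l<K. a i l * (b l x * c x j))" by (simp add: mm_def sum_distrib_right mult.assoc)
  also have "\<dots> = mm K a (mm K b c) i j" by (subst sum.swap) (simp add: mm_def sum_distrib_left)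
  finally show "mm K (mm K a b) c i j = mm K a (mm K b c) i j" .
qed

lemma mm_add: "mm K (a + b) c = mm K a c + mm K b c" "mm K a (b + c) = mm K a b + mm K a c"
  by (simp_all add: mm_def fun_eq_iff algebra_simps sum.distrib)

lemma mm_diff: "mm K (a - b) c = mm K a c - mm K b c" "mm K a (b - c) = mm K a b - mm K a c"
  by (simp_all add: mm_def fun_eq_iff algebra_simps sum_subtractf)

lemma mm_zero [simp]: "mm K 0 a = 0" "mm K a 0 = 0"
  by (simp_all add: mm_def fun_eq_iff)

text \<open>The pair \<open>v\<close>, \<open>vs\<close> implements an equivalence of
  \<open>D\<close> and \<open>D'\<close>. As \<open>W\<close> is orthogonal to both, adding it to
  the two factors gives a factorisation of \<open>D + W\<close> through
  \<open>D' + W\<close>.\<close>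

lemma mm_stabilize:
  assumes D: "mm K D D = D" "mm K D' D' = D'" and W: "mm K W W = W" "mm K D W = 0" "mm K W D = 0" "mm K D' W = 0" "mm K W D' = 0"
    and v: "mm K vs v = D" "mm K v vs = D'"
  shows "mm K (mm K D (mm K vs D') + W) (mm K (D' + W) (mm K D' (mm K v D) + W)) = D + W"
proof -
  have x: "mm K a b = c \<Longrightarrow> mm K a (mm K b z) = mm K c z" for a b c z by (simp add: mm_assoc[symmetric])
  have vv: "mm K vs (mm K D' (mm K v D)) = D"
  proof -
    have "mm K vs (mm K D' (mm K v D)) = mm K (mm K vs v) (mm K (mm K vs v) D)" by (simp only: v(2)[symmetric] mm_assoc)
    thus ?thesis by (simp only: v(1) D(1))
  qed
  show ?thesis
    by (simp add: mm_add mm_assoc D W x[OF D(1)] x[OF D(2)] x[OF W(1)] x[OF W(2)] x[OF W(3)] x[OF W(4)] x[OF W(5)] vv)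
qed

text \<open>Adding the complement of \<open>r\<close> to both sides makes them diagonal, with diagonals \<open>p, 0, 1, \<dots>, 1\<close> and
  \<open>q, 0, 1, \<dots>, 1\<close>; the ranks of the common entries then cancel in \<open>rank_inequality\<close>.\<close>

lemma (in af) stable_equiv_rank_le:
  fixes r v vs :: "nat \<Rightarrow> nat \<Rightarrow> 'a"
  defines "e \<equiv> \<lambda>q i j. (if i = 0 \<and> j = (0::nat) then q else 0)"
  assumes p: "projection p" and q: "projection q"
    and r: "mm (k + 2) r r = r" "\<And>i j. \<not> (2 \<le> i \<and> i < k + 2 \<and> 2 \<le> j \<and> j < k + 2) \<Longrightarrow> r i j = 0"
    and v: "mm (k + 2) vs v = e p + r" "mm (k + 2) v vs = e q + r"
  shows "eventually (\<lambda>N. \<forall>m. Fn.minimal N m \<longrightarrow> R N m p \<le> R N m q) sequentially"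
proof -
  \<comment> \<open>Index 0 carries the projection, index 1 the zero block of the pair in
    \<open>K0\<close>, and the indices from 2 on carry \<open>r\<close>.\<close>
  define K where "K = k + 2"
  define I where "I i j = (if i = j \<and> 2 \<le> i \<and> i < K then 1 else (0::'a))" for i j
  define W where "W = I - r"
  have rI: "mm K r I = r" "mm K I r = r" "mm K I I = I"
  proof -
    have "mm K r I i j = r i j" for i j
    proof -
      have "mm K r I i j = (\<Sum>l<K. if l = j then (if 2 \<le> j \<and> j < K then r i j else 0) else 0)"
        unfolding mm_def I_def by (intro sum.cong) auto
      thus ?thesis using r(2)[of i j] by (auto simp: K_def)
    qed
    thus "mm K r I = r" by (simp add: fun_eq_iff)
    have "mm K I b i j = (if 2 \<le> i \<and> i < K then b i j else 0)" for i j b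
    proof -
      have "mm K I b i j = (\<Sum>l<K. if l = i then (if 2 \<le> i \<and> i < K then b i j else 0) else 0)"
        unfolding mm_def I_def by (intro sum.cong) auto
      thus ?thesis by auto
    qed
    note Ib = this
    show "mm K I r = r"
    proof (intro ext)
      fix i j show "mm K I r i j = r i j" unfolding Ib using r(2)[of i j] by (auto simp: K_def)
    qed
    show "mm K I I = I" by (intro ext) (simp add: Ib, simp add: I_def)
  qed
  have ee: "mm K (e x) (e x) = e x" if "projection x" for x
  proof -
    have "mm K (e x) (e x) i j = e x i j" for i j
    proof -
      have "mm K (e x) (e x) i j = (\<Sum>l<K. if l = 0 then e x i j else 0)"
        unfolding mm_def e_def using projectionD(1)[OF that] by (intro sum.cong) auto
      thus ?thesis by (simp add: K_def)
    qed
    thus ?thesis by (simp add: fun_eq_iff)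
  qed
  have z: "mm K (e x) b = 0" "mm K b (e x) = 0" if "\<And>i j. i = 0 \<or> j = 0 \<Longrightarrow> b i j = 0" for x b
    using that by (auto simp: mm_def e_def fun_eq_iff intro!: sum.neutral)
  have r0: "r i j = 0" "I i j = 0" "W i j = 0" if "i = 0 \<or> j = 0" for i j 
    using r(2)[of i j] that by (auto simp: I_def W_def)
  have rr: "mm K r r = r" using r(1) by (simp add: K_def)
  have WW: "mm K W W = W" "mm K W r = 0" "mm K r W = 0" by (simp_all add: W_def mm_diff rI rr)
  have D: "mm K (e x + r) (e x + r) = e x + r" "mm K (e x + r) W = 0" "mm K W (e x + r) = 0" if "projection x" for x
    by (simp_all add: mm_add ee[OF that] rr z r0 WW)
  define T where "T = mm K (e q + r) (mm K v (e p + r)) + W"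
  define T' where "T' = mm K (e p + r) (mm K vs (e q + r)) + W"
  have main: "mm K T' (mm K (e q + r + W) T) = e p + r + W"
    unfolding T_def T'_def by (rule mm_stabilize) (use D p q WW v in \<open>simp_all add: K_def\<close>)
  \<comment> \<open>Diagonal of \<open>e x + r + W\<close>: as \<open>W\<close> completes
    \<open>r\<close> to the unit of its block, nothing of \<open>r\<close> remains.\<close>
  define d where "d x i = (if i = 0 then x else if 2 \<le> i \<and> i < K then 1 else (0::'a))" for x i
  have E: "e x + r + W = (\<lambda>i j. if i = j then d x i else 0)" for x
    by (auto simp: fun_eq_iff W_def I_def d_def e_def)
  have pd: "projection (d x i)" if "projection x" for x i using that by (auto simp: d_def)
  have "eventually (\<lambda>N. \<forall>m. Fn.minimal N m \<longrightarrow> (\<Sum>i<K. R N m (d p i)) \<le> (\<Sum>l<K. R N m (d q l))) sequentially"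
  proof (rule rank_inequality[where T = T and T' = T'])
    fix i j assume ij: "i < K" "j < K"
    have "mm K (e q + r + W) T l j = d q l * T l j" if "l < K" for l
    proof -
      have "mm K (e q + r + W) T l j = (\<Sum>x<K. if x = l then d q l * T l j else 0)"
        unfolding E mm_def by (intro sum.cong) auto
      thus ?thesis using that by simp
    qed
    hence eq: "mm K T' (mm K (e q + r + W) T) i j = (\<Sum>l<K. T' i l * d q l * T l j)"
      unfolding mm_def[of K T'] by (intro sum.cong) (auto simp: mult.assoc)
    thus "(\<Sum>l<K. T' i l * d q l * T l j) = (if i = j then d p i else 0)"
      using eq[symmetric, unfolded main] by (simp add: E)
  qed (use pd p q in auto)
  moreover have "(\<Sum>i<K. R N m (d x i)) = R N m x + (\<Sum>i<k + 1. R N m (d p (Suc i)))" for N m x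
    unfolding K_def by (simp add: sum.lessThan_Suc_shift d_def del: sum.lessThan_Suc)
  ultimately show ?thesis by simp
qed

subsection \<open>Extracting equivalences from the \<open>K\<^sub>0\<close>-group\<close>

lemma mat_dsum_four_block:
  "mat_dsum p q = four_block_mat p (0\<^sub>m (dim_row p) (dim_col q)) (0\<^sub>m (dim_row q) (dim_col p)) q"
proof -
  have "four_block_mat q (0\<^sub>m (dim_row q) 0) (0\<^sub>m 0 (dim_col q)) (0\<^sub>m 0 0) = q" by (rule eq_matI) auto
  thus ?thesis by (simp add: mat_dsum_def Let_def)
qed

lemma mat_dsum_index:
  "dim_row (mat_dsum p q) = dim_row p + dim_row q" "dim_col (mat_dsum p q) = dim_col p + dim_col q"
  "i < dim_row p + dim_row q \<Longrightarrow> j < dim_col p + dim_col q \<Longrightarrow> mat_dsum p q $$ (i, j) =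
    (if i < dim_row p then if j < dim_col p then p $$ (i, j) else 0 
     else if j < dim_col p then 0 else q $$ (i - dim_row p, j - dim_col p))"
  unfolding mat_dsum_four_block by auto

lemma mat_star_index [simp]:
  "dim_row (mat_star M) = dim_col M" "dim_col (mat_star M) = dim_row M"
  "i < dim_col M \<Longrightarrow> j < dim_row M \<Longrightarrow> mat_star M $$ (i, j) = star (M $$ (j, i))"
  by (auto simp: mat_star_def)

lemma mat_projectionsD:
  assumes "p \<in> mat_projections"
  shows "dim_col p = dim_row p" "p * p = p" "mat_star p = p"
  using assms unfolding mat_projections_def square_mat.simps by blast+

lemma mat_dsum_projections:
  assumes "p \<in> mat_projections" "q \<in> mat_projections"
  shows "mat_dsum p q \<in> mat_projections"
proof -
  define n m where "n = dim_row p" and "m = dim_row q"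
  have d: "dim_row p = n" "dim_col p = n" "dim_row q = m" "dim_col q = m" 
    using mat_projectionsD(1)[OF assms(1)] mat_projectionsD(1)[OF assms(2)] by (simp_all add: n_def m_def)
  have c: "p \<in> carrier_mat n n" "q \<in> carrier_mat m m" using d by (auto intro: carrier_matI)
  note pp = mat_projectionsD(2)[OF assms(1)] mat_projectionsD(2)[OF assms(2)] mat_projectionsD(3)[OF assms(1)] mat_projectionsD(3)[OF assms(2)]
  have "mat_dsum p q * mat_dsum p q = mat_dsum p q"
    unfolding mat_dsum_four_block d
    by (subst mult_four_block_mat[OF c(1) _ _ c(2) c(1) _ _ c(2)]) (use c pp in auto)
  moreover have "mat_star (mat_dsum p q) = mat_dsum p q"
  proof (rule eq_matI)
    have ps: "star (p $$ (j, i)) = p $$ (i, j)" if "i < n" "j < n" for i j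
      using arg_cong[OF pp(3), of "\<lambda>M. M $$ (i, j)"] that d by simp
    have qs: "star (q $$ (j, i)) = q $$ (i, j)" if "i < m" "j < m" for i j
      using arg_cong[OF pp(4), of "\<lambda>M. M $$ (i, j)"] that d by simp
    fix i j assume "i < dim_row (mat_dsum p q)" "j < dim_col (mat_dsum p q)"
    thus "mat_star (mat_dsum p q) $$ (i, j) = mat_dsum p q $$ (i, j)"
      using d by (auto simp: mat_dsum_index ps qs)
  qed (auto simp: mat_dsum_index d)
  ultimately show ?thesis by (auto simp: mat_projections_def mat_dsum_index d square_mat.simps)
qed

lemma mvn_equiv_refl: "p \<in> mat_projections \<Longrightarrow> mvn_equiv p p"
  unfolding mvn_equiv_def using mat_projectionsD[of p] by (intro bexI[of _ p]) (auto intro: carrier_matI)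

lemma zero_mat_projection: "0\<^sub>m n n \<in> mat_projections"
  by (auto simp: mat_projections_def square_mat.simps intro!: eq_matI)

lemma K0_rel_refl: "p \<in> mat_projections \<Longrightarrow> q \<in> mat_projections \<Longrightarrow> ((p, q), (p, q)) \<in> K0_rel"
  unfolding K0_rel_def by (auto intro!: bexI[of _ "0\<^sub>m 1 1"] mvn_equiv_refl mat_dsum_projections zero_mat_projection)

text \<open>The class \<open>X\<close> of \<open>(p, 0)\<close> is a fixed point. By reflexivity its
  image contains the pair of \<phi> p and 0, which therefore belongs to \<open>X\<close>.\<close>

lemma K0_map_fixed_rel:
  assumes "\<forall>x\<in>carrier (K0 TYPE('a::cstar_algebra)). K0_map \<phi> x = x" 
    and p: "p \<in> mat_projections" "map_mat \<phi> p \<in> mat_projections" and \<phi>: "\<phi> 0 = (0::'a)"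
  shows "((p, 0\<^sub>m 1 1), (map_mat \<phi> p, 0\<^sub>m 1 1)) \<in> K0_rel"
proof -
  let ?z = "0\<^sub>m 1 1 :: 'a mat"
  define X where "X = K0_rel `` {(p, ?z)}"
  have "X \<in> carrier (K0 TYPE('a))" unfolding K0_def X_def using p(1) zero_mat_projection by (auto intro!: quotientI)
  hence fixed: "K0_map \<phi> X = X" using assms(1) by blast
  have zz: "map_mat \<phi> ?z = ?z" using \<phi> by (intro eq_matI) auto
  have pX: "(p, ?z) \<in> X" unfolding X_def by (rule ImageI[OF K0_rel_refl[OF p(1) zero_mat_projection]]) simp
  have "(map_mat \<phi> p, ?z) \<in> K0_map \<phi> X"
    unfolding K0_map_def
  proof (rule ImageI[OF K0_rel_refl[OF p(2) zero_mat_projection]])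
    show "(map_mat \<phi> p, ?z) \<in> {(map_mat \<phi> p, map_mat \<phi> q) |p q. (p, q) \<in> X}"
      using pX zz by (intro CollectI exI[of _ p] exI[of _ ?z]) simp
  qed
  hence "(map_mat \<phi> p, ?z) \<in> K0_rel `` {(p, ?z)}" unfolding fixed unfolding X_def .
  thus ?thesis by (rule ImageE) simp
qed

text \<open>Zero outside the matrix, so that products of matrices of matching size become
  \<open>mm\<close>.\<close>

definition fn :: "'a::cstar_algebra mat \<Rightarrow> nat \<Rightarrow> nat \<Rightarrow> 'a" where
  "fn A i j = (if i < dim_row A \<and> j < dim_col A then A $$ (i, j) else 0)"

lemma fn_mult: "dim_col A = n \<Longrightarrow> dim_row B = n \<Longrightarrow> fn (A * B) = mm n (fn A) (fn B)"
  by (auto simp: fn_def mm_def fun_eq_iff scalar_prod_def lessThan_atLeast0 intro!: sum.cong)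

context af begin

text \<open>Cancellation in AF-algebras: equality in \<open>K0\<close> is equivalence after adding
  some \<open>r\<close>. Applying \<open>stable_equiv_rank_le\<close> to the partial isometry and to
  its adjoint gives equal ranks, hence equivalence.\<close>

lemma K0_fixed_imp_equiv:
  assumes K0: "\<forall>x\<in>carrier (K0 TYPE('a)). K0_map \<phi> x = x" and \<phi>: "cstar_hom \<phi>" and q: "projection q"
  shows "proj_equiv q (\<phi> q)"
proof -
  define P where "P x = mat 1 1 (\<lambda>_. x :: 'a)" for x
  have PP: "P x \<in> mat_projections" if "projection x" for x
    using projectionD[OF that] unfolding P_def mat_projections_def
    by (auto simp: square_mat.simps scalar_prod_def intro!: eq_matI)
  have \<phi>q: "projection (\<phi> q)" by (rule cstar_hom_projection[OF \<phi> q])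
  have mP: "map_mat \<phi> (P q) = P (\<phi> q)" unfolding P_def by (rule eq_matI) auto
  have "((P q, 0\<^sub>m 1 1), (P (\<phi> q), 0\<^sub>m 1 1)) \<in> K0_rel"
    using K0_map_fixed_rel[OF K0 PP[OF q]] PP[OF \<phi>q] cstar_homD(6)[OF \<phi>] by (simp add: mP)
  then obtain r v where r: "r \<in> mat_projections" and 
    v: "v \<in> carrier_mat (dim_row (mat_dsum (mat_dsum (P (\<phi> q)) (0\<^sub>m 1 1)) r)) (dim_row (mat_dsum (mat_dsum (P q) (0\<^sub>m 1 1)) r))" 
    "mat_star v * v = mat_dsum (mat_dsum (P q) (0\<^sub>m 1 1)) r" "v * mat_star v = mat_dsum (mat_dsum (P (\<phi> q)) (0\<^sub>m 1 1)) r"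
    by (auto simp: K0_rel_def mvn_equiv_def)
  define k where "k = dim_row r"
  have kr: "dim_row r = k" "dim_col r = k" "r * r = r" using mat_projectionsD[OF r] by (simp_all add: k_def)
  have dP: "dim_row (P x) = 1" "dim_col (P x) = 1" for x by (auto simp: P_def)
  have cv: "dim_row v = k + 2" "dim_col v = k + 2" using v(1) by (auto simp: mat_dsum_index kr dP)
  \<comment> \<open>The matrix \<open>r\<close> moved past the projection and the zero block, two
    rows and columns in all.\<close>
  define r' where "r' i j = (if 2 \<le> i \<and> 2 \<le> j then fn r (i - 2) (j - 2) else 0)" for i j
  have fnD: "fn (mat_dsum (mat_dsum (P x) (0\<^sub>m 1 1)) r) = (\<lambda>i j. if i = 0 \<and> j = 0 then x else 0) + r'" for x
    by (auto simp: fun_eq_iff fn_def mat_dsum_index kr dP r'_def P_def numeral_2_eq_2)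
  have rr: "mm (k + 2) r' r' = r'"
  proof -
    have "mm (k + 2) r' r' i j = r' i j" for i j
    proof -
      have "mm (k + 2) r' r' i j = (\<Sum>l<k. r' i (Suc (Suc l)) * r' (Suc (Suc l)) j)"
        by (simp add: mm_def sum.lessThan_Suc_shift r'_def del: sum.lessThan_Suc)
      also have "\<dots> = (if 2 \<le> i \<and> 2 \<le> j then mm k (fn r) (fn r) (i - 2) (j - 2) else 0)"
        by (auto simp: r'_def mm_def)
      also have "mm k (fn r) (fn r) = fn r" using fn_mult[of r k r] kr by simp
      also have "(if 2 \<le> i \<and> 2 \<le> j then fn r (i - 2) (j - 2) else 0) = r' i j" unfolding r'_def ..
      finally show ?thesis .
    qed
    thus ?thesis by (simp add: fun_eq_iff)
  qed
  have r0: "r' i j = 0" if "\<not> (2 \<le> i \<and> i < k + 2 \<and> 2 \<le> j \<and> j < k + 2)" for i j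
    using that by (auto simp: r'_def fn_def kr)
  have v1: "mm (k + 2) (fn (mat_star v)) (fn v) = (\<lambda>i j. if i = 0 \<and> j = 0 then q else 0) + r'"
    using fn_mult[of "mat_star v" "k + 2" v] cv v(2) fnD by simp
  have v2: "mm (k + 2) (fn v) (fn (mat_star v)) = (\<lambda>i j. if i = 0 \<and> j = 0 then \<phi> q else 0) + r'"
    using fn_mult[of v "k + 2" "mat_star v"] cv v(3) fnD by simp
  have 1: "eventually (\<lambda>N. \<forall>m. Fn.minimal N m \<longrightarrow> R N m q \<le> R N m (\<phi> q)) sequentially"
    by (rule stable_equiv_rank_le[OF q \<phi>q rr r0 v1 v2])
  have 2: "eventually (\<lambda>N. \<forall>m. Fn.minimal N m \<longrightarrow> R N m (\<phi> q) \<le> R N m q) sequentially"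
    by (rule stable_equiv_rank_le[OF \<phi>q q rr r0 v2 v1])
  show ?thesis
  proof (rule proj_equiv_of_rank[OF q \<phi>q])
    show "eventually (\<lambda>N. \<forall>m. Fn.minimal N m \<longrightarrow> R N m q = R N m (\<phi> q)) sequentially"
      using 1 2 by eventually_elim (auto intro: antisym)
  qed
qed

end

subsection \<open>Integer powers of automorphisms\<close>

lemma aut_powi_0 [simp]: "aut_powi f 0 x = x" by (simp add: aut_powi_def)

lemma aut_powi_Suc: assumes "bij f" shows "aut_powi f (k + 1) x = f (aut_powi f k x)"
proof (cases "k \<ge> 0")
  case True
  hence "nat (k + 1) = Suc (nat k)" by simp
  thus ?thesis using True by (simp add: aut_powi_def)
next
  case False
  define n where "n = nat (- k - 1)"
  have n: "nat (- k) = Suc n" "nat (- (k + 1)) = n" using False by (auto simp: n_def)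
  have inv: "f (inv_into UNIV f y) = y" for y using assms by (simp add: bij_is_surj surj_f_inv_f)
  show ?thesis
  proof (cases "k + 1 = 0")
    case True thus ?thesis using False n inv by (simp add: aut_powi_def)
  next
    case k: False thus ?thesis using False n inv by (simp add: aut_powi_def)
  qed
qed

lemma aut_powi_pred: assumes "bij f" shows "aut_powi f (k - 1) x = inv_into UNIV f (aut_powi f k x)"
  using aut_powi_Suc[OF assms, of "k - 1" x] assms by (simp add: bij_is_inj inv_f_f)

lemma aut_powi_add: assumes "bij f" shows "aut_powi f (k + l) x = aut_powi f k (aut_powi f l x)"
proof (induction k rule: int_induct[where k = 0])
  case (step1 i)
  have "aut_powi f (i + 1 + l) x = aut_powi f ((i + l) + 1) x" by (simp add: algebra_simps)
  thus ?case using step1 by (simp add: aut_powi_Suc[OF assms])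
next
  case (step2 i)
  have "aut_powi f (i - 1 + l) x = aut_powi f ((i + l) - 1) x" by (simp add: algebra_simps)
  thus ?case using step2 by (simp add: aut_powi_pred[OF assms])
qed simp

lemma aut_powi_1: "aut_powi f 1 x = f x" by (simp add: aut_powi_def)
lemma aut_powi_nat: "aut_powi f (int n) x = (f ^^ n) x" by (simp add: aut_powi_def)

lemma cstar_hom_comp: "cstar_hom f \<Longrightarrow> cstar_hom g \<Longrightarrow> cstar_hom (\<lambda>x. f (g x))"
  by (simp add: cstar_hom_def)

lemma cstar_hom_inv: fixes f :: "'a::cstar_algebra \<Rightarrow> 'a" assumes "cstar_hom f" "bij f" shows "cstar_hom (inv_into UNIV f)"
proof -
  have 1: "f (inv_into UNIV f y) = y" "inv_into UNIV f (f y) = y" for y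
    using assms(2) by (simp_all add: bij_is_surj surj_f_inv_f bij_is_inj inv_f_f)
  have 2: "inv_into UNIV f y = x" if "f x = y" for x y using 1(2)[of x] that by simp
  show ?thesis unfolding cstar_hom_def by (intro conjI allI 2) (simp_all add: cstar_homD[OF assms(1)] 1)
qed

lemma aut_powi_hom: assumes "cstar_hom f" "bij f" shows "cstar_hom (aut_powi f k)"
proof (induction k rule: int_induct[where k = 0])
  case base show ?case by (simp add: cstar_hom_def)
next
  case (step1 i)
  have "aut_powi f (i + 1) = (\<lambda>x. f (aut_powi f i x))" by (rule ext) (rule aut_powi_Suc[OF assms(2)])
  thus ?case using cstar_hom_comp[OF assms(1) step1(2)] by simp
next
  case (step2 i)
  have "aut_powi f (i - 1) = (\<lambda>x. inv_into UNIV f (aut_powi f i x))" by (rule ext) (rule aut_powi_pred[OF assms(2)])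
  thus ?case using cstar_hom_comp[OF cstar_hom_inv[OF assms] step2(2)] by simp
qed

lemma cstar_hom_surj_one: assumes "cstar_hom f" "surj f" shows "f 1 = 1"
proof -
  obtain x where x: "f x = 1" using assms(2) by (metis surjD)
  have "f 1 = f 1 * f x" by (simp add: x)
  also have "\<dots> = f x" by (simp add: cstar_homD(3)[OF assms(1), symmetric])
  finally show ?thesis by (simp add: x)
qed

lemma csubspace_closure: assumes "csubspace (S::'a::cstar_algebra set)" shows "csubspace (closure S)"
  unfolding complex_vector.subspace_def
proof (intro conjI ballI allI)
  show "0 \<in> closure S" using complex_vector.subspace_0[OF assms] closure_subset by blast
  fix c x assume "x \<in> closure S"
  then obtain a where a: "\<And>n. a n \<in> S" "a \<longlonglongrightarrow> x" unfolding closure_sequential by blast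
  have "(\<lambda>n. c *\<^sub>C a n) \<longlonglongrightarrow> c *\<^sub>C x" by (intro tendsto_intros a)
  thus "c *\<^sub>C x \<in> closure S" unfolding closure_sequential using complex_vector.subspace_scale[OF assms] a(1)
    by (intro exI[of _ "\<lambda>n. c *\<^sub>C a n"]) auto
  fix y assume "y \<in> closure S"
  then obtain b where b: "\<And>n. b n \<in> S" "b \<longlonglongrightarrow> y" unfolding closure_sequential by blast
  have "(\<lambda>n. a n + b n) \<longlonglongrightarrow> x + y" by (intro tendsto_intros a b)
  thus "x + y \<in> closure S" unfolding closure_sequential using complex_vector.subspace_add[OF assms] a(1) b(1)
    by (intro exI[of _ "\<lambda>n. a n + b n"]) auto
qed

section \<open>Translates of projections and Rokhlin towers in the algebra\<close>

locale rokhlin = af F for F :: "nat \<Rightarrow> 'a::cstar_algebra set" +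
  fixes \<alpha> :: "'a \<Rightarrow> 'a" and J :: nat
  assumes aut: "cstar_automorphism \<alpha>" and rokhlin: "tracial_cyclic_rokhlin \<alpha>" and \<alpha>_simple: "aut_simple \<alpha>"
    and J: "1 \<le> J" and K0_trivial: "\<forall>x\<in>carrier (K0 TYPE('a)). K0_map (\<alpha> ^^ J) x = x"
begin

abbreviation A :: "int \<Rightarrow> 'a \<Rightarrow> 'a" where "A \<equiv> aut_powi \<alpha>"

lemma bij: "bij \<alpha>" and hom: "cstar_hom \<alpha>" using aut by (auto simp: cstar_automorphism_def)
lemmas A_add = aut_powi_add[OF bij]
lemmas A_hom = aut_powi_hom[OF hom bij]
lemmas A_simps = cstar_homD[OF A_hom]
lemma A_inv [simp]: "A (- k) (A k x) = x" "A k (A (- k) x) = x" by (simp_all add: A_add[symmetric])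
lemma A_one [simp]: "A k 1 = 1"
  by (rule cstar_hom_surj_one[OF A_hom]) (metis A_inv(2) surjI)
lemma A_norm_le: "norm (A k x) \<le> norm x" by (rule cstar_hom_norm_le[OF A_hom A_one])
lemma A_norm [simp]: "norm (A k x) = norm x"
  using A_norm_le[of k x] A_norm_le[of "- k" "A k x"] by simp
lemma A_bounded_linear: "bounded_linear (A k)" by (rule cstar_hom_bounded_linear[OF A_hom A_one])
lemma A_projection: "projection p \<Longrightarrow> projection (A k p)" by (rule cstar_hom_projection[OF A_hom])
lemma A_eq_0 [simp]: "A k x = 0 \<longleftrightarrow> x = 0" by (metis A_inv(1) A_simps(6))
lemma A_proj_equiv: "proj_equiv p q \<Longrightarrow> proj_equiv (A k p) (A k q)" by (rule proj_equiv_hom[OF A_hom])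

lemma equiv_J: assumes "projection q" shows "proj_equiv q (A (int J) q)"
proof -
  have 1: "A (int J) = \<alpha> ^^ J" by (rule ext) (rule aut_powi_nat)
  show ?thesis using K0_fixed_imp_equiv[OF K0_trivial _ assms] A_hom[of "int J"] unfolding 1 by simp
qed

lemma equiv_multiple: assumes "projection q" shows "proj_equiv q (A (int n * int J) q)"
proof (induction n)
  case 0 thus ?case using proj_equiv_refl[OF assms] by simp
next
  case (Suc n)
  have "A (int (Suc n) * int J) q = A (int J) (A (int n * int J) q)" unfolding A_add[symmetric] by (simp add: algebra_simps)
  thus ?case using proj_equiv_trans[OF Suc equiv_J[OF A_projection[OF assms]]] by simp
qed

lemma equiv_dvd: assumes "projection q" "int J dvd k" shows "proj_equiv q (A k q)"
proof -
  obtain c where c: "k = int J * c" using assms(2) by blast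
  show ?thesis
  proof (cases "c \<ge> 0")
    case True
    thus ?thesis using equiv_multiple[OF assms(1), of "nat c"] by (simp add: c mult.commute)
  next
    case False
    hence "int (nat (- c)) * int J = - k" by (simp add: c mult.commute)
    hence "proj_equiv (A k q) (A (- k) (A k q))" using equiv_multiple[OF A_projection[OF assms(1), of k], of "nat (- c)"] by simp
    thus ?thesis using proj_equiv_sym by simp
  qed
qed

text \<open>The closed span of all \<open>x * A l h * y\<close> is an invariant ideal, hence
  everything. An element of the span closer than 1 to the unit is invertible, which turns an
  approximation of 1 into an exact identity.\<close>

lemma orbit_full:
  assumes h: "projection h" "h \<noteq> 0"
  shows "\<exists>n (x :: nat \<Rightarrow> 'a) l y. (\<Sum>i<(n::nat). x i * A (l i) h * y i) = 1"
proof -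
  define G where "G = {x * A l h * y | x l y. True}"
  define I where "I = closure (cspan G)"
  have cs: "csubspace (cspan G)" by (rule complex_vector.subspace_span)
  have sub: "csubspace I" unfolding I_def by (rule csubspace_closure[OF cs])
  have lin: "f ` cspan G \<subseteq> cspan G" if f: "\<And>a b. f (a + b) = f a + f b" "\<And>c a. f (c *\<^sub>C a) = c *\<^sub>C f a" "f ` G \<subseteq> G" for f
  proof
    fix z assume "z \<in> f ` cspan G"
    then obtain a where a: "a \<in> cspan G" "z = f a" by blast
    have f0: "f 0 = 0" using f(1)[of 0 0] by simp
    from a(1) have "f a \<in> cspan G"
    proof (induction rule: complex_vector.span_induct_alt)
      case base thus ?case by (simp add: f0 complex_vector.span_zero)
    next
      case (step c x y)
      have "f x \<in> cspan G" using step(1) f(3) complex_vector.span_base by blast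
      thus ?case unfolding f by (intro complex_vector.span_add complex_vector.span_scale step(2))
    qed
    thus "z \<in> cspan G" by (simp add: a)
  qed
  have cl: "f ` I \<subseteq> I" if "f ` cspan G \<subseteq> cspan G" "bounded_linear f" for f
    unfolding I_def by (rule image_closure_subset) (use that closure_subset in \<open>auto intro!: linear_continuous_on\<close>)
  have GI: "a * A l h * b \<in> G" for a l b unfolding G_def by blast
  have GE: "\<exists>a l b. z = a * A l h * b" if "z \<in> G" for z using that unfolding G_def by blast
  have left: "x * z \<in> I" and right: "z * x \<in> I" if "z \<in> I" for x z
  proof -
    have "(\<lambda>z. x * z) ` I \<subseteq> I"
    proof (rule cl[OF lin])
      show "(*) x ` G \<subseteq> G" using GE GI[of "x * _"] by (fastforce simp: mult.assoc[symmetric])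
    qed (auto simp: algebra_simps mult_scaleC_right bounded_linear_mult_right)
    thus "x * z \<in> I" using that by blast
    have "(\<lambda>z. z * x) ` I \<subseteq> I"
    proof (rule cl[OF lin])
      show "(\<lambda>z. z * x) ` G \<subseteq> G" using GE GI[of _ _ "_ * x"] by (fastforce simp: mult.assoc)
    qed (auto simp: algebra_simps mult_scaleC_left bounded_linear_mult_left)
    thus "z * x \<in> I" using that by blast
  qed
  have AI: "A k ` I \<subseteq> I" for k
  proof (rule cl[OF lin])
    have "A k (x * A l h * y) \<in> G" for x l y
      unfolding A_simps A_add[symmetric] by (rule GI)
    thus "A k ` G \<subseteq> G" using GE by blast
  qed (auto simp: A_simps A_bounded_linear)
  have "\<alpha> ` I = I"
  proof
    have a1: "A 1 x = \<alpha> x" for x by (rule aut_powi_1)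
    show "\<alpha> ` I \<subseteq> I" using AI[of 1] by (simp add: a1[abs_def] a1)
    show "I \<subseteq> \<alpha> ` I"
    proof
      fix x assume "x \<in> I"
      hence "A (-1) x \<in> I" using AI[of "-1"] by blast
      moreover have "x = \<alpha> (A (-1) x)" using A_inv(2)[of 1 x] unfolding a1 by (rule sym)
      ultimately show "x \<in> \<alpha> ` I" by blast
    qed
  qed
  moreover have "closed_ideal I" unfolding closed_ideal_def using sub left right by (auto simp: I_def)
  moreover have "h \<in> I"
  proof -
    have "1 * A 0 h * 1 \<in> G" unfolding G_def by blast
    hence "h \<in> cspan G" using complex_vector.span_base by simp
    thus ?thesis unfolding I_def using closure_subset by blast
  qed
  ultimately have "I = UNIV" using \<alpha>_simple h(2) unfolding aut_simple_def by blast
  hence "1 \<in> closure (cspan G)" by (simp add: I_def)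
  hence "\<exists>s\<in>cspan G. dist s 1 < 1" unfolding closure_approachable by (elim allE[of _ 1]) simp
  then obtain s where s: "s \<in> cspan G" "norm (1 - s) < 1" by (auto simp: dist_norm norm_minus_commute)
  obtain t c where t: "finite t" "t \<subseteq> G" "s = (\<Sum>a\<in>t. c a *\<^sub>C a)" using s(1) unfolding complex_vector.span_explicit by blast
  obtain f n where f: "bij_betw f {..<n::nat} t" using ex_bij_betw_nat_finite[OF t(1)] by (auto simp: lessThan_atLeast0)
  \<comment> \<open>An inverse of \<open>s\<close>, obtained from the square of the root
    series.\<close>
  define w where "w = rsqrt (1 - s) * rsqrt (1 - s)"
  have ws: "w * s = 1" using rsqrt_inverse(2)[OF s(2)] by (simp add: w_def)
  have "\<forall>i\<in>{..<n}. \<exists>x l y. f i = x * A l h * y" using f t(2) unfolding bij_betw_def G_def by blast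
  then obtain x l y where xly: "\<And>i. i < n \<Longrightarrow> f i = x i * A (l i) h * y i" by (metis lessThan_iff)
  have "1 = w * (\<Sum>i<n. c (f i) *\<^sub>C f i)" using ws t(3) sum.reindex_bij_betw[OF f, of "\<lambda>a. c a *\<^sub>C a"] by simp
  also have "\<dots> = (\<Sum>i<n. (w * c (f i) *\<^sub>C x i) * A (l i) h * y i)"
    unfolding sum_distrib_left using xly by (intro sum.cong) (auto simp: mult_scaleC_left mult_scaleC_right mult.assoc)
  finally have "(\<Sum>i<n. (\<lambda>i. w * c (f i) *\<^sub>C x i) i * A (l i) h * y i) = 1" by simp
  thus ?thesis by (intro exI)
qed

text \<open>The identity of \<open>orbit_full\<close> bounds the rank of 1 by ranks of finitely many
  translates; exponents may be reduced modulo \<open>J\<close> because \<alpha> to the power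
  \<open>J\<close> preserves equivalence classes.\<close>

lemma full_rank:
  assumes h: "projection h" "h \<noteq> 0"
  shows "\<exists>N>0. eventually (\<lambda>n. \<forall>m. Fn.minimal n m \<longrightarrow> R n m 1 \<le> N * (\<Sum>l<J. R n m (A (int l) h))) sequentially"
proof -
  obtain N and x :: "nat \<Rightarrow> 'a" and l y where 1: "(\<Sum>i<(N::nat). x i * A (l i) h * y i) = 1" using orbit_full[OF h] by blast
  have 2: "eventually (\<lambda>n. \<forall>m. Fn.minimal n m \<longrightarrow> R n m 1 \<le> (\<Sum>i<N. R n m (A (l i) h))) sequentially"
    by (rule R_one_le[OF A_projection[OF h(1)] 1])
  have "eventually (\<lambda>n. \<forall>i\<in>{..<N}. \<forall>m. Fn.minimal n m \<longrightarrow> R n m (A (l i) h) \<le> R n m (A (l i mod int J) h)) sequentially"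
  proof (intro eventually_ball_finite ballI R_mono_sub proj_equiv_sub)
    fix i
    have "proj_equiv (A (l i mod int J) h) (A (l i - l i mod int J) (A (l i mod int J) h))"
      by (intro equiv_dvd A_projection h) (simp add: mod_eq_dvd_iff[symmetric])
    thus "proj_equiv (A (l i) h) (A (l i mod int J) h)" using proj_equiv_sym by (simp add: A_add[symmetric])
  qed simp
  \<comment> \<open>\<open>Suc N\<close> makes the constant positive.\<close>
  with 2 have "eventually (\<lambda>n. \<forall>m. Fn.minimal n m \<longrightarrow> R n m 1 \<le> Suc N * (\<Sum>l<J. R n m (A (int l) h))) sequentially"
  proof eventually_elim
    case (elim n)
    show ?case
    proof (intro allI impI)
      fix m assume m: "Fn.minimal n m"
      have "R n m 1 \<le> (\<Sum>i<N. R n m (A (l i) h))" using elim(1) m by blast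
      also have "\<dots> \<le> (\<Sum>i<N. \<Sum>l<J. R n m (A (int l) h))"
      proof (rule sum_mono)
        fix i assume "i \<in> {..<N}"
        hence "R n m (A (l i) h) \<le> R n m (A (l i mod int J) h)" using elim(2) m by blast
        also have "l i mod int J = int (nat (l i mod int J))" using J by simp
        also have "R n m (A (int (nat (l i mod int J))) h) \<le> (\<Sum>l<J. R n m (A (int l) h))"
        proof (rule member_le_sum)
          have "l i mod int J < int J" using J by (intro pos_mod_bound) simp
          thus "nat (l i mod int J) \<in> {..<J}" using J by (simp add: nat_less_iff)
        qed auto
        finally show "R n m (A (l i) h) \<le> (\<Sum>l<J. R n m (A (int l) h))" .
      qed
      finally show "R n m 1 \<le> Suc N * (\<Sum>l<J. R n m (A (int l) h))" by simp
    qed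
  qed
  thus ?thesis by blast
qed

definition tower :: "nat \<Rightarrow> real \<Rightarrow> (nat \<Rightarrow> 'a) \<Rightarrow> bool" where
  "tower M \<eta> e \<longleftrightarrow> (\<forall>j\<in>{1..M}. projection (e j)) \<and> (\<forall>i\<in>{1..M}. \<forall>j\<in>{1..M}. i \<noteq> j \<longrightarrow> e i * e j = 0) \<and>
     (\<forall>j\<in>{1..<M}. norm (\<alpha> (e j) - e (j + 1)) < \<eta>)"

lemma rokhlin_tower:
  assumes "0 < \<eta>" "1 \<le> M" "projection h" "h \<noteq> 0" "finite P" "finite G" "\<forall>p\<in>P. projection p \<and> p \<noteq> 0" 
    "\<forall>p\<in>P. \<forall>q\<in>P. p \<noteq> q \<longrightarrow> p * q = 0"
  shows "\<exists>e. tower M \<eta> e \<and> (\<forall>j\<in>{1..M}. \<forall>b\<in>P \<union> G. norm (e j * b - b * e j) < \<eta>) \<and>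
    (\<forall>p\<in>P. norm (e 1 * p * e 1) \<ge> 1 - \<eta>) \<and> proj_le_aut \<alpha> (1 - (\<Sum>j=1..M. e j)) h"
proof -
  have "positive h" using assms(3) unfolding positive_def projection_def by metis
  hence c: "0 < \<eta> \<and> 1 \<le> M \<and> positive h \<and> h \<noteq> 0 \<and> finite P \<and> finite G \<and>
      (\<forall>p\<in>P. projection p \<and> p \<noteq> 0) \<and> (\<forall>p\<in>P. \<forall>q\<in>P. p \<noteq> q \<longrightarrow> p * q = 0)"
    by (intro conjI assms)
  from rokhlin[unfolded tracial_cyclic_rokhlin_def, rule_format, OF c]
  obtain e where e: "(\<forall>j\<in>{1..M}. projection (e j)) \<and> (\<forall>i\<in>{1..M}. \<forall>j\<in>{1..M}. i \<noteq> j \<longrightarrow> e i * e j = 0) \<and>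
        (\<forall>j\<in>{1..M}. norm (\<alpha> (e j) - (if j = M then e 1 else e (j + 1))) < \<eta>) \<and>
        (\<forall>j\<in>{1..M}. \<forall>b\<in>P \<union> G. norm (e j * b - b * e j) < \<eta>) \<and>
        (\<forall>p\<in>P. norm (e 1 * p * e 1) \<ge> 1 - \<eta>) \<and> proj_le_aut \<alpha> (1 - (\<Sum>j=1..M. e j)) h"
    by (elim exE)
  have e3: "\<forall>j\<in>{1..M}. norm (\<alpha> (e j) - (if j = M then e 1 else e (j + 1))) < \<eta>" using e by (elim conjE)
  have "norm (\<alpha> (e j) - e (j + 1)) < \<eta>" if "j \<in> {1..<M}" for j using bspec[OF e3, of j] that by simp
  hence "tower M \<eta> e" unfolding tower_def using e by (elim conjE) (intro conjI ballI; blast)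
  thus ?thesis using e by (intro exI[of _ e]) (elim conjE, intro conjI)
qed

lemma tower_shift:
  assumes t: "tower M \<eta> e" and "1 \<le> i" "i + k \<le> M" "\<eta> \<ge> 0"
  shows "norm (A (int k) (e i) - e (i + k)) \<le> real k * \<eta>"
  using assms(3)
proof (induction k)
  case (Suc k)
  have "A (int (Suc k)) (e i) - e (i + Suc k) = A 1 (A (int k) (e i) - e (i + k)) + (\<alpha> (e (i + k)) - e (i + k + 1))"
    unfolding A_simps A_add[symmetric] by (simp add: aut_powi_1 add.commute)
  also have "norm \<dots> \<le> norm (A 1 (A (int k) (e i) - e (i + k))) + norm (\<alpha> (e (i + k)) - e (i + k + 1))"
    by (rule norm_triangle_ineq)
  also have "\<dots> \<le> real k * \<eta> + \<eta>" using Suc assms(2) t by (intro add_mono) (auto simp: tower_def intro!: less_imp_le)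
  finally show ?case by (simp add: algebra_simps)
qed simp

text \<open>The power \<open>k\<close> of \<alpha> carries the first \<open>L\<close> levels close
  to their shift by \<open>k\<close>, and close projections are equivalent. As \<open>J\<close>
  divides \<open>k\<close>, this power also preserves the class.\<close>

lemma tower_sum_equiv:
  assumes t: "tower M \<eta> e" and \<eta>: "\<eta> \<ge> 0" "real L * (real M * \<eta>) \<le> 1/10" and k: "int J dvd int k" "L + k \<le> M"
  shows "proj_equiv (\<Sum>j=1..L. e j) (\<Sum>j=1..L. e (j + k))"
proof -
  have pr: "projection (\<Sum>j=1..L. e (j + k))" if "L + k \<le> M" for k
    using t that by (intro projection_sum) (auto simp: tower_def)
  have p: "projection (\<Sum>j=1..L. e j)" using pr[of 0] k by simp
  have "norm (A (int k) (\<Sum>j=1..L. e j) - (\<Sum>j=1..L. e (j + k))) \<le> (\<Sum>j=1..L. norm (A (int k) (e j) - e (j + k)))"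
    unfolding cstar_hom_sum[OF A_hom] sum_subtractf[symmetric] by (rule norm_sum)
  also have "\<dots> \<le> (\<Sum>j=1..L. real M * \<eta>)"
  proof (rule sum_mono)
    fix j assume "j \<in> {1..L}"
    hence "norm (A (int k) (e j) - e (j + k)) \<le> real k * \<eta>" using k by (intro tower_shift[OF t]) (auto simp: \<eta>)
    also have "\<dots> \<le> real M * \<eta>" using k \<eta> by (intro mult_right_mono) auto
    finally show "norm (A (int k) (e j) - e (j + k)) \<le> real M * \<eta>" .
  qed
  also have "\<dots> \<le> 1/10" using \<eta> by simp
  finally have "\<exists>s. star s * s = (\<Sum>j=1..L. e (j + k)) \<and> s * star s = A (int k) (\<Sum>j=1..L. e j) \<and> 
      norm (s - (\<Sum>j=1..L. e (j + k))) \<le> 5 * (1/10)"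
    by (intro close_projections A_projection p pr k) auto
  hence "proj_equiv (\<Sum>j=1..L. e (j + k)) (A (int k) (\<Sum>j=1..L. e j))"
    unfolding proj_equiv_def using pr[OF k(2)] A_projection[OF p] by blast
  thus ?thesis using equiv_dvd[OF p k(1)] proj_equiv_sym proj_equiv_trans by blast
qed

text \<open>The tower is cut into \<open>K\<close> consecutive blocks of \<open>L\<close> levels,
  starting at multiples of \<open>L\<close>, each equivalent to the first block.\<close>

lemma tower_rank:
  assumes t: "tower (L * K) \<eta> e" and \<eta>: "\<eta> \<ge> 0" "real L * (real (L * K) * \<eta>) \<le> 1/10" and L: "J dvd L" 
  shows "eventually (\<lambda>n. \<forall>m. Fn.minimal n m \<longrightarrow> K * R n m (\<Sum>j=1..L. e j) \<le> R n m 1) sequentially"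
proof -
  define \<rho> where "\<rho> k = (\<Sum>j=1..L. e (j + k * L))" for k
  have le: "L + k * L \<le> L * K" if "k < K" for k
    using mult_le_mono2[of "Suc k" K L] that by (simp add: mult.commute)
  have rng: "j + k * L \<in> {1..L * K}" if "j \<in> {1..L}" "k < K" for j k
    using le[OF that(2)] that(1) by auto
  have inj: "j = j' \<and> k = k'" if jk: "j + k * L = j' + k' * L" "j \<in> {1..L}" "j' \<in> {1..L}" for j j' k k'
  proof -
    obtain a a' where a: "j = Suc a" "j' = Suc a'" "a < L" "a' < L"
      using jk(2,3) by (cases j; cases j') auto
    hence "a + k * L = a' + k' * L" using jk(1) by simp
    moreover have "(a + k * L) div L = k" "(a' + k' * L) div L = k'" using a(3,4) by auto
    ultimately have "k = k'" by metis
    thus ?thesis using jk(1) by simp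
  qed
  have pr: "projection (\<rho> k)" if "k < K" for k
    unfolding \<rho>_def
  proof (rule projection_sum)
    fix i j assume "i \<in> {1..L}" "j \<in> {1..L}" "i \<noteq> j"
    thus "e (i + k * L) * e (j + k * L) = 0" using t rng[of i k] rng[of j k] that by (auto simp: tower_def)
  qed (use t rng that in \<open>auto simp: tower_def\<close>)
  have orth: "\<rho> k * \<rho> k' = 0" if "k < K" "k' < K" "k \<noteq> k'" for k k'
    unfolding \<rho>_def sum_product
  proof (intro sum.neutral ballI)
    fix i j assume ij: "i \<in> {1..L}" "j \<in> {1..L}"
    hence "i + k * L \<noteq> j + k' * L" using inj that(3) by blast
    thus "e (i + k * L) * e (j + k' * L) = 0" using t rng[OF ij(1) that(1)] rng[OF ij(2) that(2)] unfolding tower_def by blast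
  qed
  have 1: "eventually (\<lambda>n. \<forall>m. Fn.minimal n m \<longrightarrow> (\<Sum>k<K. R n m (\<rho> k)) \<le> R n m 1) sequentially"
    by (rule R_orth_sum[OF pr orth])
  have 2: "eventually (\<lambda>n. \<forall>k\<in>{..<K}. \<forall>m. Fn.minimal n m \<longrightarrow> R n m (\<Sum>j=1..L. e j) \<le> R n m (\<rho> k)) sequentially"
  proof (intro eventually_ball_finite ballI R_mono_sub proj_equiv_sub)
    fix k assume "k \<in> {..<K}"
    thus "proj_equiv (\<Sum>j=1..L. e j) (\<rho> k)" unfolding \<rho>_def using L le by (intro tower_sum_equiv[OF t \<eta>]) auto
  qed simp
  from 1 2 show ?thesis
  proof eventually_elim
    case (elim n)
    show ?case
    proof (intro allI impI)
      fix m assume m: "Fn.minimal n m"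
      have "K * R n m (\<Sum>j=1..L. e j) = (\<Sum>k<K. R n m (\<Sum>j=1..L. e j))" by simp
      also have "\<dots> \<le> (\<Sum>k<K. R n m (\<rho> k))" using elim(2) m by (intro sum_mono) auto
      also have "\<dots> \<le> R n m 1" using elim(1) m by blast
      finally show "K * R n m (\<Sum>j=1..L. e j) \<le> R n m 1" .
    qed
  qed
qed

text \<open>Combines \<open>K\<close> times the rank of a block below the rank of 1 with fullness of
  \<open>h\<close>. The bound \<open>N\<close> depends on \<open>h\<close> alone, so towers can be
  chosen afterwards.\<close>

lemma tower_small:
  assumes h: "projection h" "h \<noteq> 0"
  shows "\<exists>N>0. \<forall>L K \<eta> e. N \<le> K \<and> J dvd L \<and> tower (L * K) \<eta> e \<and> \<eta> \<ge> 0 \<and> real L * (real (L * K) * \<eta>) \<le> 1/10 \<longrightarrow>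
    (\<exists>P. (\<forall>l<J. proj_sub (P l) (A (int l) h)) \<and> (\<forall>l<J. \<forall>j<J. l \<noteq> j \<longrightarrow> P l * P j = 0) \<and> (\<Sum>j=1..L. e j) = (\<Sum>l<J. P l))"
proof -
  obtain N where N: "N > 0" "eventually (\<lambda>n. \<forall>m. Fn.minimal n m \<longrightarrow> R n m 1 \<le> N * (\<Sum>l<J. R n m (A (int l) h))) sequentially"
    using full_rank[OF h] by blast
  have "\<exists>P. (\<forall>l<J. proj_sub (P l) (A (int l) h)) \<and> (\<forall>l<J. \<forall>j<J. l \<noteq> j \<longrightarrow> P l * P j = 0) \<and> (\<Sum>j=1..L. e j) = (\<Sum>l<J. P l)"
    if H: "N \<le> K" "J dvd L" "tower (L * K) \<eta> e" "\<eta> \<ge> 0" "real L * (real (L * K) * \<eta>) \<le> 1/10" for L K \<eta> e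
  proof (rule sub_decomposition)
    have "L \<le> L * K" using H(1) N(1) by simp
    hence sub: "{1..L} \<subseteq> {1..L * K}" by auto
    show "projection (\<Sum>j=1..L. e j)"
    proof (rule projection_sum)
      show "projection (e i)" if "i \<in> {1..L}" for i using H(3) that sub unfolding tower_def by blast
      show "e i * e j = 0" if "i \<in> {1..L}" "j \<in> {1..L}" "i \<noteq> j" for i j using H(3) that sub unfolding tower_def by blast
    qed simp
    show "projection (A (int l) h)" for l by (rule A_projection[OF h(1)])
    show "eventually (\<lambda>n. \<forall>m. Fn.minimal n m \<longrightarrow> R n m (\<Sum>j=1..L. e j) \<le> (\<Sum>l<J. R n m (A (int l) h))) sequentially"
      using N(2) tower_rank[OF H(3,4,5,2)]
    proof eventually_elim
      case (elim n)
      show ?case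
      proof (intro allI impI)
        fix m assume m: "Fn.minimal n m"
        have "N * R n m (\<Sum>j=1..L. e j) \<le> K * R n m (\<Sum>j=1..L. e j)" using H(1) by simp
        also have "\<dots> \<le> R n m 1" using elim(2) m by blast
        also have "\<dots> \<le> N * (\<Sum>l<J. R n m (A (int l) h))" using elim(1) m by blast
        finally show "R n m (\<Sum>j=1..L. e j) \<le> (\<Sum>l<J. R n m (A (int l) h))" using N(1) by simp
      qed
    qed
  qed
  thus ?thesis using N(1) by blast
qed

end

section \<open>Equivalent copies, inner implementation of powers, and comparison along
  orbits\<close>

context rokhlin begin

text \<open>A tower with many equivalent blocks makes the rank of 1 large at some minimal
  projection. By fullness some translate of \<open>g\<close> has rank at least \<open>r\<close>
  there, hence contains \<open>r\<close> equivalent orthogonal minimal projections, and these are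
  translated back into \<open>g\<close>.\<close>

lemma equivalent_subprojections:
  assumes g: "projection g" "g \<noteq> 0"
  shows "\<exists>h :: nat \<Rightarrow> 'a. (\<forall>i<r. projection (h i) \<and> h i \<noteq> 0 \<and> g * h i = h i) \<and>
    (\<forall>i<r. \<forall>j<r. i \<noteq> j \<longrightarrow> h i * h j = 0) \<and> (\<forall>i<r. \<forall>j<r. proj_equiv (h i) (h j))"
proof -
  obtain N where N: "N > 0" "eventually (\<lambda>n. \<forall>m. Fn.minimal n m \<longrightarrow> R n m 1 \<le> N * (\<Sum>l<J. R n m (A (int l) g))) sequentially"
    using full_rank[OF g] by blast
  \<comment> \<open>Just above the value that fullness allows if all \<open>J\<close> translates of
    \<open>g\<close> have rank at most \<open>r\<close>.\<close>
  define K where "K = Suc (N * (J * r))"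
  define c where "c = real J * real (J * K)"
  have c0: "c \<ge> 0" by (simp add: c_def)
  define \<eta> where "\<eta> = 1 / (10 * c + 10)"
  have \<eta>: "\<eta> > 0" "\<eta> \<le> 1/10" "c * \<eta> \<le> 1/10" unfolding \<eta>_def using c0 by (auto simp: divide_simps)
  have \<eta>2: "real J * (real (J * K) * \<eta>) \<le> 1/10" using \<eta>(3) by (simp add: c_def mult.assoc)
  have M: "1 \<le> J * K" using J by (simp add: K_def)
  have "\<exists>e. tower (J * K) \<eta> e \<and> (\<forall>j\<in>{1..J * K}. \<forall>b\<in>{1} \<union> {}. norm (e j * b - b * e j) < \<eta>) \<and>
    (\<forall>p\<in>{1}. norm (e 1 * p * e 1) \<ge> 1 - \<eta>) \<and> proj_le_aut \<alpha> (1 - (\<Sum>j=1..J * K. e j)) 1"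
    by (rule rokhlin_tower) (use \<eta> M in auto)
  then obtain e where e: "tower (J * K) \<eta> e" "norm (e 1 * 1 * e 1) \<ge> 1 - \<eta>" by blast
  have e1: "e 1 \<noteq> 0" using e(2) \<eta>(2) by auto
  define \<rho> where "\<rho> = (\<Sum>j=1..J. e j)"
  have JK: "{1..J} \<subseteq> {1..J * K}" by (auto simp: K_def)
  have pr: "projection (e j)" "i \<noteq> j \<Longrightarrow> i \<in> {1..J} \<Longrightarrow> e i * e j = 0" if "j \<in> {1..J}" for i j 
    using e(1) that JK unfolding tower_def by blast+
  have \<rho>: "projection \<rho>" unfolding \<rho>_def by (rule projection_sum) (use pr in auto)
  have "\<rho> \<noteq> 0"
  proof
    assume "\<rho> = 0"
    hence "0 = (\<Sum>j=1..J. e j) * e 1" by (simp add: \<rho>_def)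
    also have "\<dots> = (\<Sum>j=1..J. if j = 1 then e 1 else 0)" unfolding sum_distrib_right
      using pr J projectionD(1)[OF pr(1)[of 1]] by (intro sum.cong) auto
    also have "\<dots> = e 1" using J by simp
    finally show False using e1 by simp
  qed
  have 1: "eventually (\<lambda>n. \<forall>m. Fn.minimal n m \<longrightarrow> K * R n m \<rho> \<le> R n m 1) sequentially"
    unfolding \<rho>_def by (rule tower_rank[OF e(1)]) (use \<eta> \<eta>2 in auto)
  have 2: "eventually (\<lambda>n. \<forall>l\<in>{..<J}. proj_equiv (A (int l) g) (ap (A (int l) g) n)) sequentially"
    by (intro eventually_ball_finite ballI ap_equiv A_projection g) simp
  have "eventually (\<lambda>n. \<exists>l<J. \<exists>m. Fn.minimal n m \<and> r \<le> R n m (A (int l) g) \<and> proj_equiv (A (int l) g) (ap (A (int l) g) n)) sequentially"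
    using N(2) 1 2 ap_equiv[OF \<rho>]
  proof eventually_elim
    case (elim n)
    \<comment> \<open>Nonvanishing of the block provides a minimal projection at which its rank is
      positive, so that the rank of 1 there is at least \<open>K\<close>.\<close>
    have "ap \<rho> n \<noteq> 0" using elim(4) proj_equiv_zero \<open>\<rho> \<noteq> 0\<close> by metis
    then obtain m where m: "Fn.minimal n m" "R n m \<rho> > 0" using Fn.rk_pos[of "ap \<rho> n" n] ap(1,2) \<rho> by (auto simp: R_def)
    have "K \<le> K * R n m \<rho>" using m(2) by simp
    also have "\<dots> \<le> R n m 1" using elim(2) m by blast
    also have "\<dots> \<le> N * (\<Sum>l<J. R n m (A (int l) g))" using elim(1) m by blast
    finally have le: "K \<le> N * (\<Sum>l<J. R n m (A (int l) g))" .
    have "\<exists>l<J. r \<le> R n m (A (int l) g)"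
    proof (rule ccontr)
      assume "\<not> ?thesis"
      hence "(\<Sum>l<J. R n m (A (int l) g)) \<le> (\<Sum>l<J. r)" by (intro sum_mono) (auto simp: not_le intro: less_imp_le)
      hence "N * (\<Sum>l<J. R n m (A (int l) g)) \<le> N * (J * r)" by simp
      thus False using le unfolding K_def by linarith
    qed
    thus ?case using m(1) elim(3) by blast
  qed
  then obtain n l m where l: "l < J" and m: "Fn.minimal n m" and rl: "r \<le> R n m (A (int l) g)" 
    and eq: "proj_equiv (A (int l) g) (ap (A (int l) g) n)"
    by (auto dest!: eventually_happens)
  define G where "G = A (int l) g"
  have G: "projection G" unfolding G_def by (rule A_projection[OF g(1)])
  obtain E where E: "Fn.orthset n E" "\<And>e. e \<in> E \<Longrightarrow> Fn.minimal n e" "\<Sum>E = ap G n"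
    using Fn.orthset_decomposition[OF ap(1) ap(2)[OF G]] by blast
  have "r \<le> card {e\<in>E. Fn.feq n m e}" using rl Fn.rk_decomposition[OF m E(1,2)] E(3) unfolding R_def G_def by simp
  then obtain T where T: "T \<subseteq> {e\<in>E. Fn.feq n m e}" "card T = r" by (meson obtain_subset_with_card_n)
  have finE: "finite E" using E(1) by (simp add: Fn.orthset_def)
  have "T \<subseteq> E" using T(1) by auto
  hence "finite T" using finE by (rule finite_subset)
  then obtain f where f: "bij_betw f {..<r} T" using ex_bij_betw_nat_finite[of T] T(2) by (auto simp: lessThan_atLeast0)
  have fE: "f i \<in> E" "Fn.feq n m (f i)" if "i < r" for i using f T(1) that by (auto simp: bij_betw_def)
  have fp: "projection (f i)" "f i \<noteq> 0" if "i < r" for i using fE(1)[OF that] E(1) by (auto simp: Fn.orthset_def)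
  have forth: "f i * f j = 0" if "i < r" "j < r" "i \<noteq> j" for i j
  proof -
    have "f i \<noteq> f j" using f that by (auto simp: bij_betw_def inj_on_def)
    thus ?thesis using fE that E(1) by (auto simp: Fn.orthset_def)
  qed
  obtain z where z: "star z * z = ap G n" "z * star z = G" using proj_equiv_sym[OF eq] by (auto simp: proj_equiv_def G_def)
  have le: "ap G n * f i = f i" if "i < r" for i using Fn.orthset_sum_left[OF E(1) fE(1)[OF that]] E(3) by simp
  define h' where "h' i = z * f i * star z" for i
  have h'eq: "proj_equiv (f i) (h' i)" if "i < r" for i
    unfolding h'_def by (rule proj_equiv_conj[OF z ap(2)[OF G] fp(1)[OF that] le[OF that]])
  have h'le: "G * h' i = h' i" if "i < r" for i
    using mult_eq_left[OF z(1), of "f i * star z"] mult_eq_left[OF le[OF that], of "star z"] 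
    by (simp add: h'_def z(2)[symmetric] mult.assoc)
  have h'orth: "h' i * h' j = 0" if "i < r" "j < r" "i \<noteq> j" for i j
  proof -
    have "h' i * h' j = z * f i * ((star z * z) * f j) * star z" by (simp add: h'_def mult.assoc)
    also have "\<dots> = z * (f i * f j) * star z" using le[OF that(2)] by (simp add: z(1) mult.assoc)
    finally show ?thesis using forth[OF that] by simp
  qed
  define h where "h i = A (- int l) (h' i)" for i
  have mf: "proj_equiv m (f i)" if "i < r" for i
    by (rule Fn.feq_equiv[OF m E(2)[OF fE(1)[OF that]] fE(2)[OF that]])
  have feq: "proj_equiv (f i) (f j)" if "i < r" "j < r" for i j
    by (rule proj_equiv_trans[OF proj_equiv_sym[OF mf[OF that(1)]] mf[OF that(2)]])
  have "projection (h i) \<and> h i \<noteq> 0 \<and> g * h i = h i" if "i < r" for i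
  proof (intro conjI)
    show "projection (h i)" unfolding h_def using h'eq[OF that] by (intro A_projection) (auto simp: proj_equiv_def)
    show "h i \<noteq> 0" unfolding h_def using h'eq[OF that] fp(2)[OF that] proj_equiv_zero[of "f i"] by auto
    have "g = A (- int l) G" by (simp add: G_def)
    thus "g * h i = h i" unfolding h_def by (simp add: A_simps(3)[symmetric] h'le[OF that])
  qed
  moreover have "h i * h j = 0" if "i < r" "j < r" "i \<noteq> j" for i j
    unfolding h_def by (simp add: A_simps(3)[symmetric] h'orth[OF that])
  moreover have "proj_equiv (h i) (h j)" if "i < r" "j < r" for i j
    unfolding h_def 
    by (intro A_proj_equiv proj_equiv_trans[OF proj_equiv_sym[OF h'eq[OF that(1)]] proj_equiv_trans[OF feq[OF that] h'eq[OF that(2)]]])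
  ultimately show ?thesis by blast
qed

text \<open>Matrix units of \<open>F n\<close> are transported from one representative per summand:
  K-theory moves only the representatives, and the sum over all minimal projections respects the
  matrix units and hence all of \<open>F n\<close>.\<close>

lemma intertwining_unitary:
  assumes S: "int J dvd S"
  shows "\<exists>v. unitary v \<and> (\<forall>c\<in>F n. v * c = A S c * v)"
proof -
  obtain E where E: "Fn.orthset n E" "\<And>e. e \<in> E \<Longrightarrow> Fn.minimal n e" "\<Sum>E = 1"
    using Fn.orthset_decomposition[OF Fn.one_in projection_one] by blast
  have fin: "finite E" using E(1) by (simp add: Fn.orthset_def)
  have pE: "projection a" "a \<in> F n" if "a \<in> E" for a using E(1) that by (auto simp: Fn.orthset_def)
  \<comment> \<open>One representative per class; equivalent projections get the same one, since the
    choice depends only on the class.\<close>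
  define rp where "rp a = (SOME b. b \<in> E \<and> Fn.feq n b a)" for a
  have rp: "rp a \<in> E" "Fn.feq n (rp a) a" if "a \<in> E" for a
  proof -
    have "a \<in> E \<and> Fn.feq n a a" using that Fn.feq_refl E(2) by blast
    hence "rp a \<in> E \<and> Fn.feq n (rp a) a" unfolding rp_def by (rule someI)
    thus "rp a \<in> E" "Fn.feq n (rp a) a" by auto
  qed
  have rp_eq: "rp a = rp b" if "a \<in> E" "b \<in> E" "Fn.feq n (rp a) (rp b)" for a b
  proof -
    have rb: "Fn.feq n (rp a) b" 
      by (rule Fn.feq_trans[OF that(3) rp(2)[OF that(2)] pE(1)[OF rp(1)[OF that(1)]] pE(1)[OF rp(1)[OF that(2)]]])
    have ab: "Fn.feq n a b"
      by (rule Fn.feq_trans[OF Fn.feq_sym[OF rp(2)[OF that(1)]] rb pE(1)[OF that(1)] pE(1)[OF rp(1)[OF that(1)]]])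
    have "(c \<in> E \<and> Fn.feq n c a) = (c \<in> E \<and> Fn.feq n c b)" for c
      using Fn.feq_trans[OF _ ab pE(1) pE(1)[OF that(1)], of c] 
        Fn.feq_trans[OF _ Fn.feq_sym[OF ab] pE(1) pE(1)[OF that(2)], of c] by blast
    hence "(\<lambda>c. c \<in> E \<and> Fn.feq n c a) = (\<lambda>c. c \<in> E \<and> Fn.feq n c b)" by (intro ext)
    thus ?thesis unfolding rp_def by (rule arg_cong)
  qed
  have "\<forall>a\<in>E. \<exists>d. d \<in> F n \<and> star d * d = rp a \<and> d * star d = a" using rp(2) unfolding Fn.feq_def by blast
  from bchoice[OF this] obtain d where d0: "\<forall>a\<in>E. d a \<in> F n \<and> star (d a) * d a = rp a \<and> d a * star (d a) = a" by (elim exE)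
  have d: "d a \<in> F n" "star (d a) * d a = rp a" "d a * star (d a) = a" if "a \<in> E" for a using bspec[OF d0 that] by auto
  have "\<forall>b\<in>E. \<exists>w. star w * w = b \<and> w * star w = A S b" using equiv_dvd[OF pE(1) S] by (auto simp: proj_equiv_def)
  from bchoice[OF this] obtain w where w0: "\<forall>b\<in>E. star (w b) * w b = b \<and> w b * star (w b) = A S b" by (elim exE)
  have w: "star (w b) * w b = b" "w b * star (w b) = A S b" if "b \<in> E" for b using bspec[OF w0 that] by auto
  have dl: "a * d a = d a" "d a * rp a = d a" "rp a * star (d a) = star (d a)" if "a \<in> E" for a
  proof -
    show "a * d a = d a" by (rule proj_equiv_left[OF d(2,3)[OF that] pE(1)[OF rp(1)[OF that]]])
    show 1: "d a * rp a = d a" by (rule partial_isometry_right[OF d(2)[OF that] pE(1)[OF rp(1)[OF that]]])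
    show "rp a * star (d a) = star (d a)" using arg_cong[OF 1, of star] projectionD(2)[OF pE(1)[OF rp(1)[OF that]]] by (simp add: star_mult)
  qed
  have wl: "A S b * w b = w b" "w b * b = w b" if "b \<in> E" for b
    using proj_equiv_left[OF w[OF that] pE(1)[OF that]] partial_isometry_right[OF w(1)[OF that] pE(1)[OF that]] .
  have dd: "star (d a) * d b = (if a = b then rp a else 0)" if "a \<in> E" "b \<in> E" for a b
  proof (cases "a = b")
    case False
    have "star (d a) * d b = star (a * d a) * (b * d b)" using dl(1) that by simp
    also have "\<dots> = star (d a) * (a * b) * d b" using projectionD(2)[OF pE(1)[OF that(1)]] by (simp add: star_mult mult.assoc)
    also have "a * b = 0" using E(1) that False by (simp add: Fn.orthset_def)
    finally show ?thesis using False by simp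
  qed (use d that in simp)
  \<comment> \<open>From \<open>a\<close> to its representative, from there to the translate of the
    representative, and up again to the translate of \<open>a\<close>.\<close>
  define y where "y a = A S (d a) * w (rp a) * star (d a)" for a
  define v where "v = sum y E"
  have yy: "star (y a) * y b = (if a = b then a else 0)" if "a \<in> E" "b \<in> E" for a b
  proof -
    have "star (y a) * y b = d a * star (w (rp a)) * A S (star (d a) * d b) * w (rp b) * star (d b)"
      by (simp add: y_def star_mult star_star A_simps mult.assoc)
    also have "\<dots> = (if a = b then a else 0)"
    proof (cases "a = b")
      case True
      have "d a * star (w (rp a)) * A S (rp a) * w (rp a) * star (d a) = d a * (star (w (rp a)) * (A S (rp a) * w (rp a))) * star (d a)"
        by (simp add: mult.assoc)
      also have "\<dots> = d a * rp a * star (d a)" using wl(1)[OF rp(1)[OF that(1)]] w(1)[OF rp(1)[OF that(1)]] by simp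
      also have "\<dots> = a" using dl(2) d(3) that by simp
      finally show ?thesis using True dd[OF that] by simp
    next
      case False thus ?thesis using dd[OF that] by (simp add: A_simps)
    qed
    finally show ?thesis .
  qed
  have yy': "y a * star (y b) = (if a = b then A S a else 0)" if "a \<in> E" "b \<in> E" for a b
  proof -
    have "y a * star (y b) = A S (d a) * w (rp a) * (star (d a) * d b) * star (w (rp b)) * A S (star (d b))"
      by (simp add: y_def star_mult star_star A_simps mult.assoc)
    also have "\<dots> = (if a = b then A S a else 0)"
    proof (cases "a = b")
      case True
      have "A S (d a) * w (rp a) * rp a * star (w (rp a)) * A S (star (d a)) = A S (d a) * ((w (rp a) * rp a) * star (w (rp a))) * A S (star (d a))"
        by (simp add: mult.assoc)
      also have "\<dots> = A S (d a * rp a * star (d a))" using wl(2)[OF rp(1)[OF that(1)]] w(2)[OF rp(1)[OF that(1)]] by (simp add: A_simps)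
      also have "\<dots> = A S a" using dl(2) d(3) that by simp
      finally show ?thesis using True dd[OF that] by simp
    next
      case False thus ?thesis using dd[OF that] by simp
    qed
    finally show ?thesis .
  qed
  have "star v * v = (\<Sum>a\<in>E. \<Sum>b\<in>E. if a = b then a else 0)"
    unfolding v_def star_sum sum_product by (intro sum.cong refl yy)
  hence vv: "star v * v = 1" using E(3) fin by simp
  have "v * star v = (\<Sum>a\<in>E. \<Sum>b\<in>E. if a = b then A S a else 0)"
    unfolding v_def star_sum sum_product by (intro sum.cong refl yy')
  also have "\<dots> = A S (\<Sum>E)" using fin by (simp add: cstar_hom_sum[OF A_hom])
  finally have vv': "v * star v = 1" using E(3) by simp
  have "v * c = A S c * v" if c: "c \<in> F n" for c
  proof -
    define X where "X a b = star (d a) * c * d b" for a b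
    \<comment> \<open>A nonzero block of \<open>c\<close> between two minimal projections forces
      equal representatives and is then a scalar, so it passes through \<open>w\<close>.\<close>
    have wX: "w (rp a) * X a b = A S (X a b) * w (rp b)" if ab: "a \<in> E" "b \<in> E" for a b
    proof (cases "X a b = 0")
      case False
      have X: "rp a * X a b * rp b = X a b" using dl(2,3) ab by (simp add: X_def mult.assoc mult_eq_left[OF dl(3)])
      have XF: "X a b \<in> F n" unfolding X_def using c d(1) ab by (intro Fn.mult_in Fn.star_in)
      have "Fn.feq n (rp b) (rp a)" using Fn.minimal_equiv[OF E(2)[OF rp(1)[OF ab(2)]] E(2)[OF rp(1)[OF ab(1)]] XF] X False by simp
      hence r: "rp b = rp a" using rp_eq ab by blast
      obtain \<mu> where "rp a * X a b * rp a = \<mu> *\<^sub>C rp a" using Fn.minimal_scalar[OF E(2)[OF rp(1)[OF ab(1)]] XF] by blast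
      hence "X a b = \<mu> *\<^sub>C rp a" using X r by simp
      thus ?thesis using wl[OF rp(1)[OF ab(1)]] r by (simp add: A_simps mult_scaleC_left mult_scaleC_right)
    qed (simp add: A_simps)
    have "c = (\<Sum>b\<in>E. c * b)" using E(3) by (simp add: sum_distrib_left[symmetric])
    also have "\<dots> = (\<Sum>b\<in>E. c * d b * star (d b))" using d(3) by (intro sum.cong) (simp_all add: mult.assoc)
    finally have c1: "c = (\<Sum>b\<in>E. c * d b * star (d b))" .
    have "v * c = (\<Sum>a\<in>E. \<Sum>b\<in>E. y a * (c * d b * star (d b)))"
      unfolding v_def by (subst c1) (rule sum_product)
    also have "\<dots> = (\<Sum>a\<in>E. \<Sum>b\<in>E. A S (d a) * (w (rp a) * X a b) * star (d b))"
      by (intro sum.cong refl) (simp add: y_def X_def mult.assoc)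
    also have "\<dots> = (\<Sum>a\<in>E. \<Sum>b\<in>E. A S (d a) * (A S (X a b) * w (rp b)) * star (d b))"
      using wX by (intro sum.cong refl) simp
    also have "\<dots> = (\<Sum>a\<in>E. \<Sum>b\<in>E. A S (a * c) * y b)"
    proof (intro sum.cong refl)
      fix a b assume ab: "a \<in> E" "b \<in> E"
      have "A S (d a) * (A S (X a b) * w (rp b)) * star (d b) = A S ((d a * star (d a)) * c * d b) * w (rp b) * star (d b)"
        by (simp add: X_def A_simps mult.assoc)
      thus "A S (d a) * (A S (X a b) * w (rp b)) * star (d b) = A S (a * c) * y b"
        using d(3)[OF ab(1)] by (simp add: y_def A_simps mult.assoc)
    qed
    also have "\<dots> = A S ((\<Sum>a\<in>E. a) * c) * v" 
      by (simp add: v_def sum_product[symmetric] sum_distrib_right cstar_hom_sum[OF A_hom])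
    finally show ?thesis using E(3) by simp
  qed
  thus ?thesis using vv vv' unfolding unitary_def by blast
qed

text \<open>The corner of \<open>h\<close> is itself a hereditary subalgebra that contains
  \<open>h\<close>. Heredity: if \<open>a\<close> and \<open>b - a\<close> are positive and
  \<open>b\<close> vanishes on \<open>1 - h\<close>, two positive compressions have sum zero, so
  both vanish by \<open>star_mult_add_eq_0\<close>.\<close>

lemma hereditary_generated_corner:
  fixes h b :: 'a
  assumes h: "projection h" and b: "b \<in> hereditary_generated h"
  shows "h * b = b" "b * h = b"
proof -
  define B where "B = {x. h * x = x \<and> x * h = x}"
  note hh = projectionD[OF h]
  have "csubspace B"
    unfolding complex_vector.subspace_def B_def by (auto simp: algebra_simps mult_scaleC_left mult_scaleC_right)
  moreover have "closed B" unfolding B_def by (intro closed_Collect_conj closed_Collect_eq continuous_intros)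
  moreover have "x * y \<in> B" if "x \<in> B" "y \<in> B" for x y
    using that mult_eq_left[of h x x y] by (simp add: B_def mult.assoc)
  moreover have "star x \<in> B" if "x \<in> B" for x
    using that unfolding B_def by (metis (mono_tags, lifting) hh(2) mem_Collect_eq star_mult)
  ultimately have sub: "cstar_subalgebra B" by (simp add: cstar_subalgebra_def)
  have her: "hereditary B"
    unfolding hereditary_def
  proof (intro allI impI)
    fix a b assume H: "b \<in> B \<and> positive a \<and> positive (b - a)"
    then obtain x y where x: "a = star x * x" and y: "b - a = star y * y" by (auto simp: positive_def)
    define k where "k = 1 - h"
    have k: "star k = k" by (simp add: k_def star_diff hh)
    have bk: "b * k = 0" using H by (simp add: B_def k_def algebra_simps)
    have "star (x * k) * (x * k) + star (y * k) * (y * k) = k * (star x * x + star y * y) * k"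
      by (simp add: star_mult k algebra_simps)
    also have "star x * x + star y * y = b" by (simp add: x[symmetric] y[symmetric])
    finally have "star (x * k) * (x * k) + star (y * k) * (y * k) = k * (b * k)" by (simp add: mult.assoc)
    hence "x * k = 0" using bk star_mult_add_eq_0[of "x * k" "y * k"] by simp
    hence xh: "x * h = x" by (simp add: k_def algebra_simps)
    have "star (x * h) = star x" by (simp only: xh)
    hence "h * star x = star x" by (simp only: star_mult hh)
    with xh show "a \<in> B" by (simp add: B_def x mult.assoc mult_eq_left[of h "star x" "star x"])
  qed
  have "h \<in> B" by (simp add: B_def hh)
  hence "b \<in> B" using b sub her unfolding hereditary_generated_def by blast
  thus "h * b = b" "b * h = b" by (auto simp: B_def)
qed

text \<open>The positive elements of the comparison are replaced by the projections found in their
  hereditary subalgebras, which inherit orthogonality and lie below \<open>h\<close>.\<close>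

lemma proj_le_aut_decomposition:
  assumes h: "projection h" and le: "proj_le_aut \<alpha> p h"
  shows "\<exists>(n::nat) P Q s. (\<forall>i\<in>{1..n}. proj_equiv (A (s i) (P i)) (Q i) \<and> h * Q i = Q i) \<and>
    (\<forall>i\<in>{1..n}. \<forall>j\<in>{1..n}. i \<noteq> j \<longrightarrow> P i * P j = 0) \<and>
    (\<forall>i\<in>{1..n}. \<forall>j\<in>{1..n}. i \<noteq> j \<longrightarrow> Q i * Q j = 0) \<and> (\<forall>i\<in>{1..n}. projection (P i)) \<and> p = (\<Sum>i=1..n. P i)"
proof -
  obtain n P B s where n: "\<forall>i\<in>{1..n}. projection (P i)" "\<forall>i\<in>{1..n}. \<forall>j\<in>{1..n}. i \<noteq> j \<longrightarrow> P i * P j = 0"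
     "\<forall>i\<in>{1..n}. positive (B i) \<and> B i \<in> hereditary_generated h"
     "\<forall>i\<in>{1..n}. \<forall>j\<in>{1..n}. i \<noteq> j \<longrightarrow> B i * B j = 0" "p = (\<Sum>i=1..n::nat. P i)"
     "\<forall>i\<in>{1..n}. proj_le (A (s i) (P i)) (B i)"
    using le unfolding proj_le_aut_def by (elim exE conjE) (rule that)
  have "\<forall>i\<in>{1..n}. \<exists>q. q \<in> closure {B i * x * B i | x. True} \<and> proj_equiv (A (s i) (P i)) q"
    using n(1,6) A_projection unfolding proj_le_def proj_equiv_def by blast
  from bchoice[OF this] obtain Q where Q0: "\<forall>i\<in>{1..n}. Q i \<in> closure {B i * x * B i | x. True} \<and> proj_equiv (A (s i) (P i)) (Q i)"
    by (elim exE)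
  have Q: "Q i \<in> closure {B i * x * B i | x. True}" "proj_equiv (A (s i) (P i)) (Q i)" if "i \<in> {1..n}" for i
    using bspec[OF Q0 that] by auto
  have hQ: "h * Q i = Q i" if "i \<in> {1..n}" for i
  proof -
    have "{B i * x * B i | x. True} \<subseteq> {z. h * z = z}"
      using hereditary_generated_corner(1)[OF h, of "B i"] n(3) that by (auto simp: mult.assoc[symmetric])
    hence "closure {B i * x * B i | x. True} \<subseteq> {z. h * z = z}" 
      by (rule closure_minimal) (intro closed_Collect_eq continuous_intros)
    thus ?thesis using Q(1)[OF that] by blast
  qed
  have QQ: "Q i * Q j = 0" if "i \<in> {1..n}" "j \<in> {1..n}" "i \<noteq> j" for i j
  proof -
    have "{B i * x * B i | x. True} \<subseteq> {z. z * B j = 0}" using n(4) that by (auto simp: mult.assoc)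
    hence "closure {B i * x * B i | x. True} \<subseteq> {z. z * B j = 0}" 
      by (rule closure_minimal) (intro closed_Collect_eq continuous_intros)
    hence "Q i * B j = 0" using Q(1)[OF that(1)] by blast
    hence "{B j * x * B j | x. True} \<subseteq> {z. Q i * z = 0}" by (auto simp: mult.assoc[symmetric])
    hence "closure {B j * x * B j | x. True} \<subseteq> {z. Q i * z = 0}" 
      by (rule closure_minimal) (intro closed_Collect_eq continuous_intros)
    thus ?thesis using Q(1)[OF that(2)] by blast
  qed
  show ?thesis
  proof (rule exI[of _ n], rule exI[of _ P], rule exI[of _ Q], rule exI[of _ s], intro conjI)
    show "\<forall>i\<in>{1..n}. proj_equiv (A (s i) (P i)) (Q i) \<and> h * Q i = Q i" by (intro ballI conjI Q(2) hQ)
    show "\<forall>i\<in>{1..n}. \<forall>j\<in>{1..n}. i \<noteq> j \<longrightarrow> Q i * Q j = 0" by (intro ballI impI QQ)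
  qed (rule n)+
qed

end

subsection \<open>The crossed product\<close>

lemma unitary_powi_Suc: assumes "unitary u" shows "unitary_powi u (k + 1) = u * unitary_powi u k"
proof (cases "k \<ge> 0")
  case True
  hence "nat (k + 1) = Suc (nat k)" by simp
  thus ?thesis using True by (simp add: unitary_powi_def)
next
  case False
  define n where "n = nat (- k - 1)"
  have n: "nat (- k) = Suc n" "nat (- (k + 1)) = n" using False by (auto simp: n_def)
  have uu: "u * (star u * x) = x" for x using assms by (simp add: unitary_def mult.assoc[symmetric])
  show ?thesis
  proof (cases "k + 1 = 0")
    case True
    hence k: "k = -1" by simp
    have "u * star u = 1" using assms by (simp add: unitary_def)
    thus ?thesis by (simp add: k unitary_powi_def)
  next
    case k: False
    hence "unitary_powi u (k + 1) = star u ^ n" "unitary_powi u k = star u ^ Suc n" using False n by (simp_all add: unitary_powi_def)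
    thus ?thesis by (simp add: uu)
  qed
qed

lemma unitary_powi_pred: assumes "unitary u" shows "unitary_powi u (k - 1) = star u * unitary_powi u k"
  using unitary_powi_Suc[OF assms, of "k - 1"] assms by (simp add: unitary_def mult.assoc[symmetric])

lemma unitary_powi_0 [simp]: "unitary_powi u 0 = 1" by (simp add: unitary_powi_def)

lemma unitary_powi_add: assumes "unitary u" shows "unitary_powi u (k + l) = unitary_powi u k * unitary_powi u l"
proof (induction k rule: int_induct[where k = 0])
  case (step1 i)
  have "unitary_powi u (i + 1 + l) = unitary_powi u ((i + l) + 1)" by (simp add: algebra_simps)
  thus ?case using step1 by (simp add: unitary_powi_Suc[OF assms] mult.assoc)
next
  case (step2 i)
  have "unitary_powi u (i - 1 + l) = unitary_powi u ((i + l) - 1)" by (simp add: algebra_simps)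
  thus ?case using step2 by (simp add: unitary_powi_pred[OF assms] mult.assoc)
qed simp

lemma star_unitary_powi: "star (unitary_powi u k) = unitary_powi u (- k)"
  by (auto simp: unitary_powi_def star_power star_star)

lemma unitary_powi_unitary: "unitary u \<Longrightarrow> unitary (unitary_powi u k)"
  using unitary_powi_add[of u "- k" k] unitary_powi_add[of u k "- k"]
  unfolding unitary_def[of "unitary_powi u k"] star_unitary_powi by simp

lemma unitary_norm: "unitary v \<Longrightarrow> norm v = 1"
  using cstar_identity[of v] by (simp add: unitary_def power2_eq_1_iff) (metis norm_ge_zero not_one_le_zero neg_0_le_iff_le)

lemma unitary_star: "unitary v \<Longrightarrow> unitary (star v)" by (auto simp: unitary_def star_star)

lemma norm_unitary_mult: assumes "unitary v" shows "norm (v * x) = norm x"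
proof (rule antisym)
  have le: "norm (w * z) \<le> norm z" if "unitary w" for w z :: 'a
    using norm_mult_ineq[of w z] unitary_norm[OF that] by simp
  show "norm (v * x) \<le> norm x" by (rule le[OF assms])
  show "norm x \<le> norm (v * x)" using le[OF unitary_star[OF assms], of "v * x"] assms by (simp add: unitary_def mult.assoc[symmetric])
qed

lemma norm_mult_unitary: assumes "unitary v" shows "norm (x * v) = norm x"
  using norm_unitary_mult[OF unitary_star[OF assms], of "star x"] norm_star[of "x * v"] by (simp add: star_mult)

lemma unitary_powi_scaleC:
  assumes "unitary u" "cmod z = 1" shows "unitary (z *\<^sub>C u)" "unitary_powi (z *\<^sub>C u) k = (z powi k) *\<^sub>C unitary_powi u k"
proof -
  have zz: "cnj z * z = 1" "z * cnj z = 1" using assms(2) complex_norm_square[of z] by (simp_all add: mult.commute)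
  show u: "unitary (z *\<^sub>C u)" using assms(1) zz
    by (simp add: unitary_def star_scaleC mult_scaleC_left mult_scaleC_right scaleC_scaleC scaleC_one)
  have z0: "z \<noteq> 0" using assms(2) by auto
  have cz: "cnj z = inverse z" using zz(2) z0 by (simp add: field_simps)
  show "unitary_powi (z *\<^sub>C u) k = (z powi k) *\<^sub>C unitary_powi u k"
  proof (induction k rule: int_induct[where k = 0])
    case (step1 i)
    thus ?case using z0 by (simp add: unitary_powi_Suc[OF u] unitary_powi_Suc[OF assms(1)] power_int_add mult_scaleC_left mult_scaleC_right scaleC_scaleC mult.commute)
  next
    case (step2 i)
    thus ?case using z0 by (simp add: unitary_powi_pred[OF u] unitary_powi_pred[OF assms(1)] power_int_diff star_scaleC cz mult_scaleC_left mult_scaleC_right scaleC_scaleC field_simps)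
  qed (simp add: scaleC_one)
qed

locale covariant =
  fixes \<alpha> :: "'a::cstar_algebra \<Rightarrow> 'a" and \<pi> :: "'a \<Rightarrow> 'b::cstar_algebra" and u :: 'b
  assumes automorphism: "cstar_automorphism \<alpha>" and covariant: "covariant_pair \<alpha> \<pi> u"
begin

abbreviation U :: "int \<Rightarrow> 'b" where "U \<equiv> unitary_powi u"

lemma \<pi>_hom: "cstar_hom \<pi>" and \<pi>_one [simp]: "\<pi> 1 = 1" and u: "unitary u" and u_conj: "u * \<pi> a * star u = \<pi> (\<alpha> a)"
  using covariant by (auto simp: covariant_pair_def)
lemmas \<pi>_simps = cstar_homD[OF \<pi>_hom]
lemma \<pi>_norm_le: "norm (\<pi> x) \<le> norm x" by (rule cstar_hom_norm_le[OF \<pi>_hom \<pi>_one])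
lemma \<pi>_projection: "projection p \<Longrightarrow> projection (\<pi> p)" by (rule cstar_hom_projection[OF \<pi>_hom])
lemma bij_\<alpha>: "bij \<alpha>" and \<alpha>_hom: "cstar_hom \<alpha>" using automorphism by (auto simp: cstar_automorphism_def)
lemmas U_add = unitary_powi_add[OF u]
lemmas U_unitary = unitary_powi_unitary[OF u]
lemma U_inv [simp]: "U (- k) * U k = 1" "U k * U (- k) = 1" by (simp_all add: U_add[symmetric])
lemma U_inv_left [simp]: "U (- k) * (U k * x) = x" "U k * (U (- k) * x) = x" by (simp_all add: mult.assoc[symmetric])

lemma U_\<pi>: "U k * \<pi> a = \<pi> (aut_powi \<alpha> k a) * U k"
proof (induction k rule: int_induct[where k = 0])
  case (step1 i)
  have c: "u * \<pi> b = \<pi> (\<alpha> b) * u" for b 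
  proof -
    have "\<pi> (\<alpha> b) * u = u * \<pi> b * (star u * u)" by (simp add: u_conj[symmetric] mult.assoc)
    thus ?thesis using u by (simp add: unitary_def)
  qed
  show ?case unfolding unitary_powi_Suc[OF u] aut_powi_Suc[OF bij_\<alpha>] using step1 c by (metis mult.assoc)
next
  case (step2 i)
  have c: "star u * \<pi> b = \<pi> (inv_into UNIV \<alpha> b) * star u" for b
  proof -
    have "\<pi> b = u * \<pi> (inv_into UNIV \<alpha> b) * star u" using bij_\<alpha> by (simp add: u_conj bij_is_surj surj_f_inv_f)
    thus ?thesis using u by (simp add: unitary_def mult.assoc[symmetric])
  qed
  show ?case unfolding unitary_powi_pred[OF u] aut_powi_pred[OF bij_\<alpha>] using step2 c by (metis mult.assoc)
qed simp

lemma U_\<pi>_conj: "U k * \<pi> a * U (- k) = \<pi> (aut_powi \<alpha> k a)"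
  by (simp add: U_\<pi> mult.assoc)

text \<open>The integrated form over a chosen finite set; enlarging the set lets several elements
  share one index set.\<close>

definition form :: "int set \<Rightarrow> (int \<Rightarrow> 'a) \<Rightarrow> 'b" where "form S f = (\<Sum>k\<in>S. \<pi> (f k) * U k)"

lemma integrated_form_eq: "finite S \<Longrightarrow> {k. f k \<noteq> 0} \<subseteq> S \<Longrightarrow> integrated_form \<pi> u f = form S f"
  unfolding integrated_form_def form_def by (rule sum.mono_neutral_left) (auto simp: \<pi>_simps)

lemma integrated_form_mult:
  assumes f: "f \<in> Cc" and g: "g \<in> Cc"
  shows "integrated_form \<pi> u (Cc_mult \<alpha> f g) = integrated_form \<pi> u f * integrated_form \<pi> u g"
proof -
  define S T where "S = {k. f k \<noteq> 0}" and "T = {k. g k \<noteq> 0}"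
  define N where "N = (\<lambda>(k, l). k + l) ` (S \<times> T)"
  have fin: "finite S" "finite T" "finite N" using f g by (auto simp: Cc_def S_def T_def N_def)
  have "{n. Cc_mult \<alpha> f g n \<noteq> 0} \<subseteq> N"
  proof
    fix n assume "n \<in> {n. Cc_mult \<alpha> f g n \<noteq> 0}"
    then obtain k where "f k \<noteq> 0" "f k * aut_powi \<alpha> k (g (n - k)) \<noteq> 0" 
      unfolding Cc_mult_def by (metis (mono_tags, lifting) mem_Collect_eq sum.neutral)
    moreover from this have "g (n - k) \<noteq> 0" using cstar_homD(6)[OF aut_powi_hom[OF \<alpha>_hom bij_\<alpha>]] by auto
    ultimately show "n \<in> N" by (auto simp: N_def S_def T_def intro!: image_eqI[of _ _ "(k, n - k)"])
  qed
  hence "integrated_form \<pi> u (Cc_mult \<alpha> f g) = (\<Sum>n\<in>N. \<Sum>k\<in>S. \<pi> (f k * aut_powi \<alpha> k (g (n - k))) * U n)"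
    by (subst integrated_form_eq[OF fin(3)]) (auto simp: form_def Cc_mult_def S_def cstar_hom_sum[OF \<pi>_hom] sum_distrib_right)
  also have "\<dots> = (\<Sum>k\<in>S. \<Sum>n\<in>N. \<pi> (f k * aut_powi \<alpha> k (g (n - k))) * U n)" by (rule sum.swap)
  also have "\<dots> = (\<Sum>k\<in>S. \<Sum>l\<in>T. (\<pi> (f k) * U k) * (\<pi> (g l) * U l))"
  proof (rule sum.cong[OF refl])
    fix k assume k: "k \<in> S"
    have "(\<Sum>n\<in>N. \<pi> (f k * aut_powi \<alpha> k (g (n - k))) * U n) = (\<Sum>n\<in>(+) k ` T. \<pi> (f k * aut_powi \<alpha> k (g (n - k))) * U n)"
    proof (rule sum.mono_neutral_right[OF fin(3)])
      show "(+) k ` T \<subseteq> N" using k by (auto simp: N_def)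
      show "\<forall>n\<in>N - (+) k ` T. \<pi> (f k * aut_powi \<alpha> k (g (n - k))) * U n = 0"
      proof
        fix n assume n: "n \<in> N - (+) k ` T"
        have "n - k \<notin> T" using n by (metis DiffD2 add.commute diff_add_cancel image_eqI)
        thus "\<pi> (f k * aut_powi \<alpha> k (g (n - k))) * U n = 0" 
          by (simp add: T_def cstar_homD(6)[OF aut_powi_hom[OF \<alpha>_hom bij_\<alpha>]] \<pi>_simps)
      qed
    qed
    also have "\<dots> = (\<Sum>l\<in>T. \<pi> (f k * aut_powi \<alpha> k (g l)) * U (k + l))" by (subst sum.reindex) auto
    also have "\<dots> = (\<Sum>l\<in>T. (\<pi> (f k) * U k) * (\<pi> (g l) * U l))"
    proof (rule sum.cong[OF refl])
      fix l
      have "(\<pi> (f k) * U k) * (\<pi> (g l) * U l) = \<pi> (f k) * (U k * \<pi> (g l)) * U l" by (simp add: mult.assoc)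
      thus "\<pi> (f k * aut_powi \<alpha> k (g l)) * U (k + l) = (\<pi> (f k) * U k) * (\<pi> (g l) * U l)"
        unfolding U_\<pi> by (simp add: U_add \<pi>_simps mult.assoc)
    qed
    finally show "(\<Sum>n\<in>N. \<pi> (f k * aut_powi \<alpha> k (g (n - k))) * U n) = (\<Sum>l\<in>T. (\<pi> (f k) * U k) * (\<pi> (g l) * U l))" .
  qed
  also have "\<dots> = integrated_form \<pi> u f * integrated_form \<pi> u g"
    unfolding integrated_form_def S_def[symmetric] T_def[symmetric] by (rule sum_product[symmetric])
  finally show ?thesis .
qed

lemma integrated_form_star:
  assumes f: "f \<in> Cc" shows "integrated_form \<pi> u (Cc_star \<alpha> f) = star (integrated_form \<pi> u f)"
proof -
  define S where "S = {k. f k \<noteq> 0}"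
  have fin: "finite S" using f by (auto simp: Cc_def S_def)
  have "{n. Cc_star \<alpha> f n \<noteq> 0} \<subseteq> uminus ` S"
  proof
    fix n assume "n \<in> {n. Cc_star \<alpha> f n \<noteq> 0}"
    hence "f (- n) \<noteq> 0" using cstar_homD(6)[OF aut_powi_hom[OF \<alpha>_hom bij_\<alpha>]] by (auto simp: Cc_star_def)
    thus "n \<in> uminus ` S" by (auto simp: S_def intro!: image_eqI[of _ _ "- n"])
  qed
  hence "integrated_form \<pi> u (Cc_star \<alpha> f) = form (uminus ` S) (Cc_star \<alpha> f)" using fin by (intro integrated_form_eq) auto
  also have "\<dots> = (\<Sum>k\<in>S. \<pi> (aut_powi \<alpha> (- k) (star (f k))) * U (- k))"
    unfolding form_def by (subst sum.reindex) (auto simp: inj_on_def Cc_star_def)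
  also have "\<dots> = (\<Sum>k\<in>S. star (\<pi> (f k) * U k))"
    by (intro sum.cong refl) (simp add: U_\<pi>[symmetric] star_mult star_unitary_powi \<pi>_simps)
  also have "\<dots> = star (integrated_form \<pi> u f)" by (simp add: integrated_form_def S_def star_sum)
  finally show ?thesis .
qed

text \<open>Every covariant pair yields a C*-seminorm; for the pair with \<open>u\<close> rotated by
  a complex phase, universality then bounds the gauge action.\<close>

lemma seminorm: "Cc_cstar_seminorm \<alpha> (\<lambda>f. norm (integrated_form \<pi> u f))"
  unfolding Cc_cstar_seminorm_def
proof (intro conjI ballI allI)
  fix f g :: "int \<Rightarrow> 'a" and c assume f: "f \<in> Cc"
  define S where "S = {k. f k \<noteq> 0}"
  have finS: "finite S" using f by (auto simp: Cc_def S_def)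
  have "integrated_form \<pi> u (\<lambda>k. c *\<^sub>C f k) = form S (\<lambda>k. c *\<^sub>C f k)" using finS by (intro integrated_form_eq) (auto simp: S_def)
  also have "\<dots> = c *\<^sub>C integrated_form \<pi> u f"
    unfolding form_def integrated_form_def S_def[symmetric] by (simp add: \<pi>_simps mult_scaleC_left complex_vector.scale_sum_right)
  finally show "norm (integrated_form \<pi> u (\<lambda>k. c *\<^sub>C f k)) = cmod c * norm (integrated_form \<pi> u f)" by (simp add: norm_scaleC)
  show "norm (integrated_form \<pi> u (Cc_mult \<alpha> (Cc_star \<alpha> f) f)) = (norm (integrated_form \<pi> u f))\<^sup>2"
  proof -
    have "Cc_star \<alpha> f \<in> Cc"
    proof -
      have "{n. Cc_star \<alpha> f n \<noteq> 0} \<subseteq> uminus ` S"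
      proof
        fix n assume "n \<in> {n. Cc_star \<alpha> f n \<noteq> 0}"
        hence "f (- n) \<noteq> 0" using cstar_homD(6)[OF aut_powi_hom[OF \<alpha>_hom bij_\<alpha>]] by (auto simp: Cc_star_def)
        thus "n \<in> uminus ` S" by (auto simp: S_def intro!: image_eqI[of _ _ "- n"])
      qed
      thus ?thesis unfolding Cc_def using finS finite_subset by blast
    qed
    thus ?thesis using f by (simp add: integrated_form_mult integrated_form_star cstar_identity)
  qed
  assume g: "g \<in> Cc"
  define T where "T = S \<union> {k. g k \<noteq> 0}"
  have finT: "finite T" using finS g by (auto simp: Cc_def T_def)
  have "integrated_form \<pi> u (\<lambda>k. f k + g k) = form T (\<lambda>k. f k + g k)" using finT by (intro integrated_form_eq) (auto simp: T_def S_def)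
  also have "\<dots> = form T f + form T g" by (simp add: form_def \<pi>_simps algebra_simps sum.distrib)
  also have "form T f = integrated_form \<pi> u f" using finT by (intro integrated_form_eq[symmetric]) (auto simp: T_def S_def)
  also have "form T g = integrated_form \<pi> u g" using finT by (intro integrated_form_eq[symmetric]) (auto simp: T_def S_def)
  finally show "norm (integrated_form \<pi> u (\<lambda>k. f k + g k)) \<le> norm (integrated_form \<pi> u f) + norm (integrated_form \<pi> u g)"
    by (simp add: norm_triangle_ineq)
  show "norm (integrated_form \<pi> u (Cc_mult \<alpha> f g)) \<le> norm (integrated_form \<pi> u f) * norm (integrated_form \<pi> u g)"
    by (simp add: integrated_form_mult f g norm_mult_ineq)
qed simp

end

subsection \<open>Fejer means\<close>

text \<open>Orthogonality of characters of a cyclic group; the bound on \<open>r\<close> excludes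
  nonzero multiples of \<open>Q\<close>.\<close>

lemma root_of_unity_sum:
  fixes r :: int and Q :: nat
  assumes "\<bar>r\<bar> < int Q"
  shows "(\<Sum>j<Q. cis (2 * pi / Q) powi (int j * r)) = (if r = 0 then of_nat Q else 0)"
proof (cases "r = 0")
  case False
  define w where "w = cis (2 * pi / Q) powi r"
  have Q: "Q > 0" using assms by linarith
  have w: "w = cis (2 * pi * r / Q)" by (simp add: w_def cis_power_int mult.commute)
  have wj: "cis (2 * pi / Q) powi (int j * r) = w ^ j" for j
    by (simp add: w_def power_int_mult[symmetric] mult.commute flip: power_int_of_nat)
  have "w ^ Q = cis (2 * pi * r)" 
  proof -
    have "real Q * (2 * pi * r / Q) = 2 * pi * r" using Q by simp
    thus ?thesis unfolding w Complex.DeMoivre by (rule arg_cong)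
  qed
  also have "\<dots> = 1" using cis_multiple_2pi[of "of_int r"] by (simp add: mult.commute)
  finally have "w ^ Q = 1" .
  moreover have "w \<noteq> 1"
  proof
    assume "w = 1"
    hence "cos (2 * pi * r / Q) = 1" by (metis cis.simps(1) one_complex.simps(1) w)
    then obtain n :: int where "2 * pi * r / Q = of_int n * 2 * pi" by (auto simp: cos_one_2pi_int)
    hence "of_int r = (of_int (n * int Q) :: real)" using Q by (simp add: field_simps)
    hence "r = n * int Q" by (simp only: of_int_eq_iff)
    hence "n \<noteq> 0" "\<bar>r\<bar> = \<bar>n\<bar> * int Q" using False by (auto simp: abs_mult)
    hence "\<bar>r\<bar> \<ge> int Q" by (simp add: mult_le_cancel_right1) (use Q in linarith)
    thus False using assms by simp
  qed
  ultimately have "(\<Sum>j<Q. w ^ j) = 0" by (simp add: geometric_sum)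
  thus ?thesis using False by (simp add: wj)
qed simp

text \<open>Coefficients max(0, 1 - |k| / N) of the Fejer kernel, written as a count because the
  kernel is the squared modulus of a geometric sum of length \<open>N\<close>.\<close>

definition fejer :: "nat \<Rightarrow> int \<Rightarrow> real" where
  "fejer N k = real (card {(m, m'). m < N \<and> m' < N \<and> int m' = int m + k}) / real N"

lemma fejer_card:
  assumes "\<bar>k\<bar> \<le> int N" shows "card {(m, m'). m < N \<and> m' < N \<and> int m' = int m + k} = N - nat \<bar>k\<bar>"
proof -
  have "bij_betw (\<lambda>i. if k \<ge> 0 then (i, i + nat k) else (i + nat (- k), i)) {..<N - nat \<bar>k\<bar>} {(m, m'). m < N \<and> m' < N \<and> int m' = int m + k}"
    by (rule bij_betwI[where g = "\<lambda>(m, m'). min m m'"]) (use assms in \<open>auto split: if_splits\<close>)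
  from bij_betw_same_card[OF this] show ?thesis by simp
qed

lemma fejer_eq_0: assumes "\<bar>k\<bar> \<ge> int N" shows "fejer N k = 0"
proof -
  have e: "{(m, m'). m < N \<and> m' < N \<and> int m' = int m + k} = {}" using assms by auto
  show ?thesis unfolding fejer_def e by simp
qed

lemma fejer_bounds: 
  assumes "N > 0" shows "0 \<le> fejer N k" "fejer N k \<le> 1" "1 - real_of_int \<bar>k\<bar> / real N \<le> fejer N k"
proof -
  note 4 = fejer_eq_0[of N k]
  show "0 \<le> fejer N k" by (simp add: fejer_def)
  have *: "fejer N k = 1 - real_of_int \<bar>k\<bar> / real N" if "\<bar>k\<bar> \<le> int N"
    using that assms unfolding fejer_def fejer_card[OF that] by (simp add: field_simps of_nat_diff nat_le_iff)
  show "fejer N k \<le> 1" using 4 * by (cases "\<bar>k\<bar> \<le> int N") auto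
  show "1 - real_of_int \<bar>k\<bar> / real N \<le> fejer N k"
  proof (cases "\<bar>k\<bar> \<le> int N")
    case False
    hence "real_of_int \<bar>k\<bar> / N \<ge> 1" using assms by (simp add: field_simps)
    thus ?thesis using False 4 by simp
  qed (use * in simp)
qed

text \<open>The Fejer mean is a convex combination of gauge translates at the \<open>Q\<close>-th
  roots of unity, with weights proportional to the squared moduli of the \<open>p j\<close>. This
  finite sum replaces the integral over the circle.\<close>

lemma fejer_contractive:
  fixes b :: "int \<Rightarrow> 'b::cstar_algebra"
  assumes S: "finite S" and N: "N > 0"
    and gauge: "\<And>z. cmod z = 1 \<Longrightarrow> norm (\<Sum>k\<in>S. (z powi k) *\<^sub>C b k) \<le> r"
  shows "norm (\<Sum>k\<in>S. fejer N k *\<^sub>R b k) \<le> r"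
proof -
  define D where "D = nat (Max (insert 0 (abs ` S)))"
  have D: "\<bar>k\<bar> \<le> int D" if "k \<in> S" for k
  proof -
    have "\<bar>k\<bar> \<le> Max (insert 0 (abs ` S))" using S that by (intro Max_ge) auto
    moreover have "0 \<le> Max (insert 0 (abs ` S))" using S by (intro Max_ge) auto
    ultimately show ?thesis by (simp add: D_def)
  qed
  \<comment> \<open>Exceeds every frequency \<open>m + k - m'\<close> that occurs, so the discrete
    average is exact.\<close>
  define Q where "Q = N + D + 1"
  define z where "z j = cis (2 * pi / Q) ^ j" for j :: nat
  have z1: "cmod (z j) = 1" for j by (simp add: z_def norm_power)
  have z0: "z j \<noteq> 0" for j using z1[of j] by auto
  define p where "p j = (\<Sum>m<N. z j powi int m)" for j
  define q where "q j = (\<Sum>m<N. z j powi (- int m))" for j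
  have cn: "cnj (z j powi int m) = z j powi (- int m)" for j m
  proof -
    have "cnj (z j) = inverse (z j)" using z1[of j] z0[of j] complex_norm_square[of "z j"] by (simp add: field_simps)
    thus ?thesis by (simp add: power_int_minus power_inverse)
  qed
  have q: "q j = cnj (p j)" for j by (simp only: p_def q_def cnj_sum cn)
  have pq: "q j * p j = of_real ((cmod (p j))\<^sup>2)" for j unfolding q using complex_norm_square[of "p j"] by (simp add: mult.commute)
  have zj: "z j powi k = cis (2 * pi / Q) powi (int j * k)" for j k
    by (simp add: z_def power_int_mult flip: power_int_of_nat)
  have expand: "(\<Sum>j<Q. q j * p j * (z j powi k)) = of_nat (Q * card {(m, m'). m < N \<and> m' < N \<and> int m' = int m + k})" if "\<bar>k\<bar> \<le> int D" for k
  proof -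
    have "(\<Sum>j<Q. q j * p j * (z j powi k)) = (\<Sum>j<Q. \<Sum>m'<N. \<Sum>m<N. z j powi (int m + k - int m'))"
    proof (rule sum.cong[OF refl])
      fix j
      have "q j * p j * (z j powi k) = (\<Sum>m'<N. \<Sum>m<N. z j powi (- int m') * z j powi int m * z j powi k)"
        unfolding p_def q_def sum_product unfolding sum_distrib_right ..
      also have "\<dots> = (\<Sum>m'<N. \<Sum>m<N. z j powi (int m + k - int m'))"
        using z0[of j] by (intro sum.cong refl) (simp add: power_int_add power_int_diff power_int_minus field_simps del: power_int_of_nat)
      finally show "q j * p j * (z j powi k) = (\<Sum>m'<N. \<Sum>m<N. z j powi (int m + k - int m'))" .
    qed
    also have "\<dots> = (\<Sum>m'<N. \<Sum>m<N. \<Sum>j<Q. z j powi (int m + k - int m'))"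
      by (subst sum.swap, rule sum.cong[OF refl], rule sum.swap)
    also have "\<dots> = (\<Sum>m'<N. \<Sum>m<N. if int m' = int m + k then of_nat Q else 0)"
      unfolding zj using that by (intro sum.cong refl, subst root_of_unity_sum) (auto simp: Q_def)
    also have "\<dots> = (\<Sum>(m, m')\<in>{..<N} \<times> {..<N}. if int m' = int m + k then of_nat Q else 0)"
      by (subst sum.swap) (simp add: sum.cartesian_product)
    also have "\<dots> = (\<Sum>(m, m')\<in>{(m, m'). m < N \<and> m' < N \<and> int m' = int m + k}. of_nat Q)"
      by (rule sum.mono_neutral_cong_right) (auto split: if_splits)
    also have "\<dots> = of_nat (Q * card {(m, m'). m < N \<and> m' < N \<and> int m' = int m + k})" by (simp add: split_def mult.commute)
    finally show ?thesis .
  qed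
  have total: "(\<Sum>j<Q. (cmod (p j))\<^sup>2) = real Q * real N"
  proof -
    have "complex_of_real (\<Sum>j<Q. (cmod (p j))\<^sup>2) = (\<Sum>j<Q. q j * p j * (z j powi 0))" by (simp add: pq)
    also have "\<dots> = of_nat (Q * N)" using fejer_card[of 0 N] by (subst expand) simp_all
    finally show ?thesis by (metis of_nat_mult of_real_eq_iff of_real_of_nat_eq)
  qed
  have "(real Q * real N) *\<^sub>R (\<Sum>k\<in>S. fejer N k *\<^sub>R b k) = (\<Sum>k\<in>S. (\<Sum>j<Q. q j * p j * (z j powi k)) *\<^sub>C b k)"
    unfolding scaleR_sum_right
  proof (rule sum.cong[OF refl])
    fix k assume k: "k \<in> S"
    have "(real Q * real N) *\<^sub>R fejer N k *\<^sub>R b k = (real Q * real (card {(m, m'). m < N \<and> m' < N \<and> int m' = int m + k})) *\<^sub>R b k"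
      using N by (simp add: fejer_def)
    also have "\<dots> = (\<Sum>j<Q. q j * p j * (z j powi k)) *\<^sub>C b k" unfolding expand[OF D[OF k]] by (simp add: scaleR_scaleC)
    finally show "(real Q * real N) *\<^sub>R fejer N k *\<^sub>R b k = (\<Sum>j<Q. q j * p j * (z j powi k)) *\<^sub>C b k" .
  qed
  also have "\<dots> = (\<Sum>j<Q. (cmod (p j))\<^sup>2 *\<^sub>R (\<Sum>k\<in>S. (z j powi k) *\<^sub>C b k))"
    unfolding complex_vector.scale_sum_left pq scaleR_sum_right
    by (subst sum.swap) (simp add: scaleR_scaleC scaleC_scaleC)
  finally have "norm ((real Q * real N) *\<^sub>R (\<Sum>k\<in>S. fejer N k *\<^sub>R b k)) = norm (\<Sum>j<Q. (cmod (p j))\<^sup>2 *\<^sub>R (\<Sum>k\<in>S. (z j powi k) *\<^sub>C b k))" by simp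
  also have "\<dots> \<le> (\<Sum>j<Q. (cmod (p j))\<^sup>2 * r)"
  proof (rule sum_norm_le)
    fix j
    show "norm ((cmod (p j))\<^sup>2 *\<^sub>R (\<Sum>k\<in>S. (z j powi k) *\<^sub>C b k)) \<le> (cmod (p j))\<^sup>2 * r"
      using gauge[OF z1[of j]] by (simp add: mult_left_mono)
  qed
  also have "\<dots> = (real Q * real N) * r" by (simp add: sum_distrib_right[symmetric] total)
  finally have "(real Q * real N) * norm (\<Sum>k\<in>S. fejer N k *\<^sub>R b k) \<le> (real Q * real N) * r" by simp
  moreover have "real Q * real N > 0" using N by (simp add: Q_def)
  ultimately show ?thesis by (simp only: mult_le_cancel_left_pos)
qed


locale crossed = covariant +
  assumes dense: "closure (integrated_form \<pi> u ` Cc) = UNIV"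
    and universal: "\<And>\<gamma> f. Cc_cstar_seminorm \<alpha> \<gamma> \<Longrightarrow> f \<in> Cc \<Longrightarrow> \<gamma> f \<le> norm (integrated_form \<pi> u f)"
begin

text \<open>Universality applied to the seminorm of the covariant pair with unitary
  \<open>z *\<^sub>C u\<close>.\<close>

lemma gauge:
  assumes S: "finite S" and z: "cmod z = 1"
  shows "norm (\<Sum>k\<in>S. (z powi k) *\<^sub>C (\<pi> (f k) * U k)) \<le> norm (form S f)"
proof -
  have uz: "unitary (z *\<^sub>C u)" by (rule unitary_powi_scaleC[OF u z])
  interpret z: covariant \<alpha> \<pi> "z *\<^sub>C u"
  proof
    have "(z *\<^sub>C u) * \<pi> a * star (z *\<^sub>C u) = \<pi> (\<alpha> a)" for a
      using z u_conj[of a] complex_norm_square[of z]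
      by (simp add: star_scaleC mult_scaleC_left mult_scaleC_right scaleC_scaleC mult.commute scaleC_one)
    thus "covariant_pair \<alpha> \<pi> (z *\<^sub>C u)" unfolding covariant_pair_def using \<pi>_hom uz by simp
  qed (rule automorphism)
  define f' where "f' k = (if k \<in> S then f k else 0)" for k
  have f': "f' \<in> Cc" "{k. f' k \<noteq> 0} \<subseteq> S" using S by (auto simp: f'_def Cc_def intro: finite_subset[OF _ S])
  have "norm (integrated_form \<pi> (z *\<^sub>C u) f') \<le> norm (integrated_form \<pi> u f')"
    by (rule universal[OF z.seminorm f'(1)])
  moreover have "integrated_form \<pi> u f' = form S f" unfolding integrated_form_eq[OF S f'(2)] by (simp add: form_def f'_def)
  moreover have "integrated_form \<pi> (z *\<^sub>C u) f' = (\<Sum>k\<in>S. (z powi k) *\<^sub>C (\<pi> (f k) * U k))"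
    unfolding z.integrated_form_eq[OF S f'(2)] z.form_def unitary_powi_scaleC(2)[OF u z] by (simp add: f'_def mult_scaleC_right)
  ultimately show ?thesis by simp
qed

lemma approx_form: assumes "0 < e" shows "\<exists>S f. finite S \<and> norm (form S f - a) < e"
proof -
  have "a \<in> closure (integrated_form \<pi> u ` Cc)" by (simp add: dense)
  then obtain f where f: "f \<in> Cc" "dist (integrated_form \<pi> u f) a < e" using assms unfolding closure_approachable by blast
  have "integrated_form \<pi> u f = form {k. f k \<noteq> 0} f" by (simp add: integrated_form_def form_def)
  thus ?thesis using f by (auto simp: Cc_def dist_norm)
qed

lemma form_extend: "finite T \<Longrightarrow> S \<subseteq> T \<Longrightarrow> form S f = form T (\<lambda>k. if k \<in> S then f k else 0)"
  unfolding form_def by (rule sum.mono_neutral_cong_left) (auto simp: \<pi>_simps)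

lemma form_diff: "form S (\<lambda>k. f k - g k) = form S f - form S g"
  by (simp add: form_def \<pi>_simps algebra_simps sum_subtractf)

lemma norm_form_coeff: "norm (\<pi> a * U k) \<le> norm a"
  using \<pi>_norm_le[of a] by (simp add: norm_mult_unitary[OF U_unitary])

lemma fejer_form:
  assumes "finite S" "N > 0" shows "norm (\<Sum>k\<in>S. fejer N k *\<^sub>R (\<pi> (f k) * U k)) \<le> norm (form S f)"
  using assms gauge by (intro fejer_contractive) auto

text \<open>If all coefficients of an approximant were small, its Fejer mean would be small. But
  Fejer means of one fixed good approximant \<open>g0\<close> nearly reproduce it, and contractivity
  transfers this to any other approximant.\<close>

lemma coefficient_bound:
  assumes a: "a \<noteq> 0"
  shows "\<exists>c>0. \<exists>\<delta>>0. \<forall>S f. finite S \<and> norm (form S f - a) < \<delta> \<longrightarrow> (\<exists>k\<in>S. norm (f k) \<ge> c)"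
proof -
  \<comment> \<open>The estimates below lose less than five times \<open>e\<close> in total.\<close>
  define e where "e = norm a / 8"
  have e: "e > 0" using a by (simp add: e_def)
  obtain S0 g0 where g0: "finite S0" "norm (form S0 g0 - a) < e" using approx_form[OF e] by blast
  define B where "B = (\<Sum>k\<in>S0. \<bar>real_of_int k\<bar> * norm (g0 k))"
  have B0: "B \<ge> 0" unfolding B_def by (intro sum_nonneg) simp
  \<comment> \<open>Long enough that the Fejer mean of order \<open>N\<close> changes the fixed
    approximant by at most \<open>e\<close>.\<close>
  obtain N :: nat where N: "real N > B / e" "N > 0" using reals_Archimedean2[of "max 0 (B / e)"] by (auto simp: max_def split: if_splits)
  have BN: "B / N \<le> e" using N e by (simp add: field_simps)
  \<comment> \<open>At most \<open>2 * N + 1\<close> coefficients survive in the Fejer mean.\<close>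
  define c where "c = e / (2 * real N + 1)"
  have c: "c > 0" using e by (simp add: c_def)
  have "\<exists>k\<in>S. norm (f k) \<ge> c" if S: "finite S" "norm (form S f - a) < e" for S f
  proof (rule ccontr)
    assume "\<not> ?thesis"
    hence small: "norm (f k) \<le> c" if "k \<in> S" for k using that by force
    define T where "T = S \<union> S0"
    have T: "finite T" "S \<subseteq> T" "S0 \<subseteq> T" using S(1) g0(1) by (auto simp: T_def)
    define f' where "f' k = (if k \<in> S then f k else 0)" for k
    define g where "g k = (if k \<in> S0 then g0 k else 0)" for k
    have fg: "form S f = form T f'" "form S0 g0 = form T g" unfolding f'_def g_def by (rule form_extend[OF T(1)], rule T)+
    define \<sigma> where "\<sigma> h = (\<Sum>k\<in>T. fejer N k *\<^sub>R (\<pi> (h k) * U k))" for h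
    have s1: "norm (\<sigma> f') \<le> e"
    proof -
      have "norm (\<sigma> f') \<le> (\<Sum>k\<in>T. if \<bar>k\<bar> < int N then c else 0)"
        unfolding \<sigma>_def
      proof (rule sum_norm_le)
        fix k assume k: "k \<in> T"
        have "norm (fejer N k *\<^sub>R (\<pi> (f' k) * U k)) \<le> fejer N k * norm (f' k)"
          using norm_form_coeff[of "f' k" k] fejer_bounds(1)[OF N(2), of k] by (simp add: mult_left_mono)
        also have "\<dots> \<le> (if \<bar>k\<bar> < int N then c else 0)"
        proof (cases "\<bar>k\<bar> < int N")
          case True
          have "fejer N k * norm (f' k) \<le> 1 * c" using fejer_bounds[OF N(2), of k] small[of k] c by (intro mult_mono) (auto simp: f'_def)
          thus ?thesis using True by simp
        qed (simp add: fejer_eq_0)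
        finally show "norm (fejer N k *\<^sub>R (\<pi> (f' k) * U k)) \<le> (if \<bar>k\<bar> < int N then c else 0)" .
      qed
      also have "\<dots> = (\<Sum>k\<in>{k\<in>T. \<bar>k\<bar> < int N}. c)" using T(1) by (simp add: sum.inter_filter[symmetric])
      also have "\<dots> = card {k\<in>T. \<bar>k\<bar> < int N} * c" by simp
      also have "card {k\<in>T. \<bar>k\<bar> < int N} \<le> card {- int N..int N}" by (intro card_mono) auto
      hence "card {k\<in>T. \<bar>k\<bar> < int N} * c \<le> (2 * real N + 1) * c" using c by (intro mult_right_mono) auto
      finally show ?thesis using N by (simp add: c_def)
    qed
    have s2: "norm (form T g - \<sigma> g) \<le> e"
    proof -
      have "form T g - \<sigma> g = (\<Sum>k\<in>T. (1 - fejer N k) *\<^sub>R (\<pi> (g k) * U k))"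
        by (simp add: form_def \<sigma>_def algebra_simps sum_subtractf)
      also have "norm \<dots> \<le> (\<Sum>k\<in>T. \<bar>real_of_int k\<bar> * norm (g k) / N)"
      proof (rule sum_norm_le)
        fix k
        have "norm ((1 - fejer N k) *\<^sub>R (\<pi> (g k) * U k)) \<le> (1 - fejer N k) * norm (g k)"
          using norm_form_coeff[of "g k" k] fejer_bounds(2)[OF N(2), of k] by (simp add: mult_left_mono)
        also have "\<dots> \<le> (\<bar>real_of_int k\<bar> / N) * norm (g k)" using fejer_bounds(3)[OF N(2), of k] by (intro mult_right_mono) auto
        finally show "norm ((1 - fejer N k) *\<^sub>R (\<pi> (g k) * U k)) \<le> \<bar>real_of_int k\<bar> * norm (g k) / N" by simp
      qed
      also have "\<dots> = (\<Sum>k\<in>T. \<bar>real_of_int k\<bar> * norm (g k)) / N" by (simp add: sum_divide_distrib)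
      also have "(\<Sum>k\<in>T. \<bar>real_of_int k\<bar> * norm (g k)) = B" unfolding B_def g_def
        using T by (intro sum.mono_neutral_cong_right) auto
      finally show ?thesis using BN by simp
    qed
    have s3: "norm (\<sigma> g - \<sigma> f') \<le> norm (form T g - form T f')"
    proof -
      have "\<sigma> g - \<sigma> f' = (\<Sum>k\<in>T. fejer N k *\<^sub>R (\<pi> (g k - f' k) * U k))"
        by (simp add: \<sigma>_def \<pi>_simps algebra_simps sum_subtractf)
      thus ?thesis using fejer_form[OF T(1) N(2), of "\<lambda>k. g k - f' k"] by (simp add: form_diff)
    qed
    have g1: "norm (form T g - a) < e" "norm (form T f' - a) < e" using g0(2) S(2) fg by simp_all
    have "norm (form T g - form T f') \<le> norm (form T g - a) + norm (form T f' - a)"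
      using norm_triangle_ineq4[of "form T g - a" "form T f' - a"] by simp
    moreover have "norm a \<le> norm (form T g - a) + norm (form T g)"
      using norm_triangle_ineq4[of "form T g" "form T g - a"] by simp
    moreover have "norm (form T g) \<le> norm (form T g - \<sigma> g) + norm (\<sigma> g)"
      using norm_triangle_ineq[of "form T g - \<sigma> g" "\<sigma> g"] by simp
    moreover have "norm (\<sigma> g) \<le> norm (\<sigma> g - \<sigma> f') + norm (\<sigma> f')"
      using norm_triangle_ineq[of "\<sigma> g - \<sigma> f'" "\<sigma> f'"] by simp
    ultimately have "norm a < 8 * e" using s1 s2 s3 g1 e by linarith
    thus False by (simp add: e_def)
  qed
  thus ?thesis using c e by blast
qed

end

subsection \<open>Simplicity of the crossed product\<close>

text \<open>In the corner of \<open>G\<close> the compression of \<open>a * a\<close> is close to a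
  positive scalar, hence invertible; \<open>a * s\<close> is the polar part of \<open>a * G\<close>.
  Its range has the form \<open>a * x * a\<close>, so it lies in the hereditary subalgebra of
  \<open>a\<close>.\<close>

lemma compression_equiv:
  fixes a G :: "'a::cstar_algebra"
  assumes G: "projection G" and a: "star a = a" and c: "\<Lambda> > 0" "norm (G * (a * a) * G - \<Lambda> *\<^sub>R G) \<le> \<Lambda> / 2"
  shows "\<exists>s. star (a * s) * (a * s) = G \<and> a * s * star (a * s) \<in> {a * x * a | x. True}"
proof -
  note GG = projectionD[OF G]
  define h where "h = (1 / \<Lambda>) *\<^sub>R (G * (a * a) * G)"
  define y where "y = G - h"
  have "y = (1 / \<Lambda>) *\<^sub>R (\<Lambda> *\<^sub>R G - G * (a * a) * G)" using c(1) by (simp add: y_def h_def algebra_simps)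
  hence "norm y = norm (G * (a * a) * G - \<Lambda> *\<^sub>R G) / \<Lambda>" using c(1) by (simp add: norm_minus_commute)
  also have "\<dots> \<le> 1/2" using c by (simp add: divide_simps)
  finally have ny: "norm y < 1" by simp
  have hs: "star h = h" by (simp add: h_def star_scaleR star_mult GG a mult.assoc)
  have hG: "h * G = h" "G * h = h" by (simp_all add: h_def mult.assoc GG mult_eq_left[OF GG(1)])
  have ys: "star y = y" "y * G = y" "G * y = y" using hs hG by (simp_all add: y_def star_diff GG algebra_simps)
  define r where "r = rsqrt y"
  have rs: "star r = r" unfolding r_def by (rule rsqrt_star[OF ny ys(1)])
  have rG: "r * G = G * r" unfolding r_def by (rule rsqrt_commutes[OF ny]) (simp add: ys)
  have ry: "r * y = y * r" unfolding r_def by (rule rsqrt_commutes[OF ny]) simp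
  have h1: "h = (1 - y) * G" using ys(2) by (simp add: y_def left_diff_distrib GG hG)
  define s where "s = (1 / sqrt \<Lambda>) *\<^sub>R (G * r)"
  have "star (a * s) * (a * s) = (1 / \<Lambda>) *\<^sub>R (r * (G * (a * a) * G) * r)"
    using c(1) by (simp add: s_def star_mult star_scaleR rs GG a mult.assoc real_sqrt_mult[symmetric])
  also have "\<dots> = r * h * r" by (simp add: h_def)
  also have "\<dots> = r * (1 - y) * (G * r)" unfolding h1 by (simp add: mult.assoc)
  also have "r * (1 - y) = (1 - y) * r" by (simp add: ry left_diff_distrib right_diff_distrib)
  also have "(1 - y) * r * (G * r) = (1 - y) * (r * r) * G" by (simp add: mult.assoc rG[symmetric])
  also have "\<dots> = G" using rsqrt_inverse(1)[OF ny] by (simp add: r_def)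
  finally have "star (a * s) * (a * s) = G" .
  moreover have "a * s * star (a * s) = a * (s * star s) * a" by (simp add: star_mult a mult.assoc)
  ultimately show ?thesis by blast
qed

locale rokhlin_crossed = rokhlin F \<alpha> J + crossed \<alpha> \<pi> u
  for F :: "nat \<Rightarrow> 'a::cstar_algebra set" and \<alpha> J and \<pi> :: "'a \<Rightarrow> 'b::cstar_algebra" and u
begin

lemma \<pi>_bounded_linear: "bounded_linear \<pi>" by (rule cstar_hom_bounded_linear[OF \<pi>_hom \<pi>_one])

text \<open>The preimage of an ideal is invariant under \<alpha> because \<alpha> is conjugation by
  \<open>u\<close>; \<alpha>-simplicity decides the rest.\<close>

lemma closed_ideal_preimage:
  assumes I: "closed_ideal I" shows "{a. \<pi> a \<in> I} = {0} \<or> {a. \<pi> a \<in> I} = UNIV"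
proof -
  have sub: "csubspace I" "closed I" and id: "\<And>x y. y \<in> I \<Longrightarrow> x * y \<in> I" "\<And>x y. y \<in> I \<Longrightarrow> y * x \<in> I"
    using I by (auto simp: closed_ideal_def)
  define K where "K = {a. \<pi> a \<in> I}"
  have "csubspace K" unfolding complex_vector.subspace_def K_def
    using complex_vector.subspace_0[OF sub(1)] complex_vector.subspace_add[OF sub(1)] complex_vector.subspace_scale[OF sub(1)]
    by (auto simp: \<pi>_simps)
  moreover have "closed K"
    using continuous_closed_vimage[OF sub(2), of \<pi>] linear_continuous_at[OF \<pi>_bounded_linear] by (simp add: K_def vimage_def)
  ultimately have "closed_ideal K" unfolding closed_ideal_def using id by (auto simp: K_def \<pi>_simps)
  moreover have "\<alpha> ` K = K"
  proof -
    have AK: "A k a \<in> K" if "a \<in> K" for a k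
      using that id unfolding K_def by (simp add: U_\<pi>_conj[symmetric])
    have "x \<in> \<alpha> ` K" if "x \<in> K" for x
    proof -
      have "x = \<alpha> (A (-1) x)" using A_inv(2)[of 1 x] unfolding aut_powi_1 by (rule sym)
      thus ?thesis using AK[OF that, of "-1"] by blast
    qed
    moreover have "\<alpha> x \<in> K" if "x \<in> K" for x using AK[OF that, of 1] unfolding aut_powi_1 .
    ultimately show ?thesis by blast
  qed
  ultimately show ?thesis using \<alpha>_simple unfolding aut_simple_def K_def by blast
qed

lemma \<pi>_eq_0: "\<pi> a = 0 \<longleftrightarrow> a = 0"
proof -
  have "closed_ideal {0::'b}" unfolding closed_ideal_def by (auto simp: complex_vector.subspace_single_0)
  from closed_ideal_preimage[OF this] have "{a. \<pi> a = 0} = {0} \<or> {a. \<pi> a = 0} = UNIV" by simp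
  moreover have "1 \<notin> {a. \<pi> a = 0}" by simp
  ultimately show ?thesis by blast
qed

text \<open>The lower bound \<open>c\<close> on some coefficient is chosen before \<epsilon>, which
  allows later errors to be measured against it. Density puts the coefficients into one
  \<open>F n\<close>.\<close>

lemma finite_dimensional_coefficients:
  assumes a: "a \<noteq> 0"
  shows "\<exists>c>0. \<forall>\<epsilon>>0. \<exists>S f n. finite S \<and> (\<forall>k\<in>S. f k \<in> F n) \<and> (\<exists>k\<in>S. norm (f k) \<ge> c) \<and> 
    norm ((\<Sum>k\<in>S. U k * \<pi> (f k)) - a) < \<epsilon>"
proof -
  obtain c \<delta> where c: "c > 0" "\<delta> > 0" "\<And>S f. finite S \<Longrightarrow> norm (form S f - a) < \<delta> \<Longrightarrow> \<exists>k\<in>S. norm (f k) \<ge> c"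
    using coefficient_bound[OF a] by blast
  have "\<exists>S f n. finite S \<and> (\<forall>k\<in>S. f k \<in> F n) \<and> (\<exists>k\<in>S. norm (f k) \<ge> c) \<and> norm ((\<Sum>k\<in>S. U k * \<pi> (f k)) - a) < \<epsilon>"
    if \<epsilon>: "\<epsilon> > 0" for \<epsilon>
  proof -
    define e where "e = min \<delta> \<epsilon>"
    have e: "e > 0" "e \<le> \<delta>" "e \<le> \<epsilon>" using c \<epsilon> by (auto simp: e_def)
    obtain S f where S: "finite S" "norm (form S f - a) < e" using approx_form[OF e(1)] by blast
    \<comment> \<open>Moves the coefficients to the right of the powers of \<open>u\<close>, where
      they enter \<open>star b * b\<close> without a twist.\<close>
    define x where "x k = A (- k) (f k)" for k
    have form_U: "form S (\<lambda>k. A k (y k)) = (\<Sum>k\<in>S. U k * \<pi> (y k))" for y by (simp add: form_def U_\<pi>)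
    have xf: "form S f = (\<Sum>k\<in>S. U k * \<pi> (x k))" using form_U[of x] by (simp add: x_def)
    have "(\<lambda>n. norm ((\<Sum>k\<in>S. U k * \<pi> (ap (x k) n)) - a)) \<longlonglongrightarrow> norm ((\<Sum>k\<in>S. U k * \<pi> (x k)) - a)"
      by (intro tendsto_intros bounded_linear.tendsto[OF \<pi>_bounded_linear] ap(3))
    hence "eventually (\<lambda>n. norm ((\<Sum>k\<in>S. U k * \<pi> (ap (x k) n)) - a) < e) sequentially"
      by (rule order_tendstoD(2)) (use S(2) xf in simp)
    then obtain n where n: "norm ((\<Sum>k\<in>S. U k * \<pi> (ap (x k) n)) - a) < e" by (auto dest!: eventually_happens)
    have "norm (form S (\<lambda>k. A k (ap (x k) n)) - a) < \<delta>" using n e unfolding form_U by simp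
    from c(3)[OF S(1) this] obtain k where k: "k \<in> S" "norm (ap (x k) n) \<ge> c" by auto
    have "norm ((\<Sum>k\<in>S. U k * \<pi> (ap (x k) n)) - a) < \<epsilon>" using n e by simp
    thus ?thesis using S(1) k ap(1) by (intro exI[of _ S] exI[of _ "\<lambda>k. ap (x k) n"] exI[of _ n] conjI) auto
  qed
  thus ?thesis using c(1) by blast
qed

text \<open>A nonzero \<open>g\<close> below the minimal projection \<open>m\<close> and approximately below \<open>e 1\<close> kills the
  off-diagonal terms of \<open>b\<^sup>* b\<close>, because \<open>e 1\<close> is almost orthogonal to its translates.\<close>

lemma tower_compression:
  assumes S: "finite S" and f: "\<And>k. k \<in> S \<Longrightarrow> f k \<in> F n" and m: "Fn.minimal n m" and \<epsilon>: "\<epsilon> > 0"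
    and \<Lambda>: "m * (\<Sum>k\<in>S. star (f k) * f k) * m = \<Lambda> *\<^sub>R m"
  shows "\<exists>g. projection g \<and> g \<noteq> 0 \<and> 
    norm (\<pi> g * (star (\<Sum>k\<in>S. U k * \<pi> (f k)) * (\<Sum>k\<in>S. U k * \<pi> (f k))) * \<pi> g - \<Lambda> *\<^sub>R \<pi> g) \<le> \<epsilon>"
proof -
  have m': "projection m" "m \<noteq> 0" using m by (auto simp: Fn.minimal_def)
  note mm = projectionD[OF m'(1)]
  define X where "X = 1 + (\<Sum>k\<in>S. norm (f k))"
  have X: "norm (f k) \<le> X" if "k \<in> S" for k
  proof -
    have "norm (f k) \<le> (\<Sum>k\<in>S. norm (f k))" using S that by (intro member_le_sum) auto
    thus ?thesis by (simp add: X_def)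
  qed
  have X1: "X \<ge> 1" unfolding X_def by (simp add: sum_nonneg)
  define D where "D = nat (Max (insert 0 (abs ` S)))"
  have D: "\<bar>k\<bar> \<le> int D" if "k \<in> S" for k
  proof -
    have "\<bar>k\<bar> \<le> Max (insert 0 (abs ` S))" "0 \<le> Max (insert 0 (abs ` S))" using S that by (auto intro!: Max_ge)
    thus ?thesis by (simp add: D_def)
  qed
  \<comment> \<open>Differences of two frequencies reach \<open>2 * D\<close>, and the translates of
    the bottom level by them must stay inside the tower.\<close>
  define M where "M = 2 * D + 1"
  \<comment> \<open>Two errors from replacing \<open>y k\<close> by \<open>e1 * y k\<close>, and one
    from the overlap of \<open>e1\<close> with its translate.\<close>
  define C where "C = 2 * (X * (18 * X + 1)) + X * X * real M"
  have C: "C \<ge> 0" using X1 by (simp add: C_def)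
  define \<eta> where "\<eta> = min (1/100) (\<epsilon> / (1 + real (card S) * real (card S) * C))"
  have den: "1 + real (card S) * real (card S) * C > 0" using C by (simp add: add_pos_nonneg)
  have \<eta>: "\<eta> > 0" using \<epsilon> den by (simp add: \<eta>_def)
  have \<eta>100: "\<eta> \<le> 1/100" unfolding \<eta>_def by (rule min.cobounded1)
  note \<eta> = \<eta> \<eta>100
  have \<eta>\<epsilon>: "real (card S) * real (card S) * (C * \<eta>) \<le> \<epsilon>"
  proof -
    have "\<eta> \<le> \<epsilon> / (1 + real (card S) * real (card S) * C)" by (simp add: \<eta>_def)
    hence "\<eta> * (1 + real (card S) * real (card S) * C) \<le> \<epsilon>" using den by (simp add: pos_le_divide_eq)
    thus ?thesis using \<eta>(1) by (simp add: algebra_simps)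
  qed
  have "\<exists>e. tower M \<eta> e \<and> (\<forall>j\<in>{1..M}. \<forall>b\<in>{m} \<union> f ` S. norm (e j * b - b * e j) < \<eta>) \<and>
    (\<forall>p\<in>{m}. norm (e 1 * p * e 1) \<ge> 1 - \<eta>) \<and> proj_le_aut \<alpha> (1 - (\<Sum>j=1..M. e j)) 1"
    by (rule rokhlin_tower) (use \<eta> S m' in \<open>auto simp: M_def\<close>)
  then obtain e where e: "tower M \<eta> e" "\<forall>j\<in>{1..M}. \<forall>b\<in>{m} \<union> f ` S. norm (e j * b - b * e j) < \<eta>" "norm (e 1 * m * e 1) \<ge> 1 - \<eta>"
    by blast
  define e1 where "e1 = e 1"
  have "1 \<in> {1..M}" by (simp add: M_def)
  hence com: "norm (e1 * b - b * e1) \<le> \<eta>" if "b \<in> {m} \<union> f ` S" for b using e(2) that less_imp_le unfolding e1_def by blast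
  have pe: "projection e1" using e(1) \<open>1 \<in> {1..M}\<close> unfolding tower_def e1_def by blast
  note ee = projectionD[OF pe]
  have contr: "norm (p * x) \<le> norm x" "norm (x * p) \<le> norm x" if "projection p" for p x :: 'a
  proof -
    have "norm (p * x) \<le> norm p * norm x" "norm (x * p) \<le> norm x * norm p" by (rule norm_mult_ineq)+
    thus "norm (p * x) \<le> norm x" "norm (x * p) \<le> norm x"
      using mult_right_mono[OF projection_norm_le[OF that], of "norm x"] mult_left_mono[OF projection_norm_le[OF that], of "norm x"] by auto
  qed
  \<comment> \<open>Almost idempotent, as \<open>m\<close> and \<open>e1\<close> almost commute; it
    is large by the norm condition on \<open>e 1\<close> in the Rokhlin property.\<close>
  define z where "z = m * e1 * m"
  have zs: "star z = z" by (simp add: z_def star_mult mm ee mult.assoc)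
  have "z * z - z = m * e1 * (m * e1 - e1 * m) * m"
    by (simp add: z_def algebra_simps mm ee mult_eq_left[OF mm(1)] mult_eq_left[OF ee(1)])
  also have "norm \<dots> \<le> norm (m * e1 - e1 * m)"
    using contr(2)[OF m'(1), of "m * e1 * (m * e1 - e1 * m)"] contr(1)[OF m'(1), of "e1 * (m * e1 - e1 * m)"] 
      contr(1)[OF pe, of "m * e1 - e1 * m"] by (simp add: mult.assoc)
  also have "\<dots> \<le> \<eta>" using com[of m] by (simp add: norm_minus_commute)
  finally have zz: "norm (z * z - z) \<le> \<eta>" .
  have "\<eta> \<le> 1/8" using \<eta> by simp
  from nearly_idempotent[OF zs zz this] obtain g0 where g0: "projection g0" "norm (g0 - z) \<le> 8 * \<eta>" "\<forall>w. z * w = w * z \<longrightarrow> g0 * w = w * g0"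
    by blast
  have "z * m = m * z" by (simp add: z_def mult.assoc mm mult_eq_left[OF mm(1)])
  hence gm: "g0 * m = m * g0" using g0(3) by blast
  \<comment> \<open>\<open>g0\<close> commutes with \<open>m\<close> because \<open>z\<close> does,
    so this is a projection below \<open>m\<close> that stays close to \<open>z\<close>.\<close>
  define g where "g = g0 * m"
  have "g * g = g0 * (m * g0) * m" by (simp add: g_def mult.assoc)
  also have "\<dots> = g" unfolding gm[symmetric] by (simp add: g_def mult.assoc mm mult_eq_left[OF projectionD(1)[OF g0(1)]])
  finally have "g * g = g" .
  moreover have "star g = g" using gm by (simp add: g_def star_mult mm projectionD[OF g0(1)])
  ultimately have pg: "projection g" by (simp add: projection_def)
  have gm': "g * m = g" by (simp add: g_def mult.assoc mm)
  have "star (g * m) = star g" by (simp only: gm')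
  hence mg': "m * g = g" by (simp only: star_mult mm projectionD(2)[OF pg])
  have zm: "z * m = z" by (simp add: z_def mult.assoc mm)
  have "g - z = (g0 - z) * m" by (simp add: g_def left_diff_distrib zm)
  hence gz: "norm (g - z) \<le> 8 * \<eta>" using contr(2)[OF m'(1), of "g0 - z"] g0(2) by simp
  have "norm (e1 * m * e1) = norm z"
  proof -
    have "norm (star (m * e1) * (m * e1)) = norm (star (star (m * e1)) * star (m * e1))"
      by (simp only: cstar_identity norm_star)
    thus ?thesis by (simp add: z_def star_mult star_star mm ee mult.assoc mm ee mult_eq_left[OF mm(1)] mult_eq_left[OF ee(1)])
  qed
  hence "norm z \<ge> 1 - \<eta>" using e(3) by (simp add: e1_def)
  hence "g \<noteq> 0" using gz \<eta> by auto
  have ge: "norm (g - e1 * m) \<le> 9 * \<eta>"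
  proof -
    have "z - e1 * m = (m * e1 - e1 * m) * m" by (simp add: z_def left_diff_distrib mult.assoc mm)
    hence "norm (z - e1 * m) \<le> \<eta>" using contr(2)[OF m'(1), of "m * e1 - e1 * m"] com[of m] by (simp add: norm_minus_commute)
    thus ?thesis using gz norm_triangle_ineq[of "g - z" "z - e1 * m"] by simp
  qed
  have geg: "norm (g - e1 * g) \<le> 18 * \<eta>"
  proof -
    have "g - e1 * g = (g - e1 * m) - e1 * (g - e1 * m)" by (simp add: algebra_simps mult_eq_left[OF ee(1)])
    hence "norm (g - e1 * g) \<le> norm (g - e1 * m) + norm (e1 * (g - e1 * m))" by (metis norm_triangle_ineq4)
    thus ?thesis using ge contr(1)[OF pe, of "g - e1 * m"] by simp
  qed
  define y where "y k = f k * g" for k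
  have ny: "norm (y k) \<le> X" if "k \<in> S" for k using contr(2)[OF pg, of "f k"] X[OF that] by (simp add: y_def)
  define \<epsilon>1 where "\<epsilon>1 = (18 * X + 1) * \<eta>"
  have \<epsilon>1: "\<epsilon>1 \<ge> 0" using X1 \<eta> by (simp add: \<epsilon>1_def)
  have ye: "norm (y k - e1 * y k) \<le> \<epsilon>1" if k: "k \<in> S" for k
  proof -
    have "y k - e1 * y k = f k * (g - e1 * g) - (e1 * f k - f k * e1) * g"
      by (simp add: y_def algebra_simps)
    hence "norm (y k - e1 * y k) \<le> norm (f k * (g - e1 * g)) + norm ((e1 * f k - f k * e1) * g)" by (metis norm_triangle_ineq4)
    also have "norm (f k * (g - e1 * g)) \<le> X * (18 * \<eta>)"
      using norm_mult_ineq[of "f k" "g - e1 * g"] mult_mono[OF X[OF k] geg] X1 by simp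
    also have "norm ((e1 * f k - f k * e1) * g) \<le> \<eta>" using contr(2)[OF pg, of "e1 * f k - f k * e1"] com[of "f k"] k by simp
    finally show ?thesis by (simp add: \<epsilon>1_def algebra_simps)
  qed
  have eAe: "norm (e1 * A r e1) \<le> real M * \<eta>" if r: "r \<noteq> 0" "\<bar>r\<bar> \<le> 2 * int D" for r
  proof -
    have pos: "norm (e1 * A (int j) e1) \<le> real M * \<eta>" if j: "j > 0" "j \<le> 2 * D" for j
    proof -
      have "e1 * e (1 + j) = 0" using e(1) j unfolding tower_def e1_def by (auto simp: M_def)
      hence "e1 * A (int j) e1 = e1 * (A (int j) e1 - e (1 + j))" by (simp add: right_diff_distrib)
      hence "norm (e1 * A (int j) e1) \<le> norm (A (int j) e1 - e (1 + j))" using contr(1)[OF pe] by simp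
      also have "\<dots> \<le> real j * \<eta>" unfolding e1_def using j \<eta> by (intro tower_shift[OF e(1)]) (auto simp: M_def)
      also have "\<dots> \<le> real M * \<eta>" using j \<eta> by (intro mult_right_mono) (auto simp: M_def)
      finally show ?thesis .
    qed
    show ?thesis
    proof (cases "r > 0")
      case True thus ?thesis using pos[of "nat r"] r by simp
    next
      case False
      have "norm (e1 * A r e1) = norm (A (- r) (e1 * A r e1))" by simp
      also have "A (- r) (e1 * A r e1) = star (e1 * A (- r) e1)" by (simp add: A_simps star_mult ee) (simp add: A_simps(4)[symmetric] ee)
      also have "norm \<dots> = norm (e1 * A (int (nat (- r))) e1)" using False by simp
      also have "\<dots> \<le> real M * \<eta>" using False r by (intro pos) auto
      finally show ?thesis .
    qed
  qed
  define b where "b = (\<Sum>k\<in>S. U k * \<pi> (f k))"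
  have bg: "b * \<pi> g = (\<Sum>k\<in>S. U k * \<pi> (y k))" by (simp add: b_def y_def \<pi>_simps sum_distrib_right mult.assoc)
  define t where "t k l = star (U k * \<pi> (y k)) * (U l * \<pi> (y l))" for k l
  have t: "t k l = \<pi> (star (y k) * A (l - k) (y l)) * U (l - k)" for k l
  proof -
    have "t k l = \<pi> (star (y k)) * (U (- k) * U l) * \<pi> (y l)" by (simp add: t_def star_mult star_unitary_powi \<pi>_simps mult.assoc)
    also have "U (- k) * U l = U (l - k)" by (simp add: U_add[symmetric])
    finally show ?thesis by (simp add: mult.assoc U_\<pi> \<pi>_simps)
  qed
  have off: "norm (t k l) \<le> C * \<eta>" if kl: "k \<in> S" "l \<in> S" "k \<noteq> l" for k l
  proof -
    define r where "r = l - k"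
    have r: "r \<noteq> 0" "\<bar>r\<bar> \<le> 2 * int D" using kl D[OF kl(1)] D[OF kl(2)] by (auto simp: r_def)
    \<comment> \<open>Inserting \<open>e1\<close> on both sides isolates the factor
      \<open>e1 * A r e1\<close>, which is small since \<open>e1\<close> is orthogonal to the level
      near its translate.\<close>
    have "star (y k) * A r (y l) = star (y k - e1 * y k) * A r (y l) + star (e1 * y k) * A r (y l - e1 * y l)
        + star (y k) * (e1 * A r e1) * A r (y l)"
      by (simp add: A_simps star_diff star_mult ee algebra_simps mult_eq_left[OF ee(1)])
    hence "norm (star (y k) * A r (y l)) \<le> norm (star (y k - e1 * y k) * A r (y l)) + norm (star (e1 * y k) * A r (y l - e1 * y l))
        + norm (star (y k) * (e1 * A r e1) * A r (y l))"
      by (metis norm_triangle_mono norm_triangle_ineq order_refl)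
    also have "norm (star (y k - e1 * y k) * A r (y l)) \<le> \<epsilon>1 * X"
      by (rule order_trans[OF norm_mult_ineq]) (use ye[OF kl(1)] ny[OF kl(2)] \<epsilon>1 in \<open>simp add: mult_mono\<close>)
    also have "norm (star (e1 * y k) * A r (y l - e1 * y l)) \<le> X * \<epsilon>1"
      by (rule order_trans[OF norm_mult_ineq]) (use contr(1)[OF pe, of "y k"] ny[OF kl(1)] ye[OF kl(2)] X1 in \<open>simp add: mult_mono\<close>)
    also have "norm (star (y k) * (e1 * A r e1) * A r (y l)) \<le> (X * (real M * \<eta>)) * X"
    proof (rule order_trans[OF norm_mult_ineq])
      have "norm (star (y k) * (e1 * A r e1)) \<le> X * (real M * \<eta>)"
        by (rule order_trans[OF norm_mult_ineq]) (use ny[OF kl(1)] eAe[OF r] X1 in \<open>simp add: mult_mono\<close>)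
      thus "norm (star (y k) * (e1 * A r e1)) * norm (A r (y l)) \<le> X * (real M * \<eta>) * X"
        using ny[OF kl(2)] X1 \<eta> by (intro mult_mono) auto
    qed
    finally have "norm (star (y k) * A r (y l)) \<le> C * \<eta>" by (simp add: C_def \<epsilon>1_def algebra_simps)
    thus ?thesis unfolding t r_def[symmetric] using norm_form_coeff order_trans by blast
  qed
  have diag: "(\<Sum>k\<in>S. t k k) = \<Lambda> *\<^sub>R \<pi> g"
  proof -
    have "(\<Sum>k\<in>S. t k k) = \<pi> (\<Sum>k\<in>S. star (y k) * y k)" by (simp add: t cstar_hom_sum[OF \<pi>_hom])
    also have "(\<Sum>k\<in>S. star (y k) * y k) = g * (\<Sum>k\<in>S. star (f k) * f k) * g"
      by (simp add: y_def star_mult projectionD[OF pg] sum_distrib_left sum_distrib_right mult.assoc)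
    also have "\<dots> = g * (m * (\<Sum>k\<in>S. star (f k) * f k) * m) * g" using mult_eq_left[OF gm'] mg' by (simp add: mult.assoc)
    also have "\<dots> = \<Lambda> *\<^sub>R g" unfolding \<Lambda> using gm' projectionD(1)[OF pg] by simp
    finally show ?thesis by (simp add: \<pi>_simps)
  qed
  have "\<pi> g * (star b * b) * \<pi> g = star (b * \<pi> g) * (b * \<pi> g)" 
    using projectionD(2)[OF \<pi>_projection[OF pg]] by (simp add: star_mult mult.assoc)
  also have "\<dots> = (\<Sum>k\<in>S. \<Sum>l\<in>S. t k l)" unfolding bg t_def star_sum by (rule sum_product)
  also have "\<dots> = (\<Sum>k\<in>S. t k k + (\<Sum>l\<in>S. if l = k then 0 else t k l))"
  proof (rule sum.cong[OF refl])
    fix k assume k: "k \<in> S"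
    have "(\<Sum>l\<in>S. t k l) = (\<Sum>l\<in>S. (if l = k then t k k else 0) + (if l = k then 0 else t k l))" by (intro sum.cong) auto
    also have "\<dots> = t k k + (\<Sum>l\<in>S. if l = k then 0 else t k l)" using S k by (simp add: sum.distrib)
    finally show "(\<Sum>l\<in>S. t k l) = t k k + (\<Sum>l\<in>S. if l = k then 0 else t k l)" .
  qed
  finally have "\<pi> g * (star b * b) * \<pi> g - \<Lambda> *\<^sub>R \<pi> g = (\<Sum>k\<in>S. \<Sum>l\<in>S. if l = k then 0 else t k l)"
    by (simp add: sum.distrib diag)
  also have "norm \<dots> \<le> (\<Sum>k\<in>S. \<Sum>l\<in>S. C * \<eta>)"
    by (intro sum_norm_le order_trans[OF norm_sum sum_mono]) (use off C \<eta> in auto)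
  also have "\<dots> \<le> \<epsilon>" using \<eta>\<epsilon> by (simp add: mult.assoc)
  finally show ?thesis using pg \<open>g \<noteq> 0\<close> unfolding b_def by blast
qed

text \<open>The diagonal scalar \<Lambda> is at least the square of \<open>c\<close>, while the
  compression error and the error of the approximation are each at most a quarter of that square;
  this is the hypothesis of \<open>compression_equiv\<close>.\<close>

lemma projection_below:
  assumes a: "star a = a" "a \<noteq> 0"
  shows "\<exists>g. projection g \<and> g \<noteq> 0 \<and> (\<exists>s. star (a * s) * (a * s) = \<pi> g \<and> a * s * star (a * s) \<in> {a * x * a | x. True})"
proof -
  obtain c where c: "c > 0" and approx: "\<And>\<epsilon>. \<epsilon> > 0 \<Longrightarrow> \<exists>S f n. finite S \<and> (\<forall>k\<in>S. f k \<in> F n) \<and> (\<exists>k\<in>S. norm (f k) \<ge> c) \<and> 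
    norm ((\<Sum>k\<in>S. U k * \<pi> (f k)) - a) < \<epsilon>" using finite_dimensional_coefficients[OF a(2)] by blast
  \<comment> \<open>Replacing \<open>a * a\<close> by \<open>star b * b\<close> costs at most
    \<open>(2 * norm a + 1) * \<delta>\<close>.\<close>
  define \<delta> where "\<delta> = min 1 (c\<^sup>2 / (4 * (2 * norm a + 1)))"
  have na: "2 * norm a + 1 > 0" by (simp add: add_nonneg_pos)
  have \<delta>: "\<delta> > 0" "\<delta> \<le> 1" using c na by (auto simp: \<delta>_def)
  have \<delta>c: "(2 * norm a + 1) * \<delta> \<le> c\<^sup>2 / 4"
  proof -
    have "\<delta> \<le> (c\<^sup>2 / 4) / (2 * norm a + 1)" by (simp add: \<delta>_def)
    hence "\<delta> * (2 * norm a + 1) \<le> c\<^sup>2 / 4" using pos_le_divide_eq[OF na] by blast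
    thus ?thesis by (simp only: mult.commute)
  qed
  obtain S f n where S: "finite S" "\<And>k. k \<in> S \<Longrightarrow> f k \<in> F n" "\<exists>k\<in>S. norm (f k) \<ge> c" 
    "norm ((\<Sum>k\<in>S. U k * \<pi> (f k)) - a) < \<delta>" using approx[OF \<delta>(1)] by blast
  define b where "b = (\<Sum>k\<in>S. U k * \<pi> (f k))"
  obtain k0 where k0: "k0 \<in> S" "norm (f k0) \<ge> c" using S(3) by blast
  have "f k0 \<noteq> 0" using k0(2) c by auto
  then obtain m r where m: "Fn.minimal n m" "m * (star (f k0) * f k0) * m = r *\<^sub>R m" "(norm (f k0))\<^sup>2 \<le> r"
    using Fn.minimal_norm[OF S(2)[OF k0(1)]] by blast
  have "\<forall>k\<in>S. \<exists>s\<ge>0. m * (star (f k) * f k) * m = s *\<^sub>R m" using Fn.minimal_star[OF m(1)] S(2) by blast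
  from bchoice[OF this] obtain s where s0: "\<forall>k\<in>S. 0 \<le> s k \<and> m * (star (f k) * f k) * m = s k *\<^sub>R m" by (elim exE)
  have s: "0 \<le> s k" "m * (star (f k) * f k) * m = s k *\<^sub>R m" if "k \<in> S" for k using bspec[OF s0 that] by auto
  have "m \<noteq> 0" using m(1) by (simp add: Fn.minimal_def)
  hence "s k0 = r" using s(2)[OF k0(1)] m(2) by simp
  define \<Lambda> where "\<Lambda> = sum s S"
  have "c\<^sup>2 \<le> (norm (f k0))\<^sup>2" using k0(2) c by (intro power_mono) auto
  also have "\<dots> \<le> s k0" using m(3) \<open>s k0 = r\<close> by simp
  also have "\<dots> \<le> \<Lambda>" unfolding \<Lambda>_def using S(1) k0(1) s(1) by (intro member_le_sum) auto
  finally have \<Lambda>c: "c\<^sup>2 \<le> \<Lambda>" .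
  have c2: "c\<^sup>2 > 0" using c by simp
  have "m * (\<Sum>k\<in>S. star (f k) * f k) * m = \<Lambda> *\<^sub>R m"
    unfolding \<Lambda>_def scaleR_sum_left sum_distrib_left sum_distrib_right using s(2) by (intro sum.cong refl) (simp add: mult.assoc)
  from tower_compression[OF S(1,2) m(1) _ this, of "c\<^sup>2 / 4"] c2
  obtain g where g: "projection g" "g \<noteq> 0" "norm (\<pi> g * (star b * b) * \<pi> g - \<Lambda> *\<^sub>R \<pi> g) \<le> c\<^sup>2 / 4" by (auto simp: b_def)
  have ba: "norm (b - a) < \<delta>" using S(4) by (simp add: b_def)
  have nb: "norm b \<le> norm a + 1" using norm_triangle_ineq[of a "b - a"] ba \<delta>(2) by simp
  have "a * a - star b * b = (a - star b) * a - star b * (b - a)" by (simp add: algebra_simps)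
  hence "norm (a * a - star b * b) \<le> norm ((a - star b) * a) + norm (star b * (b - a))" by (metis norm_triangle_ineq4)
  also have "norm ((a - star b) * a) \<le> \<delta> * norm a"
  proof (rule order_trans[OF norm_mult_ineq mult_right_mono])
    have "norm (a - star b) = norm (star (a - b))" by (simp only: star_diff a)
    thus "norm (a - star b) \<le> \<delta>" using ba by (simp add: norm_minus_commute)
  qed simp
  also have "norm (star b * (b - a)) \<le> (norm a + 1) * \<delta>"
    by (rule order_trans[OF norm_mult_ineq mult_mono]) (use nb ba in auto)
  finally have "norm (a * a - star b * b) \<le> c\<^sup>2 / 4" using \<delta>c by (simp add: algebra_simps)
  moreover have "norm (\<pi> g * (a * a - star b * b) * \<pi> g) \<le> norm (a * a - star b * b)"
  proof -
    have 1: "norm (\<pi> g) \<le> 1" by (rule projection_norm_le[OF \<pi>_projection[OF g(1)]])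
    have "norm (\<pi> g * (a * a - star b * b) * \<pi> g) \<le> norm (\<pi> g * (a * a - star b * b)) * norm (\<pi> g)" by (rule norm_mult_ineq)
    also have "\<dots> \<le> norm (\<pi> g * (a * a - star b * b)) * 1" using 1 by (intro mult_left_mono) auto
    also have "\<dots> \<le> norm (\<pi> g) * norm (a * a - star b * b)" by (simp add: norm_mult_ineq)
    also have "\<dots> \<le> 1 * norm (a * a - star b * b)" using 1 by (intro mult_right_mono) auto
    finally show ?thesis by simp
  qed
  moreover have "\<pi> g * (a * a) * \<pi> g - \<Lambda> *\<^sub>R \<pi> g = \<pi> g * (a * a - star b * b) * \<pi> g + (\<pi> g * (star b * b) * \<pi> g - \<Lambda> *\<^sub>R \<pi> g)"
    by (simp add: algebra_simps)
  hence "norm (\<pi> g * (a * a) * \<pi> g - \<Lambda> *\<^sub>R \<pi> g) \<le> norm (\<pi> g * (a * a - star b * b) * \<pi> g) + norm (\<pi> g * (star b * b) * \<pi> g - \<Lambda> *\<^sub>R \<pi> g)"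
    by (metis norm_triangle_ineq)
  ultimately have "norm (\<pi> g * (a * a) * \<pi> g - \<Lambda> *\<^sub>R \<pi> g) \<le> \<Lambda> / 2" using g(3) \<Lambda>c by linarith
  moreover have "\<Lambda> > 0" using \<Lambda>c c2 by linarith
  ultimately show ?thesis using compression_equiv[OF \<pi>_projection[OF g(1)] a(1)] g by blast
qed

lemma crossed_product_simple: "simple_algebra TYPE('b)"
  unfolding simple_algebra_def
proof (intro allI impI)
  fix I :: "'b set" assume I: "closed_ideal I"
  have id: "\<And>x y. y \<in> I \<Longrightarrow> x * y \<in> I" "\<And>x y. y \<in> I \<Longrightarrow> y * x \<in> I" and z: "0 \<in> I"
    using I complex_vector.subspace_0[of I] by (auto simp: closed_ideal_def)
  show "I = {0} \<or> I = UNIV"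
  proof (cases "I = {0}")
    case False
    then obtain x where x: "x \<in> I" "x \<noteq> 0" using z by blast
    define a where "a = star x * x"
    have a: "a \<in> I" "star a = a" "a \<noteq> 0" using x id cstar_identity[of x] by (auto simp: a_def star_mult star_star)
    obtain g s where g: "projection g" "g \<noteq> 0" "star (a * s) * (a * s) = \<pi> g" using projection_below[OF a(2,3)] by blast
    have "\<pi> g \<in> I" unfolding g(3)[symmetric] using a(1) id by blast
    hence "{a. \<pi> a \<in> I} \<noteq> {0}" using g(2) by blast
    hence "1 \<in> {a. \<pi> a \<in> I}" using closed_ideal_preimage[OF I] by blast
    hence "1 \<in> I" by simp
    hence "x \<in> I" for x using id(1)[of 1 x] by simp
    thus ?thesis by blast
  qed simp
qed

end

subsection \<open>Matrix algebras over a tower\<close>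

lemma tendsto_scaleC_left: "(c \<longlongrightarrow> c0) G \<Longrightarrow> ((\<lambda>n. c n *\<^sub>C (a::'a::cstar_algebra)) \<longlongrightarrow> c0 *\<^sub>C a) G"
proof (rule bounded_linear.tendsto[where f = "\<lambda>c. c *\<^sub>C a"])
  show "bounded_linear (\<lambda>c. c *\<^sub>C a)"
    by (rule bounded_linear_intro[where K = "norm a"]) (auto simp: scaleC_add_left norm_scaleC scaleR_scaleC scaleC_scaleC scaleR_conv_of_real)
qed

text \<open>Induction on the spanning set: the positive distance \<open>d\<close> from the new
  vector to the old span controls its coefficient, so the coefficients of a convergent sequence
  converge.\<close>

lemma closed_cspan_finite: "finite S \<Longrightarrow> closed (cspan (S :: 'a::cstar_algebra set))"
proof (induction S rule: finite_induct)
  case (insert a S)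
  define V where "V = cspan S"
  have V: "csubspace V" "closed V" using insert by (auto simp: V_def)
  show ?case
  proof (cases "a \<in> V")
    case True
    have "cspan (insert a S) = V" unfolding V_def using True by (simp add: V_def complex_vector.span_redundant)
    thus ?thesis using V by simp
  next
    case False
    have ne: "V \<noteq> {}" using complex_vector.subspace_0[OF V(1)] by blast
    define d where "d = infdist a V"
    have d: "d > 0" unfolding d_def using infdist_pos_not_in_closed[OF V(2) ne False] .
    have low: "cmod c * d \<le> norm (v + c *\<^sub>C a)" if "v \<in> V" for v c
    proof (cases "c = 0")
      case False
      have "(- (1 / c)) *\<^sub>C v \<in> V" by (rule complex_vector.subspace_scale[OF V(1) that])
      hence "d \<le> norm (a - (- (1 / c)) *\<^sub>C v)" unfolding d_def dist_norm[symmetric] by (rule infdist_le)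
      hence "cmod c * d \<le> cmod c * norm (a - (- (1 / c)) *\<^sub>C v)" by (rule mult_left_mono) simp
      also have "\<dots> = norm (c *\<^sub>C (a - (- (1 / c)) *\<^sub>C v))" by (simp add: norm_scaleC)
      also have "c *\<^sub>C (a - (- (1 / c)) *\<^sub>C v) = v + c *\<^sub>C a"
        using False by (simp add: scaleC_add_right scaleC_scaleC scaleC_one complex_vector.scale_minus_left)
      finally show ?thesis .
    qed simp
    show ?thesis
      unfolding closed_sequential_limits
    proof (intro allI impI)
      fix x l assume x: "(\<forall>n. x n \<in> cspan (insert a S)) \<and> x \<longlonglongrightarrow> l"
      hence "\<forall>n. \<exists>c. x n - c *\<^sub>C a \<in> V" unfolding complex_vector.span_insert V_def by blast
      then obtain c where c: "\<And>n. x n - c n *\<^sub>C a \<in> V" by metis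
      have "Cauchy c"
      proof (rule metric_CauchyI)
        fix e :: real assume e: "e > 0"
        have "Cauchy x" using x by (auto intro: LIMSEQ_imp_Cauchy)
        then obtain N where N: "\<And>m n. m \<ge> N \<Longrightarrow> n \<ge> N \<Longrightarrow> dist (x m) (x n) < e * d" using e d metric_CauchyD[of x "e * d"] by auto
        have "dist (c m) (c n) < e" if "m \<ge> N" "n \<ge> N" for m n
        proof -
          have "(x m - c m *\<^sub>C a) - (x n - c n *\<^sub>C a) \<in> V" by (rule complex_vector.subspace_diff[OF V(1) c c])
          from low[OF this, of "c m - c n"] have "cmod (c m - c n) * d \<le> norm (x m - x n)"
            by (simp add: complex_vector.scale_left_diff_distrib algebra_simps)
          also have "\<dots> < e * d" using N[OF that] by (simp add: dist_norm)
          finally show ?thesis using d by (simp add: dist_norm)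
        qed
        thus "\<exists>N. \<forall>m\<ge>N. \<forall>n\<ge>N. dist (c m) (c n) < e" by blast
      qed
      then obtain c0 where c0: "c \<longlonglongrightarrow> c0" by (auto simp: Cauchy_convergent_iff convergent_def)
      have "(\<lambda>n. x n - c n *\<^sub>C a) \<longlonglongrightarrow> l - c0 *\<^sub>C a" using x by (intro tendsto_diff tendsto_scaleC_left c0) auto
      hence "l - c0 *\<^sub>C a \<in> V" using closed_sequentially[OF V(2), of "\<lambda>n. x n - c n *\<^sub>C a"] c by blast
      thus "l \<in> cspan (insert a S)" unfolding complex_vector.span_insert V_def by blast
    qed
  qed
qed simp

definition unital_fd :: "'a::cstar_algebra \<Rightarrow> 'a set \<Rightarrow> bool" where
  "unital_fd p C \<longleftrightarrow> cstar_subalgebra C \<and> finite_dimensional C \<and> p \<in> C \<and> (\<forall>c\<in>C. p * c = c \<and> c * p = c)"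

lemma cspan_closure_props:
  fixes G :: "'a::cstar_algebra set"
  shows "(\<And>a b. a \<in> G \<Longrightarrow> b \<in> G \<Longrightarrow> a * b \<in> cspan G) \<Longrightarrow> x \<in> cspan G \<Longrightarrow> y \<in> cspan G \<Longrightarrow> x * y \<in> cspan G"
    and "(\<And>a. a \<in> G \<Longrightarrow> star a \<in> cspan G) \<Longrightarrow> x \<in> cspan G \<Longrightarrow> star x \<in> cspan G"
proof -
  assume m: "\<And>a b. a \<in> G \<Longrightarrow> b \<in> G \<Longrightarrow> a * b \<in> cspan G" and xy: "x \<in> cspan G" "y \<in> cspan G"
  have 1: "a * y \<in> cspan G" if a: "a \<in> G" for a
    using xy(2)
  proof (induction rule: complex_vector.span_induct_alt)
    case (step c b y)
    thus ?case using m[OF a] by (auto simp: distrib_left mult_scaleC_right intro!: complex_vector.span_add complex_vector.span_scale)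
  qed (simp add: complex_vector.span_zero)
  show "x * y \<in> cspan G" using xy(1)
  proof (induction rule: complex_vector.span_induct_alt)
    case (step c b x)
    thus ?case using 1 by (auto simp: distrib_right mult_scaleC_left intro!: complex_vector.span_add complex_vector.span_scale)
  qed (simp add: complex_vector.span_zero)
next
  assume m: "\<And>a. a \<in> G \<Longrightarrow> star a \<in> cspan G" and x: "x \<in> cspan G"
  show "star x \<in> cspan G" using x
  proof (induction rule: complex_vector.span_induct_alt)
    case (step c b x)
    thus ?case using m by (auto simp: star_add star_scaleC intro!: complex_vector.span_add complex_vector.span_scale)
  qed (simp add: complex_vector.span_zero)
qed

lemma linear_image_cspan:
  fixes \<phi> :: "'a::cstar_algebra \<Rightarrow> 'b::cstar_algebra"
  assumes "\<And>a b. \<phi> (a + b) = \<phi> a + \<phi> b" "\<And>c a. \<phi> (c *\<^sub>C a) = c *\<^sub>C \<phi> a"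
  shows "\<phi> ` cspan S = cspan (\<phi> ` S)"
proof -
  have "module_hom (*\<^sub>C) (*\<^sub>C) \<phi>" unfolding module_hom_iff
    using complex_vector.module_axioms[where 'a = 'a] complex_vector.module_axioms[where 'a = 'b] assms by auto
  from module_hom.span_image[OF this] show ?thesis unfolding cspan_def ..
qed

text \<open>The products \<open>t j * x * star (t k)\<close> multiply like matrices over
  \<open>D\<close>, and \<open>p\<close> is the unit matrix.\<close>

lemma matrix_algebra:
  fixes t :: "nat \<Rightarrow> 'a::cstar_algebra"
  assumes f: "projection f" and I: "finite I" and t: "\<And>j k. j \<in> I \<Longrightarrow> k \<in> I \<Longrightarrow> star (t j) * t k = (if j = k then f else 0)"
    and D: "unital_fd f D"
  defines "p \<equiv> \<Sum>j\<in>I. t j * star (t j)"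
  shows "\<exists>C. unital_fd p C \<and> (\<forall>j\<in>I. \<forall>k\<in>I. \<forall>x\<in>D. t j * x * star (t k) \<in> C)"
proof -
  obtain B where B: "finite B" "D = cspan B" using D by (auto simp: unital_fd_def finite_dimensional_def)
  have D': "f \<in> D" "\<And>c. c \<in> D \<Longrightarrow> f * c = c" "\<And>c. c \<in> D \<Longrightarrow> c * f = c" "\<And>x y. x \<in> D \<Longrightarrow> y \<in> D \<Longrightarrow> x * y \<in> D" 
    "\<And>x. x \<in> D \<Longrightarrow> star x \<in> D" using D by (auto simp: unital_fd_def cstar_subalgebra_def)
  have BD: "b \<in> D" if "b \<in> B" for b using that B(2) complex_vector.span_base by blast
  define G where "G = (\<lambda>(j, k, b). t j * b * star (t k)) ` (I \<times> I \<times> B)"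
  define C where "C = cspan G"
  have finG: "finite G" unfolding G_def using I B(1) by auto
  have tf: "t j * f = t j" if "j \<in> I" for j by (rule partial_isometry_right[OF _ f]) (use t that in simp)
  have GE: "\<exists>j\<in>I. \<exists>k\<in>I. \<exists>b\<in>B. a = t j * b * star (t k)" if "a \<in> G" for a using that unfolding G_def by auto
  have mem: "t j * x * star (t k) \<in> C" if jk: "j \<in> I" "k \<in> I" and x: "x \<in> D" for j k x
  proof -
    have "(\<lambda>x. t j * x * star (t k)) ` cspan B = cspan ((\<lambda>x. t j * x * star (t k)) ` B)"
      by (rule linear_image_cspan) (auto simp: algebra_simps mult_scaleC_left mult_scaleC_right)
    moreover have "(\<lambda>x. t j * x * star (t k)) ` B \<subseteq> G" unfolding G_def using jk by force
    ultimately show ?thesis using x complex_vector.span_mono unfolding C_def B(2) by blast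
  qed
  have pt: "p * t k = t k" if "k \<in> I" for k
  proof -
    have "p * t k = (\<Sum>j\<in>I. if j = k then t k else 0)" unfolding p_def sum_distrib_right
      using t that tf by (intro sum.cong) (auto simp: mult.assoc)
    thus ?thesis using I that by simp
  qed
  have sp: "star p = p" by (simp add: p_def star_sum star_mult star_star)
  have tp: "star (t k) * p = star (t k)" if "k \<in> I" for k
  proof -
    have "star (p * t k) = star (t k)" by (simp only: pt[OF that])
    thus ?thesis by (simp only: star_mult sp)
  qed
  have GG: "a * b \<in> cspan G" if ab: "a \<in> G" "b \<in> G" for a b
  proof -
    obtain j k x where a: "j \<in> I" "k \<in> I" "x \<in> B" "a = t j * x * star (t k)" using GE[OF ab(1)] by blast
    obtain l m y where b: "l \<in> I" "m \<in> I" "y \<in> B" "b = t l * y * star (t m)" using GE[OF ab(2)] by blast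
    have "a * b = t j * (x * (star (t k) * t l) * y) * star (t m)" by (simp add: a b mult.assoc)
    also have "\<dots> = (if k = l then t j * (x * y) * star (t m) else 0)" using t[OF a(2) b(1)] mult_eq_left[OF D'(2)[OF BD[OF b(3)]]] D'(2)[OF BD[OF b(3)]] by (simp add: mult.assoc)
    also have "\<dots> \<in> cspan G" using mem[OF a(1) b(2) D'(4)[OF BD[OF a(3)] BD[OF b(3)]]] complex_vector.span_zero[of G] by (auto simp: C_def)
    finally show ?thesis .
  qed
  have Gs: "star a \<in> cspan G" if aG: "a \<in> G" for a
  proof -
    obtain j k x where a: "j \<in> I" "k \<in> I" "x \<in> B" "a = t j * x * star (t k)" using GE[OF aG] by blast
    have "star a = t k * star x * star (t j)" by (simp add: a star_mult star_star mult.assoc)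
    thus ?thesis using mem[OF a(2,1) D'(5)[OF BD[OF a(3)]]] by (simp add: C_def)
  qed
  have "cstar_subalgebra C"
    unfolding cstar_subalgebra_def C_def using cspan_closure_props[of G] GG Gs closed_cspan_finite[OF finG] by (auto simp: complex_vector.subspace_span)
  moreover have "finite_dimensional C" unfolding finite_dimensional_def C_def using finG by blast
  moreover have "p \<in> C"
  proof -
    have "t j * star (t j) \<in> C" if "j \<in> I" for j using mem[OF that that D'(1)] tf[OF that] by simp
    thus ?thesis unfolding p_def C_def by (intro complex_vector.span_sum)
  qed
  moreover have "p * c = c" "c * p = c" if "c \<in> C" for c
  proof -
    have g: "p * a = a" "a * p = a" if "a \<in> G" for a
      using GE[OF that] pt tp by (auto simp: mult.assoc[symmetric]) (auto simp: mult.assoc)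
    show "p * c = c" using that unfolding C_def
      by (induction rule: complex_vector.span_induct_alt) (auto simp: distrib_left mult_scaleC_right g)
    show "c * p = c" using that unfolding C_def
      by (induction rule: complex_vector.span_induct_alt) (auto simp: distrib_right mult_scaleC_left g)
  qed
  ultimately show ?thesis using mem unfolding unital_fd_def by blast
qed

subsection \<open>Reduction to generators\<close>

text \<open>The commutation and distance requirements of tracial rank zero for a single
  element.\<close>

definition near :: "'a::cstar_algebra \<Rightarrow> 'a set \<Rightarrow> 'a \<Rightarrow> real \<Rightarrow> bool" where
  "near p C x \<delta> \<longleftrightarrow> norm (p * x - x * p) \<le> \<delta> \<and> (\<exists>c\<in>C. norm (p * x * p - c) \<le> \<delta>)"

lemma near_mono: "near p C x \<delta> \<Longrightarrow> \<delta> \<le> \<epsilon> \<Longrightarrow> near p C x \<epsilon>"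
  by (force simp: near_def)

lemma unital_fdD:
  assumes "unital_fd p C"
  shows "csubspace C" "x \<in> C \<Longrightarrow> y \<in> C \<Longrightarrow> x * y \<in> C" "x \<in> C \<Longrightarrow> star x \<in> C"
  using assms by (auto simp: unital_fd_def cstar_subalgebra_def)

lemma norm_mult_contraction:
  fixes p x :: "'a::cstar_algebra"
  assumes "norm p \<le> 1" shows "norm (p * x) \<le> norm x" "norm (x * p) \<le> norm x"
  using norm_mult_ineq[of p x] norm_mult_ineq[of x p] mult_right_mono[OF assms, of "norm x"] mult_left_mono[OF assms, of "norm x"] by auto

lemma near_star:
  assumes "unital_fd p C" "projection p" "near p C x \<delta>" shows "near p C (star x) \<delta>"
proof -
  note sp = projectionD(2)[OF assms(2)]
  obtain c where c: "c \<in> C" "norm (p * x * p - c) \<le> \<delta>" using assms(3) by (auto simp: near_def)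
  have "p * star x - star x * p = - star (p * x - x * p)" by (simp add: star_diff star_mult sp)
  hence "norm (p * star x - star x * p) \<le> \<delta>" using assms(3) by (simp only: norm_minus_cancel norm_star near_def)
  moreover have "p * star x * p - star c = star (p * x * p - c)" by (simp add: star_diff star_mult sp mult.assoc)
  hence "norm (p * star x * p - star c) \<le> \<delta>" using c(2) by (simp only: norm_star)
  ultimately show ?thesis using unital_fdD(3)[OF assms(1) c(1)] by (auto simp: near_def)
qed

lemma near_add:
  assumes "unital_fd p C" "near p C x \<delta>" "near p C y \<delta>'" shows "near p C (x + y) (\<delta> + \<delta>')"
proof -
  obtain c c' where c: "c \<in> C" "norm (p * x * p - c) \<le> \<delta>" "c' \<in> C" "norm (p * y * p - c') \<le> \<delta>'" using assms(2,3) by (auto simp: near_def)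
  have "p * (x + y) - (x + y) * p = (p * x - x * p) + (p * y - y * p)" by (simp add: algebra_simps)
  hence "norm (p * (x + y) - (x + y) * p) \<le> \<delta> + \<delta>'" using assms(2,3) norm_triangle_mono unfolding near_def by metis
  moreover have "p * (x + y) * p - (c + c') = (p * x * p - c) + (p * y * p - c')" by (simp add: algebra_simps)
  hence "norm (p * (x + y) * p - (c + c')) \<le> \<delta> + \<delta>'" using c norm_triangle_mono by metis
  ultimately show ?thesis using complex_vector.subspace_add[OF unital_fdD(1)[OF assms(1)] c(1,3)] by (auto simp: near_def)
qed

lemma near_mult:
  assumes C: "unital_fd p C" and p: "projection p" and x: "near p C x \<delta>" and y: "near p C y \<delta>" and \<delta>: "\<delta> \<le> 1"
  shows "near p C (x * y) (\<delta> * (2 * norm x + norm y + 1))"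
proof -
  note pp = projectionD[OF p]
  have np: "norm p \<le> 1" by (rule projection_norm_le[OF p])
  have \<delta>0: "\<delta> \<ge> 0" using x norm_ge_zero order_trans unfolding near_def by blast
  obtain c c' where c: "c \<in> C" "norm (p * x * p - c) \<le> \<delta>" "c' \<in> C" "norm (p * y * p - c') \<le> \<delta>" using x y by (auto simp: near_def)
  have cx: "norm (p * x - x * p) \<le> \<delta>" "norm (p * y - y * p) \<le> \<delta>" using x y by (auto simp: near_def)
  have "p * (x * y) - x * y * p = (p * x - x * p) * y + x * (p * y - y * p)" by (simp add: algebra_simps)
  hence "norm (p * (x * y) - x * y * p) \<le> norm ((p * x - x * p) * y) + norm (x * (p * y - y * p))" by (metis norm_triangle_ineq)
  also have "norm ((p * x - x * p) * y) \<le> \<delta> * norm y" by (rule order_trans[OF norm_mult_ineq mult_right_mono[OF cx(1)]]) simp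
  also have "norm (x * (p * y - y * p)) \<le> norm x * \<delta>" by (rule order_trans[OF norm_mult_ineq mult_left_mono[OF cx(2)]]) simp
  also have "\<delta> * norm y + norm x * \<delta> \<le> \<delta> * (2 * norm x + norm y + 1)" using \<delta>0 by (simp add: algebra_simps)
  finally have 1: "norm (p * (x * y) - x * y * p) \<le> \<delta> * (2 * norm x + norm y + 1)" by simp
  have nc: "norm c' \<le> norm y + 1"
  proof -
    have "norm (p * y * p) \<le> norm y" using norm_mult_contraction[OF np, of y] norm_mult_contraction[OF np, of "p * y"] by linarith
    thus ?thesis using norm_triangle_ineq4[of "p * y * p" "p * y * p - c'"] c(4) \<delta> by simp
  qed
  \<comment> \<open>Up to a commutator, \<open>p * x * y * p\<close> is the product of the two
    compressions; the last two terms replace these by \<open>c\<close> and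
    \<open>c'\<close>.\<close>
  have "p * (x * y) * p - c * c' = p * (x * ((y * p - p * y) * p)) + (p * x * p) * (p * y * p - c') + (p * x * p - c) * c'"
    by (simp add: algebra_simps mult_eq_left[OF pp(1)] pp(1))
  hence "norm (p * (x * y) * p - c * c') \<le> norm (p * (x * ((y * p - p * y) * p))) + norm ((p * x * p) * (p * y * p - c')) + norm ((p * x * p - c) * c')"
    by (metis norm_triangle_mono norm_triangle_ineq order_refl)
  also have "norm (p * (x * ((y * p - p * y) * p))) \<le> norm x * \<delta>"
  proof -
    have "norm (p * (x * ((y * p - p * y) * p))) \<le> norm (x * ((y * p - p * y) * p))" by (rule norm_mult_contraction[OF np])
    also have "\<dots> \<le> norm x * norm ((y * p - p * y) * p)" by (rule norm_mult_ineq)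
    also have "norm ((y * p - p * y) * p) \<le> norm (y * p - p * y)" by (rule norm_mult_contraction[OF np])
    also have "\<dots> \<le> \<delta>" using cx(2) by (simp add: norm_minus_commute)
    finally show ?thesis by (simp add: mult_left_mono)
  qed
  also have "norm ((p * x * p) * (p * y * p - c')) \<le> norm x * \<delta>"
  proof (rule order_trans[OF norm_mult_ineq mult_mono[OF _ c(4)]])
    show "norm (p * x * p) \<le> norm x" using norm_mult_contraction[OF np, of x] norm_mult_contraction[OF np, of "p * x"] by linarith
  qed auto
  also have "norm ((p * x * p - c) * c') \<le> \<delta> * (norm y + 1)"
    by (rule order_trans[OF norm_mult_ineq mult_mono[OF c(2) nc]]) (use \<delta>0 in auto)
  finally have "norm (p * (x * y) * p - c * c') \<le> \<delta> * (2 * norm x + norm y + 1)" by (simp add: algebra_simps)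
  thus ?thesis using 1 unital_fdD(2)[OF C c(1,3)] by (auto simp: near_def)
qed

context covariant begin

definition controlled :: "real \<Rightarrow> 'a set \<Rightarrow> 'b \<Rightarrow> real \<Rightarrow> bool" where
  "controlled \<delta> G x \<epsilon> \<longleftrightarrow> (\<forall>p C. projection p \<and> unital_fd p C \<and> near p C u \<delta> \<and> (\<forall>d\<in>G. near p C (\<pi> d) \<delta>) \<longrightarrow> near p C x \<epsilon>)"

text \<open>The tolerance and the finite set are chosen before \<open>p\<close> and
  \<open>C\<close>, so a projection built for \<open>u\<close> and finitely many
  \<open>\<pi> d\<close> serves \<open>x\<close> as well.\<close>

definition generates :: "'b \<Rightarrow> bool" where
  "generates x \<longleftrightarrow> (\<forall>\<epsilon>>0. \<exists>\<delta>>0. \<exists>G. finite G \<and> controlled \<delta> G x \<epsilon>)"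

lemma controlled_mono:
  assumes "controlled \<delta>' G' x \<epsilon>" "\<delta> \<le> \<delta>'" "G' \<subseteq> G"
  shows "controlled \<delta> G x \<epsilon>"
  unfolding controlled_def
proof (intro allI impI)
  fix p C assume H: "projection p \<and> unital_fd p C \<and> near p C u \<delta> \<and> (\<forall>d\<in>G. near p C (\<pi> d) \<delta>)"
  hence "near p C u \<delta>'" "\<forall>d\<in>G'. near p C (\<pi> d) \<delta>'" using near_mono[OF _ assms(2)] assms(3) by blast+
  with H show "near p C x \<epsilon>" using assms(1) unfolding controlled_def by blast
qed

lemma generates_u: "generates u" unfolding generates_def controlled_def by blast

lemma generates_\<pi>: "generates (\<pi> a)"
  unfolding generates_def
proof (intro allI impI)
  fix \<epsilon> :: real assume "\<epsilon> > 0"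
  thus "\<exists>\<delta>>0. \<exists>G. finite G \<and> controlled \<delta> G (\<pi> a) \<epsilon>"
    by (intro exI[of _ \<epsilon>] conjI exI[of _ "{a}"]) (auto simp: controlled_def)
qed

lemma generates_star: assumes "generates x" shows "generates (star x)"
  unfolding generates_def
proof (intro allI impI)
  fix \<epsilon> :: real assume "\<epsilon> > 0"
  with assms obtain \<delta> G where d: "\<delta> > 0" "finite G" "controlled \<delta> G x \<epsilon>" unfolding generates_def by blast
  have "controlled \<delta> G (star x) \<epsilon>" unfolding controlled_def
  proof (intro allI impI)
    fix p C assume H: "projection p \<and> unital_fd p C \<and> near p C u \<delta> \<and> (\<forall>d\<in>G. near p C (\<pi> d) \<delta>)"
    hence "near p C x \<epsilon>" using d(3) unfolding controlled_def by blast
    thus "near p C (star x) \<epsilon>" using near_star H by blast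
  qed
  thus "\<exists>\<delta>>0. \<exists>G. finite G \<and> controlled \<delta> G (star x) \<epsilon>" using d(1,2) by blast
qed

lemma generates_finite:
  assumes "finite X" "\<forall>x\<in>X. generates x" "\<epsilon> > 0"
  shows "\<exists>\<delta>>0. \<exists>G. finite G \<and> (\<forall>x\<in>X. controlled \<delta> G x \<epsilon>)"
  using assms(1,2)
proof (induction X rule: finite_induct)
  case empty show ?case by (rule exI[of _ 1]) auto
next
  case (insert x X)
  from insert.prems have gx: "generates x" and gX: "\<forall>x\<in>X. generates x" by auto
  from insert.IH[OF gX] obtain \<delta> G where 1: "\<delta> > 0" "finite G" "\<forall>x\<in>X. controlled \<delta> G x \<epsilon>" by blast
  from gx assms(3) obtain \<delta>' G' where 2: "\<delta>' > 0" "finite G'" "controlled \<delta>' G' x \<epsilon>" unfolding generates_def by blast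
  have "controlled (min \<delta> \<delta>') (G \<union> G') x \<epsilon>" by (rule controlled_mono[OF 2(3)]) auto
  moreover have "controlled (min \<delta> \<delta>') (G \<union> G') y \<epsilon>" if "y \<in> X" for y
    by (rule controlled_mono[OF 1(3)[rule_format, OF that]]) auto
  moreover have "min \<delta> \<delta>' > 0" "finite (G \<union> G')" using 1 2 by auto
  ultimately show ?case by blast
qed

lemma generates_by:
  assumes "finite X" "\<forall>x\<in>X. generates x" 
    and D: "\<And>\<epsilon>. \<epsilon> > 0 \<Longrightarrow> \<exists>\<delta>>0. \<forall>p C. projection p \<and> unital_fd p C \<and> (\<forall>x\<in>X. near p C x \<delta>) \<longrightarrow> near p C y \<epsilon>"
  shows "generates y"
  unfolding generates_def
proof (intro allI impI)
  fix \<epsilon> :: real assume "\<epsilon> > 0"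
  from D[OF this] obtain \<delta> where \<delta>: "\<delta> > 0" "\<forall>p C. projection p \<and> unital_fd p C \<and> (\<forall>x\<in>X. near p C x \<delta>) \<longrightarrow> near p C y \<epsilon>" by blast
  from generates_finite[OF assms(1,2) \<delta>(1)] obtain \<delta>' G where G: "\<delta>' > 0" "finite G" "\<forall>x\<in>X. controlled \<delta>' G x \<delta>" by blast
  have "controlled \<delta>' G y \<epsilon>" using G(3) \<delta>(2) unfolding controlled_def by blast
  thus "\<exists>\<delta>>0. \<exists>G. finite G \<and> controlled \<delta> G y \<epsilon>" using G by blast
qed

lemma generates_add: assumes "generates x" "generates y" shows "generates (x + y)"
proof (rule generates_by[of "{x, y}"])
  fix \<epsilon> :: real assume "\<epsilon> > 0"
  moreover have "near p C (x + y) \<epsilon>" if "unital_fd p C" "near p C x (\<epsilon> / 2)" "near p C y (\<epsilon> / 2)" for p C using near_add[OF that] by simp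
  ultimately show "\<exists>\<delta>>0. \<forall>p C. projection p \<and> unital_fd p C \<and> (\<forall>x\<in>{x, y}. near p C x \<delta>) \<longrightarrow> near p C (x + y) \<epsilon>"
    by (intro exI[of _ "\<epsilon> / 2"]) auto
qed (use assms in auto)

lemma generates_mult: assumes "generates x" "generates y" shows "generates (x * y)"
proof (rule generates_by[of "{x, y}"])
  fix \<epsilon> :: real assume \<epsilon>: "\<epsilon> > 0"
  define K where "K = 2 * norm x + norm y + 1"
  have K: "K > 0" by (simp add: K_def add_nonneg_pos)
  define \<delta> where "\<delta> = min 1 (\<epsilon> / K)"
  have \<delta>: "\<delta> > 0" "\<delta> \<le> 1" using \<epsilon> K by (auto simp: \<delta>_def)
  have "\<delta> \<le> \<epsilon> / K" by (simp add: \<delta>_def)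
  hence "\<delta> * K \<le> \<epsilon>" using K by (simp add: pos_le_divide_eq)
  hence "near p C (x * y) \<epsilon>" if "projection p" "unital_fd p C" "near p C x \<delta>" "near p C y \<delta>" for p C
    using near_mult[OF that(2,1,3,4) \<delta>(2)] near_mono unfolding K_def[symmetric] by blast
  thus "\<exists>\<delta>>0. \<forall>p C. projection p \<and> unital_fd p C \<and> (\<forall>x\<in>{x, y}. near p C x \<delta>) \<longrightarrow> near p C (x * y) \<epsilon>" using \<delta>(1) by auto
qed (use assms in auto)

lemma generates_U: "generates (U k)"
proof (induction k rule: int_induct[where k = 0])
  case base show ?case using generates_\<pi>[of 1] by simp
next
  case (step1 i) thus ?case using generates_mult[OF generates_u] by (simp add: unitary_powi_Suc[OF u])
next
  case (step2 i) thus ?case using generates_mult[OF generates_star[OF generates_u]] by (simp add: unitary_powi_pred[OF u])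
qed

lemma generates_form: "finite S \<Longrightarrow> generates (form S f)"
proof (induction S rule: finite_induct)
  case empty show ?case using generates_\<pi>[of 0] by (simp add: form_def \<pi>_simps)
next
  case (insert k S)
  thus ?case using generates_add[OF generates_mult[OF generates_\<pi> generates_U]] by (simp add: form_def)
qed

lemma near_perturb:
  assumes p: "projection p" and x: "near p C x \<delta>" shows "near p C y (\<delta> + 2 * norm (x - y))"
proof -
  have np: "norm p \<le> 1" by (rule projection_norm_le[OF p])
  obtain c where c: "c \<in> C" "norm (p * x * p - c) \<le> \<delta>" using x by (auto simp: near_def)
  have "p * y - y * p = (p * x - x * p) - (p * (x - y) - (x - y) * p)" by (simp add: algebra_simps)
  hence "norm (p * y - y * p) \<le> norm (p * x - x * p) + norm (p * (x - y) - (x - y) * p)" by (metis norm_triangle_ineq4)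
  also have "norm (p * (x - y) - (x - y) * p) \<le> norm (p * (x - y)) + norm ((x - y) * p)" by (rule norm_triangle_ineq4)
  finally have 1: "norm (p * y - y * p) \<le> \<delta> + 2 * norm (x - y)" using norm_mult_contraction[OF np, of "x - y"] x by (simp add: near_def)
  have "p * y * p - c = (p * x * p - c) - p * (x - y) * p" by (simp add: algebra_simps)
  hence "norm (p * y * p - c) \<le> norm (p * x * p - c) + norm (p * (x - y) * p)" by (metis norm_triangle_ineq4)
  moreover have "norm (p * (x - y) * p) \<le> norm (x - y)" using norm_mult_contraction[OF np, of "x - y"] norm_mult_contraction[OF np, of "p * (x - y)"] by linarith
  ultimately have "norm (p * y * p - c) \<le> \<delta> + 2 * norm (x - y)" using c(2) norm_ge_zero[of "x - y"] by linarith
  thus ?thesis using 1 c(1) by (auto simp: near_def)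
qed

end

text \<open>Finite forms are sums of products of generators, and \<open>near_perturb\<close> passes
  to their norm limits.\<close>

lemma (in crossed) generates_all: "generates x"
  unfolding generates_def
proof (intro allI impI)
  fix \<epsilon> :: real assume \<epsilon>: "\<epsilon> > 0"
  then obtain S f where S: "finite S" "norm (form S f - x) < \<epsilon> / 4" using approx_form[of "\<epsilon> / 4" x] by auto
  have "\<epsilon> / 2 > 0" using \<epsilon> by simp
  with generates_form[OF S(1), of f] obtain \<delta> G where \<delta>: "\<delta> > 0" "finite G" "controlled \<delta> G (form S f) (\<epsilon> / 2)"
    unfolding generates_def by blast
  have "near p C x \<epsilon>" if H: "projection p" "unital_fd p C" "near p C u \<delta>" "\<forall>d\<in>G. near p C (\<pi> d) \<delta>" for p C
  proof -
    have "near p C (form S f) (\<epsilon> / 2)" using \<delta>(3) H unfolding controlled_def by blast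
    from near_perturb[OF H(1) this, of x] show ?thesis by (rule near_mono) (use S(2) in simp)
  qed
  hence "controlled \<delta> G x \<epsilon>" unfolding controlled_def by blast
  thus "\<exists>\<delta>>0. \<exists>G. finite G \<and> controlled \<delta> G x \<epsilon>" using \<delta>(1,2) by blast
qed

subsection \<open>Berg's exchange of tails\<close>

text \<open>Partial isometries with common source \<open>f\<close> and orthogonal ranges: one column
  of a system of matrix units.\<close>

definition frame :: "'a::cstar_algebra \<Rightarrow> nat set \<Rightarrow> (nat \<Rightarrow> 'a) \<Rightarrow> bool" where
  "frame f I t \<longleftrightarrow> finite I \<and> projection f \<and> (\<forall>j\<in>I. \<forall>k\<in>I. star (t j) * t k = (if j = k then f else 0))"

lemma frameD:
  assumes "frame f I t"
  shows "finite I" "projection f" "j \<in> I \<Longrightarrow> k \<in> I \<Longrightarrow> star (t j) * t k = (if j = k then f else 0)"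
    "j \<in> I \<Longrightarrow> t j * f = t j" "j \<in> I \<Longrightarrow> f * star (t j) = star (t j)" "j \<in> I \<Longrightarrow> norm (t j) \<le> 1"
proof -
  show 1: "finite I" "projection f" "\<And>j k. j \<in> I \<Longrightarrow> k \<in> I \<Longrightarrow> star (t j) * t k = (if j = k then f else 0)"
    using assms by (auto simp: frame_def)
  have 2: "star (t j) * t j = f" if "j \<in> I" for j using 1(3)[OF that that] by simp
  show 3: "t j * f = t j" if "j \<in> I" for j by (rule partial_isometry_right[OF 2[OF that] 1(2)])
  show "f * star (t j) = star (t j)" if "j \<in> I" for j
    using arg_cong[OF 3[OF that], of star] by (simp add: star_mult projectionD[OF 1(2)])
  show "norm (t j) \<le> 1" if "j \<in> I" for j by (rule norm_eq_one_if_star_mult[OF 2[OF that] projection_norm_le[OF 1(2)]])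
qed

lemma frame_subset: "frame f I t \<Longrightarrow> I' \<subseteq> I \<Longrightarrow> frame f I' t"
  unfolding frame_def using finite_subset by blast

lemma frame_mult:
  assumes t: "frame f I t"
  shows "(\<Sum>i\<in>I. y i * star (t i)) * (\<Sum>k\<in>I. t k * z k) = (\<Sum>i\<in>I. y i * f * z i)"
proof -
  have "(\<Sum>i\<in>I. y i * star (t i)) * (\<Sum>k\<in>I. t k * z k) = (\<Sum>i\<in>I. \<Sum>k\<in>I. y i * (star (t i) * t k) * z k)"
    by (simp add: sum_product mult.assoc)
  also have "\<dots> = (\<Sum>i\<in>I. \<Sum>k\<in>I. if i = k then y i * f * z i else 0)"
    by (intro sum.cong refl) (simp add: frameD(3)[OF t])
  also have "\<dots> = (\<Sum>i\<in>I. y i * f * z i)" using frameD(1)[OF t] by simp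
  finally show ?thesis .
qed

lemma frame_left:
  assumes t: "frame f I t" and i: "i \<in> I" shows "(\<Sum>j\<in>I. t j * star (t j)) * t i = t i"
proof -
  have "(\<Sum>j\<in>I. t j * star (t j)) * t i = (\<Sum>j\<in>I. t j * (star (t j) * t i))" by (simp add: sum_distrib_right mult.assoc)
  also have "\<dots> = (\<Sum>j\<in>I. if j = i then t i * f else 0)" using i by (intro sum.cong refl) (simp add: frameD(3)[OF t])
  also have "\<dots> = t i" using i frameD(1)[OF t] frameD(4)[OF t i] by simp
  finally show ?thesis .
qed

lemma frame_mult_proj:
  assumes t: "frame f I t" shows "(\<Sum>i\<in>I. y i * star (t i)) * (\<Sum>k\<in>I. t k * star (t k)) = (\<Sum>i\<in>I. y i * star (t i))"
  unfolding frame_mult[OF t] by (intro sum.cong refl) (simp add: frameD(5)[OF t] mult.assoc)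

lemma frame_projection:
  assumes t: "frame f I t" shows "projection (\<Sum>i\<in>I. t i * star (t i))"
  unfolding projection_def using frame_mult_proj[OF t] by (simp add: star_sum star_mult star_star)

text \<open>Orthogonality of the \<open>y i\<close> and of the \<open>t i\<close> gives the bound
  \<open>c\<close> without a factor for the number of indices; this keeps the total rotation error
  at the size of one step.\<close>

lemma frame_transport_norm:
  assumes t: "frame f I t" and y: "\<And>i k. i \<in> I \<Longrightarrow> k \<in> I \<Longrightarrow> star (y i) * y k = (if i = k then (c * c) *\<^sub>R f else 0)" and c: "c \<ge> 0"
  shows "norm (\<Sum>i\<in>I. y i * star (t i)) \<le> c"
proof -
  let ?Y = "\<Sum>i\<in>I. y i * star (t i)"
  have "star ?Y * ?Y = (\<Sum>i\<in>I. \<Sum>k\<in>I. t i * (star (y i) * y k) * star (t k))"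
    by (simp add: star_sum star_mult star_star sum_product mult.assoc)
  also have "\<dots> = (\<Sum>i\<in>I. \<Sum>k\<in>I. if i = k then (c * c) *\<^sub>R (t i * star (t i)) else 0)"
    by (intro sum.cong refl) (simp add: y frameD(4)[OF t])
  also have "\<dots> = (c * c) *\<^sub>R (\<Sum>i\<in>I. t i * star (t i))" using frameD(1)[OF t] by (simp add: scaleR_sum_right)
  finally have "(norm ?Y)\<^sup>2 = (c * c) * norm (\<Sum>i\<in>I. t i * star (t i))" by (simp add: cstar_identity[symmetric] c)
  also have "\<dots> \<le> c * c" using projection_norm_le[OF frame_projection[OF t]] c by (simp add: mult_left_le)
  also have "\<dots> = c\<^sup>2" by (simp add: power2_eq_square)
  finally show ?thesis by (rule power2_le_imp_le) (rule c)
qed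

lemma frame_equiv:
  assumes t: "frame f I t" and r: "frame f I r"
  shows "proj_equiv (\<Sum>i\<in>I. t i * star (t i)) (\<Sum>i\<in>I. r i * star (r i))"
proof -
  define v where "v = (\<Sum>i\<in>I. r i * star (t i))"
  have sv: "star v = (\<Sum>i\<in>I. t i * star (r i))" by (simp add: v_def star_sum star_mult star_star)
  have "star v * v = (\<Sum>i\<in>I. t i * star (t i))" unfolding sv unfolding v_def frame_mult[OF r] by (intro sum.cong refl) (simp add: frameD(4)[OF t])
  moreover have "v * star v = (\<Sum>i\<in>I. r i * star (r i))" unfolding sv unfolding v_def frame_mult[OF t] by (intro sum.cong refl) (simp add: frameD(4)[OF r])
  ultimately show ?thesis using frame_projection[OF t] frame_projection[OF r] unfolding proj_equiv_def by blast
qed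

text \<open>The vectors \<open>s (S + i)\<close>, \<open>1 \<le> i \<le> L\<close>, are rotated gradually into \<open>s i * \<omega>\<close>, so that \<open>u\<close> moves the last
  one close to \<open>s (L + 1) * \<omega>\<close>, which closes the cycle \<open>t (L + 1), \<dots>, t (S + L)\<close>.\<close>

locale berg =
  fixes f \<omega> u :: "'b::cstar_algebra" and s :: "nat \<Rightarrow> 'b" and L S :: nat and \<eta> :: real
  assumes L: "1 \<le> L" "L < S" and s: "frame f {1..S+L} s" and \<omega>: "star \<omega> * \<omega> = f" "\<omega> * star \<omega> = f"
    and u: "unitary u" and us: "\<And>j. 1 \<le> j \<Longrightarrow> j < S + L \<Longrightarrow> norm (u * s j - s (j + 1)) \<le> \<eta>"
begin

definition \<kappa> :: "nat \<Rightarrow> real" where "\<kappa> i = cos (pi * i / (2 * L))"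
definition \<sigma> :: "nat \<Rightarrow> real" where "\<sigma> i = sin (pi * i / (2 * L))"
definition mix :: "real \<Rightarrow> real \<Rightarrow> nat \<Rightarrow> 'b" where "mix a b i = a *\<^sub>R s (S + i) + b *\<^sub>R (s i * \<omega>)"
definition t :: "nat \<Rightarrow> 'b" where "t j = (if j \<le> S then s j else mix (\<kappa> (j - S)) (\<sigma> (j - S)) (j - S))"
definition p :: 'b where "p = (\<Sum>j\<in>{L+1..S+L}. t j * star (t j))"
text \<open>The intended value of \<open>u * t j\<close>: the next vector, and after the last one
  the first, twisted by \<omega>.\<close>

definition w :: "nat \<Rightarrow> 'b" where "w j = (if j = S + L then t (L + 1) * \<omega> else t (j + 1))"
definition W :: 'b where "W = (\<Sum>j\<in>{L+1..S+L}. w j * star (t j))"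

lemma \<kappa>_\<sigma>: "\<kappa> 0 = 1" "\<sigma> 0 = 0" "\<kappa> L = 0" "\<sigma> L = 1" "\<kappa> i * \<kappa> i + \<sigma> i * \<sigma> i = 1" "\<bar>\<kappa> i\<bar> \<le> 1" "\<bar>\<sigma> i\<bar> \<le> 1"
  using L sin_cos_squared_add3[of "pi * i / (2 * L)"] by (auto simp: \<kappa>_def \<sigma>_def)

text \<open>The chord between consecutive points of a quarter circle divided into \<open>L\<close>
  equal arcs.\<close>

lemma chord: "(\<kappa> i - \<kappa> (i + 1)) * (\<kappa> i - \<kappa> (i + 1)) + (\<sigma> i - \<sigma> (i + 1)) * (\<sigma> i - \<sigma> (i + 1)) = (2 * sin (pi / (4 * L))) * (2 * sin (pi / (4 * L)))"
proof -
  define x y where "x = pi * i / (2 * L)" and "y = pi * (i + 1) / (2 * L)"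
  have yx: "y - x = 2 * (pi / (4 * L))" using L by (simp add: x_def y_def field_simps)
  have "(cos x - cos y) * (cos x - cos y) + (sin x - sin y) * (sin x - sin y) = (cos x * cos x + sin x * sin x) + (cos y * cos y + sin y * sin y) - 2 * (cos y * cos x + sin y * sin x)"
    by (simp add: algebra_simps)
  also have "\<dots> = 2 - 2 * cos (y - x)" by (simp add: cos_diff sin_cos_squared_add3)
  also have "\<dots> = 4 * (sin (pi / (4 * L)))\<^sup>2" unfolding yx cos_double_sin by simp
  finally show ?thesis by (simp add: \<kappa>_def \<sigma>_def x_def y_def power2_eq_square)
qed

lemma chord_bounds: "0 \<le> 2 * sin (pi / (4 * L))" "2 * sin (pi / (4 * L)) \<le> 2 / L"
proof -
  have "pi / (4 * L) \<le> pi" using L by (simp add: field_simps)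
  thus "0 \<le> 2 * sin (pi / (4 * L))" by (simp add: sin_ge_zero)
  have "sin (pi / (4 * L)) \<le> pi / (4 * L)" by (rule sin_x_le_x) simp
  also have "\<dots> \<le> 1 / L" using L pi_less_4 by (simp add: field_simps)
  finally show "2 * sin (pi / (4 * L)) \<le> 2 / L" by simp
qed

lemma f: "projection f" by (rule frameD(2)[OF s])

lemma \<omega>f: "f * \<omega> = \<omega>" "\<omega> * f = \<omega>" "star \<omega> * f = star \<omega>" "norm \<omega> \<le> 1"
proof -
  show 1: "\<omega> * f = \<omega>" by (rule partial_isometry_right[OF \<omega>(1) f])
  show 2: "f * \<omega> = \<omega>" by (rule proj_equiv_left[OF \<omega> f])
  show "star \<omega> * f = star \<omega>" using arg_cong[OF 2, of star] by (simp add: star_mult projectionD[OF f])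
  show "norm \<omega> \<le> 1" by (rule norm_eq_one_if_star_mult[OF \<omega>(1) projection_norm_le[OF f]])
qed

lemma mix_mult:
  assumes ik: "i \<in> {1..L}" "k \<in> {1..L}"
  shows "star (mix a b i) * mix a' b' k = (if i = k then (a * a' + b * b') *\<^sub>R f else 0)"
proof -
  have 1: "star (s (S + i)) * s (S + k) = (if i = k then f else 0)" "star (s i) * s k = (if i = k then f else 0)"
    "star (s (S + i)) * s k = 0" "star (s i) * s (S + k) = 0" using ik L by (auto simp: frameD(3)[OF s])
  have "star (mix a b i) * mix a' b' k = (a * a') *\<^sub>R (star (s (S + i)) * s (S + k)) + (b * b') *\<^sub>R (star \<omega> * (star (s i) * s k) * \<omega>)
      + (a * b') *\<^sub>R ((star (s (S + i)) * s k) * \<omega>) + (b * a') *\<^sub>R (star \<omega> * (star (s i) * s (S + k)))"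
    by (simp add: mix_def star_add star_scaleR star_mult algebra_simps)
  also have "\<dots> = (if i = k then (a * a' + b * b') *\<^sub>R f else 0)" unfolding 1 using \<omega>f \<omega> by (simp add: scaleR_left.add)
  finally show ?thesis .
qed

lemma mix_s:
  assumes ij: "i \<in> {1..L}" "j \<in> {L+1..S}"
  shows "star (mix a b i) * s j = 0" "star (s j) * mix a b i = 0"
proof -
  have 1: "star (s (S + i)) * s j = 0" "star (s i) * s j = 0" "star (s j) * s (S + i) = 0" "star (s j) * s i = 0"
    using ij L by (auto simp: frameD(3)[OF s])
  show "star (mix a b i) * s j = 0" using 1(1,2) by (simp add: mix_def star_add star_scaleR star_mult algebra_simps)
  have "star (s j) * mix a b i = a *\<^sub>R (star (s j) * s (S + i)) + b *\<^sub>R ((star (s j) * s i) * \<omega>)" by (simp add: mix_def algebra_simps)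
  thus "star (s j) * mix a b i = 0" unfolding 1 by simp
qed

lemma t_frame: "frame f {L+1..S+L} t"
  unfolding frame_def
proof (intro conjI ballI f)
  fix j k assume jk: "j \<in> {L+1..S+L}" "k \<in> {L+1..S+L}"
  show "star (t j) * t k = (if j = k then f else 0)"
  proof (cases "j \<le> S")
    case j: True
    show ?thesis
    proof (cases "k \<le> S")
      case True thus ?thesis using j jk by (simp add: t_def frameD(3)[OF s])
    next
      case False
      hence "star (s j) * mix (\<kappa> (k - S)) (\<sigma> (k - S)) (k - S) = 0" using j jk by (intro mix_s) auto
      thus ?thesis using j False by (simp add: t_def)
    qed
  next
    case j: False
    show ?thesis
    proof (cases "k \<le> S")
      case True
      hence "star (mix (\<kappa> (j - S)) (\<sigma> (j - S)) (j - S)) * s k = 0" using j jk by (intro mix_s) auto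
      thus ?thesis using j True by (simp add: t_def)
    next
      case False
      have "star (mix (\<kappa> (j - S)) (\<sigma> (j - S)) (j - S)) * mix (\<kappa> (k - S)) (\<sigma> (k - S)) (k - S) = 
        (if j - S = k - S then (\<kappa> (j - S) * \<kappa> (k - S) + \<sigma> (j - S) * \<sigma> (k - S)) *\<^sub>R f else 0)" by (rule mix_mult) (use j False jk in auto)
      thus ?thesis using j False \<kappa>_\<sigma>(5) by (auto simp: t_def)
    qed
  qed
qed simp

lemma p_projection: "projection p" unfolding p_def by (rule frame_projection[OF t_frame])

lemma w_mult:
  assumes jk: "j \<in> {L+1..S+L}" "k \<in> {L+1..S+L}" shows "w j * f = w j" "p * w j = w j" 
proof -
  have tw: "\<exists>i\<in>{L+1..S+L}. w j = t i * f \<or> w j = t i * \<omega>" 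
  proof (cases "j = S + L")
    case True thus ?thesis using L by (intro bexI[of _ "L+1"]) (auto simp: w_def)
  next
    case False 
    hence "j + 1 \<in> {L+1..S+L}" using jk by auto
    thus ?thesis using False frameD(4)[OF t_frame] by (intro bexI[of _ "j+1"]) (auto simp: w_def)
  qed
  then obtain i where i: "i \<in> {L+1..S+L}" "w j = t i * f \<or> w j = t i * \<omega>" by blast
  show "w j * f = w j" using i(2) \<omega>f projectionD(1)[OF f] by (auto simp: mult.assoc)
  have "p * t i = t i" unfolding p_def by (rule frame_left[OF t_frame i(1)])
  thus "p * w j = w j" using i(2) by (auto simp: mult.assoc[symmetric])
qed

lemma p_nonzero: assumes "f \<noteq> 0" shows "p \<noteq> 0"
proof
  assume "p = 0"
  moreover have "p * t (L + 1) = t (L + 1)" unfolding p_def by (rule frame_left[OF t_frame]) (use L in auto)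
  ultimately have "t (L + 1) = 0" by simp
  thus False using frameD(3)[OF t_frame, of "L + 1" "L + 1"] L assms by simp
qed

lemma e_p: "(\<Sum>j\<in>{1..S+L}. s j * star (s j)) * p = p"
proof -
  let ?e = "\<Sum>j\<in>{1..S+L}. s j * star (s j)"
  have es: "?e * s j = s j" if "j \<in> {1..S+L}" for j by (rule frame_left[OF s that])
  have "?e * t j = t j" if j: "j \<in> {L+1..S+L}" for j
  proof (cases "j \<le> S")
    case True thus ?thesis using es[of j] j by (simp add: t_def)
  next
    case False
    have "?e * mix a b (j - S) = a *\<^sub>R (?e * s (S + (j - S))) + b *\<^sub>R ((?e * s (j - S)) * \<omega>)" for a b
      unfolding mix_def by (simp only: distrib_left mult_scaleR_right mult.assoc)
    moreover have "?e * s (S + (j - S)) = s (S + (j - S))" by (rule es) (use False j in auto)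
    moreover have "?e * s (j - S) = s (j - S)" by (rule es) (use False j in auto)
    ultimately have "?e * mix a b (j - S) = mix a b (j - S)" for a b unfolding mix_def by simp
    thus ?thesis using False by (simp add: t_def)
  qed
  thus ?thesis unfolding p_def sum_distrib_left by (intro sum.cong refl) (simp add: mult.assoc[symmetric])
qed

lemma W_p: "W * p = W" unfolding W_def p_def by (rule frame_mult_proj[OF t_frame])

text \<open>The ranges of the \<open>w j\<close> are those of the \<open>t j\<close>, cyclically
  permuted; \<omega> is unitary in the corner of \<open>f\<close> and disappears.\<close>

lemma W_star: "W * star W = p"
proof -
  have sW: "star W = (\<Sum>j\<in>{L+1..S+L}. t j * star (w j))" by (simp add: W_def star_sum star_mult star_star)
  have "W * star W = (\<Sum>j\<in>{L+1..S+L}. w j * f * star (w j))" unfolding sW unfolding W_def by (rule frame_mult[OF t_frame])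
  also have "\<dots> = (\<Sum>j\<in>{L+1..S+L}. w j * star (w j))" by (intro sum.cong refl) (simp add: w_mult)
  also have "{L+1..S+L} = insert (S+L) {L+1..<S+L}" using L by auto
  also have "(\<Sum>j\<in>insert (S+L) {L+1..<S+L}. w j * star (w j)) = w (S+L) * star (w (S+L)) + (\<Sum>j\<in>{L+1..<S+L}. w j * star (w j))" by simp
  also have "w (S+L) * star (w (S+L)) = t (L+1) * (\<omega> * star \<omega>) * star (t (L+1))" by (simp add: w_def star_mult mult.assoc)
  also have "\<dots> = t (L+1) * star (t (L+1))" unfolding \<omega> using frameD(4)[OF t_frame, of "L+1"] L by simp
  also have "(\<Sum>j\<in>{L+1..<S+L}. w j * star (w j)) = (\<Sum>j\<in>{L+1..<S+L}. t (j+1) * star (t (j+1)))" by (intro sum.cong refl) (simp add: w_def)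
  also have "\<dots> = (\<Sum>j\<in>{Suc (L+1)..<Suc (S+L)}. t j * star (t j))" unfolding sum.shift_bounds_Suc_ivl by simp
  also have "t (L+1) * star (t (L+1)) + \<dots> = p" unfolding p_def
    using L sum.atLeast_Suc_atMost[of "L+1" "S+L" "\<lambda>j. t j * star (t j)"] by (simp add: atLeastLessThanSuc_atLeastAtMost)
  finally show ?thesis .
qed

lemma us_step: assumes "1 \<le> j" "j < S + L" "norm x \<le> 1" "\<bar>r\<bar> \<le> 1" shows "norm (r *\<^sub>R ((u * s j - s (j + 1)) * x)) \<le> \<eta>"
proof -
  have \<eta>: "\<eta> \<ge> 0" using us[OF assms(1,2)] norm_ge_zero order_trans by blast
  have "norm ((u * s j - s (j + 1)) * x) \<le> \<eta> * 1" by (rule order_trans[OF norm_mult_ineq mult_mono[OF us[OF assms(1,2)] assms(3)]]) (use \<eta> in auto)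
  hence "\<bar>r\<bar> * norm ((u * s j - s (j + 1)) * x) \<le> 1 * \<eta>" using assms(4) by (intro mult_mono) auto
  thus ?thesis by simp
qed

text \<open>Each \<open>u * t j - w j\<close> is a shift error of size at most
  \<open>2 * \<eta>\<close> plus a rotation term \<open>z j\<close>. Shift errors are added one by
  one, rotation terms together by \<open>frame_transport_norm\<close>.\<close>

lemma up_W: "norm (u * p - W) \<le> 2 * real (S + L) * \<eta> + 2 / L"
proof -
  \<comment> \<open>The change of angle from one level to the next, in the plane of index
    \<open>j - S + 1\<close>; rotation begins at \<open>j = S\<close>, where the angle is
    zero.\<close>
  define y where "y j = mix (\<kappa> (j - S) - \<kappa> (j - S + 1)) (\<sigma> (j - S) - \<sigma> (j - S + 1)) (j - S + 1)" for j
  define z where "z j = (if j \<in> {S..<S+L} then y j else 0)" for j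
  let ?I = "{L+1..S+L}"
  have \<eta>: "\<eta> \<ge> 0" using us[of 1] L norm_ge_zero[of "u * s 1 - s (1 + 1)"] by linarith
  have E: "norm (u * t j - w j - z j) \<le> 2 * \<eta>" if j: "j \<in> ?I" for j
  proof -
    consider "j < S" | "j = S" | "S < j" "j < S + L" | "j = S + L" using j by force
    thus ?thesis
    proof cases
      case 1
      thus ?thesis using us[of j] j \<eta> by (simp add: t_def w_def z_def)
    next
      case 2
      have "w j + z j = s (S + 1)" using 2 L \<kappa>_\<sigma>(1,2) by (simp add: t_def w_def z_def y_def mix_def algebra_simps)
      hence "u * t j - w j - z j = u * s S - s (S + 1)" using 2 by (simp add: t_def algebra_simps)
      thus ?thesis using us[of S] L \<eta> by simp
    next
      case 3
      define i where "i = j - S"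
      have i: "j = S + i" "1 \<le> i" "i < L" using 3 by (auto simp: i_def)
      have "u * t j - w j - z j = \<kappa> i *\<^sub>R ((u * s (S + i) - s (S + i + 1)) * 1) + \<sigma> i *\<^sub>R ((u * s i - s (i + 1)) * \<omega>)"
        using i by (simp add: t_def w_def z_def y_def mix_def algebra_simps)
      moreover have "norm (\<kappa> i *\<^sub>R ((u * s (S + i) - s (S + i + 1)) * 1)) \<le> \<eta>" by (rule us_step) (use i \<kappa>_\<sigma> in auto)
      moreover have "norm (\<sigma> i *\<^sub>R ((u * s i - s (i + 1)) * \<omega>)) \<le> \<eta>" by (rule us_step) (use i \<kappa>_\<sigma> \<omega>f in auto)
      ultimately show ?thesis using norm_triangle_mono by fastforce
    next
      \<comment> \<open>At the full angle \<open>t (S + L)\<close> is \<open>s L * \<omega>\<close>,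
        so \<open>u\<close> moves it near \<open>s (L + 1) * \<omega>\<close>, which closes the
        cycle.\<close>
      case 4
      have "u * t j - w j - z j = 1 *\<^sub>R ((u * s L - s (L + 1)) * \<omega>)" using 4 L \<kappa>_\<sigma>(3,4) by (simp add: t_def w_def z_def mix_def algebra_simps)
      moreover have "norm (1 *\<^sub>R ((u * s L - s (L + 1)) * \<omega>)) \<le> \<eta>" by (rule us_step) (use L \<omega>f in auto)
      ultimately show ?thesis using \<eta> by simp
    qed
  qed
  have e1: "u * p - W = (\<Sum>j\<in>?I. (u * t j - w j - z j) * star (t j)) + (\<Sum>j\<in>?I. z j * star (t j))"
    by (simp add: p_def W_def sum_distrib_left sum_subtractf[symmetric] sum.distrib[symmetric] algebra_simps)
  have e2: "norm (\<Sum>j\<in>?I. (u * t j - w j - z j) * star (t j)) \<le> 2 * real (S + L) * \<eta>"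
  proof -
    have "norm (\<Sum>j\<in>?I. (u * t j - w j - z j) * star (t j)) \<le> (\<Sum>j\<in>?I. 2 * \<eta>)"
    proof (rule sum_norm_le)
      fix j assume j: "j \<in> ?I"
      have "norm ((u * t j - w j - z j) * star (t j)) \<le> 2 * \<eta> * 1"
        by (rule order_trans[OF norm_mult_ineq mult_mono[OF E[OF j]]]) (use frameD(6)[OF t_frame j] \<eta> in auto)
      thus "norm ((u * t j - w j - z j) * star (t j)) \<le> 2 * \<eta>" by simp
    qed
    also have "\<dots> = 2 * real S * \<eta>" by simp
    also have "\<dots> \<le> 2 * real (S + L) * \<eta>" using \<eta> by (intro mult_right_mono) auto
    finally show ?thesis .
  qed
  have e3: "norm (\<Sum>j\<in>?I. z j * star (t j)) \<le> 2 / L"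
  proof -
    have "(\<Sum>j\<in>?I. z j * star (t j)) = (\<Sum>j\<in>{S..<S+L}. y j * star (t j))"
      by (rule sum.mono_neutral_cong_right) (use L in \<open>auto simp: z_def\<close>)
    also have "norm \<dots> \<le> 2 * sin (pi / (4 * L))"
    proof (rule frame_transport_norm[OF frame_subset[OF t_frame] _ chord_bounds(1)])
      show "{S..<S+L} \<subseteq> ?I" using L by auto
      fix i k assume ik: "i \<in> {S..<S+L}" "k \<in> {S..<S+L}"
      hence "star (y i) * y k = (if i - S + 1 = k - S + 1 then ((\<kappa> (i - S) - \<kappa> (i - S + 1)) * (\<kappa> (k - S) - \<kappa> (k - S + 1)) + (\<sigma> (i - S) - \<sigma> (i - S + 1)) * (\<sigma> (k - S) - \<sigma> (k - S + 1))) *\<^sub>R f else 0)"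
        unfolding y_def by (intro mix_mult) auto
      moreover have "i - S + 1 = k - S + 1 \<longleftrightarrow> i = k" using ik by auto
      ultimately show "star (y i) * y k = (if i = k then (2 * sin (pi / (4 * L)) * (2 * sin (pi / (4 * L)))) *\<^sub>R f else 0)"
        using chord[of "i - S"] by (cases "i = k") simp_all
    qed
    also have "\<dots> \<le> 2 / L" by (rule chord_bounds)
    finally show ?thesis .
  qed
  show ?thesis unfolding e1 by (rule norm_triangle_mono[OF e2 e3])
qed

text \<open>Follows from \<open>up_W\<close> by taking adjoints, since \<open>W * star W = p\<close>
  and \<open>u\<close> is unitary.\<close>

lemma pu_W: "norm (p * u - W) \<le> 2 * real (S + L) * \<eta> + 2 / L"
proof -
  have uu: "u * star u = 1" "star u * u = 1" using u by (auto simp: unitary_def)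
  have sp: "star p = p" by (rule projectionD(2)[OF p_projection])
  have "W * star (u * p - W) * u = W * p * (star u * u) - (W * star W) * u" by (simp add: star_diff star_mult sp algebra_simps)
  hence eq: "p * u - W = - (W * star (u * p - W) * u)" unfolding uu W_star W_p by simp
  have "norm W \<le> 1" 
  proof -
    have "(norm (star W))\<^sup>2 \<le> 1\<^sup>2" unfolding cstar_identity[symmetric] star_star W_star using projection_norm_le[OF p_projection] by simp
    thus ?thesis by (simp only: norm_star power2_le_imp_le zero_le_one)
  qed
  have "norm (p * u - W) = norm (W * star (u * p - W))" unfolding eq by (simp add: norm_mult_unitary[OF u])
  also have "\<dots> \<le> norm (star (u * p - W))" by (rule norm_mult_contraction[OF \<open>norm W \<le> 1\<close>])
  also have "\<dots> = norm (u * p - W)" by (rule norm_star)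
  finally show ?thesis using up_W by linarith
qed

text \<open>In each rotated plane the orthogonal direction \<open>r i\<close> is what
  \<open>p\<close> leaves out. These \<open>L\<close> vectors form a frame over \<open>f\<close>, as
  do \<open>s 1\<close> up to \<open>s L\<close>.\<close>

lemma defect: "proj_equiv ((\<Sum>j\<in>{1..S+L}. s j * star (s j)) - p) (\<Sum>j\<in>{1..L}. s j * star (s j))"
proof -
  define r where "r i = mix (- \<sigma> i) (\<kappa> i) i" for i
  have "frame f {1..L} r" unfolding frame_def r_def using mix_mult \<kappa>_\<sigma>(5) f by (auto simp: add.commute)
  moreover have "frame f {1..L} s" by (rule frame_subset[OF s]) auto
  ultimately have "proj_equiv (\<Sum>i\<in>{1..L}. r i * star (r i)) (\<Sum>i\<in>{1..L}. s i * star (s i))" by (rule frame_equiv)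
  moreover have "(\<Sum>j\<in>{1..S+L}. s j * star (s j)) - p = (\<Sum>i\<in>{1..L}. r i * star (r i))"
  proof -
    have split: "(\<Sum>j\<in>{L+1..S+L}. g j) = (\<Sum>j\<in>{L+1..S}. g j) + (\<Sum>i\<in>{1..L}. g (S + i))" for g :: "nat \<Rightarrow> 'b"
    proof -
      have "{L+1..S+L} = {L+1..S} \<union> {S+1..S+L}" using L by auto
      hence "(\<Sum>j\<in>{L+1..S+L}. g j) = (\<Sum>j\<in>{L+1..S}. g j) + (\<Sum>j\<in>{S+1..S+L}. g j)" by (simp add: sum.union_disjoint)
      also have "(\<Sum>j\<in>{S+1..S+L}. g j) = (\<Sum>i\<in>{1..L}. g (S + i))"
        by (rule sum.reindex_bij_witness[of _ "\<lambda>i. S + i" "\<lambda>j. j - S"]) auto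
      finally show ?thesis .
    qed
    have m: "mix (\<kappa> i) (\<sigma> i) i * star (mix (\<kappa> i) (\<sigma> i) i) + r i * star (r i) = s (S + i) * star (s (S + i)) + s i * star (s i)" if i: "i \<in> {1..L}" for i
    proof -
      have "mix (\<kappa> i) (\<sigma> i) i * star (mix (\<kappa> i) (\<sigma> i) i) + r i * star (r i) = 
        (\<kappa> i * \<kappa> i + \<sigma> i * \<sigma> i) *\<^sub>R (s (S + i) * star (s (S + i))) + (\<kappa> i * \<kappa> i + \<sigma> i * \<sigma> i) *\<^sub>R (s i * (\<omega> * star \<omega>) * star (s i))"
        by (simp add: r_def mix_def star_add star_diff star_scaleR star_mult algebra_simps)
      thus ?thesis unfolding \<kappa>_\<sigma>(5) \<omega> using frameD(4)[OF s, of i] i by simp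
    qed
    have "p + (\<Sum>i\<in>{1..L}. r i * star (r i)) = (\<Sum>j\<in>{L+1..S}. t j * star (t j)) + (\<Sum>i\<in>{1..L}. t (S + i) * star (t (S + i)) + r i * star (r i))"
      unfolding p_def split by (simp add: sum.distrib add.assoc)
    also have "(\<Sum>j\<in>{L+1..S}. t j * star (t j)) = (\<Sum>j\<in>{L+1..S}. s j * star (s j))" by (intro sum.cong refl) (simp add: t_def)
    also have "(\<Sum>i\<in>{1..L}. t (S + i) * star (t (S + i)) + r i * star (r i)) = (\<Sum>i\<in>{1..L}. s (S + i) * star (s (S + i)) + s i * star (s i))"
      by (intro sum.cong refl) (simp add: t_def m)
    also have "(\<Sum>j\<in>{L+1..S}. s j * star (s j)) + \<dots> = (\<Sum>j\<in>{L+1..S+L}. s j * star (s j)) + (\<Sum>i\<in>{1..L}. s i * star (s i))"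
      unfolding split by (simp add: sum.distrib add.assoc)
    also have "\<dots> = (\<Sum>j\<in>{1..S+L}. s j * star (s j))"
    proof -
      have "{1..S+L} = {L+1..S+L} \<union> {1..L}" by auto
      thus ?thesis by (simp add: sum.union_disjoint)
    qed
    finally show ?thesis by (simp add: algebra_simps)
  qed
  ultimately show ?thesis by simp
qed

text \<open>If \<open>d\<close> acts on each \<open>s j\<close> by a right coefficient
  \<open>c j\<close>, it does so on the rotated vectors, provided \<omega> intertwines the
  coefficients of the two levels that are mixed. Three errors add up.\<close>

lemma dt:
  assumes d: "\<And>j. j \<in> {1..S+L} \<Longrightarrow> norm (d * s j - s j * c j) \<le> \<delta>"
    and c: "\<And>i. i \<in> {1..L} \<Longrightarrow> norm (c i * \<omega> - \<omega> * c (S + i)) \<le> \<delta>" and j: "j \<in> {L+1..S+L}"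
  shows "norm (d * t j - t j * c j) \<le> 3 * \<delta>"
proof (cases "j \<le> S")
  case True
  have "norm (d * s 1 - s 1 * c 1) \<le> \<delta>" by (rule d) (use L in auto)
  hence "\<delta> \<ge> 0" using norm_ge_zero order_trans by blast
  thus ?thesis using d[of j] True j by (simp add: t_def)
next
  case False
  define i where "i = j - S"
  have i: "j = S + i" "i \<in> {1..L}" using False j by (auto simp: i_def)
  have \<delta>: "\<delta> \<ge> 0" using c[OF i(2)] norm_ge_zero order_trans by blast
  have eq: "d * t j - t j * c j = \<kappa> i *\<^sub>R (d * s (S + i) - s (S + i) * c (S + i)) + \<sigma> i *\<^sub>R ((d * s i - s i * c i) * \<omega>) + \<sigma> i *\<^sub>R (s i * (c i * \<omega> - \<omega> * c (S + i)))"
    using False by (simp add: t_def mix_def i algebra_simps)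
  have scale: "norm (r *\<^sub>R x) \<le> \<delta>" if "\<bar>r\<bar> \<le> 1" "norm x \<le> \<delta>" for r and x :: 'b
    using mult_mono[OF that] \<delta> by simp
  have 1: "norm (\<kappa> i *\<^sub>R (d * s (S + i) - s (S + i) * c (S + i))) \<le> \<delta>" by (rule scale[OF \<kappa>_\<sigma>(6) d]) (use i in auto)
  have 2: "norm (\<sigma> i *\<^sub>R ((d * s i - s i * c i) * \<omega>)) \<le> \<delta>"
    by (rule scale[OF \<kappa>_\<sigma>(7) order_trans[OF norm_mult_contraction(2)[OF \<omega>f(4)] d]]) (use i in auto)
  have "norm (s i) \<le> 1" by (rule frameD(6)[OF s]) (use i in auto)
  hence 3: "norm (\<sigma> i *\<^sub>R (s i * (c i * \<omega> - \<omega> * c (S + i)))) \<le> \<delta>"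
    by (intro scale[OF \<kappa>_\<sigma>(7) order_trans[OF norm_mult_contraction(1) c[OF i(2)]]])
  show ?thesis unfolding eq using norm_triangle_mono[OF norm_triangle_mono[OF 1 2] 3] by simp
qed

lemma dp:
  assumes d: "\<And>j. j \<in> {1..S+L} \<Longrightarrow> norm (d * s j - s j * c j) \<le> \<delta>"
    and c: "\<And>i. i \<in> {1..L} \<Longrightarrow> norm (c i * \<omega> - \<omega> * c (S + i)) \<le> \<delta>"
  shows "norm (d * p - (\<Sum>j\<in>{L+1..S+L}. t j * c j * star (t j))) \<le> 3 * real S * \<delta>"
proof -
  have \<delta>: "\<delta> \<ge> 0" using order_trans[OF norm_ge_zero c[of 1]] L by auto
  have "norm (d * p - (\<Sum>j\<in>{L+1..S+L}. t j * c j * star (t j))) = norm (\<Sum>j\<in>{L+1..S+L}. (d * t j - t j * c j) * star (t j))"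
    by (simp add: p_def sum_distrib_left sum_subtractf[symmetric] algebra_simps)
  also have "\<dots> \<le> (\<Sum>j\<in>{L+1..S+L}. 3 * \<delta>)"
  proof (rule sum_norm_le)
    fix j assume j: "j \<in> {L+1..S+L}"
    have "norm (star (t j)) \<le> 1" using frameD(6)[OF t_frame j] by simp
    from order_trans[OF norm_mult_contraction(2)[OF this] dt[OF d c j]] show "norm ((d * t j - t j * c j) * star (t j)) \<le> 3 * \<delta>" by blast
  qed
  finally show ?thesis by simp
qed

text \<open>\<open>W\<close> is a permutation matrix apart from one entry \<omega>; replacing that
  entry by \<open>\<omega>'\<close> puts it into the matrix algebra over \<open>D\<close>.\<close>

lemma near_u:
  assumes D: "unital_fd f D" "\<omega>' \<in> D" "norm (\<omega>' - \<omega>) \<le> \<delta>"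
    and C: "\<forall>j\<in>{L+1..S+L}. \<forall>k\<in>{L+1..S+L}. \<forall>x\<in>D. t j * x * star (t k) \<in> C" "unital_fd p C"
  shows "near p C u (4 * real (S + L) * \<eta> + 4 / L + \<delta>)"
proof -
  have \<delta>: "\<delta> \<ge> 0" using D(3) norm_ge_zero order_trans by blast
  have \<eta>: "\<eta> \<ge> 0" using us[of 1] L norm_ge_zero[of "u * s 1 - s (1 + 1)"] by linarith
  have pp: "p * p = p" by (rule projectionD(1)[OF p_projection])
  let ?b = "2 * real (S + L) * \<eta> + 2 / L"
  have "p * u - u * p = (p * u - W) - (u * p - W)" by simp
  hence 1: "norm (p * u - u * p) \<le> ?b + ?b" using order_trans[OF norm_triangle_ineq4 add_mono[OF pu_W up_W]] by (simp only:)
  define w' where "w' j = (if j = S + L then t (L + 1) * \<omega>' else t (j + 1))" for j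
  define W' where "W' = (\<Sum>j\<in>{L+1..S+L}. w' j * star (t j))"
  have fD: "f \<in> D" using D(1) by (auto simp: unital_fd_def)
  have W': "W' \<in> C" unfolding W'_def
  proof (rule complex_vector.subspace_sum[OF unital_fdD(1)[OF C(2)]])
    fix j assume j: "j \<in> {L+1..S+L}"
    show "w' j * star (t j) \<in> C"
    proof (cases "j = S + L")
      case True thus ?thesis using C(1) D(2) L by (auto simp: w'_def)
    next
      case False
      hence j1: "j + 1 \<in> {L+1..S+L}" using j by auto
      hence "t (j + 1) * f * star (t j) \<in> C" using C(1) j fD by blast
      thus ?thesis using False frameD(4)[OF t_frame j1] by (simp add: w'_def)
    qed
  qed
  have "W - W' = (\<Sum>j\<in>{L+1..S+L}. if j = S + L then t (L + 1) * (\<omega> - \<omega>') * star (t (S + L)) else 0)"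
    unfolding W_def W'_def sum_subtractf[symmetric] by (intro sum.cong refl) (auto simp: w_def w'_def algebra_simps)
  also have "\<dots> = t (L + 1) * (\<omega> - \<omega>') * star (t (S + L))" using L by simp
  finally have "norm (W - W') = norm (t (L + 1) * (\<omega> - \<omega>') * star (t (S + L)))" by simp
  also have "\<dots> \<le> norm (t (L + 1) * (\<omega> - \<omega>'))" by (rule norm_mult_contraction) (use frameD(6)[OF t_frame, of "S + L"] L in simp)
  also have "\<dots> \<le> norm (\<omega> - \<omega>')" by (rule norm_mult_contraction) (use frameD(6)[OF t_frame, of "L + 1"] L in simp)
  finally have 2: "norm (W - W') \<le> \<delta>" using D(3) by (simp add: norm_minus_commute)
  have 3: "p * u * p - W' = (p * u - W) * p + (W - W')" by (simp add: algebra_simps W_p)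
  have 4: "norm ((p * u - W) * p) \<le> ?b" using norm_mult_contraction(2)[OF projection_norm_le[OF p_projection]] pu_W order_trans by blast
  have 5: "norm (p * u * p - W') \<le> ?b + \<delta>" unfolding 3 by (rule norm_triangle_mono[OF 4 2])
  have b: "?b + \<delta> \<le> 4 * real (S + L) * \<eta> + 4 / L + \<delta>" "?b + ?b \<le> 4 * real (S + L) * \<eta> + 4 / L + \<delta>"
  proof -
    define X Y where XY: "X = real (S + L) * \<eta>" "Y = 1 / real L"
    have "0 \<le> X" "0 \<le> Y" unfolding XY using \<eta> by (simp_all del: of_nat_add)
    moreover have "2 * real (S + L) * \<eta> = 2 * X" "4 * real (S + L) * \<eta> = 4 * X" "2 / L = 2 * Y" "4 / L = 4 * Y"
      unfolding XY by (simp_all only: mult.assoc times_divide_eq_right mult_1_right)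
    ultimately show "?b + \<delta> \<le> 4 * real (S + L) * \<eta> + 4 / L + \<delta>" "?b + ?b \<le> 4 * real (S + L) * \<eta> + 4 / L + \<delta>" using \<delta> by simp_all
  qed
  show ?thesis unfolding near_def using order_trans[OF 1 b(2)] order_trans[OF 5 b(1)] W' by blast
qed

text \<open>The hypotheses on \<open>star d\<close> give the estimate for \<open>p * d\<close> from
  that for \<open>d * p\<close> by adjoints; both products are near the same block diagonal
  element.\<close>

lemma near_d:
  assumes d: "\<And>j. j \<in> {1..S+L} \<Longrightarrow> norm (d * s j - s j * c j) \<le> \<delta>" "\<And>j. j \<in> {1..S+L} \<Longrightarrow> norm (star d * s j - s j * star (c j)) \<le> \<delta>"
    and c: "\<And>i. i \<in> {1..L} \<Longrightarrow> norm (c i * \<omega> - \<omega> * c (S + i)) \<le> \<delta>" "\<And>i. i \<in> {1..L} \<Longrightarrow> norm (star (c i) * \<omega> - \<omega> * star (c (S + i))) \<le> \<delta>"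
    and c': "\<And>j. j \<in> {L+1..S+L} \<Longrightarrow> c' j \<in> D \<and> norm (c' j - c j) \<le> \<delta>"
    and C: "\<forall>j\<in>{L+1..S+L}. \<forall>k\<in>{L+1..S+L}. \<forall>x\<in>D. t j * x * star (t k) \<in> C" "unital_fd p C"
  shows "near p C d (6 * real S * \<delta>)"
proof -
  let ?T = "\<Sum>j\<in>{L+1..S+L}. t j * c j * star (t j)"
  have \<delta>: "\<delta> \<ge> 0" using order_trans[OF norm_ge_zero c(1)[of 1]] L by auto
  note sp = projectionD(2)[OF p_projection]
  have 1: "norm (d * p - ?T) \<le> 3 * real S * \<delta>" by (rule dp[OF d(1) c(1)])
  have "norm (star d * p - (\<Sum>j\<in>{L+1..S+L}. t j * star (c j) * star (t j))) \<le> 3 * real S * \<delta>" by (rule dp[OF d(2) c(2)])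
  also have "star d * p - (\<Sum>j\<in>{L+1..S+L}. t j * star (c j) * star (t j)) = star (p * d - ?T)"
    by (simp add: star_diff star_mult star_sum star_star sp mult.assoc)
  finally have 2: "norm (p * d - ?T) \<le> 3 * real S * \<delta>" by (simp only: norm_star)
  have "p * d - d * p = (p * d - ?T) - (d * p - ?T)" by simp
  hence 3: "norm (p * d - d * p) \<le> 6 * real S * \<delta>" using order_trans[OF norm_triangle_ineq4 add_mono[OF 2 1]] by (simp add: algebra_simps)
  define T' where "T' = (\<Sum>j\<in>{L+1..S+L}. t j * c' j * star (t j))"
  have T': "T' \<in> C" unfolding T'_def by (rule complex_vector.subspace_sum[OF unital_fdD(1)[OF C(2)]]) (use C(1) c' in blast)
  have Tp: "?T * p = ?T" using frame_mult_proj[OF t_frame, of "\<lambda>j. t j * c j"] by (simp add: p_def)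
  have "norm (?T - T') = norm (\<Sum>j\<in>{L+1..S+L}. t j * (c j - c' j) * star (t j))"
    by (simp add: T'_def sum_subtractf[symmetric] algebra_simps)
  also have "\<dots> \<le> (\<Sum>j\<in>{L+1..S+L}. \<delta>)"
  proof (rule sum_norm_le)
    fix j assume j: "j \<in> {L+1..S+L}"
    have tj: "norm (t j) \<le> 1" by (rule frameD(6)[OF t_frame j])
    have "norm (t j * (c j - c' j) * star (t j)) \<le> norm (t j * (c j - c' j))" by (rule norm_mult_contraction) (simp add: tj)
    also have "\<dots> \<le> norm (c j - c' j)" by (rule norm_mult_contraction[OF tj])
    also have "\<dots> \<le> \<delta>" using c'[OF j] by (simp add: norm_minus_commute)
    finally show "norm (t j * (c j - c' j) * star (t j)) \<le> \<delta>" .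
  qed
  finally have 4: "norm (?T - T') \<le> real S * \<delta>" by simp
  have 5: "p * d * p - T' = (p * d - ?T) * p + (?T - T')" unfolding left_diff_distrib Tp by simp
  have 6: "norm ((p * d - ?T) * p) \<le> 3 * real S * \<delta>" using norm_mult_contraction(2)[OF projection_norm_le[OF p_projection]] 2 order_trans by blast
  have 7: "norm (p * d * p - T') \<le> 3 * real S * \<delta> + real S * \<delta>" unfolding 5 by (rule norm_triangle_mono[OF 6 4])
  have 8: "3 * real S * \<delta> + real S * \<delta> \<le> 6 * real S * \<delta>" using \<delta> by (simp add: algebra_simps)
  show ?thesis unfolding near_def using 3 order_trans[OF 7 8] T' by blast
qed

end

section \<open>Corners, and isometries attached to a tower\<close>

lemma corner_unitary:
  fixes e v :: "'a::cstar_algebra"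
  assumes e: "projection e" and v: "unitary v" and d: "norm (e * v - v * e) \<le> \<delta>" "\<delta> \<le> 1/10"
  shows "\<exists>w. star w * w = e \<and> w * star w = e \<and> norm (w - e * v * e) \<le> 4 * \<delta>"
proof (rule polar_perturbation[OF e e _ _ _ _ d(2)])
  note ee = projectionD[OF e]
  have vv: "star v * v = 1" "v * star v = 1" using v by (auto simp: unitary_def)
  have ne: "norm e \<le> 1" by (rule projection_norm_le[OF e])
  have nv: "norm (star v) \<le> 1" using unitary_norm[OF v] by simp
  show "e * (e * v * e) = e * v * e" by (simp add: mult.assoc[symmetric] ee)
  show "e * v * e * e = e * v * e" by (simp add: mult.assoc ee)
  have "star (e * v * e) * (e * v * e) - e = e * (star v * ((e * v - v * e) * e))"
    by (simp add: star_mult ee algebra_simps mult_eq_left[OF ee(1)] mult_eq_left[OF vv(1)])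
  also have "norm \<dots> \<le> norm (star v * ((e * v - v * e) * e))" by (rule norm_mult_contraction[OF ne])
  also have "\<dots> \<le> norm ((e * v - v * e) * e)" by (rule norm_mult_contraction[OF nv])
  also have "\<dots> \<le> norm (e * v - v * e)" by (rule norm_mult_contraction[OF ne])
  finally show "norm (star (e * v * e) * (e * v * e) - e) \<le> \<delta>" using d(1) by linarith
  have "e * v * e * star (e * v * e) - e = e * ((v * e - e * v) * star v) * e"
    by (simp add: star_mult ee algebra_simps mult_eq_left[OF ee(1)] mult_eq_left[OF vv(2)])
  also have "norm \<dots> \<le> norm (e * ((v * e - e * v) * star v))" by (rule norm_mult_contraction[OF ne])
  also have "\<dots> \<le> norm ((v * e - e * v) * star v)" by (rule norm_mult_contraction[OF ne])
  also have "\<dots> \<le> norm (v * e - e * v)" by (rule norm_mult_contraction[OF nv])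
  finally show "norm (e * v * e * star (e * v * e) - e) \<le> \<delta>" using d(1) by (simp add: norm_minus_commute)
qed

text \<open>Cutting by \<open>e\<close> costs one commutator with \<open>v\<close> on each side, and
  replacing the cut-down unitary by \<open>w\<close> costs \<beta> on each side.\<close>

lemma corner_commute:
  fixes e v w x x' :: "'a::cstar_algebra"
  assumes e: "projection e" and v: "unitary v" and w: "norm (w - e * v * e) \<le> \<beta>" and ev: "norm (e * v - v * e) \<le> \<eta>"
    and xv: "norm (x * v - v * x') \<le> \<tau>" and b: "norm x \<le> b" "norm x' \<le> b"
  shows "norm ((e * x * e) * w - w * (e * x' * e)) \<le> \<tau> + 2 * b * \<eta> + 2 * b * \<beta>"
proof -
  note ee = projectionD[OF e]
  have ne: "norm e \<le> 1" by (rule projection_norm_le[OF e])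
  have b0: "b \<ge> 0" using b(1) norm_ge_zero order_trans by blast
  have cut: "norm (e * y * e) \<le> norm y" for y using norm_mult_contraction[OF ne, of y] norm_mult_contraction[OF ne, of "e * y"] by linarith
  have "(e * x * e) * w - w * (e * x' * e) = (e * x * e) * (w - e * v * e) + (- ((w - e * v * e) * (e * x' * e)))
     + (e * (x * v - v * x') * e + (e * (x * (e * v - v * e)) * e + (- (e * ((v * e - e * v) * x') * e))))"
    by (simp add: algebra_simps mult_eq_left[OF ee(1)] ee(1))
  moreover have "norm ((e * x * e) * (w - e * v * e)) \<le> b * \<beta>"
    by (rule order_trans[OF norm_mult_ineq mult_mono[OF order_trans[OF cut b(1)] w b0]]) simp
  moreover have "norm (- ((w - e * v * e) * (e * x' * e))) \<le> \<beta> * b" unfolding norm_minus_cancel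
    by (rule order_trans[OF norm_mult_ineq mult_mono[OF w order_trans[OF cut b(2)]]]) (use w norm_ge_zero order_trans in blast, simp)
  moreover have "norm (e * (x * v - v * x') * e) \<le> \<tau>" by (rule order_trans[OF cut xv])
  moreover have "norm (e * (x * (e * v - v * e)) * e) \<le> b * \<eta>"
    by (rule order_trans[OF cut order_trans[OF norm_mult_ineq mult_mono[OF b(1) ev b0]]]) simp
  moreover have "norm (- (e * ((v * e - e * v) * x') * e)) \<le> \<eta> * b" unfolding norm_minus_cancel
  proof (rule order_trans[OF cut order_trans[OF norm_mult_ineq mult_mono[OF _ b(2)]]])
    show "norm (v * e - e * v) \<le> \<eta>" using ev by (simp add: norm_minus_commute)
    show "0 \<le> \<eta>" using ev norm_ge_zero order_trans by blast
  qed simp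
  ultimately have "norm ((e * x * e) * w - w * (e * x' * e)) \<le> (b * \<beta> + \<beta> * b) + (\<tau> + (b * \<eta> + \<eta> * b))"
    by (simp only:) (intro norm_triangle_mono)
  thus ?thesis by (simp add: algebra_simps)
qed

lemma proj_sub_hom: assumes "cstar_hom \<phi>" "proj_sub p q" shows "proj_sub (\<phi> p) (\<phi> q)"
proof -
  obtain v where v: "star v * v = p" "q * v = v" "projection p" "projection q" using assms(2) by (auto simp: proj_sub_def)
  have "star (\<phi> v) * \<phi> v = \<phi> p" "\<phi> q * \<phi> v = \<phi> v" using v(1,2) by (simp_all only: cstar_homD[OF assms(1), symmetric])
  thus ?thesis using cstar_hom_projection[OF assms(1)] v(3,4) unfolding proj_sub_def by blast
qed

context rokhlin_crossed begin

text \<open>The projection \<open>e\<close> is close to a projection \<open>q\<close> of some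
  \<open>F n\<close>. With the partial isometry \<open>s\<close> from \<open>e\<close> to
  \<open>q\<close>, the compressed algebra \<open>star s * F n * s\<close> is finite-dimensional
  with unit \<open>e\<close>.\<close>

lemma corner_fd:
  assumes e: "projection e" and E: "finite E" "\<And>x. x \<in> E \<Longrightarrow> e * x * e = x" and \<theta>: "\<theta> > 0"
  shows "\<exists>D. unital_fd (\<pi> e) D \<and> (\<forall>x\<in>E. \<exists>y\<in>D. norm (y - \<pi> x) \<le> \<theta>)"
proof -
  define b where "b = 1 + (\<Sum>x\<in>E. norm x)"
  have b: "b \<ge> 1" "\<And>x. x \<in> E \<Longrightarrow> norm x \<le> b" unfolding b_def
    using member_le_sum[of _ E norm] E(1) by (auto simp: sum_nonneg intro: add_increasing)
  \<comment> \<open>Three replacements cost at most \<open>(1 + 10 * b) * \<delta>\<close>.\<close>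
  define \<delta> where "\<delta> = min (1/10) (\<theta> / (12 * b))"
  have \<delta>: "0 < \<delta>" "\<delta> \<le> 1/10" "12 * b * \<delta> \<le> \<theta>" using b(1) \<theta> by (auto simp: \<delta>_def min_def field_simps)
  have "eventually (\<lambda>n. norm (e - ap e n) < \<delta> \<and> (\<forall>x\<in>E. norm (x - ap x n) < \<delta>)) sequentially"
    by (intro eventually_conj eventually_ball_finite[OF E(1)] ballI ap_close \<delta>(1))
  then obtain n where n: "norm (e - ap e n) < \<delta>" "\<forall>x\<in>E. norm (x - ap x n) < \<delta>" by (auto simp: eventually_sequentially)
  define q where "q = ap e n"
  have q: "projection q" "q \<in> F n" unfolding q_def by (rule ap(2)[OF e]) (rule ap(1))
  have "norm (q - e) \<le> \<delta>" using n(1) by (simp add: q_def norm_minus_commute)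
  from close_projections[OF q(1) e this \<delta>(2)] obtain s where s: "star s * s = e" "s * star s = q" "norm (s - e) \<le> 5 * \<delta>" by blast
  have ns: "norm s \<le> 1" by (rule norm_eq_one_if_star_mult[OF s(1) projection_norm_le[OF e]])
  have ne: "norm e \<le> 1" by (rule projection_norm_le[OF e])
  have se: "s * e = s" by (rule partial_isometry_right[OF s(1) e])
  have es: "e * star s = star s" using arg_cong[OF se, of star] by (simp add: star_mult projectionD[OF e])
  define \<phi> where "\<phi> y = \<pi> (star s * y * s)" for y
  obtain B where B: "finite B" "F n = cspan B" using Fn.fin_dim by (auto simp: finite_dimensional_def)
  define D where "D = \<phi> ` F n"
  have D: "D = cspan (\<phi> ` B)" unfolding D_def B(2)
    by (rule linear_image_cspan) (auto simp: \<phi>_def algebra_simps \<pi>_simps mult_scaleC_left mult_scaleC_right)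
  have \<phi>m: "\<phi> y * \<phi> z = \<phi> (y * q * z)" for y z by (simp add: \<phi>_def \<pi>_simps(3)[symmetric] s(2)[symmetric] mult.assoc)
  have \<phi>s: "star (\<phi> y) = \<phi> (star y)" for y by (simp add: \<phi>_def \<pi>_simps(4)[symmetric] star_mult star_star mult.assoc)
  have "unital_fd (\<pi> e) D" unfolding unital_fd_def cstar_subalgebra_def finite_dimensional_def
  proof (intro conjI ballI)
    show "csubspace D" "closed D" unfolding D using closed_cspan_finite[of "\<phi> ` B"] B(1) by auto
    show "\<exists>S. finite S \<and> D = cspan S" using D B(1) by blast
    have "\<phi> 1 = \<pi> e" by (simp add: \<phi>_def s)
    thus "\<pi> e \<in> D" unfolding D_def using Fn.one_in by (metis imageI)
    fix c assume "c \<in> D"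
    then obtain y where y: "c = \<phi> y" "y \<in> F n" unfolding D_def by blast
    show "star c \<in> D" unfolding y(1) \<phi>s D_def using Fn.star_in[OF y(2)] by blast
    show "\<pi> e * c = c" unfolding y(1) by (simp add: \<phi>_def \<pi>_simps(3)[symmetric] mult.assoc[symmetric] es)
    show "c * \<pi> e = c" unfolding y(1) by (simp add: \<phi>_def \<pi>_simps(3)[symmetric] mult.assoc se)
    fix c' assume "c' \<in> D"
    then obtain z where z: "c' = \<phi> z" "z \<in> F n" unfolding D_def by blast
    show "c * c' \<in> D" unfolding y(1) z(1) \<phi>m D_def using Fn.mult_in[OF Fn.mult_in[OF y(2) q(2)] z(2)] by blast
  qed
  moreover have "\<exists>y\<in>D. norm (y - \<pi> x) \<le> \<theta>" if x: "x \<in> E" for x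
  proof (rule bexI[of _ "\<phi> (ap x n)"])
    show "\<phi> (ap x n) \<in> D" unfolding D_def using ap(1) by blast
    have exe: "star s * ap x n * s - x = star s * (ap x n - x) * s + (star (s - e) * (x * s) + e * x * (s - e))"
    proof -
      have "star s * ap x n * s - e * x * e = star s * (ap x n - x) * s + (star (s - e) * (x * s) + e * x * (s - e))"
        by (simp add: star_diff projectionD[OF e] algebra_simps)
      thus ?thesis unfolding E(2)[OF x] .
    qed
    have 1: "norm (star s * (ap x n - x) * s) \<le> \<delta>"
      using order_trans[OF norm_mult_contraction(2)[OF ns] norm_mult_contraction(1)[of "star s" "ap x n - x"]] ns n(2) x by (force simp: norm_minus_commute)
    have 2: "norm (star (s - e) * (x * s)) \<le> 5 * \<delta> * b"
      by (rule order_trans[OF norm_mult_ineq mult_mono]) (use s(3) order_trans[OF norm_mult_contraction(2)[OF ns] b(2)[OF x]] \<delta> in \<open>simp_all only: norm_star\<close>, auto)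
    have 3: "norm (e * x * (s - e)) \<le> b * (5 * \<delta>)"
      by (rule order_trans[OF norm_mult_ineq mult_mono[OF order_trans[OF norm_mult_contraction(1)[OF ne] b(2)[OF x]] s(3)]]) (use b(1) in auto)
    have "norm (\<phi> (ap x n) - \<pi> x) \<le> norm (star s * ap x n * s - x)" unfolding \<phi>_def \<pi>_simps(8)[symmetric] by (rule \<pi>_norm_le)
    also have "\<dots> \<le> \<delta> + (5 * \<delta> * b + b * (5 * \<delta>))" unfolding exe by (intro norm_triangle_mono 1 2 3)
    also have "\<dots> \<le> 12 * b * \<delta>"
    proof -
      have "\<delta> \<le> b * \<delta>" using \<delta>(1) b(1) by simp
      moreover from this have "0 \<le> b * \<delta>" using \<delta>(1) by linarith
      ultimately show ?thesis by (simp add: algebra_simps)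
    qed
    also have "\<dots> \<le> \<theta>" by (rule \<delta>(3))
    finally show "norm (\<phi> (ap x n) - \<pi> x) \<le> \<theta>" .
  qed
  ultimately show ?thesis by blast
qed

lemma \<pi>_equiv_A: assumes "projection x" shows "proj_equiv (\<pi> x) (\<pi> (A k x))"
proof -
  note px = projectionD[OF \<pi>_projection[OF assms]]
  have "star (U k * \<pi> x) * (U k * \<pi> x) = \<pi> x" by (simp add: star_mult star_unitary_powi px mult.assoc)
  moreover have "U k * \<pi> x * star (U k * \<pi> x) = \<pi> (A k x)"
    by (simp add: star_mult star_unitary_powi px U_\<pi>_conj[symmetric] mult.assoc mult_eq_left[OF px(1)])
  ultimately show ?thesis using \<pi>_projection[OF assms] \<pi>_projection[OF A_projection[OF assms]] unfolding proj_equiv_def by blast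
qed

text \<open>Polar part of \<open>\<pi> p * U k * \<pi> q\<close>; four units of error come from
  \<open>polar_perturbation\<close> and one from inserting \<open>\<pi> p\<close>.\<close>

lemma tower_isometry:
  assumes p: "projection p" and q: "projection q" and d: "norm (A k q - p) \<le> \<delta>" "\<delta> \<le> 1/10"
  shows "\<exists>s. star s * s = \<pi> q \<and> s * star s = \<pi> p \<and> norm (s - U k * \<pi> q) \<le> 5 * \<delta>"
proof -
  define x where "x = \<pi> p * U k * \<pi> q"
  note pp = projectionD[OF \<pi>_projection[OF p]] and qq = projectionD[OF \<pi>_projection[OF q]]
  note p' = projectionD[OF p] and q' = projectionD[OF q]
  have np: "norm p \<le> 1" "norm q \<le> 1" by (rule projection_norm_le, fact)+
  have cut: "norm (p * y * p) \<le> norm y" "norm (q * y * q) \<le> norm y" for y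
    using norm_mult_contraction[OF np(1), of y] norm_mult_contraction[OF np(1), of "p * y"] norm_mult_contraction[OF np(2), of y] norm_mult_contraction[OF np(2), of "q * y"] by linarith+
  have qp: "norm (A (- k) p - q) \<le> \<delta>"
  proof -
    have "A (- k) p - q = A (- k) (p - A k q)" by (simp add: A_simps)
    thus ?thesis using d(1) by (simp add: norm_minus_commute)
  qed
  have "\<exists>s. star s * s = \<pi> q \<and> s * star s = \<pi> p \<and> norm (s - x) \<le> 4 * \<delta>"
  proof (rule polar_perturbation[OF \<pi>_projection[OF p] \<pi>_projection[OF q] _ _ _ _ d(2)])
    show "\<pi> p * x = x" by (simp add: x_def mult.assoc[symmetric] pp)
    show "x * \<pi> q = x" by (simp add: x_def mult.assoc qq)
    have "U (- k) * (\<pi> p * (U k * z)) = \<pi> (A (- k) p) * z" for z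
      using arg_cong[OF U_\<pi>_conj[of "- k" p], of "\<lambda>x. x * z"] by (simp add: mult.assoc)
    hence "star x * x = \<pi> q * \<pi> (A (- k) p) * \<pi> q" 
      by (simp add: x_def star_mult star_unitary_powi pp qq mult.assoc mult_eq_left[OF pp(1)])
    hence "star x * x - \<pi> q = \<pi> (q * (A (- k) p - q) * q)" by (simp add: \<pi>_simps algebra_simps qq)
    thus "norm (star x * x - \<pi> q) \<le> \<delta>" using order_trans[OF \<pi>_norm_le order_trans[OF cut(2) qp]] by simp
    have "x * star x = \<pi> p * (U k * \<pi> q * U (- k)) * \<pi> p"
      by (simp add: x_def star_mult star_unitary_powi pp qq mult.assoc mult_eq_left[OF qq(1)])
    hence "x * star x = \<pi> p * \<pi> (A k q) * \<pi> p" unfolding U_\<pi>_conj .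
    hence "x * star x - \<pi> p = \<pi> (p * (A k q - p) * p)" by (simp add: \<pi>_simps algebra_simps pp)
    thus "norm (x * star x - \<pi> p) \<le> \<delta>" using order_trans[OF \<pi>_norm_le order_trans[OF cut(1) d(1)]] by simp
  qed
  then obtain s where s: "star s * s = \<pi> q" "s * star s = \<pi> p" "norm (s - x) \<le> 4 * \<delta>" by blast
  have "U k * \<pi> q = \<pi> (A k q) * U k * \<pi> q" by (simp add: U_\<pi>[symmetric] mult.assoc qq)
  hence "x - U k * \<pi> q = \<pi> (p - A k q) * (U k * \<pi> q)" by (simp add: x_def \<pi>_simps algebra_simps)
  hence "norm (x - U k * \<pi> q) \<le> norm (\<pi> (p - A k q))"
    using norm_mult_contraction(2)[of "U k * \<pi> q" "\<pi> (p - A k q)"] norm_unitary_mult[OF U_unitary, of k "\<pi> q"] \<pi>_norm_le[of q] np(2) by simp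
  also have "\<dots> \<le> \<delta>" using \<pi>_norm_le[of "p - A k q"] d(1) by (simp add: norm_minus_commute)
  finally have 2: "norm (x - U k * \<pi> q) \<le> \<delta>" .
  have eq: "s - U k * \<pi> q = (s - x) + (x - U k * \<pi> q)" by simp
  have "norm (s - U k * \<pi> q) \<le> 5 * \<delta>" unfolding eq using norm_triangle_mono[OF s(3) 2] by simp
  thus ?thesis using s(1,2) by blast
qed

text \<open>The element \<open>q * A (- k) d * q\<close> is the coefficient of \<open>d\<close> at
  level \<open>p\<close>, brought down to the bottom level \<open>q\<close>.\<close>

lemma tower_commute:
  assumes p: "projection p" and q: "projection q" and d: "norm (A k q - p) \<le> \<delta>" and s: "norm (s - U k * \<pi> q) \<le> \<beta>"
    and \<eta>: "norm (p * d - d * p) \<le> \<eta>" and b: "norm d \<le> b"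
  shows "norm (\<pi> d * s - s * \<pi> (q * A (- k) d * q)) \<le> \<eta> + 2 * b * \<delta> + 2 * b * \<beta>"
proof -
  define y where "y = A (- k) d"
  note qq = projectionD[OF q]
  have nq: "norm q \<le> 1" by (rule projection_norm_le[OF q])
  have b0: "b \<ge> 0" using b norm_ge_zero order_trans by blast
  have \<beta>0: "\<beta> \<ge> 0" using s norm_ge_zero order_trans by blast
  have \<delta>0: "\<delta> \<ge> 0" using d norm_ge_zero order_trans by blast
  have ny: "norm (\<pi> (q * y * q)) \<le> b"
    using \<pi>_norm_le[of "q * y * q"] norm_mult_contraction[OF nq, of y] norm_mult_contraction[OF nq, of "q * y"] b by (simp add: y_def)
  have eq1: "\<pi> d * (U k * \<pi> q) - U k * \<pi> q * \<pi> (q * y * q) = U k * \<pi> ((y * q - q * y) * q)"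
  proof -
    have "\<pi> d * U k = U k * \<pi> y" unfolding U_\<pi> y_def by simp
    from mult_eq_left[OF this, of "\<pi> q"] have "\<pi> d * (U k * \<pi> q) = U k * \<pi> (y * q)" by (simp add: \<pi>_simps mult.assoc)
    moreover have "q * (q * y * q) = q * y * q" "(y * q - q * y) * q = y * q - q * y * q" by (simp_all add: algebra_simps mult_eq_left[OF qq(1)] qq(1))
    hence "U k * \<pi> q * \<pi> (q * y * q) = U k * \<pi> (q * y * q)" "\<pi> ((y * q - q * y) * q) = \<pi> (y * q) - \<pi> (q * y * q)"
      by (simp_all only: mult.assoc \<pi>_simps(3,8)[symmetric])
    ultimately show ?thesis by (simp only: right_diff_distrib)
  qed
  have "norm (y * q - q * y) \<le> \<eta> + 2 * b * \<delta>"
  proof -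
    have "A k (y * q - q * y) = - (p * d - d * p) + (d * (A k q - p) + (- ((A k q - p) * d)))" by (simp add: A_simps y_def algebra_simps)
    moreover have "norm (- (p * d - d * p)) \<le> \<eta>" using \<eta> by (simp only: norm_minus_cancel)
    moreover have "norm (d * (A k q - p)) \<le> b * \<delta>" by (rule order_trans[OF norm_mult_ineq mult_mono[OF b d b0]]) simp
    moreover have "norm (- ((A k q - p) * d)) \<le> \<delta> * b" unfolding norm_minus_cancel
      by (rule order_trans[OF norm_mult_ineq mult_mono[OF d b \<delta>0]]) simp
    ultimately have "norm (A k (y * q - q * y)) \<le> \<eta> + (b * \<delta> + \<delta> * b)" by (simp only:) (intro norm_triangle_mono)
    thus ?thesis by (simp add: algebra_simps)
  qed
  moreover have "norm (U k * \<pi> ((y * q - q * y) * q)) \<le> norm (y * q - q * y)"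
    using norm_unitary_mult[OF U_unitary, of k "\<pi> ((y * q - q * y) * q)"] \<pi>_norm_le[of "(y * q - q * y) * q"] norm_mult_contraction(2)[OF nq, of "y * q - q * y"] by linarith
  ultimately have 1: "norm (U k * \<pi> ((y * q - q * y) * q)) \<le> \<eta> + 2 * b * \<delta>" by linarith
  have 2: "norm (\<pi> d * (s - U k * \<pi> q)) \<le> b * \<beta>" by (rule order_trans[OF norm_mult_ineq mult_mono[OF order_trans[OF \<pi>_norm_le b] s b0]]) simp
  have 3: "norm (- ((s - U k * \<pi> q) * \<pi> (q * y * q))) \<le> \<beta> * b" unfolding norm_minus_cancel
    by (rule order_trans[OF norm_mult_ineq mult_mono[OF s ny \<beta>0]]) simp
  have "\<pi> d * s - s * \<pi> (q * y * q) = (\<pi> d * (U k * \<pi> q) - U k * \<pi> q * \<pi> (q * y * q)) + (\<pi> d * (s - U k * \<pi> q) + (- ((s - U k * \<pi> q) * \<pi> (q * y * q))))"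
    by (simp add: algebra_simps)
  hence "norm (\<pi> d * s - s * \<pi> (q * y * q)) \<le> (\<eta> + 2 * b * \<delta>) + (b * \<beta> + \<beta> * b)"
    unfolding eq1 using 1 2 3 by (simp only:) (intro norm_triangle_mono)
  thus ?thesis unfolding y_def by (simp add: algebra_simps)
qed

text \<open>In the crossed product a projection is equivalent to its translates, so comparison
  modulo \<alpha> becomes ordinary comparison.\<close>

lemma proj_le_aut_sub:
  assumes h: "projection h" and le: "proj_le_aut \<alpha> p h"
  shows "proj_sub (\<pi> p) (\<pi> h)"
proof -
  from proj_le_aut_decomposition[OF h le] obtain n :: nat and P Q s where *: "\<forall>i\<in>{1..n}. proj_equiv (A (s i) (P i)) (Q i) \<and> h * Q i = Q i"
    "\<forall>i\<in>{1..n}. \<forall>j\<in>{1..n}. i \<noteq> j \<longrightarrow> P i * P j = 0" "\<forall>i\<in>{1..n}. \<forall>j\<in>{1..n}. i \<noteq> j \<longrightarrow> Q i * Q j = 0" 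
    "\<forall>i\<in>{1..n}. projection (P i)" "p = (\<Sum>i=1..n. P i)" by (elim exE conjE)
  have Q: "projection (Q i)" if "i \<in> {1..n}" for i using *(1) that by (auto simp: proj_equiv_def)
  have "proj_equiv (\<Sum>i=1..n. \<pi> (P i)) (\<Sum>i=1..n. \<pi> (Q i))"
  proof (rule proj_equiv_sum)
    fix i assume i: "i \<in> {1..n}"
    have "proj_equiv (\<pi> (A (s i) (P i))) (\<pi> (Q i))" using *(1) i proj_equiv_hom[OF \<pi>_hom] by blast
    thus "proj_equiv (\<pi> (P i)) (\<pi> (Q i))" using \<pi>_equiv_A[of "P i"] *(4) i proj_equiv_trans by blast
    fix j assume j: "j \<in> {1..n}" "i \<noteq> j"
    show "\<pi> (P i) * \<pi> (P j) = 0" "\<pi> (Q i) * \<pi> (Q j) = 0" unfolding \<pi>_simps(3)[symmetric] using *(2,3) i j \<pi>_simps(6) by auto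
  qed simp
  hence "proj_equiv (\<pi> p) (\<pi> (\<Sum>i=1..n. Q i))" unfolding *(5) by (simp add: cstar_hom_sum[OF \<pi>_hom])
  moreover have "proj_sub (\<pi> (\<Sum>i=1..n. Q i)) (\<pi> h)"
  proof (rule proj_sub_hom[OF \<pi>_hom proj_sub_le[OF _ h]])
    show "projection (\<Sum>i=1..n. Q i)" by (rule projection_sum) (use Q *(3) in auto)
    show "h * (\<Sum>i=1..n. Q i) = (\<Sum>i=1..n. Q i)" unfolding sum_distrib_left by (rule sum.cong) (use *(1) in auto)
  qed
  ultimately show ?thesis using proj_equiv_sub proj_sub_trans by blast
qed

end

section \<open>Tracial rank zero of the crossed product\<close>

context rokhlin_crossed begin

text \<open>The parameters are chosen in the order \<open>N\<close>, \<open>L\<close>, \<delta>,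
  \<eta>, unitary, tower: the unitary must be known before the tower, whose bottom level has to
  commute with it.\<close>

lemma tracial_approximation:
  assumes \<epsilon>: "\<epsilon> > 0" and G: "finite G" and h: "\<And>i. i \<le> J \<Longrightarrow> projection (h i) \<and> h i \<noteq> 0"
    "\<And>i j. i \<le> J \<Longrightarrow> j \<le> J \<Longrightarrow> i \<noteq> j \<Longrightarrow> h i * h j = 0" "\<And>i. i \<le> J \<Longrightarrow> proj_equiv (h 0) (h i)"
  shows "\<exists>p C. projection p \<and> p \<noteq> 0 \<and> unital_fd p C \<and> near p C u \<epsilon> \<and> (\<forall>d\<in>G. near p C (\<pi> d) \<epsilon>) \<and>
    proj_sub (1 - p) (\<pi> (\<Sum>i<Suc J. h i))"
proof -
  from tower_small[of "h 0"] h(1) obtain N where N: "N > 0" "\<forall>L K \<eta> e. N \<le> K \<and> J dvd L \<and> tower (L * K) \<eta> e \<and> \<eta> \<ge> 0 \<and> real L * (real (L * K) * \<eta>) \<le> 1/10 \<longrightarrow>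
    (\<exists>P. (\<forall>l<J. proj_sub (P l) (A (int l) (h 0))) \<and> (\<forall>l<J. \<forall>j<J. l \<noteq> j \<longrightarrow> P l * P j = 0) \<and> (\<Sum>j=1..L. e j) = (\<Sum>l<J. P l))" by blast
  \<comment> \<open>Makes the rotation error \<open>4 / L\<close> at most \<epsilon>/3.\<close>
  define m :: nat where "m = nat \<lceil>12 / \<epsilon>\<rceil> + 1"
  \<comment> \<open>\<open>L\<close> and \<open>S\<close> are multiples of \<open>J\<close>,
    \<open>S\<close> exceeds \<open>L\<close>, and the height is \<open>K\<close> blocks of length
    \<open>L\<close> with \<open>K\<close> above the bound of \<open>tower_small\<close>.\<close>
  define L S M K where LSM: "L = J * m" "S = L * (N + 2)" "M = S + L" "K = N + 3"
  have m: "1 \<le> m" "12 / \<epsilon> \<le> real m" unfolding m_def by linarith+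
  have L1: "1 \<le> L" "real m \<le> real L" using J m(1) by (auto simp: LSM)
  have L4: "4 / real L \<le> \<epsilon> / 3"
  proof -
    have "12 / \<epsilon> \<le> real L" using m(2) L1(2) by linarith
    hence "12 \<le> real L * \<epsilon>" using \<epsilon> by (simp add: pos_divide_le_eq)
    thus ?thesis using L1(1) by (simp add: field_simps)
  qed
  have LS: "L < S" using L1(1) unfolding LSM(2) by simp
  have MK: "M = L * K" by (simp add: LSM algebra_simps)
  have M1: "1 \<le> M" using L1(1) unfolding LSM(3) by simp
  have JS: "int J dvd int S" by (simp add: LSM)
  define G' where "G' = G \<union> star ` G"
  have G': "finite G'" "\<And>d. d \<in> G \<Longrightarrow> d \<in> G' \<and> star d \<in> G'" using G by (auto simp: G'_def)
  define b where "b = 1 + (\<Sum>d\<in>G'. norm d)"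
  have b: "b \<ge> 1" "\<And>d. d \<in> G' \<Longrightarrow> norm d \<le> b" unfolding b_def
    using member_le_sum[of _ G' norm] G'(1) by (auto simp: sum_nonneg intro: add_increasing)
  \<comment> \<open>\<open>near_d\<close> multiplies \<delta> by at most \<open>6 * M\<close>;
    \<open>near_u\<close> adds it once more.\<close>
  define \<delta> where "\<delta> = min (\<epsilon> / (6 * real M)) (\<epsilon> / 3)"
  have \<delta>: "\<delta> > 0" "6 * real M * \<delta> \<le> \<epsilon>" "\<delta> \<le> \<epsilon> / 3"
  proof -
    show "\<delta> > 0" "\<delta> \<le> \<epsilon> / 3" using \<epsilon> M1 by (auto simp: \<delta>_def)
    have "\<delta> \<le> \<epsilon> / (6 * real M)" by (simp add: \<delta>_def)
    thus "6 * real M * \<delta> \<le> \<epsilon>" using M1 by (simp add: pos_le_divide_eq mult.commute)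
  qed
  define \<eta> where "\<eta> = min (\<delta> / (40 * b * real M * real M)) (1 / (10 * real L * real M))"
  have \<eta>: "\<eta> > 0" "40 * b * real M * real M * \<eta> \<le> \<delta>" "real L * (real M * \<eta>) \<le> 1/10"
  proof -
    have pos: "40 * b * real M * real M > 0" "10 * real L * real M > 0" using b(1) M1 L1(1) by auto
    show "\<eta> > 0" using \<delta>(1) pos by (simp add: \<eta>_def)
    have "\<eta> \<le> \<delta> / (40 * b * real M * real M)" by (simp add: \<eta>_def)
    thus "40 * b * real M * real M * \<eta> \<le> \<delta>" using pos(1) by (simp add: pos_le_divide_eq mult.commute)
    have "\<eta> \<le> 1 / (10 * real L * real M)" by (simp add: \<eta>_def)
    thus "real L * (real M * \<eta>) \<le> 1/10" using pos(2) by (simp add: pos_le_divide_eq algebra_simps)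
  qed
  \<comment> \<open>The accumulated error of climbing the whole tower.\<close>
  define \<mu> where "\<mu> = real M * \<eta>"
  have \<mu>: "\<eta> \<le> \<mu>" "\<mu> \<le> b * \<mu>" "40 * real M * \<mu> \<le> \<delta>" "40 * (b * \<mu>) \<le> \<delta>" "\<mu> \<le> 1/10" "b * \<eta> \<le> b * \<mu>" "0 < \<mu>"
  proof -
    show p: "0 < \<mu>" using \<eta>(1) M1 by (simp add: \<mu>_def)
    show 1: "\<eta> \<le> \<mu>" "\<mu> \<le> b * \<mu>" using \<eta>(1) M1 b(1) by (auto simp: \<mu>_def)
    show "b * \<eta> \<le> b * \<mu>" by (rule mult_left_mono[OF 1(1)]) (use b(1) in simp)
    have "1 * (real M * \<mu>) \<le> b * (real M * \<mu>)" by (rule mult_right_mono[OF b(1)]) (use p in simp)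
    thus "40 * real M * \<mu> \<le> \<delta>" using \<eta>(2) by (simp add: \<mu>_def algebra_simps)
    have "1 * (b * \<mu>) \<le> real M * (b * \<mu>)" by (rule mult_right_mono) (use M1 b(1) p in auto)
    thus "40 * (b * \<mu>) \<le> \<delta>" using \<eta>(2) by (simp add: \<mu>_def algebra_simps)
    have "1 * \<mu> \<le> real L * \<mu>" by (rule mult_right_mono) (use L1(1) p in auto)
    thus "\<mu> \<le> 1/10" using \<eta>(3) by (simp add: \<mu>_def)
  qed
  \<comment> \<open>Coefficients at the first \<open>L\<close> levels: only these meet the levels
    \<open>S + i\<close> in the rotation, so \<omega> has to intertwine them.\<close>
  define Y where "Y = (\<lambda>(i, d). A (- (int i - 1)) d) ` ({1..L} \<times> G')"
  have Y: "finite Y" using G'(1) by (simp add: Y_def)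
  have "eventually (\<lambda>n. \<forall>x\<in>Y. norm (x - ap x n) < \<delta> / 8) sequentially"
    by (intro eventually_ball_finite[OF Y] ballI ap_close) (use \<delta>(1) in simp)
  then obtain n where n: "\<forall>x\<in>Y. norm (x - ap x n) < \<delta> / 8" by (auto simp: eventually_sequentially)
  obtain v0 where v0: "unitary v0" "\<forall>c\<in>F n. v0 * c = A (int S) c * v0" using intertwining_unitary[OF JS] by blast
  \<comment> \<open>Translating back by \<open>S\<close> reverses the intertwining:
    \<open>x * v\<close> is near \<open>v * A (- int S) x\<close>, which pairs the coefficients of
    levels \<open>i\<close> and \<open>S + i\<close>.\<close>
  define v where "v = A (- int S) v0"
  have v: "unitary v" using v0(1) unfolding unitary_def v_def by (simp add: A_simps[symmetric])
  have xv: "norm (x * v - v * A (- int S) x) \<le> \<delta> / 4" if x: "x \<in> Y" for x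
  proof -
    let ?y = "ap x n"
    have "A (- int S) (v0 * ?y) = A (- int S) (A (int S) ?y * v0)" by (rule arg_cong[OF bspec[OF v0(2) ap(1)]])
    hence "v * A (- int S) ?y = ?y * v" by (simp add: A_simps v_def)
    hence eq: "x * v - v * A (- int S) x = (x - ?y) * v + v * A (- int S) (?y - x)" by (simp add: A_simps algebra_simps)
    have 1: "norm ((x - ?y) * v) \<le> \<delta> / 8" unfolding norm_mult_unitary[OF v] using n x by (simp add: less_imp_le)
    have 2: "norm (v * A (- int S) (?y - x)) \<le> \<delta> / 8" unfolding norm_unitary_mult[OF v] A_norm using n x by (simp add: less_imp_le norm_minus_commute)
    show ?thesis unfolding eq using norm_triangle_mono[OF 1 2] by simp
  qed
  \<comment> \<open>The projection 1 in the finite set forces \<open>e 1\<close> to be nonzero;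
    including \<open>v\<close> makes its corner at \<open>e 1\<close> almost unitary.\<close>
  have "\<exists>e. tower M \<eta> e \<and> (\<forall>j\<in>{1..M}. \<forall>b\<in>{1} \<union> insert v G'. norm (e j * b - b * e j) < \<eta>) \<and>
    (\<forall>p\<in>{1}. norm (e 1 * p * e 1) \<ge> 1 - \<eta>) \<and> proj_le_aut \<alpha> (1 - (\<Sum>j=1..M. e j)) (h J)"
    by (rule rokhlin_tower) (use \<eta>(1) M1 h(1) G'(1) in auto)
  then obtain e where e: "tower M \<eta> e" "\<forall>j\<in>{1..M}. \<forall>b\<in>{1} \<union> insert v G'. norm (e j * b - b * e j) < \<eta>"
    "norm (e 1 * 1 * e 1) \<ge> 1 - \<eta>" "proj_le_aut \<alpha> (1 - (\<Sum>j=1..M. e j)) (h J)" by blast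
  have ep: "projection (e j)" if "j \<in> {1..M}" for j using e(1) that by (auto simp: tower_def)
  have eo: "e i * e j = 0" if "i \<in> {1..M}" "j \<in> {1..M}" "i \<noteq> j" for i j using e(1) that unfolding tower_def by blast
  define f where "f = e 1"
  have f: "projection f" unfolding f_def by (rule ep) (use M1 in simp)
  have f0: "f \<noteq> 0"
  proof
    assume "f = 0"
    hence "\<eta> \<ge> 1" using e(3) by (simp add: f_def)
    thus False using \<mu>(1,5) by linarith
  qed
  have ed: "norm (e j * d - d * e j) \<le> \<eta>" if "j \<in> {1..M}" "d \<in> insert v G'" for j d
    by (rule less_imp_le[OF bspec[OF bspec[OF e(2) that(1)]]]) (use that(2) in blast)
  have shift: "norm (A (int j - 1) f - e j) \<le> \<mu>" if j: "j \<in> {1..M}" for j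
  proof -
    have "norm (A (int (j - 1)) (e 1) - e (1 + (j - 1))) \<le> real (j - 1) * \<eta>" by (rule tower_shift[OF e(1)]) (use j \<eta>(1) in auto)
    also have "real (j - 1) * \<eta> \<le> \<mu>" unfolding \<mu>_def by (rule mult_right_mono) (use j \<eta>(1) in auto)
    finally show ?thesis using j by (simp add: f_def of_nat_diff)
  qed
  have "\<forall>j\<in>{1..M}. \<exists>s. star s * s = \<pi> f \<and> s * star s = \<pi> (e j) \<and> norm (s - U (int j - 1) * \<pi> f) \<le> 5 * \<mu>"
    using tower_isometry[OF ep f shift \<mu>(5)] by blast
  from bchoice[OF this] obtain s where s0: "\<forall>j\<in>{1..M}. star (s j) * s j = \<pi> f \<and> s j * star (s j) = \<pi> (e j) \<and> norm (s j - U (int j - 1) * \<pi> f) \<le> 5 * \<mu>"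
    by (elim exE)
  have s: "star (s j) * s j = \<pi> f" "s j * star (s j) = \<pi> (e j)" "norm (s j - U (int j - 1) * \<pi> f) \<le> 5 * \<mu>" if "j \<in> {1..M}" for j
    using bspec[OF s0 that] by simp_all
  have pf: "projection (\<pi> f)" by (rule \<pi>_projection[OF f])
  have es: "\<pi> (e j) * s j = s j" if "j \<in> {1..M}" for j by (rule proj_equiv_left[OF s(1,2)[OF that] pf])
  have se: "star (s j) * \<pi> (e j) = star (s j)" if "j \<in> {1..M}" for j
    using arg_cong[OF es[OF that], of star] projectionD(2)[OF \<pi>_projection[OF ep[OF that]]] by (simp add: star_mult)
  have fr: "frame (\<pi> f) {1..S+L} s" unfolding frame_def
  proof (intro conjI ballI pf)
    fix j k assume jk: "j \<in> {1..S+L}" "k \<in> {1..S+L}"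
    have M: "j \<in> {1..M}" "k \<in> {1..M}" using jk unfolding LSM(3) by auto
    show "star (s j) * s k = (if j = k then \<pi> f else 0)"
    proof (cases "j = k")
      case False
      have "star (s j) * s k = star (s j) * (\<pi> (e j) * \<pi> (e k)) * s k" 
        by (simp add: mult.assoc es[OF M(2)]) (simp add: mult.assoc[symmetric] se[OF M(1)])
      also have "\<pi> (e j) * \<pi> (e k) = 0" unfolding \<pi>_simps(3)[symmetric] eo[OF M False] by (rule \<pi>_simps(6))
      finally show ?thesis using False by simp
    qed (use s(1)[OF M(1)] in simp)
  qed simp
  have "\<exists>w. star w * w = f \<and> w * star w = f \<and> norm (w - f * v * f) \<le> 4 * \<eta>"
    by (rule corner_unitary[OF f v]) (use ed[of 1 v] M1 \<mu>(1,5) in \<open>auto simp: f_def\<close>)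
  then obtain w where w: "star w * w = f" "w * star w = f" "norm (w - f * v * f) \<le> 4 * \<eta>" by blast
  have us: "norm (u * s j - s (j + 1)) \<le> 10 * \<mu>" if j: "1 \<le> j" "j < S + L" for j
  proof -
    have M: "j \<in> {1..M}" "j + 1 \<in> {1..M}" using j unfolding LSM(3) by auto
    have "U (int (j + 1) - 1) = u * U (int j - 1)" using unitary_powi_Suc[OF u, of "int j - 1"] by simp
    hence eq: "u * s j - s (j + 1) = u * (s j - U (int j - 1) * \<pi> f) + (- (s (j + 1) - U (int (j + 1) - 1) * \<pi> f))" by (simp add: algebra_simps)
    have 1: "norm (u * (s j - U (int j - 1) * \<pi> f)) \<le> 5 * \<mu>" unfolding norm_unitary_mult[OF u] by (rule s(3)[OF M(1)])
    have 2: "norm (- (s (j + 1) - U (int (j + 1) - 1) * \<pi> f)) \<le> 5 * \<mu>" unfolding norm_minus_cancel by (rule s(3)[OF M(2)])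
    show ?thesis unfolding eq using norm_triangle_mono[OF 1 2] by simp
  qed
  have w\<pi>: "star (\<pi> w) * \<pi> w = \<pi> f" "\<pi> w * star (\<pi> w) = \<pi> f" unfolding \<pi>_simps(3,4)[symmetric] w(1,2) by (rule refl)+
  interpret B: berg "\<pi> f" "\<pi> w" u s L S "10 * \<mu>"
    by unfold_locales (fact L1(1) LS fr w\<pi> u us)+
  define c where "c d j = f * A (- (int j - 1)) d * f" for d and j :: nat
  have cs: "star (\<pi> (c d j)) = \<pi> (c (star d) j)" for d j
    by (simp add: c_def \<pi>_simps(4)[symmetric] A_simps(4)[symmetric] star_mult projectionD[OF f] mult.assoc)
  have ds: "norm (\<pi> d * s j - s j * \<pi> (c d j)) \<le> \<delta>" if d: "d \<in> G'" and j: "j \<in> {1..S+L}" for d j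
  proof -
    have M: "j \<in> {1..M}" using j by (simp add: LSM(3))
    have "norm (\<pi> d * s j - s j * \<pi> (c d j)) \<le> \<eta> + 2 * b * \<mu> + 2 * b * (5 * \<mu>)" unfolding c_def
      by (rule tower_commute[OF ep[OF M] f shift[OF M] s(3)[OF M] ed[OF M] b(2)]) (use d in auto)
    also have "\<dots> = \<eta> + 12 * (b * \<mu>)" by (simp add: algebra_simps)
    also have "\<dots> \<le> \<delta>" using \<mu> by linarith
    finally show ?thesis .
  qed
  have cw: "norm (\<pi> (c d i) * \<pi> w - \<pi> w * \<pi> (c d (S + i))) \<le> \<delta>" if d: "d \<in> G'" and i: "i \<in> {1..L}" for d i
  proof -
    let ?x = "A (- (int i - 1)) d"
    have x: "?x \<in> Y" unfolding Y_def using d i by force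
    have x': "A (- (int (S + i) - 1)) d = A (- int S) ?x" unfolding A_add[symmetric] by (simp add: algebra_simps)
    have "norm ((f * ?x * f) * w - w * (f * A (- int S) ?x * f)) \<le> \<delta> / 4 + 2 * b * \<eta> + 2 * b * (4 * \<eta>)"
      by (rule corner_commute[OF f v w(3) _ xv[OF x]]) (use b(2)[OF d] ed[of 1 v] M1 in \<open>auto simp: f_def\<close>)
    also have "\<dots> = \<delta> / 4 + 10 * (b * \<eta>)" by (simp add: algebra_simps)
    also have "\<dots> \<le> \<delta>" using \<mu> by linarith
    finally have "norm (c d i * w - w * c d (S + i)) \<le> \<delta>" unfolding c_def x' .
    thus ?thesis unfolding \<pi>_simps(3)[symmetric] \<pi>_simps(8)[symmetric] by (rule order_trans[OF \<pi>_norm_le])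
  qed
  \<comment> \<open>The gluing unitary and all coefficients are approximated in a single
    finite-dimensional algebra.\<close>
  define E where "E = insert w ((\<lambda>(d, j). c d j) ` (G \<times> {1..S+L}))"
  have wf: "f * w * f = w"
    using partial_isometry_right[OF w(1) f] proj_equiv_left[OF w(1,2) f] by simp
  have "\<exists>D. unital_fd (\<pi> f) D \<and> (\<forall>x\<in>E. \<exists>y\<in>D. norm (y - \<pi> x) \<le> \<delta>)"
  proof (rule corner_fd[OF f _ _ \<delta>(1)])
    show "finite E" using G by (simp add: E_def)
    have "f * c d j * f = c d j" for d j by (simp add: c_def mult.assoc projectionD(1)[OF f]) (simp add: mult.assoc[symmetric] projectionD(1)[OF f])
    thus "f * x * f = x" if "x \<in> E" for x using that wf by (auto simp: E_def)
  qed
  then obtain D where D: "unital_fd (\<pi> f) D" "\<And>x. x \<in> E \<Longrightarrow> \<exists>y\<in>D. norm (y - \<pi> x) \<le> \<delta>" by blast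
  have "\<exists>C. unital_fd (\<Sum>j\<in>{L+1..S+L}. B.t j * star (B.t j)) C \<and> (\<forall>j\<in>{L+1..S+L}. \<forall>k\<in>{L+1..S+L}. \<forall>x\<in>D. B.t j * x * star (B.t k) \<in> C)"
    by (rule matrix_algebra[OF pf _ _ D(1)]) (simp_all only: finite_atLeastAtMost frameD(3)[OF B.t_frame])
  then obtain C where C: "unital_fd B.p C" "\<forall>j\<in>{L+1..S+L}. \<forall>k\<in>{L+1..S+L}. \<forall>x\<in>D. B.t j * x * star (B.t k) \<in> C"
    unfolding B.p_def[symmetric] by blast
  have nu: "near B.p C u \<epsilon>"
  proof -
    obtain w' where w': "w' \<in> D" "norm (w' - \<pi> w) \<le> \<delta>" using D(2)[of w] by (auto simp: E_def)
    have 1: "near B.p C u (4 * real (S + L) * (10 * \<mu>) + 4 / L + \<delta>)" by (rule B.near_u[OF D(1) w' C(2,1)])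
    have 2: "4 * real (S + L) * (10 * \<mu>) = 40 * real M * \<mu>" unfolding LSM(3) by simp
    have "40 * real M * \<mu> + 4 / L + \<delta> \<le> \<epsilon> / 3 + \<epsilon> / 3 + \<epsilon> / 3"
      by (rule add_mono[OF add_mono[OF order_trans[OF \<mu>(3) \<delta>(3)] L4] \<delta>(3)])
    also have "\<dots> = \<epsilon>" by simp
    finally show ?thesis by (rule near_mono[OF 1[unfolded 2]])
  qed
  have nd: "near B.p C (\<pi> d) \<epsilon>" if d: "d \<in> G" for d
  proof -
    have "\<forall>j\<in>{1..S+L}. \<exists>y. y \<in> D \<and> norm (y - \<pi> (c d j)) \<le> \<delta>"
    proof
      fix j assume "j \<in> {1..S+L}"
      hence "c d j \<in> E" unfolding E_def using d by force
      thus "\<exists>y. y \<in> D \<and> norm (y - \<pi> (c d j)) \<le> \<delta>" using D(2) by blast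
    qed
    from bchoice[OF this] obtain c' where c': "\<forall>j\<in>{1..S+L}. c' j \<in> D \<and> norm (c' j - \<pi> (c d j)) \<le> \<delta>" by (elim exE)
    have "near B.p C (\<pi> d) (6 * real S * \<delta>)"
    proof (rule B.near_d[where c = "\<lambda>j. \<pi> (c d j)" and c' = c' and D = D])
      show "norm (\<pi> d * s j - s j * \<pi> (c d j)) \<le> \<delta>" if "j \<in> {1..S+L}" for j by (rule ds[OF _ that]) (use G'(2) d in blast)
      show "norm (star (\<pi> d) * s j - s j * star (\<pi> (c d j))) \<le> \<delta>" if "j \<in> {1..S+L}" for j 
        unfolding cs \<pi>_simps(4)[of d, symmetric] by (rule ds[OF _ that]) (use G'(2) d in blast)
      show "norm (\<pi> (c d i) * \<pi> w - \<pi> w * \<pi> (c d (S + i))) \<le> \<delta>" if "i \<in> {1..L}" for i by (rule cw[OF _ that]) (use G'(2) d in blast)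
      show "norm (star (\<pi> (c d i)) * \<pi> w - \<pi> w * star (\<pi> (c d (S + i)))) \<le> \<delta>" if "i \<in> {1..L}" for i 
        unfolding cs by (rule cw[OF _ that]) (use G'(2) d in blast)
      show "c' j \<in> D \<and> norm (c' j - \<pi> (c d j)) \<le> \<delta>" if "j \<in> {L+1..S+L}" for j using c' that by auto
    qed (fact C)+
    moreover have "6 * real S * \<delta> \<le> 6 * real M * \<delta>" by (rule mult_right_mono) (use \<delta>(1) in \<open>auto simp: LSM(3)\<close>)
    ultimately show ?thesis using \<delta>(2) near_mono order_trans by blast
  qed
  define q where "q = (\<Sum>j=1..M. e j)"
  have q: "projection q" unfolding q_def by (rule projection_sum) (use ep eo in auto)
  have sq: "(\<Sum>j\<in>{1..S+L}. s j * star (s j)) = \<pi> q"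
    unfolding q_def cstar_hom_sum[OF \<pi>_hom] LSM(3) by (rule sum.cong) (use s(2) in \<open>auto simp: LSM(3)\<close>)
  have sL: "(\<Sum>j\<in>{1..L}. s j * star (s j)) = \<pi> (\<Sum>j=1..L. e j)"
    unfolding cstar_hom_sum[OF \<pi>_hom] by (rule sum.cong) (use s(2) in \<open>auto simp: LSM(3)\<close>)
  have qp: "\<pi> q * B.p = B.p" using B.e_p unfolding sq .
  have 1: "proj_sub (\<pi> (1 - q)) (\<pi> (h J))" by (rule proj_le_aut_sub) (use h(1) e(4) in \<open>auto simp: q_def\<close>)
  obtain P where P: "\<forall>l<J. proj_sub (P l) (A (int l) (h 0))" "\<forall>l<J. \<forall>j<J. l \<noteq> j \<longrightarrow> P l * P j = 0" "(\<Sum>j=1..L. e j) = (\<Sum>l<J. P l)"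
  proof -
    have "N \<le> K \<and> J dvd L \<and> tower (L * K) \<eta> e \<and> \<eta> \<ge> 0 \<and> real L * (real (L * K) * \<eta>) \<le> 1/10"
      using e(1) \<eta> unfolding MK[symmetric] by (simp add: LSM)
    from N(2)[rule_format, OF this] show ?thesis using that by (elim exE conjE)
  qed
  have "proj_equiv (\<pi> q - B.p) (\<Sum>l<J. \<pi> (P l))" using B.defect unfolding sq sL P(3) cstar_hom_sum[OF \<pi>_hom] .
  moreover have "proj_sub (\<Sum>l<J. \<pi> (P l)) (\<Sum>l<J. \<pi> (h l))"
  proof (rule proj_sub_sum)
    fix l assume l: "l \<in> {..<J}"
    have "proj_sub (\<pi> (P l)) (\<pi> (A (int l) (h 0)))" using P(1) l proj_sub_hom[OF \<pi>_hom] by blast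
    moreover have "proj_equiv (\<pi> (A (int l) (h 0))) (\<pi> (h 0))" by (rule proj_equiv_sym[OF \<pi>_equiv_A]) (use h(1) in simp)
    moreover have "proj_equiv (\<pi> (h 0)) (\<pi> (h l))" by (rule proj_equiv_hom[OF \<pi>_hom h(3)]) (use l in simp)
    ultimately show "proj_sub (\<pi> (P l)) (\<pi> (h l))" using proj_equiv_sub proj_sub_trans by meson
    fix j assume j: "j \<in> {..<J}" "l \<noteq> j"
    have "P l * P j = 0" "h l * h j = 0" using P(2) h(2) l j by auto
    thus "\<pi> (P l) * \<pi> (P j) = 0" "\<pi> (h l) * \<pi> (h j) = 0" by (simp_all add: \<pi>_simps(3)[symmetric] \<pi>_simps(6))
  qed simp
  ultimately have 2: "proj_sub (\<pi> q - B.p) (\<Sum>l<J. \<pi> (h l))" using proj_equiv_sub proj_sub_trans by blast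
  \<comment> \<open>\<open>1 - p\<close> splits into the complement of the tower, placed under
    \<open>h J\<close>, and the defect, placed under the other copies.\<close>
  have "proj_sub (\<pi> (1 - q) + (\<pi> q - B.p)) (\<pi> (h J) + (\<Sum>l<J. \<pi> (h l)))"
  proof (rule proj_sub_add[OF 1 2])
    show "\<pi> (1 - q) * (\<pi> q - B.p) = 0" 
      by (simp add: \<pi>_simps(8) left_diff_distrib right_diff_distrib qp projectionD(1)[OF \<pi>_projection[OF q]])
    have "\<pi> (h J) * \<pi> (h l) = 0" if "l < J" for l using h(2)[of J l] that by (simp add: \<pi>_simps(3)[symmetric] \<pi>_simps(6))
    thus "\<pi> (h J) * (\<Sum>l<J. \<pi> (h l)) = 0" by (simp add: sum_distrib_left)
  qed
  moreover have "\<pi> (1 - q) + (\<pi> q - B.p) = 1 - B.p" by (simp add: \<pi>_simps(8))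
  moreover have "\<pi> (h J) + (\<Sum>l<J. \<pi> (h l)) = \<pi> (\<Sum>i<Suc J. h i)" by (simp add: \<pi>_simps(1) cstar_hom_sum[OF \<pi>_hom] add.commute)
  ultimately have 3: "proj_sub (1 - B.p) (\<pi> (\<Sum>i<Suc J. h i))" by simp
  have "B.p \<noteq> 0" by (rule B.p_nonzero) (simp add: \<pi>_eq_0 f0)
  thus ?thesis using B.p_projection C(1) nu nd 3 by blast
qed

lemma crossed_product_tracial_rank_zero: "tracial_rank_zero TYPE('b)"
  unfolding tracial_rank_zero_def
proof (intro conjI allI impI crossed_product_simple)
  fix \<epsilon> :: real and X :: "'b set" and a :: 'b assume H: "0 < \<epsilon> \<and> finite X \<and> positive a \<and> a \<noteq> 0"
  have sa: "star a = a" using H by (auto simp: positive_def star_mult star_star)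
  obtain g s where g: "projection g" "g \<noteq> 0" "star (a * s) * (a * s) = \<pi> g" "a * s * star (a * s) \<in> {a * x * a | x. True}"
    using projection_below[OF sa] H by blast
  obtain h :: "nat \<Rightarrow> 'a" where h: "\<forall>i<Suc J. projection (h i) \<and> h i \<noteq> 0 \<and> g * h i = h i"
    "\<forall>i<Suc J. \<forall>j<Suc J. i \<noteq> j \<longrightarrow> h i * h j = 0" "\<forall>i<Suc J. \<forall>j<Suc J. proj_equiv (h i) (h j)"
    using equivalent_subprojections[OF g(1,2), of "Suc J"] by blast
  have \<epsilon>: "\<epsilon> / 2 > 0" using H by simp
  from generates_finite[of X, OF _ _ \<epsilon>] generates_all H obtain \<delta> G where \<delta>: "\<delta> > 0" "finite G" "\<forall>x\<in>X. controlled \<delta> G x (\<epsilon> / 2)" by blast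
  have "\<exists>p C. projection p \<and> p \<noteq> 0 \<and> unital_fd p C \<and> near p C u \<delta> \<and> (\<forall>d\<in>G. near p C (\<pi> d) \<delta>) \<and>
    proj_sub (1 - p) (\<pi> (\<Sum>i<Suc J. h i))" by (rule tracial_approximation[OF \<delta>(1,2)]) (use h in auto)
  then obtain p C where p: "projection p" "p \<noteq> 0" "unital_fd p C" "near p C u \<delta>" "\<forall>d\<in>G. near p C (\<pi> d) \<delta>"
    "proj_sub (1 - p) (\<pi> (\<Sum>i<Suc J. h i))" by blast
  have nx: "near p C x (\<epsilon> / 2)" if "x \<in> X" for x using \<delta>(3) that p(1,3-5) unfolding controlled_def by blast
  have "proj_sub (\<Sum>i<Suc J. h i) g"
  proof (rule proj_sub_le[OF projection_sum g(1)])
    show "g * (\<Sum>i<Suc J. h i) = (\<Sum>i<Suc J. h i)" unfolding sum_distrib_left by (rule sum.cong) (use h in auto)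
  qed (use h in auto)
  hence "proj_sub (1 - p) (\<pi> g)" using p(6) proj_sub_hom[OF \<pi>_hom] proj_sub_trans by blast
  then obtain V where V: "star V * V = 1 - p" "\<pi> g * V = V" "projection (1 - p)" by (auto simp: proj_sub_def)
  \<comment> \<open>\<open>V\<close> embeds \<open>1 - p\<close> into \<open>\<pi> g\<close>, and
    \<open>a * s\<close> carries \<open>\<pi> g\<close> into the hereditary subalgebra of
    \<open>a\<close>.\<close>
  define y where "y = a * s * V"
  have y1: "star y * y = 1 - p"
  proof -
    have "star y * y = star V * ((star (a * s) * (a * s)) * V)" by (simp add: y_def star_mult mult.assoc)
    thus ?thesis unfolding g(3) V(2) V(1) .
  qed
  have "y * star y = a * (s * V * star V * star s) * a" by (simp add: y_def star_mult sa mult.assoc)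
  hence "y * star y \<in> {a * x * a | x. True}" by blast
  hence y2: "y * star y \<in> closure {a * x * a | x. True}" by (rule subsetD[OF closure_subset])
  have "proj_le (1 - p) a" unfolding proj_le_def partial_isometry_def
    by (rule exI[of _ "y * star y"], rule exI[of _ y]) (intro conjI partial_isometry_left[OF y1 V(3)] y1 y2 refl)
  moreover have "norm (p * x - x * p) < \<epsilon>" if "x \<in> X" for x using nx[OF that] H by (auto simp: near_def)
  moreover have "infdist (p * x * p) C < \<epsilon>" if x: "x \<in> X" for x
  proof -
    obtain c where c: "c \<in> C" "norm (p * x * p - c) \<le> \<epsilon> / 2" using nx[OF x] by (auto simp: near_def)
    have "infdist (p * x * p) C \<le> dist (p * x * p) c" by (rule infdist_le[OF c(1)])
    thus ?thesis using c(2) H by (simp add: dist_norm)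
  qed
  ultimately show "\<exists>p C. projection p \<and> p \<noteq> 0 \<and> cstar_subalgebra C \<and> finite_dimensional C \<and>
        p \<in> C \<and> (\<forall>c\<in>C. p * c = c \<and> c * p = c) \<and> (\<forall>x\<in>X. norm (p * x - x * p) < \<epsilon>) \<and>
        (\<forall>x\<in>X. infdist (p * x * p) C < \<epsilon>) \<and> proj_le (1 - p) a"
    using p(1-3) unfolding unital_fd_def by blast
qed

end

theorem theorem3p3:
  fixes \<alpha> :: "'a::cstar_algebra \<Rightarrow> 'a"
    and \<pi> :: "'a \<Rightarrow> 'b::cstar_algebra" and u :: 'b
  assumes "AF_algebra TYPE('a)"
    and "cstar_automorphism \<alpha>"
    and "tracial_cyclic_rokhlin \<alpha>"
    and "aut_simple \<alpha>"
    and "\<exists>J::nat. 1 \<le> J \<and> (\<forall>x\<in>carrier (K0 TYPE('a)). K0_map (\<alpha> ^^ J) x = x)"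
    and "crossed_product \<alpha> \<pi> u"
  shows "tracial_rank_zero TYPE('b)"
proof -
  obtain F :: "nat \<Rightarrow> 'a set" where F: "af F" using AF_algebra_af[OF assms(1)] by blast
  obtain J :: nat where J: "1 \<le> J" "\<forall>x\<in>carrier (K0 TYPE('a)). K0_map (\<alpha> ^^ J) x = x" using assms(5) by blast
  have "rokhlin_crossed F \<alpha> J \<pi> u"
    using F J assms(2-4,6) unfolding rokhlin_crossed_def rokhlin_def rokhlin_axioms_def crossed_def crossed_axioms_def covariant_def crossed_product_def by blast
  thus ?thesis by (rule rokhlin_crossed.crossed_product_tracial_rank_zero)
qed

end
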